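(* Assume $\mathrm{OCA}+\mathrm{MA}_{\aleph_1}(\sigma\text{-linked})$. Let $\mathcal G=\{(G_k,d_k):k\in\mathbb N\}$ be a sequence of separable bi-invariant metric groups of uniformly bounded diameter, endowed with an equivalence relation $\asymp$ on $(\mathbb N^{\mathbb N})_\infty$ and, for all $(k_n)_n\asymp(l_n)_n$, a (canonical) group isomorphism of product form $\Gamma[(k_n)_n,(l_n)_n]:\mathcal G[(k_n)_n]\to\mathcal G[(l_n)_n]$. Assume that $\mathcal G$ satisfies the conditions (CR) and (PF): (CR) For all $(k_n)_n,(l_n)_n\in(\mathbb N^{\mathbb N})_\infty$ and every group isomorphism $\varphi:\mathcal G[(k_n)_n]\to\mathcal G[(l_n)_n]$ there exists an automorphism $\theta$ of the Boolean algebra $\mathscr P(\mathbb N)/\mathrm{Fin}$ such that for all $a,b\in\mathcal G[(k_n)_n]$ and all $S\in\mathscr P(\mathbb N)/\mathrm{Fin}$: $a=_Sb\iff\varphi(a)=_{\theta(S)}\varphi(b)$. (PF) Whenever $(k_n)_n,(l_n)_n\in(\mathbb N^{\mathbb N})_\infty$ and $\psi:\mathcal G[(k_n)_n]\to\mathcal G[(l_n)_n]$ is a group isomorphism of product form, then $(k_n)_n\asymp(l_n)_n$ and there exists a sequence $\alpha_n\in\mathrm{Aut}(G_{l_n})$ such that $\psi=\varphi[(\alpha_n)_n]\circ\Gamma[(k_n)_n,(l_n)_n]$. Then for all $(k_n)_n,(l_n)_n\in(\mathbb N^{\mathbb N})_\infty$ every group isomorphism $\varphi:\mathcal G[(k_n)_n]\to\mathcal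 G[(l_n)_n]$ is trivial, i.e. there exist an almost permutation $f:\mathbb N\to\mathbb N$ and a sequence of automorphisms $\alpha_n\in\mathrm{Aut}(G_{l_n})$ such that $(k_{f(n)})_n\asymp(l_n)_n$ and $$\varphi=\varphi[(\alpha_n)_n]\circ\Gamma[(k_{f(n)})_n,(l_n)_n]\circ\psi_f.$$
   Context: $\mathrm{OCA}$ is Todorčević's Open Coloring Axiom: for every separable metrizable space $X$ and every partition $[X]^2=K_0\sqcup K_1$ with $K_0$ open (i.e. $\{(x,y):\{x,y\}\in K_0\}$ is open in $X\times X$), either there is an uncountable $Y\subseteq X$ with $[Y]^2\subseteq K_0$, or $X=\bigcup_{n\in\mathbb N}X_n$ with $[X_n]^2\subseteq K_1$ for all $n$. $\mathrm{MA}_{\aleph_1}(\sigma\text{-linked})$ is Martin's axiom for $\aleph_1$ dense sets restricted to $\sigma$-linked posets (posets that are countable unions of sets of pairwise compatible elements). $(\mathbb N^{\mathbb N})_\infty$ is the set of sequences $(k_n)_n$ of natural numbers with $k_n\to\infty$. For such a sequence, $\mathcal G[(k_n)_n]=\prod_nG_{k_n}/\mathrm{Fin}$ is the quotient of the group $\prod_nG_{k_n}$ by the normal subgroup of sequences $(a_n)_n$ with $d_{k_n}(a_n,1)\to0$; $[a_n]_n$ is the class of $(a_n)_n$. For $a=[a_n]_n$, $b=[b_n]_n$ and $S\subseteq\mathbb N$, $a=_Sb$ means $\lim_{n\in S}d_{k_n}(a_n,b_n)=0$ (vacuous for finite $S$); it depends only on the class of $S$ modulo the ideal $\mathrm{Fin}$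 of finite sets. A map $\mathcal G[(k_n)_n]\to\mathcal G[(l_n)_n]$ is of product form if it is given by $[a_n]_n\mapsto[h_n(a_n)]_n$ for some sequence of maps $h_n:G_{k_n}\to G_{l_n}$. For $\alpha_n\in\mathrm{Aut}(G_{l_n})$, $\varphi[(\alpha_n)_n]:\mathcal G[(l_n)_n]\to\mathcal G[(l_n)_n]$ denotes the automorphism of product form $[a_n]_n\mapsto[\alpha_n(a_n)]_n$ (it is part of the assertions in (PF) and in the conclusion that this is a well-defined automorphism). An almost permutation is a map $f:\mathbb N\to\mathbb N$ that restricts to a bijection between two cofinite subsets of $\mathbb N$. $\psi_f:\mathcal G[(k_n)_n]\to\mathcal G[(k_{f(n)})_n]$ is the reindexing isomorphism $\psi_f([a_n]_n)=[a_{f(n)}]_n$. *)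

theory Defs
  imports "HOL-Analysis.Analysis" "HOL-Library.Ramsey" "HOL-Algebra.Product_Groups"
begin

section \<open>Set-theoretic hypotheses\<close>

definition open_colouring_dichotomy :: "'a topology \<Rightarrow> bool" where
  "open_colouring_dichotomy X \<longleftrightarrow>
     (\<forall>K0 K1. K0 \<union> K1 = nsets (topspace X) 2 \<and> K0 \<inter> K1 = {} \<and>
        openin (prod_topology X X) {(x, y). {x, y} \<in> K0} \<longrightarrow>
        (\<exists>Y \<subseteq> topspace X. uncountable Y \<and> nsets Y 2 \<subseteq> K0) \<or>
        (\<exists>Z :: nat \<Rightarrow> 'a set. topspace X = (\<Union>n. Z n) \<and> (\<forall>n. nsets (Z n) 2 \<subseteq> K1)))"

text \<open>
  HOL cannot quantify over all types inside a formula.  A separable metrizable space has at most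
  continuum many points, so it suffices to let the points be sets of natural numbers;
  \<open>OCA_any_type\<close> below recovers the dichotomy for spaces over an arbitrary type.
\<close>

definition OCA :: bool where
  "OCA \<longleftrightarrow> (\<forall>X :: nat set topology.
     metrizable_space X \<and> separable_space X \<longrightarrow> open_colouring_dichotomy X)"

lemma OCA_any_type:
  fixes X :: "'a topology"
  assumes OCA and met: "metrizable_space X" and sep: "separable_space X"
  shows "open_colouring_dichotomy X"
proof -
  obtain M d where "Metric_space M d" and X: "X = Metric_space.mtopology M d"
    using met unfolding metrizable_space_def by blast
  then interpret M: Metric_space M d by simp
  obtain C where "countable C" and "C \<subseteq> M" and dense: "M.mtopology closure_of C = M"
    using sep unfolding separable_space_def X by auto
  define e where
    "e x = to_nat_on (C \<times> (\<rat> :: real set)) ` {(c, q). c \<in> C \<and> q \<in> \<rat> \<and> d x c < q}" for x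
  have cnt: "countable (C \<times> (\<rat> :: real set))"
    using \<open>countable C\<close> countable_rat by blast
  have "inj_on e M"
  proof (rule inj_onI)
    fix x y assume xy: "x \<in> M" "y \<in> M" "e x = e y"
    have inj: "inj_on (to_nat_on (C \<times> (\<rat> :: real set))) (C \<times> \<rat>)"
      using cnt by (rule inj_on_to_nat_on)
    have "{(c, q). c \<in> C \<and> q \<in> \<rat> \<and> d x c < q} = {(c, q). c \<in> C \<and> q \<in> \<rat> \<and> d y c < q}"
      using xy(3) unfolding e_def by (subst (asm) inj_on_image_eq_iff[OF inj]) auto
    then have eq: "d x c < q \<longleftrightarrow> d y c < q" if "c \<in> C" "q \<in> \<rat>" for c q
      using that by (auto simp: set_eq_iff)
    show "x = y"
    proof (rule ccontr)
      assume "x \<noteq> y"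
      then have "d x y > 0" using xy M.mdist_pos_less by blast
      then obtain q where q: "q \<in> \<rat>" "0 < q" "q < d x y / 2"
        using Rats_dense_in_real[of 0 "d x y / 2"] by auto
      have "x \<in> M.mtopology closure_of C" using dense xy by simp
      then obtain c where c: "c \<in> C" "c \<in> M.mball x q"
        using q(2) by (auto simp: M.metric_closure_of)
      then have "d x c < q" by auto
      moreover have "d y c < q" using eq[of c q] c q calculation by simp
      ultimately show False
        using M.triangle[of x c y] c xy q by (auto simp: M.commute)
    qed
  qed
  define g where "g = inv_into M e"
  have ge: "g (e x) = x" if "x \<in> M" for x
    using that \<open>inj_on e M\<close> by (simp add: g_def)
  define X' where "X' = pullback_topology (e ` M) g X"
  have top: "topspace X = M" by (simp add: X)
  have top': "topspace X' = e ` M"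
    using ge by (auto simp: X'_def topspace_pullback_topology top)
  have hom: "homeomorphic_maps X X' e g"
    unfolding homeomorphic_maps_def
  proof (intro conjI)
    show "continuous_map X X' e"
      unfolding X'_def
    proof (rule continuous_map_pullback')
      show "continuous_map X X (g \<circ> e)"
        by (rule continuous_map_eq[OF continuous_map_id]) (simp add: top ge)
    qed (auto simp: top)
    show "continuous_map X' X g"
      unfolding X'_def using continuous_map_pullback[OF continuous_map_id, of "e ` M" g X] by simp
  qed (use ge in \<open>auto simp: top top'\<close>)
  then have homs: "X homeomorphic_space X'"
    using homeomorphic_space_def by blast
  have "open_colouring_dichotomy X'"
    using \<open>OCA\<close> met sep homeomorphic_metrizable_space[OF homs] homeomorphic_separable_space[OF homs]
    unfolding OCA_def by blast
  show ?thesis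
    unfolding open_colouring_dichotomy_def
  proof (intro allI impI, elim conjE)
    fix K0 K1
    assume K: "K0 \<union> K1 = nsets (topspace X) 2" "K0 \<inter> K1 = {}"
      and op: "openin (prod_topology X X) {(x, y). {x, y} \<in> K0}"
    define K0' where "K0' = (`) e ` K0"
    define K1' where "K1' = (`) e ` K1"
    have sub: "k \<subseteq> M" if "k \<in> K0 \<union> K1" for k
      using that K(1) by (auto simp: nsets_def top)
    have injP: "inj_on ((`) e) (Pow M)"
      using \<open>inj_on e M\<close> by (rule inj_on_image_Pow)
    have ns: "nsets (e ` S) 2 = (`) e ` nsets S 2" if "S \<subseteq> M" for S
    proof (intro equalityI subsetI)
      fix N assume "N \<in> nsets (e ` S) 2"
      then have N: "N \<subseteq> e ` S" "finite N" "card N = 2" by (auto simp: nsets_def)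
      have "N = e ` (g ` N)" using N(1) ge that by (force simp: image_iff)
      moreover have "card (g ` N) = 2"
        using N \<open>inj_on e M\<close> that by (subst card_image) (auto simp: g_def intro!: inj_on_inv_into)
      moreover have "g ` N \<subseteq> S" using N(1) ge that by force
      ultimately show "N \<in> (`) e ` nsets S 2" using N by (auto simp: nsets_def)
    next
      fix N assume "N \<in> (`) e ` nsets S 2"
      then obtain k where k: "N = e ` k" "k \<subseteq> S" "finite k" "card k = 2"
        by (auto simp: nsets_def)
      moreover have "inj_on e k"
        using \<open>inj_on e M\<close> k(2) that by (meson inj_on_subset)
      ultimately show "N \<in> nsets (e ` S) 2"
        by (simp add: nsets_def card_image image_mono)
    qed
    have K': "K0' \<union> K1' = nsets (topspace X') 2"
      using K(1) by (simp add: K0'_def K1'_def top' ns top flip: image_Un)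
    have disj: "K0' \<inter> K1' = {}"
      using K(2) injP sub unfolding K0'_def K1'_def
      by (subst inj_on_image_Int[OF injP, symmetric]) auto
    have cont: "continuous_map (prod_topology X' X') (prod_topology X X) (\<lambda>(x, y). (g x, g y))"
      using hom by (auto simp: homeomorphic_maps_def continuous_map_prod_top)
    have "{(x, y). {x, y} \<in> K0'} =
      {z \<in> topspace (prod_topology X' X'). (\<lambda>(x, y). (g x, g y)) z \<in> {(x, y). {x, y} \<in> K0}}"
    proof (rule Set.set_eqI)
      fix z :: "nat set \<times> nat set"
      obtain u v where z: "z = (u, v)" by (cases z)
      have "{u, v} \<in> K0' \<longleftrightarrow> u \<in> e ` M \<and> v \<in> e ` M \<and> {g u, g v} \<in> K0"
      proof
        assume "{u, v} \<in> K0'"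
        then obtain k where k: "k \<in> K0" "{u, v} = e ` k" by (auto simp: K0'_def)
        then have "k \<subseteq> M" using sub by blast
        then have "g ` {u, v} = k" unfolding k(2) using ge by (force simp: image_iff)
        then have "{g u, g v} \<in> K0" using k(1) by simp
        moreover have "{u, v} \<subseteq> e ` M" unfolding k(2) using \<open>k \<subseteq> M\<close> by (rule image_mono)
        ultimately show "u \<in> e ` M \<and> v \<in> e ` M \<and> {g u, g v} \<in> K0" by simp
      next
        assume *: "u \<in> e ` M \<and> v \<in> e ` M \<and> {g u, g v} \<in> K0"
        then have "{u, v} = e ` {g u, g v}" using ge by force
        then show "{u, v} \<in> K0'" using * unfolding K0'_def by blast
      qed
      then show "z \<in> {(x, y). {x, y} \<in> K0'} \<longleftrightarrow> z \<in> {z \<in> topspace (prod_topology X' X').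
          (\<lambda>(x, y). (g x, g y)) z \<in> {(x, y). {x, y} \<in> K0}}"
        by (simp add: z top')
    qed
    then have op': "openin (prod_topology X' X') {(x, y). {x, y} \<in> K0'}"
      using openin_continuous_map_preimage[OF cont op] by simp
    have lift: "nsets (g ` S) 2 \<subseteq> K" if "S \<subseteq> e ` M" "nsets S 2 \<subseteq> (`) e ` K" "K \<subseteq> K0 \<union> K1" for S K
    proof
      fix N assume "N \<in> nsets (g ` S) 2"
      moreover have gS: "g ` S \<subseteq> M" using that(1) ge by auto
      moreover have "e ` g ` S = S" using that(1) ge by force
      ultimately have "e ` N \<in> (`) e ` K"
        using ns[OF gS] that(2) by auto
      then obtain k where "k \<in> K" "e ` N = e ` k" by auto
      moreover have "N \<subseteq> M" using gS \<open>N \<in> nsets (g ` S) 2\<close> by (auto simp: nsets_def)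
      moreover have "k \<subseteq> M" using sub that(3) \<open>k \<in> K\<close> by blast
      ultimately show "N \<in> K"
        using inj_on_image_eq_iff[OF \<open>inj_on e M\<close>] by metis
    qed
    have "(\<exists>Y \<subseteq> topspace X'. uncountable Y \<and> nsets Y 2 \<subseteq> K0') \<or>
        (\<exists>Z :: nat \<Rightarrow> nat set set. topspace X' = (\<Union>n. Z n) \<and> (\<forall>n. nsets (Z n) 2 \<subseteq> K1'))"
      using \<open>open_colouring_dichotomy X'\<close> K' disj op' unfolding open_colouring_dichotomy_def by blast
    then show "(\<exists>Y \<subseteq> topspace X. uncountable Y \<and> nsets Y 2 \<subseteq> K0) \<or>
        (\<exists>Z :: nat \<Rightarrow> 'a set. topspace X = (\<Union>n. Z n) \<and> (\<forall>n. nsets (Z n) 2 \<subseteq> K1))"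
    proof (elim disjE exE conjE)
      fix Y assume Y: "Y \<subseteq> topspace X'" "uncountable Y" "nsets Y 2 \<subseteq> K0'"
      have "e ` g ` Y = Y" using Y(1) ge top' by force
      then have "uncountable (g ` Y)" using Y(2) by (metis countable_image)
      moreover have "g ` Y \<subseteq> topspace X" using Y(1) ge top' top by auto
      moreover have "nsets (g ` Y) 2 \<subseteq> K0"
        using lift[of Y K0] Y by (simp add: K0'_def top')
      ultimately show ?thesis by blast
    next
      fix Z :: "nat \<Rightarrow> nat set set"
      assume Z: "topspace X' = (\<Union>n. Z n)" "\<forall>n. nsets (Z n) 2 \<subseteq> K1'"
      have "Z n \<subseteq> e ` M" for n using Z(1) top' by blast
      then have "nsets (g ` Z n) 2 \<subseteq> K1" for n
        using lift[of "Z n" K1] Z(2) by (simp add: K1'_def)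
      moreover have "topspace X = (\<Union>n. g ` Z n)"
      proof -
        have "(\<Union>n. g ` Z n) = g ` e ` M" using Z(1) top' by (simp flip: image_UN)
        also have "\<dots> = M" using ge by (force simp: image_iff)
        finally show ?thesis by (simp add: top)
      qed
      ultimately show ?thesis by (intro disjI2 exI[of _ "\<lambda>n. g ` Z n"]) auto
    qed
  qed
qed

text \<open>Forcing convention: \<^term>\<open>(q, p) \<in> R\<close> means that \<^term>\<open>q\<close> is below (stronger than) \<^term>\<open>p\<close>.\<close>

definition compatible_in :: "'p set \<Rightarrow> 'p rel \<Rightarrow> 'p \<Rightarrow> 'p \<Rightarrow> bool" where
  "compatible_in P R p q \<longleftrightarrow> (\<exists>r\<in>P. (r, p) \<in> R \<and> (r, q) \<in> R)"

definition sigma_linked :: "'p set \<Rightarrow> 'p rel \<Rightarrow> bool" where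
  "sigma_linked P R \<longleftrightarrow>
     (\<exists>L :: nat \<Rightarrow> 'p set. P = (\<Union>n. L n) \<and> (\<forall>n. \<forall>p\<in>L n. \<forall>q\<in>L n. compatible_in P R p q))"

definition dense_in_poset :: "'p set \<Rightarrow> 'p rel \<Rightarrow> 'p set \<Rightarrow> bool" where
  "dense_in_poset P R D \<longleftrightarrow> D \<subseteq> P \<and> (\<forall>p\<in>P. \<exists>q\<in>D. (q, p) \<in> R)"

definition filter_in_poset :: "'p set \<Rightarrow> 'p rel \<Rightarrow> 'p set \<Rightarrow> bool" where
  "filter_in_poset P R F \<longleftrightarrow> F \<subseteq> P \<and> F \<noteq> {} \<and>
     (\<forall>p\<in>F. \<forall>q\<in>P. (p, q) \<in> R \<longrightarrow> q \<in> F) \<and>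
     (\<forall>p\<in>F. \<forall>q\<in>F. \<exists>r\<in>F. (r, p) \<in> R \<and> (r, q) \<in> R)"

definition meets_aleph1_dense_sets :: "'p set \<Rightarrow> 'p rel \<Rightarrow> bool" where
  "meets_aleph1_dense_sets P R \<longleftrightarrow>
     (\<forall>\<D>. (card_of \<D>, cardSuc natLeq) \<in> ordLeq \<and> (\<forall>D\<in>\<D>. dense_in_poset P R D) \<longrightarrow>
        (\<exists>F. filter_in_poset P R F \<and> (\<forall>D\<in>\<D>. F \<inter> D \<noteq> {})))"

text \<open>
  Posets may be taken on sets of natural numbers: every \<open>\<sigma>\<close>-linked poset with \<open>\<aleph>\<^sub>1\<close> dense
  sets has a \<open>\<sigma>\<close>-linked subposet of size at most \<open>\<aleph>\<^sub>1\<close> in which the traces of these sets are dense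
  and whose generic filters generate generic filters of the original poset.
  See \<open>MA_any_type\<close> below.
\<close>

definition MA_aleph1_sigma_linked :: bool where
  "MA_aleph1_sigma_linked \<longleftrightarrow> (\<forall>(P :: nat set set) R.
     P \<noteq> {} \<and> partial_order_on P R \<and> sigma_linked P R \<longrightarrow> meets_aleph1_dense_sets P R)"

lemma MA_any_type:
  fixes P :: "'p set"
  assumes MA_aleph1_sigma_linked
    and "P \<noteq> {}" and po: "partial_order_on P R" and "sigma_linked P R"
  shows "meets_aleph1_dense_sets P R"
  unfolding meets_aleph1_dense_sets_def
proof (intro allI impI, elim conjE)
  fix \<D>
  assume card_D: "(card_of \<D>, cardSuc natLeq) \<in> ordLeq" and D: "\<forall>D\<in>\<D>. dense_in_poset P R D"
  obtain p0 where "p0 \<in> P" using \<open>P \<noteq> {}\<close> by blast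
  obtain L :: "nat \<Rightarrow> 'p set" where L: "P = (\<Union>n. L n)"
    "\<And>n p q. p \<in> L n \<Longrightarrow> q \<in> L n \<Longrightarrow> compatible_in P R p q"
    using \<open>sigma_linked P R\<close> unfolding sigma_linked_def by blast
  have R: "R \<subseteq> P \<times> P" "\<And>p. p \<in> P \<Longrightarrow> (p, p) \<in> R" "trans R" "antisym R"
    using partial_order_onD[OF po] by (auto simp: refl_on_def)
  define s where "s D p = (SOME q. q \<in> D \<and> (q, p) \<in> R)" for D p
  have s: "s D p \<in> D" "(s D p, p) \<in> R" "s D p \<in> P" if "D \<in> \<D>" "p \<in> P" for D p
  proof -
    have "\<exists>q. q \<in> D \<and> (q, p) \<in> R" using D that unfolding dense_in_poset_def by blast
    then have "s D p \<in> D \<and> (s D p, p) \<in> R" unfolding s_def by (rule someI_ex)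
    then show "s D p \<in> D" "(s D p, p) \<in> R" "s D p \<in> P"
      using D that by (auto simp: dense_in_poset_def)
  qed
  define c where "c p q = (SOME r. r \<in> P \<and> (r, p) \<in> R \<and> (r, q) \<in> R)" for p q
  have c: "c p q \<in> P" "(c p q, p) \<in> R" "(c p q, q) \<in> R" if "compatible_in P R p q" for p q
  proof -
    have "\<exists>r. r \<in> P \<and> (r, p) \<in> R \<and> (r, q) \<in> R" using that by (auto simp: compatible_in_def)
    then have "c p q \<in> P \<and> (c p q, p) \<in> R \<and> (c p q, q) \<in> R" unfolding c_def by (rule someI_ex)
    then show "c p q \<in> P" "(c p q, p) \<in> R" "(c p q, q) \<in> R" by auto
  qed
  define step where "step S = S \<union> case_prod s ` (\<D> \<times> S) \<union> (case_prod c ` (S \<times> S) \<inter> P)" for S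
  define Q where "Q = (\<Union>n. (step ^^ n) {p0})"
  have stepP: "(step ^^ n) {p0} \<subseteq> P" for n
    by (induction n) (use \<open>p0 \<in> P\<close> s in \<open>auto simp: step_def\<close>)
  have QP: "Q \<subseteq> P" unfolding Q_def using stepP by blast
  have mono: "(step ^^ m) {p0} \<subseteq> (step ^^ n) {p0}" if "m \<le> n" for m n
    using that by (induction rule: dec_induct) (auto simp: step_def)
  have Qs: "s D p \<in> Q" if "D \<in> \<D>" "p \<in> Q" for D p
  proof -
    obtain n where "p \<in> (step ^^ n) {p0}" using \<open>p \<in> Q\<close> by (auto simp: Q_def)
    then have "s D p \<in> (step ^^ Suc n) {p0}" using \<open>D \<in> \<D>\<close> by (force simp: step_def)
    then show ?thesis unfolding Q_def by blast
  qed
  have Qc: "c p q \<in> Q" if comp: "compatible_in P R p q" and pq: "p \<in> Q" "q \<in> Q" for p q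
  proof -
    obtain m n where "p \<in> (step ^^ m) {p0}" "q \<in> (step ^^ n) {p0}"
      using pq unfolding Q_def by blast
    then have "p \<in> (step ^^ max m n) {p0}" "q \<in> (step ^^ max m n) {p0}"
      using mono[of m "max m n"] mono[of n "max m n"] by auto
    then have "c p q \<in> (step ^^ Suc (max m n)) {p0}"
      using c(1)[OF comp] by (force simp: step_def)
    then show ?thesis unfolding Q_def by blast
  qed
  let ?U = "UNIV :: nat set set"
  have infU: "infinite ?U"
    by (simp add: Finite_Set.finite_set)
  have natU: "(natLeq, card_of ?U) \<in> ordLess"
    using card_of_nat card_of_Pow[of "UNIV :: nat set", unfolded Pow_UNIV] ordIso_ordLess_trans ordIso_symmetric by blast
  have card_DU: "(card_of \<D>, card_of ?U) \<in> ordLeq"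
    using card_D cardSuc_least[OF natLeq_Card_order card_of_Card_order natU] ordLeq_transitive by blast
  have card_step: "(card_of ((step ^^ n) {p0}), card_of ?U) \<in> ordLeq" for n
  proof (induction n)
    case 0
    show ?case by (simp add: card_of_singl_ordLeq)
  next
    case (Suc n)
    let ?S = "(step ^^ n) {p0}"
    have "(card_of (\<D> \<times> ?S), card_of ?U) \<in> ordLeq"
      by (rule card_of_Times_ordLeq_infinite_Field[OF _ card_DU Suc card_of_Card_order]) (simp add: infU Field_card_of)
    then have 1: "(card_of (case_prod s ` (\<D> \<times> ?S)), card_of ?U) \<in> ordLeq"
      using card_of_image ordLeq_transitive by blast
    have "(card_of (?S \<times> ?S), card_of ?U) \<in> ordLeq"
      by (rule card_of_Times_ordLeq_infinite_Field[OF _ Suc Suc card_of_Card_order]) (simp add: infU Field_card_of)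
    then have "(card_of (case_prod c ` (?S \<times> ?S)), card_of ?U) \<in> ordLeq"
      using card_of_image ordLeq_transitive by blast
    then have 2: "(card_of (case_prod c ` (?S \<times> ?S) \<inter> P), card_of ?U) \<in> ordLeq"
      using card_of_mono1[of "case_prod c ` (?S \<times> ?S) \<inter> P" "case_prod c ` (?S \<times> ?S)"]
        ordLeq_transitive by blast
    show ?case
      using card_of_Un_ordLeq_infinite_Field[OF _ card_of_Un_ordLeq_infinite_Field[OF _ Suc 1 card_of_Card_order] 2 card_of_Card_order] infU
      by (simp only: funpow.simps comp_apply step_def[of ?S] Field_card_of not_False_eq_True)
  qed
  have "(card_of Q, card_of ?U) \<in> ordLeq"
    unfolding Q_def
  proof (rule card_of_UNION_ordLeq_infinite[OF infU])
    show "(card_of (UNIV :: nat set), card_of ?U) \<in> ordLeq"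
      using card_of_Pow[of "UNIV :: nat set", unfolded Pow_UNIV] ordLess_imp_ordLeq by blast
  qed (use card_step in auto)
  then obtain e :: "'p \<Rightarrow> nat set" where inj: "inj_on e Q"
    by (metis card_of_ordLeq)
  define P' where "P' = e ` Q"
  define R' where "R' = {(e p, e q) | p q. p \<in> Q \<and> q \<in> Q \<and> (p, q) \<in> R}"
  have R'_iff: "(e p, e q) \<in> R' \<longleftrightarrow> (p, q) \<in> R" if "p \<in> Q" "q \<in> Q" for p q
    using that inj by (auto simp: R'_def dest: inj_onD)
  have "p0 \<in> Q" unfolding Q_def by (rule UN_I[of 0]) auto
  then have "P' \<noteq> {}" by (auto simp: P'_def)
  moreover have "partial_order_on P' R'"
    unfolding partial_order_on_def preorder_on_def
  proof (intro conjI)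
    show "R' \<subseteq> P' \<times> P'" by (auto simp: R'_def P'_def)
    show "refl_on P' R'" using R(2) QP by (auto simp: refl_on_def P'_def R'_iff)
    show "trans R'"
    proof (rule transI)
      fix x y z assume "(x, y) \<in> R'" "(y, z) \<in> R'"
      moreover then obtain p q r where "x = e p" "y = e q" "z = e r" "p \<in> Q" "q \<in> Q" "r \<in> Q"
        by (auto simp: R'_def)
      ultimately show "(x, z) \<in> R'" using R(3) by (auto simp: R'_iff dest: transD)
    qed
    show "antisym R'"
    proof (rule antisymI)
      fix x y assume "(x, y) \<in> R'" "(y, x) \<in> R'"
      moreover then obtain p q where "x = e p" "y = e q" "p \<in> Q" "q \<in> Q"
        by (auto simp: R'_def)
      ultimately show "x = y" using R(4) by (auto simp: R'_iff dest: antisymD)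
    qed
  qed
  moreover have "sigma_linked P' R'"
    unfolding sigma_linked_def
  proof (intro exI conjI allI ballI)
    show "P' = (\<Union>n. e ` (L n \<inter> Q))" using QP unfolding L(1) P'_def by blast
    fix n x y assume "x \<in> e ` (L n \<inter> Q)" "y \<in> e ` (L n \<inter> Q)"
    then obtain p q where pq: "x = e p" "y = e q" "p \<in> L n" "q \<in> L n" "p \<in> Q" "q \<in> Q" by auto
    then have "compatible_in P R p q" using L(2) by blast
    with pq show "compatible_in P' R' x y"
      unfolding compatible_in_def[of P']
      by (intro bexI[of _ "e (c p q)"]) (auto simp: R'_iff Qc c P'_def)
  qed
  ultimately have meets: "meets_aleph1_dense_sets P' R'"
    using \<open>MA_aleph1_sigma_linked\<close> unfolding MA_aleph1_sigma_linked_def by blast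
  define \<D>' where "\<D>' = (\<lambda>D. e ` (D \<inter> Q)) ` \<D>"
  have "(card_of \<D>', cardSuc natLeq) \<in> ordLeq"
    using card_D card_of_image ordLeq_transitive unfolding \<D>'_def by blast
  moreover have "dense_in_poset P' R' D'" if prem: "D' \<in> \<D>'" for D'
  proof -
    obtain D where D': "D \<in> \<D>" "D' = e ` (D \<inter> Q)" using prem by (auto simp: \<D>'_def)
    show ?thesis
      unfolding dense_in_poset_def
    proof (intro conjI ballI)
      show "D' \<subseteq> P'" by (auto simp: D' P'_def)
      fix x assume "x \<in> P'"
      then obtain p where p: "x = e p" "p \<in> Q" by (auto simp: P'_def)
      then have "p \<in> P" using QP by blast
      with p D' show "\<exists>q\<in>D'. (q, x) \<in> R'"
        by (intro bexI[of _ "e (s D p)"]) (auto simp: R'_iff Qs s)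
    qed
  qed
  ultimately have "\<exists>F'. filter_in_poset P' R' F' \<and> (\<forall>D'\<in>\<D>'. F' \<inter> D' \<noteq> {})"
    using meets[unfolded meets_aleph1_dense_sets_def, rule_format, of \<D>'] by blast
  then obtain F' where F': "filter_in_poset P' R' F'" "\<forall>D'\<in>\<D>'. F' \<inter> D' \<noteq> {}"
    by blast
  define F where "F = {p \<in> P. \<exists>q\<in>Q. e q \<in> F' \<and> (q, p) \<in> R}"
  have F'Q: "\<exists>q\<in>Q. x = e q" if "x \<in> F'" for x
    using F'(1) that by (auto simp: filter_in_poset_def P'_def)
  have eF: "q \<in> F" if "q \<in> Q" "e q \<in> F'" for q
    using that QP R(2) by (auto simp: F_def)
  have "filter_in_poset P R F"
    unfolding filter_in_poset_def
  proof (intro conjI ballI impI)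
    show "F \<subseteq> P" by (auto simp: F_def)
    have "F' \<noteq> {}" using F'(1) by (simp add: filter_in_poset_def)
    then show "F \<noteq> {}" using F'Q eF by blast
    show "q \<in> F" if "p \<in> F" "q \<in> P" "(p, q) \<in> R" for p q
      using that R(3) by (auto simp: F_def dest: transD)
    fix p q assume "p \<in> F" "q \<in> F"
    then obtain p' q' where pq: "p' \<in> Q" "e p' \<in> F'" "(p', p) \<in> R" "q' \<in> Q" "e q' \<in> F'" "(q', q) \<in> R"
      by (auto simp: F_def)
    then obtain x where "x \<in> F'" "(x, e p') \<in> R'" "(x, e q') \<in> R'"
      using F'(1) unfolding filter_in_poset_def by blast
    moreover then obtain r where "r \<in> Q" "x = e r" using F'Q by blast
    ultimately show "\<exists>r\<in>F. (r, p) \<in> R \<and> (r, q) \<in> R"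
      using pq R(3) eF by (intro bexI[of _ r]) (auto simp: R'_iff dest: transD)
  qed
  moreover have "F \<inter> D \<noteq> {}" if "D \<in> \<D>" for D
  proof -
    have "F' \<inter> e ` (D \<inter> Q) \<noteq> {}" using F'(2) that by (auto simp: \<D>'_def)
    then show ?thesis using eF by blast
  qed
  ultimately show "\<exists>F. filter_in_poset P R F \<and> (\<forall>D\<in>\<D>. F \<inter> D \<noteq> {})" by blast
qed


section \<open>The Boolean algebra of sets of natural numbers modulo finite sets\<close>

quotient_type nat_set_mod_fin = "nat set" / "\<lambda>A B. finite (sym_diff A B)"
proof (rule equivpI)
  show "transp (\<lambda>A B :: nat set. finite (sym_diff A B))"
  proof (rule transpI)
    fix A B C :: "nat set"
    assume "finite (sym_diff A B)" "finite (sym_diff B C)"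
    then show "finite (sym_diff A C)"
      by (rule_tac finite_subset[of _ "sym_diff A B \<union> sym_diff B C"]) auto
  qed
qed (auto simp: reflp_def symp_def Un_commute)

instantiation nat_set_mod_fin :: boolean_algebra
begin

lift_definition inf_nat_set_mod_fin :: "nat_set_mod_fin \<Rightarrow> nat_set_mod_fin \<Rightarrow> nat_set_mod_fin"
  is "(\<inter>)"
  subgoal for A A' B B'
    by (rule finite_subset[of _ "sym_diff A A' \<union> sym_diff B B'"]) auto
  done

lift_definition sup_nat_set_mod_fin :: "nat_set_mod_fin \<Rightarrow> nat_set_mod_fin \<Rightarrow> nat_set_mod_fin"
  is "(\<union>)"
  subgoal for A A' B B'
    by (rule finite_subset[of _ "sym_diff A A' \<union> sym_diff B B'"]) auto
  done

lift_definition minus_nat_set_mod_fin :: "nat_set_mod_fin \<Rightarrow> nat_set_mod_fin \<Rightarrow> nat_set_mod_fin"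
  is "(-)"
  subgoal for A A' B B'
    by (rule finite_subset[of _ "sym_diff A A' \<union> sym_diff B B'"]) auto
  done

lift_definition uminus_nat_set_mod_fin :: "nat_set_mod_fin \<Rightarrow> nat_set_mod_fin"
  is "uminus"
  subgoal for A A'
    by (rule finite_subset[of _ "sym_diff A A'"]) auto
  done

lift_definition bot_nat_set_mod_fin :: nat_set_mod_fin is "{}" .

lift_definition top_nat_set_mod_fin :: nat_set_mod_fin is "UNIV" .

lift_definition less_eq_nat_set_mod_fin :: "nat_set_mod_fin \<Rightarrow> nat_set_mod_fin \<Rightarrow> bool"
  is "\<lambda>A B. finite (A - B)"
proof -
  fix A A' B B' :: "nat set"
  assume *: "finite (sym_diff A A')" "finite (sym_diff B B')"
  have "finite (A' - B')" if "finite (A - B)"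
    by (rule finite_subset[of _ "(A - B) \<union> sym_diff A A' \<union> sym_diff B B'"]) (use * that in auto)
  moreover have "finite (A - B)" if "finite (A' - B')"
    by (rule finite_subset[of _ "(A' - B') \<union> sym_diff A A' \<union> sym_diff B B'"]) (use * that in auto)
  ultimately show "finite (A - B) = finite (A' - B')" by blast
qed

definition less_nat_set_mod_fin :: "nat_set_mod_fin \<Rightarrow> nat_set_mod_fin \<Rightarrow> bool" where
  "less_nat_set_mod_fin S T \<longleftrightarrow> S \<le> T \<and> \<not> T \<le> S"

instance
proof
  fix x y z :: nat_set_mod_fin
  show "x < y \<longleftrightarrow> x \<le> y \<and> \<not> y \<le> x" by (rule less_nat_set_mod_fin_def)
  show "x \<le> x" by transfer simp
  show "x \<le> z" if "x \<le> y" "y \<le> z"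
    using that
  proof transfer
    fix x y z :: "nat set"
    assume "finite (x - y)" "finite (y - z)"
    then show "finite (x - z)" by (rule_tac finite_subset[of _ "(x - y) \<union> (y - z)"]) auto
  qed
  show "x = y" if "x \<le> y" "y \<le> x" using that by transfer simp
  show "inf x y \<le> x" by transfer (simp add: Diff_eq Int_ac)
  show "inf x y \<le> y" by transfer (simp add: Diff_eq Int_ac)
  show "x \<le> inf y z" if "x \<le> y" "x \<le> z" using that by transfer (simp add: Diff_Int)
  show "x \<le> sup x y" by transfer (simp add: Diff_eq)
  show "y \<le> sup x y" by transfer (simp add: Diff_eq)
  show "sup y z \<le> x" if "y \<le> x" "z \<le> x" using that by transfer (simp add: Un_Diff)
  show "Orderings.bot \<le> x" by transfer simp
  show "x \<le> Orderings.top" by transfer simp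
  show "sup x (inf y z) = inf (sup x y) (sup x z)" by transfer (simp add: Un_Int_distrib)
  show "inf x (- x) = Orderings.bot" by transfer simp
  show "sup x (- x) = Orderings.top" by transfer simp
  show "x - y = inf x (- y)" by transfer (simp add: Diff_eq)
qed

end

definition boolean_algebra_automorphism :: "('b :: boolean_algebra \<Rightarrow> 'b) \<Rightarrow> bool" where
  "boolean_algebra_automorphism \<theta> \<longleftrightarrow> bij \<theta> \<and>
     (\<forall>S T. \<theta> (inf S T) = inf (\<theta> S) (\<theta> T)) \<and> (\<forall>S T. \<theta> (sup S T) = sup (\<theta> S) (\<theta> T)) \<and>
     (\<forall>S. \<theta> (- S) = - \<theta> S) \<and> \<theta> Orderings.bot = Orderings.bot \<and> \<theta> Orderings.top = Orderings.top"


section \<open>Reduced products of metric groups\<close>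

definition bi_invariant_metric_group :: "('a, 'b) monoid_scheme \<Rightarrow> ('a \<Rightarrow> 'a \<Rightarrow> real) \<Rightarrow> bool" where
  "bi_invariant_metric_group H dist_H \<longleftrightarrow> group H \<and> Metric_space (carrier H) dist_H \<and>
     (\<forall>x\<in>carrier H. \<forall>y\<in>carrier H. \<forall>z\<in>carrier H.
        dist_H (z \<otimes>\<^bsub>H\<^esub> x) (z \<otimes>\<^bsub>H\<^esub> y) = dist_H x y \<and>
        dist_H (x \<otimes>\<^bsub>H\<^esub> z) (y \<otimes>\<^bsub>H\<^esub> z) = dist_H x y)"

definition separable_metric_groups_bounded ::
  "(nat \<Rightarrow> ('a, 'b) monoid_scheme) \<Rightarrow> (nat \<Rightarrow> 'a \<Rightarrow> 'a \<Rightarrow> real) \<Rightarrow> bool" where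
  "separable_metric_groups_bounded G d \<longleftrightarrow>
     (\<forall>k. bi_invariant_metric_group (G k) (d k) \<and>
          separable_space (Metric_space.mtopology (carrier (G k)) (d k))) \<and>
     (\<exists>C. \<forall>k. \<forall>x\<in>carrier (G k). \<forall>y\<in>carrier (G k). d k x y \<le> C)"

definition seqs_to_infinity :: "(nat \<Rightarrow> nat) set" where
  "seqs_to_infinity = {k. filterlim k at_top sequentially}"

definition seq_group :: "(nat \<Rightarrow> ('a, 'b) monoid_scheme) \<Rightarrow> (nat \<Rightarrow> nat) \<Rightarrow> (nat \<Rightarrow> 'a) monoid" where
  "seq_group G k = product_group UNIV (\<lambda>n. G (k n))"

definition null_seqs ::
  "(nat \<Rightarrow> ('a, 'b) monoid_scheme) \<Rightarrow> (nat \<Rightarrow> 'a \<Rightarrow> 'a \<Rightarrow> real) \<Rightarrow> (nat \<Rightarrow> nat) \<Rightarrow> (nat \<Rightarrow> 'a) set"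
  where
  "null_seqs G d k =
     {a \<in> carrier (seq_group G k). (\<lambda>n. d (k n) (a n) \<one>\<^bsub>G (k n)\<^esub>) \<longlonglongrightarrow> 0}"

definition reduced_product ::
  "(nat \<Rightarrow> ('a, 'b) monoid_scheme) \<Rightarrow> (nat \<Rightarrow> 'a \<Rightarrow> 'a \<Rightarrow> real) \<Rightarrow> (nat \<Rightarrow> nat) \<Rightarrow> (nat \<Rightarrow> 'a) set monoid"
  where
  "reduced_product G d k = seq_group G k Mod null_seqs G d k"

definition seq_class ::
  "(nat \<Rightarrow> ('a, 'b) monoid_scheme) \<Rightarrow> (nat \<Rightarrow> 'a \<Rightarrow> 'a \<Rightarrow> real) \<Rightarrow> (nat \<Rightarrow> nat) \<Rightarrow> (nat \<Rightarrow> 'a) \<Rightarrow> (nat \<Rightarrow> 'a) set"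
  where
  "seq_class G d k a = null_seqs G d k #>\<^bsub>seq_group G k\<^esub> a"

text \<open>
  The limit along \<^term>\<open>A\<close>; for finite \<^term>\<open>A\<close> the filter is \<^term>\<open>Orderings.bot\<close> and the condition is vacuous.
  The choice of representatives is immaterial, see \<open>equal_along_set_seq_class\<close> below.
\<close>

definition equal_along_set ::
  "(nat \<Rightarrow> ('a, 'b) monoid_scheme) \<Rightarrow> (nat \<Rightarrow> 'a \<Rightarrow> 'a \<Rightarrow> real) \<Rightarrow> (nat \<Rightarrow> nat) \<Rightarrow>
     nat set \<Rightarrow> (nat \<Rightarrow> 'a) set \<Rightarrow> (nat \<Rightarrow> 'a) set \<Rightarrow> bool"
  where
  "equal_along_set G d k A x y \<longleftrightarrow>
     (\<exists>a\<in>carrier (seq_group G k). \<exists>b\<in>carrier (seq_group G k).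
        x = seq_class G d k a \<and> y = seq_class G d k b \<and>
        ((\<lambda>n. d (k n) (a n) (b n)) \<longlongrightarrow> 0) (inf sequentially (principal A)))"

lemma seq_group_simps:
  "a \<in> carrier (seq_group G k) \<longleftrightarrow> (\<forall>n. a n \<in> carrier (G (k n)))"
  "a \<otimes>\<^bsub>seq_group G k\<^esub> b = (\<lambda>n. a n \<otimes>\<^bsub>G (k n)\<^esub> b n)"
  "\<one>\<^bsub>seq_group G k\<^esub> = (\<lambda>n. \<one>\<^bsub>G (k n)\<^esub>)"
  by (auto simp: seq_group_def product_group_def PiE_def Pi_def)

lemma tendsto_null_squeeze:
  fixes f g :: "'i \<Rightarrow> real"
  assumes "\<And>n. 0 \<le> f n" "\<And>n. f n \<le> g n" "(g \<longlongrightarrow> 0 + 0) F"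
  shows "(f \<longlongrightarrow> 0) F"
  by (rule tendsto_sandwich[of "\<lambda>_. 0" f F g]) (use assms in auto)

lemma null_seqs_normal:
  assumes "separable_metric_groups_bounded G d"
  shows "null_seqs G d k \<lhd> seq_group G k"
proof -
  have grp: "group (G n)" and met: "Metric_space (carrier (G n)) (d n)"
    and inv: "\<And>x y z. x \<in> carrier (G n) \<Longrightarrow> y \<in> carrier (G n) \<Longrightarrow> z \<in> carrier (G n) \<Longrightarrow>
        d n (z \<otimes>\<^bsub>G n\<^esub> x) (z \<otimes>\<^bsub>G n\<^esub> y) = d n x y"
      "\<And>x y z. x \<in> carrier (G n) \<Longrightarrow> y \<in> carrier (G n) \<Longrightarrow> z \<in> carrier (G n) \<Longrightarrow>
        d n (x \<otimes>\<^bsub>G n\<^esub> z) (y \<otimes>\<^bsub>G n\<^esub> z) = d n x y" for n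
    using assms by (auto simp: separable_metric_groups_bounded_def bi_invariant_metric_group_def)
  interpret S: group "seq_group G k"
    unfolding seq_group_def by (rule product_group) (rule grp)
  have inv_seq: "inv\<^bsub>seq_group G k\<^esub> a = (\<lambda>n. inv\<^bsub>G (k n)\<^esub> a n)"
    if "a \<in> carrier (seq_group G k)" for a
    using that unfolding seq_group_def by (subst inv_product_group) (auto simp: grp)
  have mult: "d n (x \<otimes>\<^bsub>G n\<^esub> y) \<one>\<^bsub>G n\<^esub> \<le> d n x \<one>\<^bsub>G n\<^esub> + d n y \<one>\<^bsub>G n\<^esub>"
    if "x \<in> carrier (G n)" "y \<in> carrier (G n)" for n x y
  proof -
    interpret H: group "G n" by (rule grp)
    have "d n (x \<otimes>\<^bsub>G n\<^esub> y) \<one>\<^bsub>G n\<^esub> \<le> d n (x \<otimes>\<^bsub>G n\<^esub> y) (\<one>\<^bsub>G n\<^esub> \<otimes>\<^bsub>G n\<^esub> y) + d n y \<one>\<^bsub>G n\<^esub>"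
      using Metric_space.triangle[OF met, of "x \<otimes>\<^bsub>G n\<^esub> y" n y "\<one>\<^bsub>G n\<^esub>"] that by simp
    then show ?thesis using that inv(2)[of x n "\<one>\<^bsub>G n\<^esub>" y] by (simp del: H.l_one)
  qed
  have inverse: "d n (inv\<^bsub>G n\<^esub> x) \<one>\<^bsub>G n\<^esub> = d n x \<one>\<^bsub>G n\<^esub>" if "x \<in> carrier (G n)" for n x
  proof -
    interpret H: group "G n" by (rule grp)
    show ?thesis
      using inv(1)[of "inv\<^bsub>G n\<^esub> x" n "\<one>\<^bsub>G n\<^esub>" x] that
      by (simp add: Metric_space.commute[OF met, of n x])
  qed
  have conj: "d n (x \<otimes>\<^bsub>G n\<^esub> h \<otimes>\<^bsub>G n\<^esub> inv\<^bsub>G n\<^esub> x) \<one>\<^bsub>G n\<^esub> = d n h \<one>\<^bsub>G n\<^esub>"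
    if "x \<in> carrier (G n)" "h \<in> carrier (G n)" for n x h
  proof -
    interpret H: group "G n" by (rule grp)
    show ?thesis
      using inv(2)[of "x \<otimes>\<^bsub>G n\<^esub> h" n x "inv\<^bsub>G n\<^esub> x"] inv(1)[of h n "\<one>\<^bsub>G n\<^esub>" x] that by simp
  qed
  have nonneg: "0 \<le> d n x y" for n x y by (rule Metric_space.nonneg[OF met])
  have "subgroup (null_seqs G d k) (seq_group G k)"
  proof (rule S.subgroupI)
    show "null_seqs G d k \<subseteq> carrier (seq_group G k)" by (auto simp: null_seqs_def)
    have "d n \<one>\<^bsub>G n\<^esub> \<one>\<^bsub>G n\<^esub> = 0" for n
      using Metric_space.zero[OF met] group.is_monoid[OF grp] monoid.one_closed by blast
    then have "\<one>\<^bsub>seq_group G k\<^esub> \<in> null_seqs G d k"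
      using S.one_closed by (simp add: null_seqs_def seq_group_simps(3))
    then show "null_seqs G d k \<noteq> {}" by blast
    show "inv\<^bsub>seq_group G k\<^esub> a \<in> null_seqs G d k" if "a \<in> null_seqs G d k" for a
    proof -
      have a: "a \<in> carrier (seq_group G k)" using that by (simp add: null_seqs_def)
      then show ?thesis
        using that S.inv_closed[OF a] by (simp add: null_seqs_def inv_seq inverse seq_group_simps(1))
    qed
    show "a \<otimes>\<^bsub>seq_group G k\<^esub> b \<in> null_seqs G d k" if "a \<in> null_seqs G d k" "b \<in> null_seqs G d k" for a b
    proof -
      have ab: "a \<in> carrier (seq_group G k)" "b \<in> carrier (seq_group G k)"
        using that by (auto simp: null_seqs_def)
      have "(\<lambda>n. d (k n) (a n) \<one>\<^bsub>G (k n)\<^esub> + d (k n) (b n) \<one>\<^bsub>G (k n)\<^esub>) \<longlonglongrightarrow> 0 + 0"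
        using that by (intro tendsto_add) (auto simp: null_seqs_def)
      then have "(\<lambda>n. d (k n) (a n \<otimes>\<^bsub>G (k n)\<^esub> b n) \<one>\<^bsub>G (k n)\<^esub>) \<longlonglongrightarrow> 0"
        using ab by (intro tendsto_null_squeeze[OF nonneg mult]) (auto simp: seq_group_simps(1))
      then show ?thesis
        using S.m_closed[OF ab] by (simp add: null_seqs_def seq_group_simps(2))
    qed
  qed
  moreover have "x \<otimes>\<^bsub>seq_group G k\<^esub> h \<otimes>\<^bsub>seq_group G k\<^esub> inv\<^bsub>seq_group G k\<^esub> x \<in> null_seqs G d k"
    if x: "x \<in> carrier (seq_group G k)" and "h \<in> null_seqs G d k" for x h
  proof -
    have h: "h \<in> carrier (seq_group G k)" "(\<lambda>n. d (k n) (h n) \<one>\<^bsub>G (k n)\<^esub>) \<longlonglongrightarrow> 0"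
      using that by (auto simp: null_seqs_def)
    have "x \<otimes>\<^bsub>seq_group G k\<^esub> h \<otimes>\<^bsub>seq_group G k\<^esub> inv\<^bsub>seq_group G k\<^esub> x \<in> carrier (seq_group G k)"
      using x h(1) by simp
    with x h conj show ?thesis
      by (simp add: null_seqs_def inv_seq seq_group_simps(2)) (simp add: seq_group_simps(1))
  qed
  ultimately show ?thesis by (simp add: S.normal_inv_iff)
qed

lemma equal_along_set_seq_class:
  assumes G: "separable_metric_groups_bounded G d"
    and ab: "a \<in> carrier (seq_group G k)" "b \<in> carrier (seq_group G k)"
  shows "equal_along_set G d k A (seq_class G d k a) (seq_class G d k b) \<longleftrightarrow>
     ((\<lambda>n. d (k n) (a n) (b n)) \<longlongrightarrow> 0) (inf sequentially (principal A))"
proof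
  have grp: "group (G n)" and met: "Metric_space (carrier (G n)) (d n)"
    and inv: "\<And>x y z. x \<in> carrier (G n) \<Longrightarrow> y \<in> carrier (G n) \<Longrightarrow> z \<in> carrier (G n) \<Longrightarrow>
        d n (x \<otimes>\<^bsub>G n\<^esub> z) (y \<otimes>\<^bsub>G n\<^esub> z) = d n x y" for n
    using G by (auto simp: separable_metric_groups_bounded_def bi_invariant_metric_group_def)
  interpret N: normal "null_seqs G d k" "seq_group G k"
    using G by (rule null_seqs_normal)
  have close: "(\<lambda>n. d (k n) (x n) (y n)) \<longlonglongrightarrow> 0"
    if xy: "x \<in> carrier (seq_group G k)" "y \<in> carrier (seq_group G k)"
      "seq_class G d k x = seq_class G d k y" for x y
  proof -
    have "x \<in> seq_class G d k y"
      using that N.rcos_self[OF xy(1) N.subgroup_axioms] by (simp add: seq_class_def)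
    then obtain h where h: "h \<in> null_seqs G d k" "x = h \<otimes>\<^bsub>seq_group G k\<^esub> y"
      by (auto simp: seq_class_def r_coset_def)
    have eq: "(\<lambda>n. d (k n) (x n) (y n)) = (\<lambda>n. d (k n) (h n) \<one>\<^bsub>G (k n)\<^esub>)"
    proof (rule ext)
      fix n
      interpret H: group "G (k n)" by (rule grp)
      have "h n \<in> carrier (G (k n))" "y n \<in> carrier (G (k n))"
        using h(1) xy(2) by (auto simp: null_seqs_def seq_group_simps(1))
      then show "d (k n) (x n) (y n) = d (k n) (h n) \<one>\<^bsub>G (k n)\<^esub>"
        using inv[of "h n" "k n" "\<one>\<^bsub>G (k n)\<^esub>" "y n"] by (simp add: h(2) seq_group_simps(2))
    qed
    show ?thesis using h(1) unfolding eq null_seqs_def by (elim CollectE conjE)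
  qed
  assume "equal_along_set G d k A (seq_class G d k a) (seq_class G d k b)"
  then obtain a' b' where ab': "a' \<in> carrier (seq_group G k)" "b' \<in> carrier (seq_group G k)"
    "seq_class G d k a = seq_class G d k a'" "seq_class G d k b = seq_class G d k b'"
    and lim: "((\<lambda>n. d (k n) (a' n) (b' n)) \<longlongrightarrow> 0) (inf sequentially (principal A))"
    unfolding equal_along_set_def by blast
  have "((\<lambda>n. d (k n) (a n) (a' n) + d (k n) (a' n) (b' n) + d (k n) (b' n) (b n)) \<longlongrightarrow> 0 + 0)
      (inf sequentially (principal A))"
    using tendsto_add[OF tendsto_add[OF tendsto_mono[OF inf_le1 close[OF ab(1) ab'(1,3)]] lim]
      tendsto_mono[OF inf_le1 close[OF ab'(2) ab(2) ab'(4)[symmetric]]]] by simp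
  moreover have "d (k n) (a n) (b n) \<le> d (k n) (a n) (a' n) + d (k n) (a' n) (b' n) + d (k n) (b' n) (b n)"
    for n
  proof -
    have "a n \<in> carrier (G (k n))" "a' n \<in> carrier (G (k n))"
      "b n \<in> carrier (G (k n))" "b' n \<in> carrier (G (k n))"
      using ab ab'(1,2) by (simp_all add: seq_group_simps(1))
    then show ?thesis
      using Metric_space.triangle[OF met, of "a n" "k n" "a' n" "b n"]
        Metric_space.triangle[OF met, of "a' n" "k n" "b' n" "b n"] by linarith
  qed
  ultimately show "((\<lambda>n. d (k n) (a n) (b n)) \<longlongrightarrow> 0) (inf sequentially (principal A))"
    by (intro tendsto_null_squeeze[OF Metric_space.nonneg[OF met]]) auto
next
  show "((\<lambda>n. d (k n) (a n) (b n)) \<longlongrightarrow> 0) (inf sequentially (principal A)) \<Longrightarrow>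
    equal_along_set G d k A (seq_class G d k a) (seq_class G d k b)"
    using ab unfolding equal_along_set_def by (intro bexI[of _ a] bexI[of _ b] conjI refl)
qed

lemma sequentially_inf_principal_cong:
  assumes "finite (sym_diff A B)"
  shows "inf sequentially (principal A) = inf sequentially (principal B)"
proof -
  have "eventually (\<lambda>n. n \<notin> sym_diff A B) sequentially"
    using assms by (simp flip: cofinite_eq_sequentially add: eventually_cofinite set_diff_eq)
  then have "eventually (\<lambda>n. n \<in> A \<longleftrightarrow> n \<in> B) sequentially"
    by eventually_elim auto
  then have "eventually (\<lambda>n. n \<in> A \<longrightarrow> P n) sequentially \<longleftrightarrow>
             eventually (\<lambda>n. n \<in> B \<longrightarrow> P n) sequentially" for P
    by (auto elim: eventually_elim2)
  then show ?thesis
    by (simp add: filter_eq_iff eventually_inf_principal)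
qed

lift_definition equal_along ::
  "(nat \<Rightarrow> ('a, 'b) monoid_scheme) \<Rightarrow> (nat \<Rightarrow> 'a \<Rightarrow> 'a \<Rightarrow> real) \<Rightarrow> (nat \<Rightarrow> nat) \<Rightarrow>
     nat_set_mod_fin \<Rightarrow> (nat \<Rightarrow> 'a) set \<Rightarrow> (nat \<Rightarrow> 'a) set \<Rightarrow> bool"
  is equal_along_set
  by (intro ext) (simp add: equal_along_set_def sequentially_inf_principal_cong)

definition product_form ::
  "(nat \<Rightarrow> ('a, 'b) monoid_scheme) \<Rightarrow> (nat \<Rightarrow> 'a \<Rightarrow> 'a \<Rightarrow> real) \<Rightarrow> (nat \<Rightarrow> nat) \<Rightarrow> (nat \<Rightarrow> nat) \<Rightarrow>
     ((nat \<Rightarrow> 'a) set \<Rightarrow> (nat \<Rightarrow> 'a) set) \<Rightarrow> bool"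
  where
  "product_form G d k l \<psi> \<longleftrightarrow>
     (\<exists>h. (\<forall>n. h n \<in> carrier (G (k n)) \<rightarrow> carrier (G (l n))) \<and>
          (\<forall>a\<in>carrier (seq_group G k). \<psi> (seq_class G d k a) = seq_class G d l (\<lambda>n. h n (a n))))"

text \<open>
  The map \<open>[a] \<mapsto> [F a]\<close> into the reduced product along \<^term>\<open>l\<close>.  If this is well defined at a class
  \<^term>\<open>x\<close>, the union below is over copies of a single coset and equals that coset.  If it is not well
  defined at \<^term>\<open>x\<close>, the union comprises several distinct cosets and hence is not an element of the
  reduced product; so membership of the map in \<^const>\<open>iso\<close> entails that it is well defined.
  See \<open>class_map_in_reduced_product_iff\<close> below.
\<close>

definition class_map ::
  "(nat \<Rightarrow> ('a, 'b) monoid_scheme) \<Rightarrow> (nat \<Rightarrow> 'a \<Rightarrow> 'a \<Rightarrow> real) \<Rightarrow> (nat \<Rightarrow> nat) \<Rightarrow>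
     ((nat \<Rightarrow> 'a) \<Rightarrow> (nat \<Rightarrow> 'a)) \<Rightarrow> (nat \<Rightarrow> 'a) set \<Rightarrow> (nat \<Rightarrow> 'a) set"
  where
  "class_map G d l F x = (\<Union>a\<in>x. seq_class G d l (F a))"

lemma class_map_in_reduced_product_iff:
  assumes G: "separable_metric_groups_bounded G d"
    and F: "F \<in> carrier (seq_group G k) \<rightarrow> carrier (seq_group G l)"
    and a: "a \<in> carrier (seq_group G k)"
  shows "class_map G d l F (seq_class G d k a) \<in> carrier (reduced_product G d l) \<longleftrightarrow>
     (\<forall>b\<in>carrier (seq_group G k).
        seq_class G d k b = seq_class G d k a \<longrightarrow> seq_class G d l (F b) = seq_class G d l (F a))"
    (is "?in \<longleftrightarrow> ?wd")
    and "class_map G d l F (seq_class G d k a) \<in> carrier (reduced_product G d l) \<Longrightarrow>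
      class_map G d l F (seq_class G d k a) = seq_class G d l (F a)"
proof -
  interpret K: normal "null_seqs G d k" "seq_group G k" using G by (rule null_seqs_normal)
  interpret L: normal "null_seqs G d l" "seq_group G l" using G by (rule null_seqs_normal)
  have mem: "b \<in> seq_class G d k a \<longleftrightarrow>
      b \<in> carrier (seq_group G k) \<and> seq_class G d k b = seq_class G d k a" for b
    unfolding seq_class_def
    using K.repr_independence[OF _ a K.subgroup_axioms, of b] K.rcos_self[OF _ K.subgroup_axioms, of b]
      K.r_coset_subset_G[OF K.subset a] by auto
  have eq: "class_map G d l F (seq_class G d k a) = seq_class G d l (F b)"
    if "?in" "b \<in> seq_class G d k a" for b
  proof -
    obtain c where c: "c \<in> carrier (seq_group G l)"
      "class_map G d l F (seq_class G d k a) = seq_class G d l c"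
      using \<open>?in\<close> by (auto simp: reduced_product_def carrier_FactGroup seq_class_def)
    have Fb: "F b \<in> carrier (seq_group G l)" using that(2) F mem by auto
    have "F b \<in> seq_class G d l (F b)"
      unfolding seq_class_def by (rule L.rcos_self[OF Fb L.subgroup_axioms])
    then have "F b \<in> seq_class G d l c"
      using that(2) unfolding c(2)[symmetric] class_map_def by blast
    then show ?thesis
      unfolding c(2) unfolding seq_class_def by (rule L.repr_independence[OF _ c(1) L.subgroup_axioms])
  qed
  have a_mem: "a \<in> seq_class G d k a" using a mem by simp
  show "class_map G d l F (seq_class G d k a) = seq_class G d l (F a)" if ?in
    using eq[OF that a_mem] .
  show "?in \<longleftrightarrow> ?wd"
  proof
    assume ?in
    then show ?wd using eq[OF _ a_mem] eq mem by metis
  next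
    assume wd: ?wd
    then have "class_map G d l F (seq_class G d k a) = seq_class G d l (F a)"
      using a_mem mem unfolding class_map_def by blast
    moreover have "F a \<in> carrier (seq_group G l)" using F a by blast
    ultimately show ?in
      by (auto simp: reduced_product_def carrier_FactGroup seq_class_def)
  qed
qed

definition coordinatewise_map ::
  "(nat \<Rightarrow> ('a, 'b) monoid_scheme) \<Rightarrow> (nat \<Rightarrow> 'a \<Rightarrow> 'a \<Rightarrow> real) \<Rightarrow> (nat \<Rightarrow> nat) \<Rightarrow>
     (nat \<Rightarrow> 'a \<Rightarrow> 'a) \<Rightarrow> (nat \<Rightarrow> 'a) set \<Rightarrow> (nat \<Rightarrow> 'a) set"
  where
  "coordinatewise_map G d l \<alpha> = class_map G d l (\<lambda>a n. \<alpha> n (a n))"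

definition reindexing_map ::
  "(nat \<Rightarrow> ('a, 'b) monoid_scheme) \<Rightarrow> (nat \<Rightarrow> 'a \<Rightarrow> 'a \<Rightarrow> real) \<Rightarrow> (nat \<Rightarrow> nat) \<Rightarrow>
     (nat \<Rightarrow> nat) \<Rightarrow> (nat \<Rightarrow> 'a) set \<Rightarrow> (nat \<Rightarrow> 'a) set"
  where
  "reindexing_map G d k f = class_map G d (k \<circ> f) (\<lambda>a. a \<circ> f)"

definition almost_permutation :: "(nat \<Rightarrow> nat) \<Rightarrow> bool" where
  "almost_permutation f \<longleftrightarrow> (\<exists>A B. finite (- A) \<and> finite (- B) \<and> bij_betw f A B)"

definition condition_CR ::
  "(nat \<Rightarrow> ('a, 'b) monoid_scheme) \<Rightarrow> (nat \<Rightarrow> 'a \<Rightarrow> 'a \<Rightarrow> real) \<Rightarrow> bool" where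
  "condition_CR G d \<longleftrightarrow>
     (\<forall>k\<in>seqs_to_infinity. \<forall>l\<in>seqs_to_infinity.
      \<forall>\<phi>\<in>iso (reduced_product G d k) (reduced_product G d l).
        \<exists>\<theta>. boolean_algebra_automorphism \<theta> \<and>
          (\<forall>a\<in>carrier (reduced_product G d k). \<forall>b\<in>carrier (reduced_product G d k). \<forall>S.
             equal_along G d k S a b \<longleftrightarrow> equal_along G d l (\<theta> S) (\<phi> a) (\<phi> b)))"

definition condition_PF ::
  "(nat \<Rightarrow> ('a, 'b) monoid_scheme) \<Rightarrow> (nat \<Rightarrow> 'a \<Rightarrow> 'a \<Rightarrow> real) \<Rightarrow> (nat \<Rightarrow> nat) rel \<Rightarrow>
     ((nat \<Rightarrow> nat) \<Rightarrow> (nat \<Rightarrow> nat) \<Rightarrow> (nat \<Rightarrow> 'a) set \<Rightarrow> (nat \<Rightarrow> 'a) set) \<Rightarrow> bool"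
  where
  "condition_PF G d E \<Gamma> \<longleftrightarrow>
     (\<forall>k\<in>seqs_to_infinity. \<forall>l\<in>seqs_to_infinity.
      \<forall>\<psi>\<in>iso (reduced_product G d k) (reduced_product G d l).
        product_form G d k l \<psi> \<longrightarrow>
          (k, l) \<in> E \<and>
          (\<exists>\<alpha>. (\<forall>n. \<alpha> n \<in> iso (G (l n)) (G (l n))) \<and>
               coordinatewise_map G d l \<alpha> \<in> iso (reduced_product G d l) (reduced_product G d l) \<and>
               (\<forall>x\<in>carrier (reduced_product G d k). \<psi> x = coordinatewise_map G d l \<alpha> (\<Gamma> k l x))))"

end

theory Submission
  imports Defs "HOL-Library.Countable_Set_Type" "HOL-Library.Sublist"
begin

text \<open>
  Let \<open>\<theta>\<close> be the automorphism given by (CR).  Two uniformization arguments carry the proof; both apply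
  OCA to pairs \<open>(x, p)\<close>, where \<open>x\<close> is a binary sequence and \<open>p\<close> an element of a family of functions
  that cohere modulo finite sets, the colour counting the clashes of two elements against the level at which
  their binary sequences split.  Uncountable homogeneous sets are excluded by a forcing of finite approximations,
  to which MA applies.

  The first argument shows that every automorphism of the Boolean algebra of sets modulo finite is induced by a
  point map.  For all but countably many branches of a tree of finite sets, OCA covers the power set of the branch
  by countably many pieces on which a lift of the automorphism is continuous in a weak sense; for a sufficiently
  generic set each coordinate of its image then depends on a single point, so that the automorphism is trivial on
  the branch.  The trivial pieces cohere and uniformize to a point map \<open>f\<close> inducing \<open>\<theta>\<close>.

  After reindexing by \<open>f\<close> the isomorphism respects coordinates.  The second argument, applied to its values on
  sequences from fixed countable dense sets, shows that it is of product form, and (PF) yields the conclusion.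
\<close>

section \<open>Combinatorial forms of OCA and MA\<close>

text \<open>The binary sequences are there to make the homogeneous alternative of OCA refutable. To
  amalgamate conditions one must capture up to k pairs of elements, where k bounds both the stem
  length and the number of elements, and each pair needs a clash of its own at a point not yet
  decided. Asking for a number of clashes proportional to the level at which the sequences split
  supplies them, since elements of equal type split at level k or later. The factor 4 is what it
  takes to choose clashes whose values are disjoint for different pairs. The price is paid in the
  other alternative: on a piece of the cover clashes are not absent, only fewer than four times the
  split level. Diagonalizing over all pieces and stems reduces this to a constant bound on the
  clashes, and an induction on that bound, with largeness measured by an ultrafilter that avoids all
  uniformizable sets of points, produces the uniformization. Partial sections let two cases share
  this argument: total functions with metric values, and partial point maps with the discrete
  metric.\<close>

lemma OCA_coded:
  fixes S :: "'p set" and code :: "'p \<Rightarrow> nat \<Rightarrow> nat"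
  assumes OCA and inj: "inj_on code S"
    and sym: "\<And>p q. p \<in> S \<Longrightarrow> q \<in> S \<Longrightarrow> K p q \<Longrightarrow> K q p"
    and opn: "\<And>p q. p \<in> S \<Longrightarrow> q \<in> S \<Longrightarrow> p \<noteq> q \<Longrightarrow> K p q \<Longrightarrow>
      \<exists>N. \<forall>p'\<in>S. \<forall>q'\<in>S. (\<forall>n<N. code p' n = code p n) \<and> (\<forall>n<N. code q' n = code q n) \<longrightarrow> K p' q'"
    and no_hom: "\<And>Y. Y \<subseteq> S \<Longrightarrow> uncountable Y \<Longrightarrow> \<exists>p\<in>Y. \<exists>q\<in>Y. p \<noteq> q \<and> \<not> K p q"
  obtains Z :: "nat \<Rightarrow> 'p set" where "S = (\<Union>n. Z n)"
    "\<And>n p q. p \<in> Z n \<Longrightarrow> q \<in> Z n \<Longrightarrow> p \<noteq> q \<Longrightarrow> \<not> K p q"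
proof -
  \<comment> \<open>Baire space is embedded in the real sequences, whose product topology is
    metrizable with a countable base; integers are isolated by balls of radius 1/2, so cylinders
    stay open. A code may record any discrete data that make the colour open.\<close>
  define rcode where "rcode p n = real (code p n)" for p n
  have inj: "inj_on rcode S" and rcode: "rcode p n = rcode q n \<longleftrightarrow> code p n = code q n" for p q n
    using inj by (auto simp: rcode_def inj_on_def fun_eq_iff)
  define X where "X = top_of_set (rcode ` S)"
  have met: "metrizable_space X"
    unfolding X_def by (intro metrizable_space_subtopology metrizable_space_euclidean)
  have "second_countable (euclidean :: (nat \<Rightarrow> real) topology)"
    unfolding second_countable_def
  proof -
    obtain B :: "(nat \<Rightarrow> real) set set" where B: "countable B" "topological_basis B"
      using ex_countable_basis by blast
    show "\<exists>\<B>. countable \<B> \<and> (\<forall>V\<in>\<B>. openin (euclidean :: (nat \<Rightarrow> real) topology) V) \<and>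
       (\<forall>U x. openin euclidean U \<and> x \<in> U \<longrightarrow> (\<exists>V\<in>\<B>. x \<in> V \<and> V \<subseteq> U))"
      using B topological_basis_open topological_basisE by (metis open_openin)
  qed
  then have sep: "separable_space X"
    unfolding X_def by (intro second_countable_imp_separable_space second_countable_subtopology)
  have dich: "open_colouring_dichotomy X" using OCA_any_type[OF \<open>OCA\<close> met sep] .
  have top: "topspace X = rcode ` S" by (simp add: X_def)
  define K0 where "K0 = {{rcode p, rcode q} | p q. p \<in> S \<and> q \<in> S \<and> p \<noteq> q \<and> K p q}"
  define K1 where "K1 = nsets (topspace X) 2 - K0"
  have K0: "{rcode p, rcode q} \<in> K0 \<longleftrightarrow> p \<noteq> q \<and> K p q" if "p \<in> S" "q \<in> S" for p q
  proof
    assume "{rcode p, rcode q} \<in> K0"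
    then obtain p' q' where pq': "{rcode p, rcode q} = {rcode p', rcode q'}" "p' \<in> S" "q' \<in> S" "p' \<noteq> q'" "K p' q'"
      unfolding K0_def by (elim CollectE exE conjE) (rule that)
    then have "p = p' \<and> q = q' \<or> p = q' \<and> q = p'"
      using that inj_onD[OF inj] unfolding doubleton_eq_iff by metis
    then show "p \<noteq> q \<and> K p q" using pq' sym by metis
  next
    assume "p \<noteq> q \<and> K p q"
    with that show "{rcode p, rcode q} \<in> K0" unfolding K0_def by blast
  qed
  have "K0 \<subseteq> nsets (topspace X) 2"
  proof
    fix k assume "k \<in> K0"
    then obtain p q where "k = {rcode p, rcode q}" "p \<in> S" "q \<in> S" "p \<noteq> q"
      unfolding K0_def by blast
    then show "k \<in> nsets (topspace X) 2"
      using inj_onD[OF inj] by (auto simp: nsets_def top card_insert_if)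
  qed
  then have part: "K0 \<union> K1 = nsets (topspace X) 2" "K0 \<inter> K1 = {}" by (auto simp: K1_def)
  have cyl: "openin X {g \<in> rcode ` S. \<forall>n<N. g n = a n}" if "a \<in> rcode ` S" for N :: nat and a
  proof -
    have "open {g :: nat \<Rightarrow> real. g n \<in> ball (a n) (1/2)}" for n
    proof -
      have "open ((\<lambda>g :: nat \<Rightarrow> real. g n) -` ball (a n) (1/2))"
        by (intro open_vimage open_ball continuous_on_product_coordinates)
      then show ?thesis by (simp add: vimage_def)
    qed
    then have "open (\<Inter>n\<in>{..<N}. {g :: nat \<Rightarrow> real. g n \<in> ball (a n) (1/2)})" by (intro open_INT) auto
    moreover have key: "g n \<in> ball (a n) (1/2) \<longleftrightarrow> g n = a n" if "g \<in> rcode ` S" for g n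
    proof -
      obtain p where "g = rcode p" using \<open>g \<in> rcode ` S\<close> by (rule imageE)
      moreover obtain q where "a = rcode q" using \<open>a \<in> rcode ` S\<close> by (rule imageE)
      ultimately have pq: "g n = real (code p n)" "a n = real (code q n)" by (simp_all add: rcode_def)
      have "real k \<in> ball (real m) (1/2) \<longleftrightarrow> k = m" for k m
      proof (cases k m rule: linorder_cases)
        case less
        then have "real k + 1 \<le> real m" by simp
        with less show ?thesis by (simp add: dist_real_def)
      next
        case greater
        then have "real m + 1 \<le> real k" by simp
        with greater show ?thesis by (simp add: dist_real_def)
      qed simp
      then show ?thesis unfolding pq by simp
    qed
    moreover have "{g \<in> rcode ` S. \<forall>n<N. g n = a n} = rcode ` S \<inter> (\<Inter>n\<in>{..<N}. {g. g n \<in> ball (a n) (1/2)})"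
      using key by blast
    ultimately show ?thesis unfolding X_def openin_open by blast
  qed
  have "openin (prod_topology X X) {(x, y). {x, y} \<in> K0}"
  proof (subst openin_subopen, intro ballI)
    fix z assume "z \<in> {(x, y). {x, y} \<in> K0}"
    moreover obtain x y where "z = (x, y)" by (cases z)
    ultimately have z: "z = (x, y)" "{x, y} \<in> K0" by simp_all
    obtain p' q' where pq': "{x, y} = {rcode p', rcode q'}" "p' \<in> S" "q' \<in> S" "p' \<noteq> q'" "K p' q'"
      using z(2) unfolding K0_def by (elim CollectE exE conjE) (rule that)
    then obtain p q where pq: "p \<in> S" "q \<in> S" "x = rcode p" "y = rcode q" "p \<noteq> q" "K p q"
      using sym[of p' q'] unfolding doubleton_eq_iff by metis
    obtain N where N: "\<forall>p'\<in>S. \<forall>q'\<in>S. (\<forall>n<N. code p' n = code p n) \<and> (\<forall>n<N. code q' n = code q n) \<longrightarrow> K p' q'"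
      using opn[OF pq(1,2,5,6)] by blast
    obtain M where M: "rcode p M \<noteq> rcode q M" using rcode inj_onD[OF inj _ pq(1,2)] pq(5) by (metis ext)
    define L where "L = max N (Suc M)"
    let ?A = "\<lambda>a. {g \<in> rcode ` S. \<forall>n<L. g n = a n}"
    have "openin (prod_topology X X) (?A x \<times> ?A y)"
      using cyl pq by (simp add: openin_prod_Times_iff)
    moreover have "z \<in> ?A x \<times> ?A y" unfolding z(1) using pq(1-4) by simp
    moreover have "?A x \<times> ?A y \<subseteq> {(x, y). {x, y} \<in> K0}"
    proof
      fix w assume "w \<in> ?A x \<times> ?A y"
      then obtain p' q' where w: "w = (rcode p', rcode q')"
        and *: "p' \<in> S" "q' \<in> S" "\<forall>n<L. rcode p' n = rcode p n" "\<forall>n<L. rcode q' n = rcode q n"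
        unfolding pq(3,4) by (elim SigmaE CollectE conjE imageE) blast
      then have "K p' q'" using N rcode by (simp add: L_def)
      moreover have "M < L" by (simp add: L_def)
      then have "p' \<noteq> q'" using M * rcode by metis
      ultimately show "w \<in> {(x, y). {x, y} \<in> K0}" using K0 * w by simp
    qed
    ultimately show "\<exists>T. openin (prod_topology X X) T \<and> z \<in> T \<and> T \<subseteq> {(x, y). {x, y} \<in> K0}" by blast
  qed
  then have "(\<exists>Y \<subseteq> rcode ` S. uncountable Y \<and> nsets Y 2 \<subseteq> K0) \<or>
        (\<exists>Z :: nat \<Rightarrow> (nat \<Rightarrow> real) set. rcode ` S = (\<Union>n. Z n) \<and> (\<forall>n. nsets (Z n) 2 \<subseteq> K1))"
    using dich[unfolded open_colouring_dichotomy_def, rule_format, of K0 K1] part top by simp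
  then show thesis
  proof (elim disjE exE conjE)
    fix Y assume Y: "Y \<subseteq> rcode ` S" "uncountable Y" "nsets Y 2 \<subseteq> K0"
    define Y' where "Y' = {p \<in> S. rcode p \<in> Y}"
    have "Y = rcode ` Y'" using Y(1) by (auto simp: Y'_def)
    then have "uncountable Y'" using Y(2) by auto
    then have "\<exists>p\<in>Y'. \<exists>q\<in>Y'. p \<noteq> q \<and> \<not> K p q"
      by (rule no_hom[rotated]) (auto simp: Y'_def)
    then obtain p q where pq: "p \<in> Y'" "q \<in> Y'" "p \<noteq> q" "\<not> K p q" by blast
    then have "{rcode p, rcode q} \<in> nsets Y 2"
      using inj_onD[OF inj] by (auto simp: nsets_def Y'_def card_insert_if)
    then have "{rcode p, rcode q} \<in> K0" using Y(3) by blast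
    then show thesis using K0 pq by (simp add: Y'_def)
  next
    fix Z :: "nat \<Rightarrow> (nat \<Rightarrow> real) set"
    assume Z: "rcode ` S = (\<Union>n. Z n)" "\<forall>n. nsets (Z n) 2 \<subseteq> K1"
    show thesis
    proof (rule that)
      show "S = (\<Union>n. {p \<in> S. rcode p \<in> Z n})" using Z(1) by auto
      fix n p q assume pq: "p \<in> {p \<in> S. rcode p \<in> Z n}" "q \<in> {p \<in> S. rcode p \<in> Z n}" "p \<noteq> q"
      then have "{rcode p, rcode q} \<in> nsets (Z n) 2"
        using inj_onD[OF inj] by (auto simp: nsets_def card_insert_if)
      then have "{rcode p, rcode q} \<in> K1" using Z(2) by blast
      then have "{rcode p, rcode q} \<notin> K0" by (simp add: K1_def)
      then show "\<not> K p q" using K0 pq by simp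
    qed
  qed
qed

text \<open>Zorn's lemma for the reversed order: the infimum of a chain is proper because a chain is
  directed, and a minimal proper filter decides every predicate.\<close>

lemma ultrafilter_extension:
  fixes F :: "'z filter"
  assumes "F \<noteq> bot"
  obtains U where "U \<le> F" "U \<noteq> bot" "\<And>P. eventually P U \<or> eventually (\<lambda>z. \<not> P z) U"
proof -
  let ?A = "{U. U \<le> F \<and> U \<noteq> bot}"
  have "\<exists>U\<in>?A. \<forall>V\<in>?A. (U, V) \<in> {(U, V). V \<le> U \<and> V \<in> ?A \<and> U \<in> ?A} \<longrightarrow> V = U"
  proof -
    define r where "r = {(U, V). V \<le> U \<and> V \<in> ?A \<and> U \<in> ?A}"
    have field: "Field r = ?A" by (auto simp: r_def Field_def)
    have po: "Partial_order r"
      unfolding partial_order_on_def preorder_on_def field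
      by (auto simp: r_def refl_on_def trans_def antisym_def)
    have "\<exists>u\<in>Field r. \<forall>a\<in>C. (a, u) \<in> r" if C: "C \<in> Chains r" for C
    proof (cases "C = {}")
      case True
      then show ?thesis using assms field by auto
    next
      case False
      have CA: "C \<subseteq> ?A" using C by (auto simp: Chains_def r_def)
      have "Inf C \<noteq> bot"
      proof -
        have "\<exists>V\<in>C. V \<le> inf U W" if "U \<in> C" "W \<in> C" for U W
          using that C by (auto simp: Chains_def r_def)
        then have "eventually P (Inf C) \<longleftrightarrow> (\<exists>b\<in>C. eventually P b)" for P
          using False eventually_Inf_base[of C P] by fastforce
        from this[of "\<lambda>_. False"] show ?thesis using CA by (auto simp: eventually_False)
      qed
      moreover have "Inf C \<le> F"
      proof -
        obtain V where "V \<in> C" using False by blast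
        then show ?thesis using CA by (intro Inf_lower2[of V]) auto
      qed
      ultimately have "Inf C \<in> ?A" by simp
      then show ?thesis
        using CA unfolding field by (intro bexI[of _ "Inf C"]) (auto simp: r_def intro: Inf_lower)
    qed
    from Zorns_po_lemma[OF po this] show ?thesis unfolding field unfolding r_def .
  qed
  then obtain U where U: "U \<in> ?A" and min: "\<forall>V\<in>?A. (U, V) \<in> {(U, V). V \<le> U \<and> V \<in> ?A \<and> U \<in> ?A} \<longrightarrow> V = U"
    by (elim bexE)
  have U: "U \<in> ?A" "\<And>V. V \<in> ?A \<Longrightarrow> V \<le> U \<Longrightarrow> V = U" using U min by simp_all
  show thesis
  proof (rule that)
    fix P
    show "eventually P U \<or> eventually (\<lambda>z. \<not> P z) U"
    proof (cases "inf U (principal {z. P z}) = bot")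
      case True
      have "eventually (\<lambda>_. False) (inf U (principal {z. P z}))" unfolding True by (rule eventually_bot)
      then show ?thesis unfolding eventually_inf_principal by simp
    next
      case False
      have "inf U (principal {z. P z}) \<le> F" using U(1) by (intro le_infI1) auto
      then have "inf U (principal {z. P z}) = U" using False by (intro U(2)) auto
      then have "U \<le> principal {z. P z}" by (metis inf_le2)
      then show ?thesis by (simp add: le_principal)
    qed
  qed (use U in auto)
qed

text \<open>MA meets only aleph_1 dense sets, so \<open>Y\<close> is replaced by an injective image
  of a well-order \<open>r\<close> of type omega_1. Equal labels imply compatibility and labels are
  countable in number, so any uncountable family of conditions contains compatible ones; this lets a
  filter absorb cofinally many elements.\<close>

lemma MA_capture:
  fixes P :: "('s \<times> 'p set) set" and le :: "'s \<Rightarrow> 's \<Rightarrow> bool"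
  assumes MA: MA_aleph1_sigma_linked
    and refl: "\<And>s. le s s" and trans: "\<And>s t u. le s t \<Longrightarrow> le t u \<Longrightarrow> le s u"
    and antisym: "\<And>s t. le s t \<Longrightarrow> le t s \<Longrightarrow> s = t"
    and "uncountable Y"
    and single: "\<And>p. p \<in> Y \<Longrightarrow> \<exists>s. (s, {p}) \<in> P"
    and lab: "countable (range lab)"
    and link: "\<And>s F s' F'. (s, F) \<in> P \<Longrightarrow> (s', F') \<in> P \<Longrightarrow> lab (s, F) = lab (s', F') \<Longrightarrow>
      \<exists>s'' F''. (s'', F'') \<in> P \<and> le s s'' \<and> le s' s'' \<and> F \<union> F' \<subseteq> F''"
  obtains \<G> where "\<G> \<subseteq> P"
    "\<And>s F s' F'. (s, F) \<in> \<G> \<Longrightarrow> (s', F') \<in> \<G> \<Longrightarrow>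
      \<exists>s'' F''. (s'', F'') \<in> \<G> \<and> le s s'' \<and> le s' s'' \<and> F \<union> F' \<subseteq> F''"
    "uncountable (Y \<inter> \<Union> (snd ` \<G>))"
proof -
  define r where "r = cardSuc natLeq"
  define I where "I = Field r"
  have co: "Card_order r" unfolding r_def using cardSuc_Card_order natLeq_Card_order by blast
  then have wo: "Well_order r" by (rule card_order_on_well_order_on)
  then have lin: "Refl r" "Total r" "Relation.trans r" "Relation.antisym r"
    by (auto simp: well_order_on_def linear_order_on_def partial_order_on_def preorder_on_def)
  have cI: "(card_of I, r) \<in> ordIso" unfolding I_def using co card_of_Field_ordIso by blast
  have small: "countable {b \<in> I. (a, b) \<notin> r}" if "a \<in> I" for a
  proof -
    have "(card_of (underS r a), cardSuc natLeq) \<in> ordLess"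
      using card_of_underS[OF co] that by (simp add: I_def r_def)
    then have "countable (underS r a)"
      by (simp add: cardSuc_ordLeq_ordLess[OF natLeq_Card_order card_of_Card_order] countable_card_le_natLeq)
    moreover have "{b \<in> I. (a, b) \<notin> r} \<subseteq> underS r a"
      using that lin(1,2) by (fastforce simp: I_def underS_def total_on_def refl_on_def)
    ultimately show ?thesis by (meson countable_subset)
  qed
  have unc_I: "uncountable I"
  proof
    assume "countable I"
    then have "(card_of I, natLeq) \<in> ordLeq" by (simp only: countable_card_le_natLeq)
    then have "(r, natLeq) \<in> ordLeq" by (rule ordIso_ordLeq_trans[OF ordIso_symmetric[OF cI]])
    then show False unfolding r_def using cardSuc_greater[OF natLeq_Card_order] not_ordLess_ordLeq by metis
  qed
  have "(natLeq, card_of Y) \<in> ordLess"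
    using \<open>uncountable Y\<close> countable_card_le_natLeq
    by (metis card_of_Well_order natLeq_Well_order not_ordLeq_iff_ordLess)
  then have "(r, card_of Y) \<in> ordLeq" unfolding r_def by (rule cardSuc_least[OF natLeq_Card_order card_of_Card_order])
  then have "(card_of I, card_of Y) \<in> ordLeq" by (rule ordIso_ordLeq_trans[OF cI])
  then obtain g where g: "inj_on g I" "g ` I \<subseteq> Y" by (metis card_of_ordLeq)
  define ext where "ext c c' \<longleftrightarrow> le (fst c) (fst c') \<and> snd c \<subseteq> snd c'" for c c' :: "'s \<times> 'p set"
  have ext_refl: "ext c c" for c by (simp add: ext_def refl)
  have ext_trans: "ext c c' \<Longrightarrow> ext c' c'' \<Longrightarrow> ext c c''" for c c' c'' by (auto simp: ext_def dest: trans)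
  have link': "\<exists>c''\<in>P. ext c c'' \<and> ext c' c''" if "c \<in> P" "c' \<in> P" "lab c = lab c'" for c c'
  proof -
    have "\<exists>s'' F''. (s'', F'') \<in> P \<and> le (fst c) s'' \<and> le (fst c') s'' \<and> snd c \<union> snd c' \<subseteq> F''"
      using link[of "fst c" "snd c" "fst c'" "snd c'"] that unfolding prod.collapse .
    then obtain s'' F'' where "(s'', F'') \<in> P" "le (fst c) s''" "le (fst c') s''" "snd c \<union> snd c' \<subseteq> F''"
      by (elim exE conjE)
    then show ?thesis by (intro bexI[of _ "(s'', F'')"]) (auto simp: ext_def)
  qed
  \<comment> \<open>\<open>D a\<close> asks for an element of index at least \<open>a\<close>;
    meeting all of them makes the captured indices cofinal in omega_1, hence uncountable in
    number.\<close>
  define D where "D a = {c \<in> P. \<exists>b\<in>I. (a, b) \<in> r \<and> g b \<in> snd c}" for a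
  \<comment> \<open>The sets \<open>D a\<close> need not be dense in \<open>P\<close>, but they are
    below some \<open>c0\<close>. Otherwise every index \<open>b\<close> has a condition
    \<open>c b\<close> containing \<open>g b\<close> below which some \<open>D (a b)\<close> is
    never met. Uncountably many of these share a label, so \<open>c b\<close> is compatible with
    \<open>c b'\<close> for some \<open>b'\<close> above \<open>a b\<close>, and the common
    extension lies in \<open>D (a b)\<close>.\<close>
  have "\<exists>c0\<in>P. \<forall>c\<in>P. ext c0 c \<longrightarrow> (\<forall>a\<in>I. \<exists>c'\<in>D a. ext c c')"
  proof (rule ccontr)
    assume "\<not> ?thesis"
    then have "\<forall>c0\<in>P. \<exists>c a. c \<in> P \<and> ext c0 c \<and> a \<in> I \<and> (\<forall>c'\<in>D a. \<not> ext c c')" by blast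
    note * = this
    have "\<exists>c a. c \<in> P \<and> g b \<in> snd c \<and> a \<in> I \<and> (\<forall>c'\<in>D a. \<not> ext c c')" if "b \<in> I" for b
    proof -
      have "g b \<in> Y" using g(2) that by auto
      then obtain s where "(s, {g b}) \<in> P" using single by blast
      from bspec[OF * this] obtain c a where "c \<in> P" "ext (s, {g b}) c" "a \<in> I" "\<forall>c'\<in>D a. \<not> ext c c'"
        by (elim exE conjE)
      then show ?thesis by (intro exI[of _ c] exI[of _ a]) (auto simp: ext_def)
    qed
    then obtain c a where ca: "\<And>b. b \<in> I \<Longrightarrow> c b \<in> P \<and> g b \<in> snd (c b) \<and> a b \<in> I \<and> (\<forall>c'\<in>D (a b). \<not> ext (c b) c')"
      by metis
    have "I = (\<Union>l\<in>range lab. {b \<in> I. lab (c b) = l})" by auto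
    then obtain l where l: "uncountable {b \<in> I. lab (c b) = l}"
      using unc_I countable_UN[OF lab, of "\<lambda>l. {b \<in> I. lab (c b) = l}"] by metis
    then have "{b \<in> I. lab (c b) = l} \<noteq> {}" by (metis countable_empty)
    then obtain b where b: "b \<in> I" "lab (c b) = l" by blast
    have "\<not> {b' \<in> I. lab (c b') = l} \<subseteq> {b' \<in> I. (a b, b') \<notin> r}"
    proof
      assume sub: "{b' \<in> I. lab (c b') = l} \<subseteq> {b' \<in> I. (a b, b') \<notin> r}"
      have "countable {b' \<in> I. (a b, b') \<notin> r}" using small ca[OF b(1)] by simp
      from countable_subset[OF sub this] l show False by contradiction
    qed
    then obtain b' where b': "b' \<in> I" "lab (c b') = l" "(a b, b') \<in> r" by blast
    obtain c'' where "c'' \<in> P" "ext (c b) c''" "ext (c b') c''"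
      using link'[of "c b" "c b'"] ca[OF b(1)] ca[OF b'(1)] b(2) b'(2) by auto
    moreover then have "c'' \<in> D (a b)" using ca[OF b'(1)] b' unfolding D_def ext_def by blast
    ultimately show False using ca[OF b(1)] by blast
  qed
  then obtain c0 where c0: "c0 \<in> P" "\<And>c a. c \<in> P \<Longrightarrow> ext c0 c \<Longrightarrow> a \<in> I \<Longrightarrow> \<exists>c'\<in>D a. ext c c'" by blast
  define P0 where "P0 = {c \<in> P. ext c0 c}"
  define R where "R = {(c', c). c' \<in> P0 \<and> c \<in> P0 \<and> ext c c'}"
  have "c0 \<in> P0" using c0(1) ext_refl by (simp add: P0_def)
  then have "P0 \<noteq> {}" by blast
  moreover have "partial_order_on P0 R"
    unfolding partial_order_on_def preorder_on_def
  proof (intro conjI)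
    show "R \<subseteq> P0 \<times> P0" by (auto simp: R_def)
    show "refl_on P0 R" by (auto simp: R_def refl_on_def ext_refl)
    show "Relation.trans R"
    proof (rule transI)
      fix c c' c'' assume "(c, c') \<in> R" "(c', c'') \<in> R"
      then show "(c, c'') \<in> R" using ext_trans[of c'' c' c] by (simp add: R_def)
    qed
    show "Relation.antisym R"
    proof (rule antisymI)
      fix c c' assume "(c, c') \<in> R" "(c', c) \<in> R"
      then show "c = c'" by (intro prod_eqI antisym) (auto simp: R_def ext_def)
    qed
  qed
  moreover have "sigma_linked P0 R"
  proof -
    define L where "L n = {c \<in> P0. to_nat_on (range lab) (lab c) = n}" for n
    have "P0 = (\<Union>n. L n)" by (auto simp: L_def)
    moreover have "compatible_in P0 R p q" if "p \<in> L n" "q \<in> L n" for n p q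
    proof -
      have "lab p = lab q" using that lab by (auto simp: L_def)
      moreover have "p \<in> P" "q \<in> P" using that by (auto simp: L_def P0_def)
      ultimately obtain c'' where c'': "c'' \<in> P" "ext p c''" "ext q c''" using link'[of p q] by blast
      moreover have "ext c0 p" using that by (simp add: L_def P0_def)
      ultimately have "c'' \<in> P0" using ext_trans[of c0 p c''] by (simp add: P0_def)
      then show ?thesis using that c'' unfolding compatible_in_def R_def L_def by (intro bexI[of _ c'']) simp_all
    qed
    ultimately show ?thesis unfolding sigma_linked_def by blast
  qed
  ultimately have "meets_aleph1_dense_sets P0 R" by (intro MA_any_type[OF MA])
  moreover have "(card_of ((\<lambda>a. D a \<inter> P0) ` I), cardSuc natLeq) \<in> ordLeq"
    using ordLeq_ordIso_trans[OF card_of_image cI] by (simp add: r_def)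
  moreover have "\<forall>E\<in>(\<lambda>a. D a \<inter> P0) ` I. dense_in_poset P0 R E"
  proof (clarsimp simp: dense_in_poset_def)
    fix a s F assume "a \<in> I" "(s, F) \<in> P0"
    then have "\<exists>c'\<in>D a. ext (s, F) c'" by (intro c0(2)) (simp_all add: P0_def)
    then obtain c' where "c' \<in> D a" "ext (s, F) c'" ..
    moreover have "c' \<in> P0" using calculation \<open>(s, F) \<in> P0\<close> ext_trans[of c0 "(s, F)" c'] by (simp add: P0_def D_def)
    ultimately show "\<exists>q\<in>D a \<inter> P0. (q, s, F) \<in> R" using \<open>(s, F) \<in> P0\<close> by (auto simp: R_def)
  qed
  ultimately obtain \<G> where \<G>: "filter_in_poset P0 R \<G>" "\<And>a. a \<in> I \<Longrightarrow> \<G> \<inter> D a \<noteq> {}"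
    unfolding meets_aleph1_dense_sets_def
  proof -
    assume m: "\<forall>\<D>. (card_of \<D>, cardSuc natLeq) \<in> ordLeq \<and> (\<forall>D\<in>\<D>. dense_in_poset P0 R D) \<longrightarrow>
        (\<exists>F. filter_in_poset P0 R F \<and> (\<forall>D\<in>\<D>. F \<inter> D \<noteq> {}))"
      and "(card_of ((\<lambda>a. D a \<inter> P0) ` I), cardSuc natLeq) \<in> ordLeq"
      and "\<forall>E\<in>(\<lambda>a. D a \<inter> P0) ` I. dense_in_poset P0 R E"
    then obtain F where F: "filter_in_poset P0 R F" "\<forall>E\<in>(\<lambda>a. D a \<inter> P0) ` I. F \<inter> E \<noteq> {}"
      using spec[OF m, of "(\<lambda>a. D a \<inter> P0) ` I"] by (elim impE exE conjE) simp_all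
    then have "F \<inter> D a \<noteq> {}" if "a \<in> I" for a using that by auto
    with F(1) show thesis by (rule that)
  qed
  show thesis
  proof (rule that)
    show "\<G> \<subseteq> P" using \<G>(1) by (auto simp: filter_in_poset_def P0_def)
    fix s F s' F' assume "(s, F) \<in> \<G>" "(s', F') \<in> \<G>"
    then obtain c where "c \<in> \<G>" "(c, (s, F)) \<in> R" "(c, (s', F')) \<in> R"
      using \<G>(1) unfolding filter_in_poset_def by meson
    then show "\<exists>s'' F''. (s'', F'') \<in> \<G> \<and> le s s'' \<and> le s' s'' \<and> F \<union> F' \<subseteq> F''"
      by (intro exI[of _ "fst c"] exI[of _ "snd c"]) (auto simp: R_def ext_def)
  next
    show "uncountable (Y \<inter> \<Union> (snd ` \<G>))"
    proof
      assume cnt: "countable (Y \<inter> \<Union> (snd ` \<G>))"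
      define B where "B = {b \<in> I. g b \<in> \<Union> (snd ` \<G>)}"
      have "g ` B \<subseteq> Y \<inter> \<Union> (snd ` \<G>)" using g by (auto simp: B_def)
      then have "countable (g ` B)" using cnt by (rule countable_subset)
      moreover have "inj_on g B" by (rule inj_on_subset[OF g(1)]) (auto simp: B_def)
      ultimately have "countable B" by (rule countable_image_inj_on)
      have "I \<subseteq> (\<Union>b\<in>B. insert b {a \<in> I. (b, a) \<notin> r})"
      proof
        fix a assume "a \<in> I"
        then obtain c where c: "c \<in> \<G>" "c \<in> D a" using \<G>(2)[of a] by auto
        then obtain b where "b \<in> I" "(a, b) \<in> r" "g b \<in> snd c" by (auto simp: D_def)
        then have b: "b \<in> B" "(a, b) \<in> r" using c(1) by (auto simp: B_def)
        then have "a = b \<or> (b, a) \<notin> r" using antisymD[OF lin(4)] by metis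
        then have "a \<in> insert b {a \<in> I. (b, a) \<notin> r}" using \<open>a \<in> I\<close> by simp
        with b(1) show "a \<in> (\<Union>b\<in>B. insert b {a \<in> I. (b, a) \<notin> r})" by (rule UN_I)
      qed
      moreover have "countable (\<Union>b\<in>B. insert b {a \<in> I. (b, a) \<notin> r})"
        by (intro countable_UN[OF \<open>countable B\<close>] countable_insert small) (simp add: B_def)
      ultimately have "countable I" by (rule countable_subset)
      with unc_I show False by contradiction
    qed
  qed
qed

section \<open>Uniformization of coherent families\<close>

text \<open>The pair \<open>(D, H)\<close> stands for the partial section \<open>n \<mapsto> (n, D n)\<close> of \<open>\<nat> \<times> \<nat>\<close> together with the value
  \<open>H n\<close> at its point \<open>(n, D n)\<close>.\<close>
type_synonym section_point = "(nat \<rightharpoonup> nat) \<times> (nat \<Rightarrow> nat)"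

section \<open>Clashes, split levels and recurrent density\<close>

definition clash :: "(nat \<Rightarrow> nat \<Rightarrow> nat \<Rightarrow> real) \<Rightarrow> real \<Rightarrow> section_point \<Rightarrow> section_point \<Rightarrow> nat set" where
  "clash \<delta> e p q = {n. fst p n \<noteq> None \<and> fst p n = fst q n \<and> e < \<delta> n (snd p n) (snd q n)}"

definition split_level :: "(nat \<Rightarrow> bool) \<Rightarrow> (nat \<Rightarrow> bool) \<Rightarrow> nat" where
  "split_level x y = (LEAST k. x k \<noteq> y k)"

lemma split_levelI:
  assumes "\<And>j. j < k \<Longrightarrow> x j = y j" "x k \<noteq> y k"
  shows "split_level x y = k"
  unfolding split_level_def
proof (rule Least_equality)
  show "k \<le> j" if "x j \<noteq> y j" for j
    using assms(1)[of j] that by (cases "j < k") simp_all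
qed (fact assms(2))

lemma split_level_props:
  assumes "x \<noteq> y"
  shows "x (split_level x y) \<noteq> y (split_level x y)" "j < split_level x y \<Longrightarrow> x j = y j"
proof -
  obtain k where "x k \<noteq> y k" using assms by auto
  then show "x (split_level x y) \<noteq> y (split_level x y)" unfolding split_level_def by (rule LeastI)
  show "j < split_level x y \<Longrightarrow> x j = y j" unfolding split_level_def using not_less_Least by blast
qed

text \<open>For almost all \<open>z\<^sub>0\<close>, \<dots>, for almost all \<open>z\<^sub>e\<close>, some element of \<open>B\<close> passes through all of
  \<open>z\<^sub>0, \<dots>, z\<^sub>e\<close>.\<close>
fun rdense :: "(nat \<times> nat) filter \<Rightarrow> nat \<Rightarrow> section_point set \<Rightarrow> bool" where
  "rdense U 0 B \<longleftrightarrow> eventually (\<lambda>z. \<exists>q\<in>B. fst q (fst z) = Some (snd z)) U"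
| "rdense U (Suc e) B \<longleftrightarrow> eventually (\<lambda>z. rdense U e {q \<in> B. fst q (fst z) = Some (snd z)}) U"

lemma rdense_mono: "B \<subseteq> B' \<Longrightarrow> rdense U e B \<Longrightarrow> rdense U e B'"
proof (induction e arbitrary: B B')
  case 0
  from 0(2) show ?case unfolding rdense.simps by (rule eventually_mono) (use 0(1) in blast)
next
  case (Suc e)
  from Suc.prems(2) show ?case unfolding rdense.simps
    by (rule eventually_mono) (rule Suc.IH[rotated], assumption, use Suc.prems(1) in blast)
qed

text \<open>Deleting columns that the filter avoids costs no density; this is how a clash already
  counted is discarded later.\<close>

lemma rdense_restrict:
  assumes "eventually (\<lambda>z. fst z \<notin> M) U" "rdense U e B"
  shows "rdense U e ((\<lambda>q. (fst q |` (- M), snd q)) ` B)"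
  using assms(2)
proof (induction e arbitrary: B)
  case 0
  from 0[unfolded rdense.simps] assms(1) show ?case unfolding rdense.simps
    by eventually_elim (auto simp: restrict_map_def)
next
  case (Suc e)
  from Suc.prems[unfolded rdense.simps] assms(1) show ?case unfolding rdense.simps
  proof eventually_elim
    case (elim z)
    show ?case
      by (rule rdense_mono[OF _ Suc.IH[OF elim(1)]]) (use elim(2) in \<open>auto simp: restrict_map_def\<close>)
  qed
qed

section \<open>Ultrafilters on the plane that avoid any finite set of columns\<close>

locale ultra_columns =
  fixes U :: "(nat \<times> nat) filter" and V :: "nat set"
  assumes ultra: "\<And>P. eventually P U \<or> eventually (\<lambda>z. \<not> P z) U"
    and not_bot: "U \<noteq> bot"
    and columns: "\<And>N. eventually (\<lambda>z. N \<le> fst z) U"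
    and values_V: "eventually (\<lambda>z. snd z \<in> V) U"
begin

lemma ultraD: "\<not> eventually P U \<Longrightarrow> eventually (\<lambda>z. \<not> P z) U"
  using ultra by blast

text \<open>Partition regularity; each level of the recursion uses that the filter is ultra.\<close>

lemma rdense_Un: "rdense U e (B \<union> B') \<Longrightarrow> rdense U e B \<or> rdense U e B'"
proof (induction e arbitrary: B B')
  case 0
  show ?case
  proof (cases "rdense U 0 B")
    case False
    then have "eventually (\<lambda>z. \<not> (\<exists>q\<in>B. fst q (fst z) = Some (snd z))) U"
      unfolding rdense.simps by (rule ultraD)
    with 0[unfolded rdense.simps] have "rdense U 0 B'" unfolding rdense.simps by eventually_elim blast
    then show ?thesis ..
  qed simp
next
  case (Suc e)
  show ?case
  proof (cases "rdense U (Suc e) B")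
    case False
    then have "eventually (\<lambda>z. \<not> rdense U e {q \<in> B. fst q (fst z) = Some (snd z)}) U"
      unfolding rdense.simps by (rule ultraD)
    with Suc.prems[unfolded rdense.simps] have "rdense U (Suc e) B'" unfolding rdense.simps
    proof eventually_elim
      case (elim z)
      have eq: "{q \<in> B \<union> B'. fst q (fst z) = Some (snd z)} =
        {q \<in> B. fst q (fst z) = Some (snd z)} \<union> {q \<in> B'. fst q (fst z) = Some (snd z)}" by blast
      from Suc.IH[OF elim(1)[unfolded eq]] elim(2) show ?case by blast
    qed
    then show ?thesis ..
  qed simp
qed

text \<open>Failure of density is witnessed by a finite section with no extension in
  \<open>B\<close>. Its columns are chosen strictly increasing, so that the points form a partial
  function.\<close>

lemma rdense_pick:
  "\<not> rdense U e B \<Longrightarrow> \<exists>\<sigma>. finite (dom \<sigma>) \<and> dom \<sigma> \<subseteq> {N..} \<and> ran \<sigma> \<subseteq> V \<and> \<not> (\<exists>q\<in>B. \<sigma> \<subseteq>\<^sub>m fst q)"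
proof (induction e arbitrary: B N)
  case 0
  then have "eventually (\<lambda>z. \<not> (\<exists>q\<in>B. fst q (fst z) = Some (snd z))) U"
    unfolding rdense.simps by (rule ultraD)
  then have "eventually (\<lambda>z. N \<le> fst z \<and> snd z \<in> V \<and> \<not> (\<exists>q\<in>B. fst q (fst z) = Some (snd z))) U"
    using columns[of N] values_V by eventually_elim blast
  then obtain z where "N \<le> fst z" "snd z \<in> V" "\<not> (\<exists>q\<in>B. fst q (fst z) = Some (snd z))"
    using eventually_happens'[OF not_bot] by blast
  moreover have "[fst z \<mapsto> snd z] \<subseteq>\<^sub>m fst q \<longleftrightarrow> fst q (fst z) = Some (snd z)" for q :: section_point
    by (auto simp: map_le_def)
  ultimately show ?case by (intro exI[of _ "[fst z \<mapsto> snd z]"]) (simp del: fun_upd_apply)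
next
  case (Suc e)
  from Suc.prems have "eventually (\<lambda>z. \<not> rdense U e {q \<in> B. fst q (fst z) = Some (snd z)}) U"
    unfolding rdense.simps by (rule ultraD)
  then have "eventually (\<lambda>z. N \<le> fst z \<and> snd z \<in> V \<and> \<not> rdense U e {q \<in> B. fst q (fst z) = Some (snd z)}) U"
    using columns[of N] values_V by eventually_elim blast
  then obtain z where z: "N \<le> fst z" "snd z \<in> V" "\<not> rdense U e {q \<in> B. fst q (fst z) = Some (snd z)}"
    using eventually_happens'[OF not_bot] by blast
  obtain \<sigma> where \<sigma>: "finite (dom \<sigma>)" "dom \<sigma> \<subseteq> {Suc (fst z)..}" "ran \<sigma> \<subseteq> V"
    "\<not> (\<exists>q\<in>{q \<in> B. fst q (fst z) = Some (snd z)}. \<sigma> \<subseteq>\<^sub>m fst q)"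
    using Suc.IH[OF z(3), of "Suc (fst z)"] by (elim exE conjE)
  have new: "fst z \<notin> dom \<sigma>" using \<sigma>(2) by auto
  show ?case
  proof (intro exI[of _ "\<sigma>(fst z \<mapsto> snd z)"] conjI)
    show "dom (\<sigma>(fst z \<mapsto> snd z)) \<subseteq> {N..}" using \<sigma>(2) z(1) by (simp add: subset_eq) (meson Suc_leD order_trans)
    show "ran (\<sigma>(fst z \<mapsto> snd z)) \<subseteq> V" using \<sigma>(3) z(2) new by (simp add: ran_map_upd domIff)
    show "\<not> (\<exists>q\<in>B. \<sigma>(fst z \<mapsto> snd z) \<subseteq>\<^sub>m fst q)"
    proof
      assume "\<exists>q\<in>B. \<sigma>(fst z \<mapsto> snd z) \<subseteq>\<^sub>m fst q"
      then obtain q where q: "q \<in> B" "\<sigma>(fst z \<mapsto> snd z) \<subseteq>\<^sub>m fst q" ..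
      have "fst q (fst z) = Some (snd z)" using q(2) unfolding map_le_def by (auto dest: bspec[of _ _ "fst z"])
      moreover have "\<sigma> \<subseteq>\<^sub>m fst q" unfolding map_le_def
      proof
        fix n assume n: "n \<in> dom \<sigma>"
        then have "n \<noteq> fst z" using new by blast
        with n q(2) show "\<sigma> n = fst q n" unfolding map_le_def by (auto dest: bspec[of _ _ n])
      qed
      ultimately show False using \<sigma>(4) q(1) by blast
    qed
  qed (use \<sigma>(1) in \<open>simp del: fun_upd_apply\<close>)
qed

end

text \<open>\<open>\<delta>\<close> is the distance of values and \<open>V\<close> the set of
  admissible second coordinates. \<open>reservoir\<close> is the genericity available in
  \<open>C\<close>: countably many sequences of finite sections drifting to infinity are all met
  infinitely often by one element. \<open>mix\<close> splices two elements along any set of columns,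
  up to finitely many points.\<close>

locale coherent_points =
  fixes \<delta> :: "nat \<Rightarrow> nat \<Rightarrow> nat \<Rightarrow> real" and V :: "nat set" and C :: "section_point set"
  assumes \<delta>_sym: "\<delta> n u v = \<delta> n v u" and \<delta>_triangle: "\<delta> n u w \<le> \<delta> n u v + \<delta> n v w"
    and C_V: "p \<in> C \<Longrightarrow> fst p n = Some u \<Longrightarrow> u \<in> V"
    and finite_clash: "p \<in> C \<Longrightarrow> q \<in> C \<Longrightarrow> 0 < e \<Longrightarrow> finite (clash \<delta> e p q)"
    and reservoir: "\<And>W :: nat \<Rightarrow> nat \<Rightarrow> nat \<rightharpoonup> nat.
      (\<And>m i. finite (dom (W m i)) \<and> dom (W m i) \<subseteq> {i..} \<and> ran (W m i) \<subseteq> V) \<Longrightarrow>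
      \<exists>p\<in>C. \<forall>m. infinite {i. W m i \<subseteq>\<^sub>m fst p}"
    and mix: "p \<in> C \<Longrightarrow> q \<in> C \<Longrightarrow> \<exists>r\<in>C. finite {n \<in> M. fst p n \<noteq> None \<and> fst r n \<noteq> fst p n} \<and>
      finite {n \<in> - M. fst q n \<noteq> None \<and> fst r n \<noteq> fst q n}"
begin

text \<open>For fixed \<open>e\<close> these sets form an ideal containing every finite union of
  columns; uniformization means that the whole plane belongs to it.\<close>

definition good :: "real \<Rightarrow> (nat \<times> nat) set \<Rightarrow> bool" where
  "good e S \<longleftrightarrow> (\<exists>h. \<forall>p\<in>C. finite {n. \<exists>u. fst p n = Some u \<and> (n, u) \<in> S \<and> e < \<delta> n (snd p n) (h n u)})"

lemma good_Un:
  assumes "good e S" "good e T"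
  shows "good e (S \<union> T)"
proof -
  obtain g h where
    g: "\<And>p. p \<in> C \<Longrightarrow> finite {n. \<exists>u. fst p n = Some u \<and> (n, u) \<in> S \<and> e < \<delta> n (snd p n) (g n u)}" and
    h: "\<And>p. p \<in> C \<Longrightarrow> finite {n. \<exists>u. fst p n = Some u \<and> (n, u) \<in> T \<and> e < \<delta> n (snd p n) (h n u)}"
    using assms unfolding good_def by blast
  show ?thesis unfolding good_def
  proof (intro exI[of _ "\<lambda>n u. if (n, u) \<in> S then g n u else h n u"] ballI)
    fix p assume "p \<in> C"
    show "finite {n. \<exists>u. fst p n = Some u \<and> (n, u) \<in> S \<union> T \<and> e < \<delta> n (snd p n) (if (n, u) \<in> S then g n u else h n u)}"
      by (rule finite_subset[OF _ finite_UnI[OF g[OF \<open>p \<in> C\<close>] h[OF \<open>p \<in> C\<close>]]]) (auto split: if_splits)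
  qed
qed

text \<open>Approximations \<open>H i\<close> that for every \<open>a\<close> are correct once level
  and column are large get diagonalized: \<open>h\<close> uses the last \<open>H i\<close>, with i
  at most the column, whose domain contains the point. If this failed on every \<open>S j\<close>,
  the reservoir would give one \<open>p\<close> through infinitely many bad points of each failing
  \<open>a j\<close>. Past its own threshold \<open>p\<close> is approximated, and its coherence
  with \<open>a N\<close> refutes the failure there; the slack \<open>\<epsilon>\<close> pays for
  that coherence.\<close>

lemma good_limit:
  assumes U: "ultra_columns U V" and "0 < \<epsilon>"
    and G: "\<And>i :: nat. eventually (\<lambda>z. z \<in> G i) U"
    and H: "\<And>a. a \<in> C \<Longrightarrow> \<exists>N. \<forall>i\<ge>N. \<forall>n\<ge>N. \<forall>u. fst a n = Some u \<longrightarrow> (n, u) \<in> G i \<longrightarrow>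
      \<delta> n (snd a n) (H i (n, u)) \<le> t"
  shows "\<exists>S. eventually (\<lambda>z. z \<in> S) U \<and> good (t + \<epsilon>) S"
proof -
  interpret ultra_columns U V by (rule U)
  define S where "S j = {z. \<exists>i. j \<le> i \<and> i \<le> fst z \<and> z \<in> G i}" for j
  define lev where "lev z = Max {i. i \<le> fst z \<and> z \<in> G i}" for z :: "nat \<times> nat"
  define h where "h n u = H (lev (n, u)) (n, u)" for n u
  have lev: "j \<le> lev z" "z \<in> G (lev z)" if "z \<in> S j" for z j
  proof -
    obtain i where i: "j \<le> i" "i \<le> fst z" "z \<in> G i" using \<open>z \<in> S j\<close> unfolding S_def by blast
    let ?I = "{i. i \<le> fst z \<and> z \<in> G i}"
    have fin: "finite ?I" by simp
    have "i \<in> ?I" using i by simp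
    then have "i \<le> lev z" unfolding lev_def using fin by (rule Max_ge[rotated])
    then show "j \<le> lev z" using i by simp
    have "lev z \<in> ?I" unfolding lev_def using \<open>i \<in> ?I\<close> fin by (intro Max_in) blast+
    then show "z \<in> G (lev z)" by simp
  qed
  have "\<exists>j. good (t + \<epsilon>) (S j)"
  proof (rule ccontr)
    assume not_good: "\<not> (\<exists>j. good (t + \<epsilon>) (S j))"
    define Bad where "Bad j a = {n. \<exists>u. fst a n = Some u \<and> (n, u) \<in> S j \<and> t + \<epsilon> < \<delta> n (snd a n) (h n u)}" for j a
    have "\<exists>a\<in>C. infinite (Bad j a)" for j
      using not_good unfolding good_def Bad_def by blast
    then obtain a where a: "\<And>j. a j \<in> C" "\<And>j. infinite (Bad j (a j))" by metis
    have "\<exists>n\<ge>i. n \<in> Bad j (a j)" for i j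
      using a(2)[of j] unfolding infinite_nat_iff_unbounded_le by blast
    moreover define \<nu> where "\<nu> j i = (SOME n. i \<le> n \<and> n \<in> Bad j (a j))" for i j
    ultimately have "i \<le> \<nu> j i \<and> \<nu> j i \<in> Bad j (a j)" for i j
      by (metis (mono_tags, lifting) someI_ex)
    then have \<nu>: "\<And>i j. i \<le> \<nu> j i" "\<And>i j. \<nu> j i \<in> Bad j (a j)" by simp_all
    define W where "W j i = [\<nu> j i \<mapsto> the (fst (a j) (\<nu> j i))]" for j i
    have aS: "\<exists>u. fst (a j) (\<nu> j i) = Some u \<and> (\<nu> j i, u) \<in> S j \<and> t + \<epsilon> < \<delta> (\<nu> j i) (snd (a j) (\<nu> j i)) (h (\<nu> j i) u)" for j i
      using \<nu>(2)[of j i] by (simp add: Bad_def)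
    have "\<exists>p\<in>C. \<forall>m. infinite {i. W m i \<subseteq>\<^sub>m fst p}"
    proof (rule reservoir, intro conjI)
      fix m i
      obtain u where "fst (a m) (\<nu> m i) = Some u" using aS[of m i] by blast
      then show "ran (W m i) \<subseteq> V" using C_V[OF a(1)] by (simp add: W_def)
      show "dom (W m i) \<subseteq> {i..}" using \<nu>(1) by (simp add: W_def)
    qed (simp add: W_def)
    then obtain p where p: "p \<in> C" "\<And>m. infinite {i. W m i \<subseteq>\<^sub>m fst p}" by blast
    obtain N where N: "\<And>i n u. N \<le> i \<Longrightarrow> N \<le> n \<Longrightarrow> fst p n = Some u \<Longrightarrow> (n, u) \<in> G i \<Longrightarrow>
        \<delta> n (snd p n) (H i (n, u)) \<le> t"
      using H[OF p(1)] by blast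
    have "finite (clash \<delta> \<epsilon> p (a N))" using finite_clash[OF p(1) a(1) \<open>0 < \<epsilon>\<close>] .
    then obtain K where K: "\<forall>n\<in>clash \<delta> \<epsilon> p (a N). n < K" unfolding finite_nat_set_iff_bounded ..
    obtain i where i: "max N K \<le> i" "W N i \<subseteq>\<^sub>m fst p"
      using p(2)[of N] unfolding infinite_nat_iff_unbounded_le by blast
    define n where "n = \<nu> N i"
    have n: "N \<le> n" "K \<le> n" using i(1) \<nu>(1)[of i N] by (simp_all add: n_def)
    obtain u where u: "fst (a N) n = Some u" "(n, u) \<in> S N" "t + \<epsilon> < \<delta> n (snd (a N) n) (h n u)"
      using aS[of N i] unfolding n_def by blast
    have "fst p n = Some u" using i(2) u(1) by (simp add: W_def map_le_def n_def)
    moreover have "n \<notin> clash \<delta> \<epsilon> p (a N)" using K n(2) by auto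
    ultimately have "\<delta> n (snd p n) (snd (a N) n) \<le> \<epsilon>" using u(1) by (simp add: clash_def)
    moreover have "\<delta> n (snd p n) (h n u) \<le> t"
      unfolding h_def using N[OF lev(1)[OF u(2)] n(1) \<open>fst p n = Some u\<close> lev(2)[OF u(2)]] .
    ultimately show False
      using u(3) \<delta>_triangle[of n "snd (a N) n" "h n u" "snd p n"] \<delta>_sym[of n "snd (a N) n" "snd p n"] by linarith
  qed
  then obtain j where "good (t + \<epsilon>) (S j)" ..
  moreover have "eventually (\<lambda>z. z \<in> S j) U"
    using G[of j] columns[of j] by eventually_elim (auto simp: S_def)
  ultimately show ?thesis by blast
qed

text \<open>Induction on the number of clashes. With none left, any element of \<open>B i\<close>
  through a point predicts the value there. Otherwise either some \<open>a\<close> is contradicted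
  at infinitely many points by densely many elements, and restricting to these uses up one clash; or
  for every \<open>a\<close> the value is eventually near that of densely many elements through the
  point, which determines it up to \<open>2 * t'\<close>.\<close>

lemma good_of_bounded_clashes:
  assumes U: "ultra_columns U V" and "0 \<le> t" "t < T"
    and "\<And>i. rdense U e (B i)"
    and "\<And>a. a \<in> C \<Longrightarrow> \<exists>N. \<forall>i\<ge>N. \<forall>q\<in>B i.
      finite (clash \<delta> t q a \<inter> {N..}) \<and> card (clash \<delta> t q a \<inter> {N..}) \<le> e"
  shows "\<exists>S. eventually (\<lambda>z. z \<in> S) U \<and> good (3 * T) S"
  using assms(2-)
proof (induction e arbitrary: t B)
  case 0
  define G where "G i = {z. \<exists>q\<in>B i. fst q (fst z) = Some (snd z)}" for i
  define sel where "sel i z = (SOME q. q \<in> B i \<and> fst q (fst z) = Some (snd z))" for i and z :: "nat \<times> nat"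
  have sel: "sel i z \<in> B i" "fst (sel i z) (fst z) = Some (snd z)" if "z \<in> G i" for i z
  proof -
    have "\<exists>q. q \<in> B i \<and> fst q (fst z) = Some (snd z)" using that unfolding G_def by blast
    then have "sel i z \<in> B i \<and> fst (sel i z) (fst z) = Some (snd z)" unfolding sel_def by (rule someI_ex)
    then show "sel i z \<in> B i" "fst (sel i z) (fst z) = Some (snd z)" by auto
  qed
  have "\<exists>S. eventually (\<lambda>z. z \<in> S) U \<and> good (t + (3 * T - t)) S"
  proof (rule good_limit[OF U, where H = "\<lambda>i z. snd (sel i z) (fst z)" and G = G])
    show "0 < 3 * T - t" using 0 by simp
    show "eventually (\<lambda>z. z \<in> G i) U" for i using 0(3)[of i] by (simp add: G_def)
    fix a assume "a \<in> C"
    from 0(4)[OF this] obtain N where N: "\<forall>i\<ge>N. \<forall>q\<in>B i.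
      finite (clash \<delta> t q a \<inter> {N..}) \<and> card (clash \<delta> t q a \<inter> {N..}) \<le> 0" ..
    show "\<exists>N. \<forall>i\<ge>N. \<forall>n\<ge>N. \<forall>u. fst a n = Some u \<longrightarrow> (n, u) \<in> G i \<longrightarrow>
        \<delta> n (snd a n) (snd (sel i (n, u)) (fst (n, u))) \<le> t"
    proof (intro exI[of _ N] allI impI)
      fix i n u assume *: "N \<le> i" "N \<le> n" "fst a n = Some u" "(n, u) \<in> G i"
      have "finite (clash \<delta> t (sel i (n, u)) a \<inter> {N..}) \<and> card (clash \<delta> t (sel i (n, u)) a \<inter> {N..}) \<le> 0"
        using N sel(1)[OF *(4)] *(1) by blast
      then have "clash \<delta> t (sel i (n, u)) a \<inter> {N..} = {}" by (metis card_0_eq le_0_eq)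
      then have "n \<notin> clash \<delta> t (sel i (n, u)) a" using *(2) by auto
      then show "\<delta> n (snd a n) (snd (sel i (n, u)) (fst (n, u))) \<le> t"
        using sel(2)[OF *(4)] *(3) \<delta>_sym[of n "snd a n"] by (simp add: clash_def)
    qed
  qed
  then show ?case by simp
next
  case (Suc e)
  interpret ultra_columns U V by (rule U)
  \<comment> \<open>The tolerance rises by half of the remaining gap at each level of the induction,
    and \<open>t' - t\<close> absorbs the coherence errors.\<close>
  define t' where "t' = (t + T) / 2"
  have t': "0 \<le> t'" "t < t'" "t' < T" using Suc.prems(1,2) by (auto simp: t'_def)
  define wrong where "wrong a i n \<longleftrightarrow> fst a n \<noteq> None \<and>
      rdense U e {q \<in> B i. fst q n = fst a n \<and> t' < \<delta> n (snd q n) (snd a n)}" for a i n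
  show ?case
  proof (cases "\<exists>a\<in>C. \<forall>N. \<exists>i\<ge>N. \<exists>n\<ge>N. wrong a i n")
    case True
    then obtain a where a: "a \<in> C" "\<forall>N. \<exists>i\<ge>N. \<exists>n\<ge>N. wrong a i n" by (elim bexE)
    then have "\<forall>N. \<exists>ij. N \<le> fst ij \<and> N \<le> snd ij \<and> wrong a (fst ij) (snd ij)" by simp
    from choice[OF this] obtain ij where "\<forall>N. N \<le> fst (ij N) \<and> N \<le> snd (ij N) \<and> wrong a (fst (ij N)) (snd (ij N))" ..
    moreover define I J where "I N = fst (ij N)" and "J N = snd (ij N)" for N
    ultimately have IJ: "\<And>N. N \<le> I N" "\<And>N. N \<le> J N" "\<And>N. wrong a (I N) (J N)" by simp_all
    define s where "s = rec_nat 0 (\<lambda>_ N. Suc (J N))"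
    have s_Suc: "s (Suc l) = Suc (J (s l))" for l by (simp add: s_def)
    have J_mono: "strict_mono (\<lambda>l. J (s l))"
      unfolding strict_mono_Suc_iff
    proof
      fix l show "J (s l) < J (s (Suc l))" using IJ(2)[of "Suc (J (s l))"] by (simp add: s_Suc)
    qed
    have s_ge: "l \<le> s l" for l
    proof (induction l)
      case (Suc l)
      then show ?case using IJ(2)[of "s l"] by (simp add: s_Suc)
    qed simp
    \<comment> \<open>The columns where \<open>a\<close> is contradicted are split into two disjoint
      infinite halves. The ultrafilter avoids one of them, so elements may be made undefined there
      without losing density, and \<open>a\<close> can be spliced in there.\<close>
    define M where "M b = range (\<lambda>l. J (s (2 * l + b)))" for b
    have "M 0 \<inter> M 1 = {}"
    proof -
      have "2 * k \<noteq> 2 * l + 1" for k l :: nat by presburger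
      then show ?thesis unfolding M_def using strict_mono_eq[OF J_mono] by auto
    qed
    moreover have "eventually (\<lambda>z. fst z \<in> M 0) U \<or> eventually (\<lambda>z. fst z \<notin> M 0) U" by (rule ultra)
    ultimately have "\<exists>b. eventually (\<lambda>z. fst z \<notin> M b) U"
    proof (elim disjE)
      assume dis: "M 0 \<inter> M 1 = {}" and "eventually (\<lambda>z. fst z \<in> M 0) U"
      from this(2) have "eventually (\<lambda>z. fst z \<notin> M 1) U" by (rule eventually_mono) (use dis in blast)
      then show ?thesis ..
    qed blast
    then obtain b where b: "eventually (\<lambda>z. fst z \<notin> M b) U" ..
    define \<nu> where "\<nu> l = J (s (2 * l + b))" for l
    define \<iota> where "\<iota> l = I (s (2 * l + b))" for l
    have \<nu>\<iota>: "l \<le> \<nu> l" "l \<le> \<iota> l" "wrong a (\<iota> l) (\<nu> l)" "\<nu> l \<in> M b" for l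
      using IJ(1,2)[of "s (2 * l + b)"] s_ge[of "2 * l + b"] IJ(3) by (auto simp: \<nu>_def \<iota>_def M_def)
    define B' where "B' l = (\<lambda>q. (fst q |` (- M b), snd q)) `
      {q \<in> B (\<iota> l). fst q (\<nu> l) = fst a (\<nu> l) \<and> t' < \<delta> (\<nu> l) (snd q (\<nu> l)) (snd a (\<nu> l))}" for l
    show ?thesis
    proof (rule Suc.IH[of t' B'])
      show "0 \<le> t'" "t' < T" using t' by auto
      show "rdense U e (B' l)" for l
        unfolding B'_def by (rule rdense_restrict[OF b]) (use \<nu>\<iota>(3) in \<open>simp add: wrong_def\<close>)
      fix a' assume a': "a' \<in> C"
      \<comment> \<open>\<open>r\<close> follows \<open>a\<close> on \<open>M b\<close> and
        \<open>a'\<close> elsewhere. The clashes of \<open>q\<close> with \<open>r\<close> are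
        bounded by \<open>Suc e\<close>, and one of them is spent at \<open>\<nu> l\<close>, a
        column on which \<open>q'\<close> is undefined; so at most \<open>e\<close> are left for
        \<open>a'\<close>.\<close>
      obtain r where r: "r \<in> C" "finite {n \<in> M b. fst a n \<noteq> None \<and> fst r n \<noteq> fst a n}"
        "finite {n \<in> - M b. fst a' n \<noteq> None \<and> fst r n \<noteq> fst a' n}"
        using mix[OF a(1) a', of "M b"] by blast
      obtain N where N: "\<forall>i\<ge>N. \<forall>q\<in>B i.
          finite (clash \<delta> t q r \<inter> {N..}) \<and> card (clash \<delta> t q r \<inter> {N..}) \<le> Suc e"
        using Suc.prems(4)[OF r(1)] ..
      have "finite ({n \<in> M b. fst a n \<noteq> None \<and> fst r n \<noteq> fst a n} \<union>
          {n \<in> - M b. fst a' n \<noteq> None \<and> fst r n \<noteq> fst a' n} \<union> clash \<delta> (t' - t) r a \<union> clash \<delta> (t' - t) r a')"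
        (is "finite ?X")
        using t' by (intro finite_UnI r(2,3) finite_clash[OF r(1)] a(1) a') simp_all
      then obtain K where "\<forall>n\<in>?X. n < K" unfolding finite_nat_set_iff_bounded ..
      then have K: "n < K" if "n \<in> ?X" for n using that by (rule bspec)
      define N' where "N' = max N K"
      show "\<exists>N. \<forall>i\<ge>N. \<forall>q\<in>B' i. finite (clash \<delta> t' q a' \<inter> {N..}) \<and> card (clash \<delta> t' q a' \<inter> {N..}) \<le> e"
      proof (intro exI[of _ N'] allI impI ballI)
        fix l q' assume l: "N' \<le> l" and "q' \<in> B' l"
        then obtain q where q': "q' = (fst q |` (- M b), snd q)" and q: "q \<in> B (\<iota> l)" "fst q (\<nu> l) = fst a (\<nu> l)"
          "t' < \<delta> (\<nu> l) (snd q (\<nu> l)) (snd a (\<nu> l))"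
          unfolding B'_def by (elim imageE CollectE conjE) simp
        let ?R = "clash \<delta> t q r \<inter> {N..}"
        have "N \<le> \<iota> l" using \<nu>\<iota>(2)[of l] l by (simp add: N'_def)
        then have R: "finite ?R" "card ?R \<le> Suc e" using N q(1) by blast+
        have \<nu>K: "K \<le> \<nu> l" "N \<le> \<nu> l" using l \<nu>\<iota>(1)[of l] by (auto simp: N'_def)
        have r\<nu>: "fst r (\<nu> l) = fst a (\<nu> l)" "fst a (\<nu> l) \<noteq> None"
        proof -
          show *: "fst a (\<nu> l) \<noteq> None" using \<nu>\<iota>(3)[of l] by (simp add: wrong_def)
          show "fst r (\<nu> l) = fst a (\<nu> l)"
          proof (rule ccontr)
            assume "fst r (\<nu> l) \<noteq> fst a (\<nu> l)"
            with * \<nu>\<iota>(4)[of l] have "\<nu> l \<in> ?X" by simp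
            from K[OF this] \<nu>K show False by simp
          qed
        qed
        have "\<nu> l \<notin> clash \<delta> (t' - t) r a" using K[of "\<nu> l"] \<nu>K by auto
        then have "\<delta> (\<nu> l) (snd r (\<nu> l)) (snd a (\<nu> l)) \<le> t' - t" using r\<nu> by (simp add: clash_def)
        then have "t < \<delta> (\<nu> l) (snd q (\<nu> l)) (snd r (\<nu> l))"
          using q(3) \<delta>_triangle[of "\<nu> l" "snd q (\<nu> l)" "snd a (\<nu> l)" "snd r (\<nu> l)"] by linarith
        then have 1: "\<nu> l \<in> ?R" using r\<nu> q(2) \<nu>K by (simp add: clash_def)
        let ?Y = "clash \<delta> t' q' a' \<inter> {N'..}"
        have 2: "?Y \<subseteq> ?R - {\<nu> l}"
        proof
          fix n assume n: "n \<in> ?Y"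
          then have n1: "fst q' n \<noteq> None" "fst q' n = fst a' n" "t' < \<delta> n (snd q n) (snd a' n)" "N \<le> n" "K \<le> n"
            by (auto simp: clash_def q' N'_def)
          have nM: "n \<notin> M b" using n1(1) by (auto simp: q' restrict_map_def split: if_splits)
          then have n2: "fst q n = fst a' n" "fst a' n \<noteq> None" using n1 by (auto simp: q' restrict_map_def)
          have n3: "fst r n = fst a' n"
          proof (rule ccontr)
            assume "fst r n \<noteq> fst a' n"
            with nM n2 have "n \<in> ?X" by simp
            from K[OF this] n1(5) show False by simp
          qed
          have "n \<notin> clash \<delta> (t' - t) r a'" using K[of n] n1(5) by auto
          then have "\<delta> n (snd r n) (snd a' n) \<le> t' - t" using n3 n2 by (simp add: clash_def)
          then have "t < \<delta> n (snd q n) (snd r n)"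
            using n1(3) \<delta>_triangle[of n "snd q n" "snd a' n" "snd r n"] by linarith
          then have "n \<in> ?R" using n2 n3 n1(4) by (simp add: clash_def)
          moreover have "n \<noteq> \<nu> l" using nM \<nu>\<iota>(4)[of l] by auto
          ultimately show "n \<in> ?R - {\<nu> l}" by simp
        qed
        have fin: "finite (?R - {\<nu> l})" using R(1) by simp
        have "card (?R - {\<nu> l}) \<le> e" using R 1 by (simp add: card_Diff_singleton)
        then have "card ?Y \<le> e" using card_mono[OF fin 2] by simp
        then show "finite ?Y \<and> card ?Y \<le> e" using finite_subset[OF 2 fin] by simp
      qed
    qed
  next
    case False
    \<comment> \<open>Here no element is contradicted past its threshold, so by partition regularity
      the true value is near densely many elements. Any other \<open>v\<close> near densely many
      elements is within \<open>2 * t'\<close> of it, for otherwise these elements would contradict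
      \<open>a\<close>.\<close>
    define G where "G i = {z. rdense U e {q \<in> B i. fst q (fst z) = Some (snd z)}}" for i
    define near where "near i z v \<longleftrightarrow> rdense U e {q \<in> B i. fst q (fst z) = Some (snd z) \<and> \<delta> (fst z) (snd q (fst z)) v \<le> t'}"
      for i and z :: "nat \<times> nat" and v
    have "\<exists>S. eventually (\<lambda>z. z \<in> S) U \<and> good (2 * t' + (3 * T - 2 * t')) S"
    proof (rule good_limit[OF U, where H = "\<lambda>i z. SOME v. near i z v" and G = G])
      show "0 < 3 * T - 2 * t'" using t' by simp
      show "eventually (\<lambda>z. z \<in> G i) U" for i using Suc.prems(3)[of i] by (simp add: G_def)
      fix a assume a: "a \<in> C"
      then obtain N where N: "\<And>i n. N \<le> i \<Longrightarrow> N \<le> n \<Longrightarrow> \<not> wrong a i n" using False by blast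
      show "\<exists>N. \<forall>i\<ge>N. \<forall>n\<ge>N. \<forall>u. fst a n = Some u \<longrightarrow> (n, u) \<in> G i \<longrightarrow>
          \<delta> n (snd a n) (SOME v. near i (n, u) v) \<le> 2 * t'"
      proof (intro exI[of _ N] allI impI)
        fix i n u assume *: "N \<le> i" "N \<le> n" "fst a n = Some u" "(n, u) \<in> G i"
        have nw: "\<not> rdense U e {q \<in> B i. fst q n = Some u \<and> t' < \<delta> n (snd q n) (snd a n)}"
          using N[OF *(1,2)] *(3) by (simp add: wrong_def)
        have "rdense U e {q \<in> B i. fst q n = Some u}" using *(4) by (simp add: G_def)
        then have "rdense U e ({q \<in> B i. fst q n = Some u \<and> \<delta> n (snd q n) (snd a n) \<le> t'} \<union>
            {q \<in> B i. fst q n = Some u \<and> t' < \<delta> n (snd q n) (snd a n)})"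
          by (rule rdense_mono[rotated]) auto
        from rdense_Un[OF this] nw have "near i (n, u) (snd a n)" by (simp add: near_def)
        then have v: "near i (n, u) (SOME v. near i (n, u) v)" by (rule someI)
        define v where "v = (SOME v. near i (n, u) v)"
        have "\<delta> n (snd a n) v \<le> 2 * t'"
        proof (rule ccontr)
          assume far: "\<not> ?thesis"
          have "rdense U e {q \<in> B i. fst q n = Some u \<and> t' < \<delta> n (snd q n) (snd a n)}"
          proof (rule rdense_mono[OF _ v[folded v_def, unfolded near_def fst_conv snd_conv]])
            have "t' < \<delta> n w (snd a n)" if "\<delta> n w v \<le> t'" for w
              using that far \<delta>_triangle[of n "snd a n" v w] \<delta>_sym[of n w "snd a n"] by linarith
            then show "{q \<in> B i. fst q n = Some u \<and> \<delta> n (snd q n) v \<le> t'}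
              \<subseteq> {q \<in> B i. fst q n = Some u \<and> t' < \<delta> n (snd q n) (snd a n)}" by blast
          qed
          with nw show False by contradiction
        qed
        then show "\<delta> n (snd a n) (SOME v. near i (n, u) v) \<le> 2 * t'" by (simp only: v_def)
      qed
    qed
    then show ?thesis by simp
  qed
qed


text \<open>Otherwise a binary sequence \<open>x\<close> and a reservoir of finite sections are built stage by stage.  At stage \<open>m\<close>
  the sections either are not extended by any element of \<open>Z m\<close> above the sequence built so far, or lie on some \<open>a\<close>
  and clash there with elements of \<open>Z m\<close> whose next bit is \<open>b\<close>; in the latter case \<open>x\<close> takes the opposite
  bit.  If \<open>p\<close> meets the reservoir, then \<open>(x, p)\<close> lies in no \<open>Z m\<close>.\<close>
theorem uniformization:
  assumes "0 < \<epsilon>"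
    and cover: "\<And>x p. p \<in> C \<Longrightarrow> \<exists>m :: nat. (x, p) \<in> Z m"
    and Z_C: "\<And>m x p. (x, p) \<in> Z m \<Longrightarrow> p \<in> C"
    and few: "\<And>m x p y q. (x, p) \<in> Z m \<Longrightarrow> (y, q) \<in> Z m \<Longrightarrow> x \<noteq> y \<Longrightarrow>
      card (clash \<delta> \<epsilon> p q) < 4 * split_level x y"
  shows "good (9 * \<epsilon>) UNIV"
proof (rule ccontr)
  assume not_good: "\<not> good (9 * \<epsilon>) UNIV"
  \<comment> \<open>The filter dual to the ideal of good sets: an ultrafilter below it contains no
    good set, so a set that is both large and good is a contradiction.\<close>
  define F where "F = (INF S\<in>{S. good (9 * \<epsilon>) S}. principal (- S))"
  have good_small: "good (9 * \<epsilon>) S" if "\<And>p. p \<in> C \<Longrightarrow> finite {n. \<exists>u. fst p n = Some u \<and> (n, u) \<in> S}" for S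
    unfolding good_def
  proof (intro exI[of _ "\<lambda>_ _. 0"] ballI)
    fix p assume "p \<in> C"
    show "finite {n. \<exists>u. fst p n = Some u \<and> (n, u) \<in> S \<and> 9 * \<epsilon> < \<delta> n (snd p n) 0}"
      by (rule finite_subset[OF _ that[OF \<open>p \<in> C\<close>]]) blast
  qed
  have F: "eventually P F \<longleftrightarrow> (\<exists>S. good (9 * \<epsilon>) S \<and> (\<forall>z. z \<notin> S \<longrightarrow> P z))" for P
  proof -
    have "eventually P F \<longleftrightarrow> (\<exists>S\<in>{S. good (9 * \<epsilon>) S}. eventually P (principal (- S)))"
      unfolding F_def
    proof (rule eventually_INF_base)
      have "good (9 * \<epsilon>) {}" by (rule good_small) simp
      then show "{S. good (9 * \<epsilon>) S} \<noteq> {}" by blast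
      fix S T assume "S \<in> {S. good (9 * \<epsilon>) S}" "T \<in> {S. good (9 * \<epsilon>) S}"
      then show "\<exists>R\<in>{S. good (9 * \<epsilon>) S}. principal (- R) \<le> inf (principal (- S)) (principal (- T))"
        using good_Un[of "9 * \<epsilon>" S T] by (intro bexI[of _ "S \<union> T"]) auto
    qed
    then show ?thesis by (auto simp: eventually_principal)
  qed
  have "F \<noteq> bot"
  proof
    assume "F = bot"
    then have "eventually (\<lambda>_. False) F" by simp
    then obtain S where "good (9 * \<epsilon>) S" "\<forall>z. z \<notin> S \<longrightarrow> False" unfolding F by blast
    moreover from this(2) have "S = UNIV" by blast
    ultimately show False using not_good by simp
  qed
  then obtain U where U: "U \<le> F" "U \<noteq> bot" "\<And>P. eventually P U \<or> eventually (\<lambda>z. \<not> P z) U"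
    using ultrafilter_extension[of F] by metis
  have U_good: "eventually (\<lambda>z. z \<notin> S) U" if "good (9 * \<epsilon>) S" for S
    using filter_leD[OF U(1), of "\<lambda>z. z \<notin> S"] that unfolding F by blast
  interpret U: ultra_columns U V
  proof
    show "eventually P U \<or> eventually (\<lambda>z. \<not> P z) U" for P by (rule U(3))
    show "U \<noteq> bot" by (rule U(2))
    show "eventually (\<lambda>z. N \<le> fst z) U" for N
    proof -
      have "good (9 * \<epsilon>) {z. fst z < N}"
        by (rule good_small) (rule finite_subset[of _ "{..<N}"], auto)
      from U_good[OF this] show ?thesis by (simp add: not_less)
    qed
    show "eventually (\<lambda>z. snd z \<in> V) U"
    proof -
      have "good (9 * \<epsilon>) {z. snd z \<notin> V}"
      proof (rule good_small)
        fix p assume "p \<in> C"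
        have "{n. \<exists>u. fst p n = Some u \<and> (n, u) \<in> {z. snd z \<notin> V}} = {}" using C_V[OF \<open>p \<in> C\<close>] by auto
        then show "finite {n. \<exists>u. fst p n = Some u \<and> (n, u) \<in> {z. snd z \<notin> V}}" by (simp only: finite.emptyI)
      qed
      from U_good[OF this] show ?thesis by simp
    qed
  qed
  define ext where "ext m \<tau> y q \<longleftrightarrow> (y, q) \<in> Z m \<and> (\<forall>j<length \<tau>. y j = \<tau> ! j)"
    for m and \<tau> :: "bool list" and y q
  define small where "small i \<sigma> \<longleftrightarrow> finite (dom \<sigma>) \<and> dom \<sigma> \<subseteq> {i..} \<and> ran \<sigma> \<subseteq> V" for i and \<sigma> :: "nat \<rightharpoonup> nat"
  define avoids where "avoids m \<tau> \<sigma> \<longleftrightarrow> (\<forall>y q. ext m \<tau> y q \<longrightarrow> \<not> \<sigma> \<subseteq>\<^sub>m fst q)" for m \<tau> \<sigma>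
  define errs where "errs m \<tau> a b \<sigma> \<longleftrightarrow> (\<exists>y q. ext m \<tau> y q \<and> y (length \<tau>) = b \<and> \<sigma> \<subseteq>\<^sub>m fst a \<and> \<sigma> \<subseteq>\<^sub>m fst q \<and>
      dom \<sigma> \<subseteq> clash \<delta> (2 * \<epsilon>) q a \<and> card (dom \<sigma>) = 4 * length \<tau>)" for m \<tau> a b \<sigma>
  have stage: "\<exists>W b. (\<forall>i. small i (W i)) \<and> ((\<forall>i. avoids m \<tau> (W i)) \<or> (\<exists>a\<in>C. \<forall>i. errs m \<tau> a b (W i)))" for m \<tau>
  proof (cases "\<forall>N. \<exists>\<sigma>. small N \<sigma> \<and> avoids m \<tau> \<sigma>")
    case True
    from choice[OF this] show ?thesis by blast
  next
    case False
    then obtain N0 where N0: "\<And>\<sigma>. small N0 \<sigma> \<Longrightarrow> \<not> avoids m \<tau> \<sigma>" by blast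
    define B where "B = {q. \<exists>y. ext m \<tau> y q}"
    have BC: "q \<in> C" if "q \<in> B" for q using that Z_C unfolding B_def ext_def by blast
    have dense: "rdense U e B" for e
    proof (rule ccontr)
      assume "\<not> rdense U e B"
      from U.rdense_pick[OF this, of N0] obtain \<sigma> where "small N0 \<sigma>" "\<not> (\<exists>q\<in>B. \<sigma> \<subseteq>\<^sub>m fst q)"
        unfolding small_def by blast
      then show False using N0 unfolding avoids_def B_def by blast
    qed
    \<comment> \<open>Otherwise the clashes of elements of \<open>B\<close> with each
      \<open>a\<close> are eventually bounded by \<open>4 * length \<tau>\<close>, and the induction
      with tolerances \<open>2 * \<epsilon>\<close> and \<open>3 * \<epsilon>\<close> yields a large
      set that is good for \<open>3 * (3 * \<epsilon>)\<close>.\<close>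
    have "\<exists>a\<in>C. \<forall>N. \<exists>q\<in>B. \<not> card (clash \<delta> (2 * \<epsilon>) q a \<inter> {N..}) \<le> 4 * length \<tau>"
    proof (rule ccontr)
      assume none: "\<not> ?thesis"
      have "\<exists>S. eventually (\<lambda>z. z \<in> S) U \<and> good (3 * (3 * \<epsilon>)) S"
      proof (rule good_of_bounded_clashes[OF U.ultra_columns_axioms, where B = "\<lambda>_. B" and t = "2 * \<epsilon>"])
        show "rdense U (4 * length \<tau>) B" by (rule dense)
        fix a assume a: "a \<in> C"
        with none obtain N where "\<forall>q\<in>B. card (clash \<delta> (2 * \<epsilon>) q a \<inter> {N..}) \<le> 4 * length \<tau>" by blast
        moreover have "finite (clash \<delta> (2 * \<epsilon>) q a \<inter> {N..})" if "q \<in> B" for q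
          using finite_clash[OF BC[OF that] a, of "2 * \<epsilon>"] \<open>0 < \<epsilon>\<close> by simp
        ultimately show "\<exists>N. \<forall>i\<ge>N. \<forall>q\<in>B. finite (clash \<delta> (2 * \<epsilon>) q a \<inter> {N..}) \<and>
            card (clash \<delta> (2 * \<epsilon>) q a \<inter> {N..}) \<le> 4 * length \<tau>" by blast
      qed (use \<open>0 < \<epsilon>\<close> in auto)
      then obtain S where "eventually (\<lambda>z. z \<in> S) U" "good (9 * \<epsilon>) S" by auto
      from this(1) U_good[OF this(2)] have "eventually (\<lambda>z. False) U" by eventually_elim simp
      then show False using U(2) by (simp add: eventually_False)
    qed
    then obtain a where a: "a \<in> C" "\<And>N. \<exists>q\<in>B. \<not> card (clash \<delta> (2 * \<epsilon>) q a \<inter> {N..}) \<le> 4 * length \<tau>" by blast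
    have "\<exists>\<sigma> b. small N \<sigma> \<and> errs m \<tau> a b \<sigma>" for N
    proof -
      obtain q where q: "q \<in> B" "\<not> card (clash \<delta> (2 * \<epsilon>) q a \<inter> {N..}) \<le> 4 * length \<tau>" using a(2) by blast
      then obtain X where X: "X \<subseteq> clash \<delta> (2 * \<epsilon>) q a \<inter> {N..}" "card X = 4 * length \<tau>" "finite X"
        using obtain_subset_with_card_n[of "4 * length \<tau>" "clash \<delta> (2 * \<epsilon>) q a \<inter> {N..}"] by auto
      obtain y where y: "ext m \<tau> y q" using q(1) unfolding B_def by blast
      have Xn: "fst q n \<noteq> None" "fst q n = fst a n" if "n \<in> X" for n using X(1) that by (auto simp: clash_def)
      have dom: "dom (fst a |` X) = X" using Xn by (auto simp: dom_def restrict_map_def) 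
      have "small N (fst a |` X)"
        unfolding small_def dom
      proof (intro conjI)
        show "ran (fst a |` X) \<subseteq> V" using C_V[OF a(1)] by (auto simp: ran_def restrict_map_def split: if_splits)
      qed (use X in auto)
      moreover have "errs m \<tau> a (y (length \<tau>)) (fst a |` X)"
        unfolding errs_def dom
      proof (intro exI[of _ y] exI[of _ q] conjI y)
        show "fst a |` X \<subseteq>\<^sub>m fst q" using Xn(2) by (auto simp: map_le_def restrict_map_def split: if_splits)
        show "fst a |` X \<subseteq>\<^sub>m fst a" by (auto simp: map_le_def restrict_map_def split: if_splits)
      qed (use X in auto)
      ultimately show ?thesis by blast
    qed
    have small_mono: "small N \<sigma>" if "small N' \<sigma>" "N \<le> N'" for N N' \<sigma>
      using that unfolding small_def by (meson atLeast_subset_iff order_trans)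
    \<comment> \<open>The witness, and with it the next bit, may vary with \<open>N\<close>. One of
      the two bits occurs for arbitrarily large \<open>N\<close>, hence for all \<open>N\<close> by
      monotonicity of \<open>small\<close>.\<close>
    have "\<exists>b. \<forall>N. \<exists>\<sigma>. small N \<sigma> \<and> errs m \<tau> a b \<sigma>"
    proof (rule ccontr)
      assume "\<not> ?thesis"
      then have "\<forall>b. \<exists>N. \<forall>\<sigma>. \<not> (small N \<sigma> \<and> errs m \<tau> a b \<sigma>)" by blast
      from choice[OF this] obtain N where N: "\<forall>b \<sigma>. \<not> (small (N b) \<sigma> \<and> errs m \<tau> a b \<sigma>)" ..
      obtain \<sigma> b where \<sigma>: "small (max (N True) (N False)) \<sigma>" "errs m \<tau> a b \<sigma>"
        using \<open>\<And>N. \<exists>\<sigma> b. small N \<sigma> \<and> errs m \<tau> a b \<sigma>\<close>[of "max (N True) (N False)"] by (elim exE conjE)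
      have "N b \<le> max (N True) (N False)" by (cases b) auto
      from small_mono[OF \<sigma>(1) this] \<sigma>(2) N show False by simp
    qed
    then obtain b where "\<forall>N. \<exists>\<sigma>. small N \<sigma> \<and> errs m \<tau> a b \<sigma>" ..
    from choice[OF this] a(1) show ?thesis by blast
  qed
  then have "\<forall>m\<tau>. \<exists>Wb. (\<forall>i. small i (fst Wb i)) \<and> ((\<forall>i. avoids (fst m\<tau>) (snd m\<tau>) (fst Wb i)) \<or>
      (\<exists>a\<in>C. \<forall>i. errs (fst m\<tau>) (snd m\<tau>) a (snd Wb) (fst Wb i)))" by simp
  from choice[OF this] obtain Wb where Wb: "\<And>m\<tau> i. small i (fst (Wb m\<tau>) i)"
    "\<And>m\<tau>. (\<forall>i. avoids (fst m\<tau>) (snd m\<tau>) (fst (Wb m\<tau>) i)) \<or> (\<exists>a\<in>C. \<forall>i. errs (fst m\<tau>) (snd m\<tau>) a (snd (Wb m\<tau>)) (fst (Wb m\<tau>) i))"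
    by blast
  \<comment> \<open>The sequence leaves every witness at its next bit, so it splits from the
    \<open>y\<close> of stage \<open>m\<close> exactly at level \<open>m\<close>; there
    \<open>few\<close> allows fewer than \<open>4 * m\<close> clashes.\<close>
  define \<tau> where "\<tau> = rec_nat [] (\<lambda>m t. t @ [\<not> snd (Wb (m, t))])"
  have \<tau>_Suc: "\<tau> (Suc m) = \<tau> m @ [\<not> snd (Wb (m, \<tau> m))]" and \<tau>_0: "\<tau> 0 = []" for m by (simp_all add: \<tau>_def)
  have len: "length (\<tau> m) = m" for m by (induction m) (simp_all add: \<tau>_0 \<tau>_Suc)
  define x where "x m = (\<not> snd (Wb (m, \<tau> m)))" for m
  have x\<tau>: "j < m \<Longrightarrow> \<tau> m ! j = x j" for j m
    by (induction m) (auto simp: \<tau>_Suc nth_append len x_def less_Suc_eq)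
  define W where "W m = fst (Wb (m, \<tau> m))" for m
  have "\<exists>p\<in>C. \<forall>m. infinite {i. W m i \<subseteq>\<^sub>m fst p}"
    by (rule reservoir) (use Wb(1) in \<open>simp add: W_def small_def\<close>)
  then obtain p where p: "p \<in> C" "\<And>m. infinite {i. W m i \<subseteq>\<^sub>m fst p}" by blast
  obtain m where m: "(x, p) \<in> Z m" using cover[OF p(1)] by blast
  have xp: "ext m (\<tau> m) x p" unfolding ext_def using m x\<tau> len by simp
  from Wb(2)[of "(m, \<tau> m)"] show False
  proof (elim disjE bexE)
    assume "\<forall>i. avoids (fst (m, \<tau> m)) (snd (m, \<tau> m)) (fst (Wb (m, \<tau> m)) i)"
    then have "avoids m (\<tau> m) (W m i)" for i by (simp add: W_def)
    then have "\<not> W m i \<subseteq>\<^sub>m fst p" for i using xp unfolding avoids_def by blast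
    then have "{i. W m i \<subseteq>\<^sub>m fst p} = {}" by blast
    then show False using p(2)[of m] by simp
  next
    fix a assume a: "a \<in> C" and all: "\<forall>i. errs (fst (m, \<tau> m)) (snd (m, \<tau> m)) a (snd (Wb (m, \<tau> m))) (fst (Wb (m, \<tau> m)) i)"
    have "finite (clash \<delta> \<epsilon> p a)" using finite_clash[OF p(1) a \<open>0 < \<epsilon>\<close>] .
    then obtain K where K: "\<forall>n\<in>clash \<delta> \<epsilon> p a. n < K" unfolding finite_nat_set_iff_bounded ..
    obtain i where i: "K \<le> i" "W m i \<subseteq>\<^sub>m fst p"
      using p(2)[of m] unfolding infinite_nat_iff_unbounded_le by blast
    have "errs m (\<tau> m) a (snd (Wb (m, \<tau> m))) (W m i)" using all by (simp add: W_def)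
    then obtain y q where yq: "ext m (\<tau> m) y q" "y m = snd (Wb (m, \<tau> m))" "W m i \<subseteq>\<^sub>m fst a" "W m i \<subseteq>\<^sub>m fst q"
      "dom (W m i) \<subseteq> clash \<delta> (2 * \<epsilon>) q a" "card (dom (W m i)) = 4 * m"
      unfolding errs_def len by (elim exE conjE)
    have split: "split_level x y = m"
    proof (rule split_levelI)
      show "x j = y j" if "j < m" for j using yq(1) that x\<tau>[OF that] by (simp add: ext_def len)
      show "x m \<noteq> y m" using yq(2) by (simp add: x_def)
    qed
    have "x \<noteq> y" using yq(2) by (auto simp: x_def fun_eq_iff)
    have "q \<in> C" using yq(1) Z_C unfolding ext_def by blast
    \<comment> \<open>Far out \<open>p\<close> is within \<open>\<epsilon>\<close> of
      \<open>a\<close>, so a clash of size \<open>2 * \<epsilon>\<close> between \<open>q\<close>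
      and \<open>a\<close> leaves one of size \<open>\<epsilon>\<close> between \<open>p\<close> and
      \<open>q\<close>.\<close>
    have "dom (W m i) \<subseteq> clash \<delta> \<epsilon> p q"
    proof
      fix n assume n: "n \<in> dom (W m i)"
      have nK: "K \<le> n" using Wb(1)[of i "(m, \<tau> m)"] n i(1) unfolding small_def W_def by fastforce
      have eq: "fst p n = W m i n" "fst a n = W m i n" "fst q n = W m i n" "W m i n \<noteq> None"
        using n i(2) yq(3,4) unfolding map_le_def by (auto dest: bspec[of _ _ n])
      have "n \<notin> clash \<delta> \<epsilon> p a" using K nK by auto
      then have "\<delta> n (snd p n) (snd a n) \<le> \<epsilon>" using eq by (simp add: clash_def)
      moreover have "2 * \<epsilon> < \<delta> n (snd q n) (snd a n)" using yq(5) n by (auto simp: clash_def)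
      ultimately have "\<epsilon> < \<delta> n (snd p n) (snd q n)"
        using \<delta>_triangle[of n "snd q n" "snd a n" "snd p n"] \<delta>_sym[of n "snd q n" "snd p n"] by linarith
      then show "n \<in> clash \<delta> \<epsilon> p q" using eq by (simp add: clash_def)
    qed
    then have "4 * m \<le> card (clash \<delta> \<epsilon> p q)"
      using card_mono[OF finite_clash[OF p(1) \<open>q \<in> C\<close> \<open>0 < \<epsilon>\<close>]] yq(6) by metis
    moreover have "card (clash \<delta> \<epsilon> p q) < 4 * m"
      using few[OF m _ \<open>x \<noteq> y\<close>] yq(1) split unfolding ext_def by metis
    ultimately show False by simp
  qed
qed

end

section \<open>Maps respecting coordinates\<close>

lemma uncountable_collision:
  fixes g :: "'a \<Rightarrow> 't :: countable"
  assumes "uncountable Y"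
  obtains a b where "a \<in> Y" "b \<in> Y" "a \<noteq> b" "g a = g b"
proof -
  have "\<not> inj_on g Y" using assms countableI'[of g Y] by blast
  then show thesis using that unfolding inj_on_def by blast
qed

lemma map_upt_eq_iff: "map f [0..<k] = map g [0..<k] \<longleftrightarrow> (\<forall>j<k. f j = g j)"
  by (simp add: list_eq_iff_nth_eq)

lemma split_level_ge:
  assumes "x \<noteq> y" "\<And>j. j < k \<Longrightarrow> x j = y j"
  shows "k \<le> split_level x y"
  using split_level_props(1)[OF assms(1)] assms(2)[of "split_level x y"] by (meson not_le)

lemma prefix_nth: "prefix s t \<Longrightarrow> n < length s \<Longrightarrow> t ! n = s ! n"
  by (auto simp: prefix_def nth_append)

text \<open>A condition is a stem \<open>s\<close> with a finite set of elements pairwise captured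
  by \<open>s\<close>; its label is \<open>s\<close> with the types of the elements at its length k.
  In two conditions with equal labels each element has a partner of the same type, and only distinct
  partners need new captures. There are at most k such pairs, because \<open>card F\<close> is
  bounded by the stem length, and their sequences agree below k, so they are far at some level not
  below k: this is the situation that \<open>amalgam\<close> handles.\<close>

lemma MA_types:
  fixes Y :: "((nat \<Rightarrow> bool) \<times> 'p) set" and tp :: "nat \<Rightarrow> 'p \<Rightarrow> 't :: countable"
    and cap :: "'s :: countable list \<Rightarrow> 'p \<Rightarrow> 'p \<Rightarrow> bool"
  assumes MA: MA_aleph1_sigma_linked and "uncountable Y"
    and hom: "\<And>a b. a \<in> Y \<Longrightarrow> b \<in> Y \<Longrightarrow> a \<noteq> b \<Longrightarrow>
      fst a \<noteq> fst b \<and> far (split_level (fst a) (fst b)) (snd a) (snd b)"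
    and cap_sym: "\<And>s p q. cap s p q \<Longrightarrow> cap s q p"
    and cap_prefix: "\<And>s s' p q. prefix s s' \<Longrightarrow> cap s p q \<Longrightarrow> cap s' p q"
    and cap_tp: "\<And>s p q q'. cap s p q \<Longrightarrow> tp (length s) q = tp (length s) q' \<Longrightarrow> cap s p q'"
    and amalgam: "\<And>s R. finite R \<Longrightarrow> card R \<le> length s \<Longrightarrow> R \<subseteq> snd ` Y \<times> snd ` Y \<Longrightarrow>
      (\<And>p q. (p, q) \<in> R \<Longrightarrow> tp (length s) p = tp (length s) q \<and> (\<exists>j\<ge>length s. far j p q)) \<Longrightarrow>
      \<exists>s'. prefix s s' \<and> (\<forall>(p, q) \<in> R. cap s' p q)"
  obtains c Y' where "Y' \<subseteq> Y" "uncountable Y'"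
    "\<And>a b. a \<in> Y' \<Longrightarrow> b \<in> Y' \<Longrightarrow> a \<noteq> b \<Longrightarrow> \<exists>n. cap (map c [0..<n]) (snd a) (snd b)"
proof -
  define loc where "loc k a = (map (fst a) [0..<k], tp k (snd a))" for k and a :: "(nat \<Rightarrow> bool) \<times> 'p"
  define P where "P = {(s, F). finite F \<and> F \<subseteq> Y \<and> card F \<le> length s \<and>
    (\<forall>a\<in>F. \<forall>b\<in>F. a \<noteq> b \<longrightarrow> cap s (snd a) (snd b) \<and>
      map (fst a) [0..<length s] \<noteq> map (fst b) [0..<length s])}"
  define lab where "lab c = (fst c, if finite (snd c) then loc (length (fst c)) ` snd c else {})" for c :: "'s list \<times> _"
  have "range lab \<subseteq> UNIV \<times> {A. finite A}" by (auto simp: lab_def)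
  then have cnt: "countable (range lab)"
    by (rule countable_subset) (intro countable_SIGMA countableI_type countable_Collect_finite)
  have single: "\<exists>s. (s, {a}) \<in> P" if "a \<in> Y" for a
    using that by (intro exI[of _ "[undefined]"]) (simp add: P_def)
  have link: "\<exists>s'' F''. (s'', F'') \<in> P \<and> prefix s s'' \<and> prefix s' s'' \<and> F \<union> F' \<subseteq> F''"
    if "(s, F) \<in> P" "(s', F') \<in> P" "lab (s, F) = lab (s', F')" for s F s' F'
  proof -
    define k where "k = length s"
    have F: "finite F" "F \<subseteq> Y" "card F \<le> k"
      "\<And>a b. a \<in> F \<Longrightarrow> b \<in> F \<Longrightarrow> a \<noteq> b \<Longrightarrow> cap s (snd a) (snd b) \<and> map (fst a) [0..<k] \<noteq> map (fst b) [0..<k]"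
      using that(1) unfolding P_def k_def by auto
    have ss: "s' = s" using that(3) by (simp add: lab_def)
    have F': "finite F'" "F' \<subseteq> Y"
      "\<And>a b. a \<in> F' \<Longrightarrow> b \<in> F' \<Longrightarrow> a \<noteq> b \<Longrightarrow> cap s (snd a) (snd b) \<and> map (fst a) [0..<k] \<noteq> map (fst b) [0..<k]"
      using that(2) unfolding P_def k_def ss by auto
    have im: "loc k ` F = loc k ` F'" using that(3) F(1) F'(1) by (simp add: lab_def k_def ss)
    define m where "m a = (SOME b. b \<in> F' \<and> loc k b = loc k a)" for a
    have m: "m a \<in> F'" "loc k (m a) = loc k a" if "a \<in> F" for a
    proof -
      have "loc k a \<in> loc k ` F'" using that im by blast
      then have "\<exists>b. b \<in> F' \<and> loc k b = loc k a" by (metis imageE)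
      then have "m a \<in> F' \<and> loc k (m a) = loc k a" unfolding m_def by (rule someI_ex)
      then show "m a \<in> F'" "loc k (m a) = loc k a" by auto
    qed
    define R where "R = (\<lambda>a. (snd a, snd (m a))) ` {a \<in> F. m a \<noteq> a}"
    have "finite R" using F(1) by (simp add: R_def)
    have "card R \<le> card {a \<in> F. m a \<noteq> a}" unfolding R_def using F(1) by (intro card_image_le) simp
    also have "\<dots> \<le> card F" using F(1) by (intro card_mono) auto
    finally have "card R \<le> length s" using F(3) by (simp add: k_def)
    have RY: "R \<subseteq> snd ` Y \<times> snd ` Y" using m(1) F(2) F'(2) unfolding R_def by blast
    have far: "tp (length s) p = tp (length s) q \<and> (\<exists>j\<ge>length s. far j p q)" if "(p, q) \<in> R" for p q
    proof -
      obtain a where a: "a \<in> F" "m a \<noteq> a" "p = snd a" "q = snd (m a)" using \<open>(p, q) \<in> R\<close> unfolding R_def by blast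
      have "map (fst a) [0..<k] = map (fst (m a)) [0..<k]" "tp k (snd a) = tp k (snd (m a))"
        using m(2)[OF a(1)] unfolding loc_def by auto
      moreover have h: "fst a \<noteq> fst (m a) \<and> far (split_level (fst a) (fst (m a))) (snd a) (snd (m a))"
        using hom[of a "m a"] a m(1)[OF a(1)] F(2) F'(2) by auto
      ultimately have "k \<le> split_level (fst a) (fst (m a))"
        by (intro split_level_ge) (auto simp: map_upt_eq_iff)
      then show ?thesis using h \<open>tp k (snd a) = tp k (snd (m a))\<close> unfolding a(3,4) k_def by blast
    qed
    obtain s1 where s1: "prefix s s1" "\<forall>(p, q)\<in>R. cap s1 p q"
      using amalgam[OF \<open>finite R\<close> \<open>card R \<le> length s\<close> RY far] by blast
    define G where "G = F \<union> F'"
    have G: "finite G" "G \<subseteq> Y" using F F' by (auto simp: G_def)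
    have "finite ((\<lambda>(a, b). split_level (fst a) (fst b)) ` (G \<times> G))" using G(1) by simp
    then obtain L where L: "\<forall>j\<in>(\<lambda>(a, b). split_level (fst a) (fst b)) ` (G \<times> G). j < L"
      unfolding finite_nat_set_iff_bounded ..
    \<comment> \<open>Padding makes the stem longer than every split level in \<open>G\<close>, so
      that distinct elements have distinct restricted sequences, and at least as long as the number
      of elements.\<close>
    define s2 where "s2 = s1 @ replicate (L + card G) undefined"
    have s2: "prefix s1 s2" "prefix s s2" using s1(1) by (auto simp: s2_def intro: prefix_order.trans)
    have cap_s2: "cap s2 (snd a) (snd b)" if ab: "a \<in> F" "b \<in> F'" "a \<noteq> b" for a b
    proof (cases "loc k a = loc k b")
      case True
      have "map (fst b) [0..<k] = map (fst (m a)) [0..<k]"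
        using True m(2)[OF ab(1)] unfolding loc_def by auto
      have "b = m a"
      proof (rule ccontr)
        assume "b \<noteq> m a"
        from F'(3)[OF ab(2) m(1)[OF ab(1)] this] \<open>map (fst b) [0..<k] = map (fst (m a)) [0..<k]\<close>
        show False by simp
      qed
      then have "(snd a, snd b) \<in> R" unfolding R_def using ab by (intro image_eqI[of _ _ a]) simp_all
      then have "cap s1 (snd a) (snd b)" using bspec[OF s1(2)] by fastforce
      then show ?thesis by (rule cap_prefix[OF s2(1)])
    next
      case False
      \<comment> \<open>For elements of different types, \<open>b\<close> has the type of some
        \<open>a'\<close> in \<open>F\<close> that is already captured against \<open>a\<close>, and
        capture depends only on the type.\<close>
      have "loc k b \<in> loc k ` F" unfolding im using ab(2) by (rule imageI)
      then obtain a' where a': "a' \<in> F" "loc k b = loc k a'" by (rule imageE)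
      have "cap s (snd a) (snd a')" using F(4)[OF ab(1) a'(1)] a'(2) False by metis
      then have "cap s (snd a) (snd b)" by (rule cap_tp) (use a'(2) in \<open>simp add: loc_def k_def\<close>)
      then show ?thesis by (rule cap_prefix[OF s2(2)])
    qed
    have cap_G: "cap s2 (snd a) (snd b)" if ab: "a \<in> G" "b \<in> G" "a \<noteq> b" for a b
    proof -
      consider "a \<in> F" "b \<in> F" | "a \<in> F'" "b \<in> F'" | "a \<in> F" "b \<in> F'" | "a \<in> F'" "b \<in> F"
        using ab unfolding G_def by blast
      then show ?thesis
      proof cases
        case 1
        then show ?thesis using F(4) ab(3) cap_prefix[OF s2(2)] by metis
      next
        case 2
        then show ?thesis using F'(3) ab(3) cap_prefix[OF s2(2)] by metis
      next
        case 3
        then show ?thesis using cap_s2 ab(3) by blast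
      next
        case 4
        then show ?thesis using cap_s2[of b a] ab(3) cap_sym by metis
      qed
    qed
    have "(s2, G) \<in> P"
      unfolding P_def
    proof (intro CollectI case_prodI conjI ballI impI G)
      show "card G \<le> length s2" by (simp add: s2_def)
      fix a b assume ab: "a \<in> G" "b \<in> G" "a \<noteq> b"
      show "cap s2 (snd a) (snd b)" by (rule cap_G[OF ab])
      have "fst a \<noteq> fst b" using hom[of a b] ab G(2) by blast
      from split_level_props(1)[OF this] have "fst a (split_level (fst a) (fst b)) \<noteq> fst b (split_level (fst a) (fst b))" .
      moreover have "split_level (fst a) (fst b) < L" using L ab(1,2) by force
      then have "split_level (fst a) (fst b) < length s2" by (simp add: s2_def)
      ultimately show "map (fst a) [0..<length s2] \<noteq> map (fst b) [0..<length s2]"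
        unfolding map_upt_eq_iff by blast
    qed
    then show ?thesis using s2(2) ss unfolding G_def by blast
  qed
  obtain \<G> where \<G>: "\<G> \<subseteq> P"
    "\<And>s F s' F'. (s, F) \<in> \<G> \<Longrightarrow> (s', F') \<in> \<G> \<Longrightarrow>
      \<exists>s'' F''. (s'', F'') \<in> \<G> \<and> prefix s s'' \<and> prefix s' s'' \<and> F \<union> F' \<subseteq> F''"
    "uncountable (Y \<inter> \<Union> (snd ` \<G>))"
  proof (rule MA_capture[OF MA prefix_order.refl prefix_order.trans prefix_order.antisym \<open>uncountable Y\<close> single cnt link])
    fix \<G> assume a: "\<G> \<subseteq> P" and b: "\<And>s F s' F'. (s, F) \<in> \<G> \<Longrightarrow> (s', F') \<in> \<G> \<Longrightarrow>
      \<exists>s'' F''. (s'', F'') \<in> \<G> \<and> prefix s s'' \<and> prefix s' s'' \<and> F \<union> F' \<subseteq> F''"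
      and c: "uncountable (Y \<inter> \<Union> (snd ` \<G>))"
    show thesis by (rule that[OF a b c])
  qed
  \<comment> \<open>Stems in the filter have common extensions, hence are comparable;
    \<open>c\<close> is their union, with arbitrary values beyond it.\<close>
  define c where "c n = (SOME v. \<exists>s F. (s, F) \<in> \<G> \<and> n < length s \<and> s ! n = v)" for n
  have c: "map c [0..<length s] = s" if sF: "(s, F) \<in> \<G>" for s F
  proof (rule nth_equalityI)
    fix n assume "n < length (map c [0..<length s])"
    then have n: "n < length s" by simp
    then have "\<exists>v s F. (s, F) \<in> \<G> \<and> n < length s \<and> s ! n = v" using sF by blast
    then have "\<exists>s F. (s, F) \<in> \<G> \<and> n < length s \<and> s ! n = c n" unfolding c_def by (rule someI_ex)
    then obtain s' F' where s': "(s', F') \<in> \<G>" "n < length s'" "s' ! n = c n" by blast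
    obtain s'' where "prefix s s''" "prefix s' s''" using \<G>(2)[OF sF s'(1)] by blast
    then have "s ! n = s' ! n" using prefix_nth n s'(2) by metis
    then show "map c [0..<length s] ! n = s ! n" using n s'(3) by simp
  qed simp
  show thesis
  proof (rule that[of "Y \<inter> \<Union> (snd ` \<G>)" c])
    show "uncountable (Y \<inter> \<Union> (snd ` \<G>))" by (rule \<G>(3))
    fix a b assume ab: "a \<in> Y \<inter> \<Union> (snd ` \<G>)" "b \<in> Y \<inter> \<Union> (snd ` \<G>)" "a \<noteq> b"
    then obtain s F s' F' where 1: "(s, F) \<in> \<G>" "a \<in> F" "(s', F') \<in> \<G>" "b \<in> F'" by auto
    obtain s'' F'' where 2: "(s'', F'') \<in> \<G>" "F \<union> F' \<subseteq> F''" using \<G>(2)[OF 1(1,3)] by blast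
    have "(s'', F'') \<in> P" using 2(1) \<G>(1) by blast
    then have "cap s'' (snd a) (snd b)" using 1(2,4) 2(2) ab(3) unfolding P_def by blast
    then show "\<exists>n. cap (map c [0..<n]) (snd a) (snd b)" using c[OF 2(1)] by metis
  qed blast
qed

lemma split_level_sym: "split_level x y = split_level y x"
  unfolding split_level_def by (rule arg_cong[where f = Least]) auto

section \<open>Uniformization from OCA\<close>

context coherent_points
begin

lemma clash_sym: "clash \<delta> e p q = clash \<delta> e q p"
  unfolding clash_def using \<delta>_sym by auto

text \<open>The colour is open although a clash set involves infinitely many coordinates: by
  coherence it is finite, hence visible below some \<open>N\<close>, and a neighbouring pair can
  only clash more. \<open>no_hom\<close> is the part left to MA.\<close>

theorem uniformization_OCA:
  assumes OCA and "0 < \<epsilon>"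
    and no_hom: "\<And>Y. Y \<subseteq> UNIV \<times> C \<Longrightarrow> uncountable Y \<Longrightarrow>
      (\<And>a b. a \<in> Y \<Longrightarrow> b \<in> Y \<Longrightarrow> a \<noteq> b \<Longrightarrow> fst a \<noteq> fst b \<and>
        4 * split_level (fst a) (fst b) \<le> card (clash \<delta> \<epsilon> (snd a) (snd b))) \<Longrightarrow> False"
  shows "good (9 * \<epsilon>) UNIV"
proof -
  define code :: "(nat \<Rightarrow> bool) \<times> section_point \<Rightarrow> nat \<Rightarrow> nat"
    where "code a n = to_nat (fst a n, fst (snd a) n, snd (snd a) n)" for a n
  have code: "code a n = code b n \<longleftrightarrow> fst a n = fst b n \<and> fst (snd a) n = fst (snd b) n \<and> snd (snd a) n = snd (snd b) n" for a b n
    by (simp add: code_def)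
  define K where "K a b \<longleftrightarrow> fst a \<noteq> fst b \<and> 4 * split_level (fst a) (fst b) \<le> card (clash \<delta> \<epsilon> (snd a) (snd b))"
    for a b :: "(nat \<Rightarrow> bool) \<times> section_point"
  have inj: "inj_on code (UNIV \<times> C)"
  proof (rule inj_onI)
    fix a b assume "code a = code b"
    then have "\<And>n. code a n = code b n" by simp
    then show "a = b" unfolding code by (intro prod_eqI ext) blast+
  qed
  have K_sym: "K b a" if "K a b" for a b
    using that clash_sym[of \<epsilon> "snd a" "snd b"] split_level_sym[of "fst a" "fst b"] unfolding K_def by auto
  have K_open: "\<exists>N. \<forall>a'\<in>UNIV \<times> C. \<forall>b'\<in>UNIV \<times> C. (\<forall>n<N. code a' n = code a n) \<and> (\<forall>n<N. code b' n = code b n) \<longrightarrow> K a' b'"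
    if ab: "a \<in> UNIV \<times> C" "b \<in> UNIV \<times> C" "K a b" for a b
  proof -
    define k where "k = split_level (fst a) (fst b)"
    have "finite (clash \<delta> \<epsilon> (snd a) (snd b))" using finite_clash[of "snd a" "snd b"] ab(1,2) \<open>0 < \<epsilon>\<close> by auto
    then obtain N where N: "\<forall>n\<in>clash \<delta> \<epsilon> (snd a) (snd b). n < N" unfolding finite_nat_set_iff_bounded ..
    show ?thesis
    proof (intro exI[of _ "max N (Suc k)"] ballI impI, elim conjE)
      fix a' b' assume C': "a' \<in> UNIV \<times> C" "b' \<in> UNIV \<times> C"
        and eq: "\<forall>n<max N (Suc k). code a' n = code a n" "\<forall>n<max N (Suc k). code b' n = code b n"
      have ne: "fst a \<noteq> fst b" using ab(3) by (simp add: K_def)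
      have "split_level (fst a') (fst b') = k"
      proof (rule split_levelI)
        show "fst a' j = fst b' j" if "j < k" for j
          using eq[unfolded code] split_level_props(2)[OF ne, of j] that by (simp add: k_def)
        show "fst a' k \<noteq> fst b' k"
          using eq[unfolded code] split_level_props(1)[OF ne] by (simp add: k_def)
      qed
      moreover have "fst a' \<noteq> fst b'"
        using eq[unfolded code] split_level_props(1)[OF ne] unfolding k_def[symmetric]
        by (metis lessI max.strict_coboundedI2)
      moreover have sub: "clash \<delta> \<epsilon> (snd a) (snd b) \<subseteq> clash \<delta> \<epsilon> (snd a') (snd b')"
      proof
        fix n assume n: "n \<in> clash \<delta> \<epsilon> (snd a) (snd b)"
        then have "n < max N (Suc k)" using N by auto
        then show "n \<in> clash \<delta> \<epsilon> (snd a') (snd b')" using n eq[unfolded code] by (auto simp: clash_def)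
      qed
      moreover have "finite (clash \<delta> \<epsilon> (snd a') (snd b'))"
        using finite_clash[of "snd a'" "snd b'"] C' \<open>0 < \<epsilon>\<close> by auto
      moreover from card_mono[OF this sub]
      have "4 * k \<le> card (clash \<delta> \<epsilon> (snd a') (snd b'))" using ab(3) by (simp add: K_def k_def)
      ultimately show "K a' b'" by (simp add: K_def)
    qed
  qed
  have K_hom: "\<exists>a\<in>Y. \<exists>b\<in>Y. a \<noteq> b \<and> \<not> K a b" if "Y \<subseteq> UNIV \<times> C" "uncountable Y" for Y
  proof (rule ccontr)
    assume none: "\<not> ?thesis"
    have "K a b" if ab: "a \<in> Y" "b \<in> Y" "a \<noteq> b" for a b
    proof (rule ccontr)
      assume "\<not> K a b"
      with ab(3) have "a \<noteq> b \<and> \<not> K a b" ..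
      from this ab(2) have "\<exists>b\<in>Y. a \<noteq> b \<and> \<not> K a b" by (rule bexI)
      from this ab(1) have "\<exists>a\<in>Y. \<exists>b\<in>Y. a \<noteq> b \<and> \<not> K a b" by (rule bexI)
      with none show False by contradiction
    qed
    note * = this
    show False
    proof (rule no_hom[OF that])
      fix a b assume "a \<in> Y" "b \<in> Y" "a \<noteq> b"
      from *[OF this] show "fst a \<noteq> fst b \<and> 4 * split_level (fst a) (fst b) \<le> card (clash \<delta> \<epsilon> (snd a) (snd b))"
        unfolding K_def .
    qed
  qed
  obtain Z :: "nat \<Rightarrow> ((nat \<Rightarrow> bool) \<times> section_point) set"
    where Z: "UNIV \<times> C = (\<Union>m. Z m)" "\<And>m a b. a \<in> Z m \<Longrightarrow> b \<in> Z m \<Longrightarrow> a \<noteq> b \<Longrightarrow> \<not> K a b"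
  proof (rule OCA_coded[OF \<open>OCA\<close> inj])
    show "K b a" if "K a b" for a b using that by (rule K_sym)
    show "\<exists>N. \<forall>a'\<in>UNIV \<times> C. \<forall>b'\<in>UNIV \<times> C. (\<forall>n<N. code a' n = code a n) \<and> (\<forall>n<N. code b' n = code b n) \<longrightarrow> K a' b'"
      if "a \<in> UNIV \<times> C" "b \<in> UNIV \<times> C" "K a b" for a b using that by (rule K_open)
    show "\<exists>a\<in>Y. \<exists>b\<in>Y. a \<noteq> b \<and> \<not> K a b" if "Y \<subseteq> UNIV \<times> C" "uncountable Y" for Y
      using that by (rule K_hom)
    fix Z :: "nat \<Rightarrow> ((nat \<Rightarrow> bool) \<times> section_point) set"
    assume 1: "UNIV \<times> C = (\<Union>m. Z m)" and 2: "\<And>m a b. a \<in> Z m \<Longrightarrow> b \<in> Z m \<Longrightarrow> a \<noteq> b \<Longrightarrow> \<not> K a b"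
    show thesis by (rule that[OF 1 2])
  qed
  show ?thesis
  proof (rule uniformization[OF \<open>0 < \<epsilon>\<close>])
    show "\<exists>m. (x, p) \<in> Z m" if "p \<in> C" for x p using that Z(1) by blast
    show "p \<in> C" if "(x, p) \<in> Z m" for m x p using that Z(1) by blast
    show "card (clash \<delta> \<epsilon> p q) < 4 * split_level x y" if "(x, p) \<in> Z m" "(y, q) \<in> Z m" "x \<noteq> y" for m x p y q
      using Z(2)[OF that(1,2)] that(3) by (simp add: K_def not_le)
  qed
qed

end

section \<open>Total functions and coordinatewise form\<close>

lemma distinct_representatives:
  assumes "finite R" "\<And>r. r \<in> R \<Longrightarrow> finite (A r) \<and> card R \<le> card (A r)"
  shows "\<exists>\<nu>. inj_on \<nu> R \<and> (\<forall>r\<in>R. \<nu> r \<in> A r)"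
  using assms
proof (induction R rule: finite_induct)
  case (insert r R)
  have "\<exists>\<nu>. inj_on \<nu> R \<and> (\<forall>r\<in>R. \<nu> r \<in> A r)"
    by (rule insert.IH) (use insert.prems insert.hyps in fastforce)
  then obtain \<nu> where \<nu>: "inj_on \<nu> R" "\<forall>r\<in>R. \<nu> r \<in> A r" by blast
  have A: "finite (A r)" "card (insert r R) \<le> card (A r)" using insert.prems[of r] by simp_all
  have "card (\<nu> ` R) < card (A r)" using A insert.hyps card_image_le[OF insert.hyps(1), of \<nu>] by simp
  then have "\<not> A r \<subseteq> \<nu> ` R" using card_mono[of "\<nu> ` R" "A r"] insert.hyps(1) by auto
  then obtain w where w: "w \<in> A r" "w \<notin> \<nu> ` R" by blast
  show ?case
  proof (intro exI[of _ "\<nu>(r := w)"] conjI)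
    show "inj_on (\<nu>(r := w)) (insert r R)"
      using \<nu>(1) w(2) insert.hyps(2) by (auto simp: inj_on_def)
    show "\<forall>r'\<in>insert r R. (\<nu>(r := w)) r' \<in> A r'" using \<nu>(2) w(1) by simp
  qed
qed simp

text \<open>Sequence \<open>m\<close> is attended at every stage \<open>prod_encode (m, i)\<close>,
  hence infinitely often. The sections used occupy consecutive disjoint blocks of columns, so their
  union is a function.\<close>

lemma total_reservoir:
  fixes W :: "nat \<Rightarrow> nat \<Rightarrow> nat \<rightharpoonup> nat"
  assumes W: "\<And>m i. finite (dom (W m i)) \<and> dom (W m i) \<subseteq> {i..}"
  shows "\<exists>a. \<forall>m. infinite {i. W m i \<subseteq>\<^sub>m Some \<circ> a}"
proof -
  define mm where "mm j = fst (prod_decode j)" for j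
  define b where "b = rec_nat 0 (\<lambda>j b. Suc (Max (insert b (dom (W (mm j) b)))))"
  have b_Suc: "b (Suc j) = Suc (Max (insert (b j) (dom (W (mm j) (b j)))))" for j by (simp add: b_def)
  have dom: "dom (W (mm j) (b j)) \<subseteq> {b j..<b (Suc j)}" for j
  proof
    fix n assume n: "n \<in> dom (W (mm j) (b j))"
    have "finite (insert (b j) (dom (W (mm j) (b j))))" using W by simp
    then have "n \<le> Max (insert (b j) (dom (W (mm j) (b j))))" using n by (intro Max_ge) auto
    moreover have "b j \<le> n" using W n by blast
    ultimately show "n \<in> {b j..<b (Suc j)}" by (simp add: b_Suc)
  qed
  have b_less: "b j < b (Suc j)" for j
  proof -
    have "finite (insert (b j) (dom (W (mm j) (b j))))" using W by simp
    then have "b j \<le> Max (insert (b j) (dom (W (mm j) (b j))))" by (intro Max_ge) auto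
    then show ?thesis by (simp add: b_Suc)
  qed
  then have mono: "strict_mono b" by (simp add: strict_mono_Suc_iff)
  have uniq: "j = j'" if "n \<in> dom (W (mm j) (b j))" "n \<in> dom (W (mm j') (b j'))" for n j j'
  proof (rule ccontr)
    assume "j \<noteq> j'"
    then consider "Suc j \<le> j'" | "Suc j' \<le> j" by linarith
    then show False
    proof cases
      case 1
      then have "b (Suc j) \<le> b j'" using mono by (simp add: strict_mono_less_eq)
      then show ?thesis using dom[of j] dom[of j'] that by fastforce
    next
      case 2
      then have "b (Suc j') \<le> b j" using mono by (simp add: strict_mono_less_eq)
      then show ?thesis using dom[of j] dom[of j'] that by fastforce
    qed
  qed
  define J where "J n = (SOME j. n \<in> dom (W (mm j) (b j)))" for n
  define a where "a n = the (W (mm (J n)) (b (J n)) n)" for n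
  have le: "W (mm j) (b j) \<subseteq>\<^sub>m Some \<circ> a" for j
    unfolding map_le_def
  proof
    fix n assume n: "n \<in> dom (W (mm j) (b j))"
    then have "n \<in> dom (W (mm (J n)) (b (J n)))" unfolding J_def by (rule someI)
    then have "J n = j" using uniq n by blast
    then show "W (mm j) (b j) n = (Some \<circ> a) n" using n by (auto simp: a_def)
  qed
  show ?thesis
  proof (intro exI allI)
    fix m
    have "inj (\<lambda>i. b (prod_encode (m, i)))"
      using mono by (auto simp: inj_def strict_mono_eq prod_encode_eq)
    then have "infinite (range (\<lambda>i. b (prod_encode (m, i))))" using finite_imageD by blast
    moreover have "range (\<lambda>i. b (prod_encode (m, i))) \<subseteq> {i. W m i \<subseteq>\<^sub>m Some \<circ> a}"
    proof
      fix i assume "i \<in> range (\<lambda>i. b (prod_encode (m, i)))"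
      then obtain i' where "i = b (prod_encode (m, i'))" by blast
      then show "i \<in> {i. W m i \<subseteq>\<^sub>m Some \<circ> a}" using le[of "prod_encode (m, i')"] by (simp add: mm_def)
    qed
    ultimately show "infinite {i. W m i \<subseteq>\<^sub>m Some \<circ> a}" using infinite_super by blast
  qed
qed


text \<open>Pigeonhole on the threshold past which an element is within half of
  \<open>\<epsilon>\<close> of \<open>c\<close>, together with its values below it. Two elements
  with the same data cannot be \<open>\<epsilon>\<close> apart on the graph of \<open>c\<close>:
  below the threshold they coincide, above it the triangle inequality applies.\<close>

lemma nearly_equal_far_contradiction:
  fixes c :: section_point and Y :: "((nat \<Rightarrow> bool) \<times> section_point) set"
  assumes "uncountable Y" and tri: "\<And>n u v w. \<delta> n u w \<le> \<delta> n u v + \<delta> n v w"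
    and sym: "\<And>n u v. \<delta> n u v = \<delta> n v u" and zero: "\<And>n u. \<delta> n u u = 0"
    and c: "\<And>a. a \<in> Y \<Longrightarrow> finite (clash \<delta> (\<epsilon> / 2) (snd a) c)"
    and far: "\<And>a b. a \<in> Y \<Longrightarrow> b \<in> Y \<Longrightarrow> a \<noteq> b \<Longrightarrow>
      \<exists>n. fst (snd a) n \<noteq> None \<and> fst (snd a) n = fst c n \<and> fst (snd b) n = fst c n \<and>
        \<epsilon> < \<delta> n (snd (snd a) n) (snd (snd b) n)"
    and "0 < \<epsilon>"
  shows False
proof -
  have "\<exists>N. \<forall>n\<in>clash \<delta> (\<epsilon> / 2) (snd a) c. n < N" if "a \<in> Y" for a
    using c[OF that] unfolding finite_nat_set_iff_bounded .
  then obtain N where N: "\<And>a. a \<in> Y \<Longrightarrow> \<forall>n\<in>clash \<delta> (\<epsilon> / 2) (snd a) c. n < N a" by metis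
  obtain a b where ab: "a \<in> Y" "b \<in> Y" "a \<noteq> b"
    "(N a, map (snd (snd a)) [0..<N a]) = (N b, map (snd (snd b)) [0..<N b])"
    by (rule uncountable_collision[OF \<open>uncountable Y\<close>])
  obtain n where n: "fst (snd a) n \<noteq> None" "fst (snd a) n = fst c n" "fst (snd b) n = fst c n"
    "\<epsilon> < \<delta> n (snd (snd a) n) (snd (snd b) n)" using far[OF ab(1-3)] by blast
  have H: "snd (snd a) j = snd (snd b) j" if "j < N a" for j
    using ab(4) that by (auto simp: list_eq_iff_nth_eq)
  have "N a \<le> n" using H[of n] n(4) zero \<open>0 < \<epsilon>\<close> by (cases "n < N a") auto
  then have "n \<notin> clash \<delta> (\<epsilon> / 2) (snd a) c" "n \<notin> clash \<delta> (\<epsilon> / 2) (snd b) c"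
    using N[OF ab(1)] N[OF ab(2)] ab(4) by auto
  then have "\<delta> n (snd (snd a) n) (snd c n) \<le> \<epsilon> / 2" "\<delta> n (snd (snd b) n) (snd c n) \<le> \<epsilon> / 2"
    using n by (auto simp: clash_def)
  then show False using n(4) tri[of n "snd (snd a) n" "snd (snd b) n" "snd c n"] sym[of n "snd (snd b) n" "snd c n"]
    by linarith
qed

text \<open>A total function \<open>a\<close> with its value \<open>\<Phi> a\<close> is a section
  defined everywhere. The generic object is again such a function \<open>c\<close>, so
  \<open>\<Phi> c\<close> is available, and coherence with it excludes an uncountable homogeneous
  set. Uniformization is only approximate; the approximations for the precisions 1/(j+1) are merged
  at the end.\<close>

theorem product_form_of_coordinate_respecting:
  fixes \<Phi> :: "(nat \<Rightarrow> nat) \<Rightarrow> nat \<Rightarrow> nat" and \<delta> :: "nat \<Rightarrow> nat \<Rightarrow> nat \<Rightarrow> real"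
  assumes OCA and MA: MA_aleph1_sigma_linked
    and sym: "\<And>n u v. \<delta> n u v = \<delta> n v u" and tri: "\<And>n u v w. \<delta> n u w \<le> \<delta> n u v + \<delta> n v w"
    and zero: "\<And>n u. \<delta> n u u = 0"
    and resp: "\<And>a b e. 0 < e \<Longrightarrow> finite {n. a n = b n \<and> e < \<delta> n (\<Phi> a n) (\<Phi> b n)}"
  obtains h where "\<And>a e. 0 < e \<Longrightarrow> finite {n. e < \<delta> n (\<Phi> a n) (h n (a n))}"
proof -
  define C where "C = range (\<lambda>a. (Some \<circ> a, \<Phi> a))"
  interpret coherent_points \<delta> UNIV C
  proof
    show "\<delta> n u v = \<delta> n v u" for n u v by (rule sym)
    show "\<delta> n u w \<le> \<delta> n u v + \<delta> n v w" for n u v w by (rule tri)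
    show "u \<in> UNIV" for u :: nat by simp
    show "finite (clash \<delta> e p q)" if "p \<in> C" "q \<in> C" "0 < e" for e p q
      using that resp[OF that(3)] by (auto simp: C_def clash_def)
    show "\<exists>p\<in>C. \<forall>m. infinite {i. W m i \<subseteq>\<^sub>m fst p}"
      if W: "\<And>m i. finite (dom (W m i)) \<and> dom (W m i) \<subseteq> {i..} \<and> ran (W m i) \<subseteq> UNIV" for W :: "nat \<Rightarrow> nat \<Rightarrow> nat \<rightharpoonup> nat"
    proof -
      obtain a where "\<forall>m. infinite {i. W m i \<subseteq>\<^sub>m Some \<circ> a}" using total_reservoir[of W] W by blast
      then show ?thesis by (intro bexI[of _ "(Some \<circ> a, \<Phi> a)"]) (auto simp: C_def)
    qed
    show "\<exists>r\<in>C. finite {n \<in> M. fst p n \<noteq> None \<and> fst r n \<noteq> fst p n} \<and> finite {n \<in> - M. fst q n \<noteq> None \<and> fst r n \<noteq> fst q n}"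
      if pq: "p \<in> C" "q \<in> C" for p q M
    proof -
      obtain a b where "p = (Some \<circ> a, \<Phi> a)" "q = (Some \<circ> b, \<Phi> b)" using pq unfolding C_def by blast
      then show ?thesis
        by (intro bexI[of _ "(Some \<circ> (\<lambda>n. if n \<in> M then a n else b n), \<Phi> (\<lambda>n. if n \<in> M then a n else b n))"])
          (auto simp: C_def)
    qed
  qed
  have approx: "good (9 * \<epsilon>) UNIV" if "0 < \<epsilon>" for \<epsilon> :: real
  proof (rule uniformization_OCA[OF \<open>OCA\<close> that])
    fix Y :: "((nat \<Rightarrow> bool) \<times> section_point) set"
    assume Y: "Y \<subseteq> UNIV \<times> C" "uncountable Y"
      and hom: "\<And>a b. a \<in> Y \<Longrightarrow> b \<in> Y \<Longrightarrow> a \<noteq> b \<Longrightarrow> fst a \<noteq> fst b \<and>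
        4 * split_level (fst a) (fst b) \<le> card (clash \<delta> \<epsilon> (snd a) (snd b))"
    \<comment> \<open>The values belong to the type, so two elements of equal type at k clash only
      at columns k or later, where the stem is still free.\<close>
    define tp where "tp k p = (map (fst p) [0..<k], map (snd p) [0..<k])" for k and p :: section_point
    define cap where "cap s p q \<longleftrightarrow> (\<exists>n<length s. fst p n = Some (s ! n) \<and> fst q n = Some (s ! n) \<and>
      \<epsilon> < \<delta> n (snd p n) (snd q n))" for s and p q :: section_point
    have C_total: "fst p n \<noteq> None" if "p \<in> C" for p n using that by (auto simp: C_def)
    obtain c Y' where Y': "Y' \<subseteq> Y" "uncountable Y'"
      "\<And>a b. a \<in> Y' \<Longrightarrow> b \<in> Y' \<Longrightarrow> a \<noteq> b \<Longrightarrow> \<exists>n. cap (map c [0..<n]) (snd a) (snd b)"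
    proof (rule MA_types[OF MA Y(2), where tp = tp and cap = cap and far = "\<lambda>k p q. 4 * k \<le> card (clash \<delta> \<epsilon> p q)"])
      show "cap s q p" if "cap s p q" for s p q using that sym unfolding cap_def by metis
      show "cap s' p q" if "prefix s s'" "cap s p q" for s s' p q
        using that unfolding cap_def prefix_def by (auto simp: nth_append)
      show "cap s p q'" if "cap s p q" "tp (length s) q = tp (length s) q'" for s p q q'
        using that unfolding cap_def tp_def by (auto simp: map_upt_eq_iff)
      show "\<exists>s'. prefix s s' \<and> (\<forall>(p, q)\<in>R. cap s' p q)"
        if R: "finite R" "card R \<le> length s" "R \<subseteq> snd ` Y \<times> snd ` Y"
          "\<And>p q. (p, q) \<in> R \<Longrightarrow> tp (length s) p = tp (length s) q \<and> (\<exists>j\<ge>length s. 4 * j \<le> card (clash \<delta> \<epsilon> p q))" for s R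
      proof -
        define k where "k = length s"
        have RC: "p \<in> C" "q \<in> C" if "(p, q) \<in> R" for p q using subsetD[OF R(3) that] Y(1) by fastforce+
        have "\<exists>\<nu>. inj_on \<nu> R \<and> (\<forall>r\<in>R. \<nu> r \<in> clash \<delta> \<epsilon> (fst r) (snd r))"
        proof (rule distinct_representatives[OF R(1)])
          fix r assume r: "r \<in> R"
          then obtain j where "length s \<le> j" "4 * j \<le> card (clash \<delta> \<epsilon> (fst r) (snd r))"
            using R(4)[of "fst r" "snd r"] by auto
          then show "finite (clash \<delta> \<epsilon> (fst r) (snd r)) \<and> card R \<le> card (clash \<delta> \<epsilon> (fst r) (snd r))"
            using R(2) finite_clash[of "fst r" "snd r" \<epsilon>] RC[of "fst r" "snd r"] r \<open>0 < \<epsilon>\<close> by simp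
        qed
        then obtain \<nu> where \<nu>: "inj_on \<nu> R" "\<And>r. r \<in> R \<Longrightarrow> \<nu> r \<in> clash \<delta> \<epsilon> (fst r) (snd r)" by blast
        have \<nu>_ge: "k \<le> \<nu> r" if r: "r \<in> R" for r
        proof (rule ccontr)
          assume "\<not> k \<le> \<nu> r"
          moreover have "tp k (fst r) = tp k (snd r)" using R(4)[of "fst r" "snd r"] r by (simp add: k_def)
          ultimately have "snd (fst r) (\<nu> r) = snd (snd r) (\<nu> r)" unfolding tp_def by (auto simp: map_upt_eq_iff)
          then show False using \<nu>(2)[OF r] zero \<open>0 < \<epsilon>\<close> by (simp add: clash_def)
        qed
        obtain L where L: "\<forall>n\<in>\<nu> ` R. n < L" using R(1) finite_nat_set_iff_bounded[of "\<nu> ` R"] by auto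
        \<comment> \<open>The columns \<open>\<nu> r\<close> are distinct, so at each of them the
          stem can pass through the point common to both elements of the pair; elsewhere it is
          0.\<close>
        define t where "t = map (\<lambda>n. if \<exists>r\<in>R. \<nu> r = n then the (fst (fst (THE r. r \<in> R \<and> \<nu> r = n)) n) else 0) [k..<max k L]"
        have "cap (s @ t) p q" if pq: "(p, q) \<in> R" for p q
        proof -
          define n where "n = \<nu> (p, q)"
          have n: "k \<le> n" "n < L" "n \<in> clash \<delta> \<epsilon> p q" using \<nu>_ge[OF pq] L pq \<nu>(2)[OF pq] by (auto simp: n_def)
          have "(THE r. r \<in> R \<and> \<nu> r = n) = (p, q)"
            using pq \<nu>(1) by (intro the_equality) (auto simp: n_def inj_on_def)
          then have "(s @ t) ! n = the (fst p n)"
            using n pq by (auto simp: t_def nth_append k_def n_def)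
          moreover obtain u where "fst p n = Some u" using C_total[OF RC(1)[OF pq]] by blast
          moreover have "n < length (s @ t)" using n(1,2) by (simp add: t_def k_def)
          ultimately show ?thesis unfolding cap_def using n(3) by (intro exI[of _ n]) (auto simp: clash_def)
        qed
        then show ?thesis by (intro exI[of _ "s @ t"]) auto
      qed
    qed (use hom in blast)+
    show False
    proof (rule nearly_equal_far_contradiction[where Y = Y' and c = "(Some \<circ> c, \<Phi> c)", OF Y'(2) tri sym zero _ _ that])
      fix a assume "a \<in> Y'"
      then have "snd a \<in> C" using Y'(1) Y(1) by auto
      then show "finite (clash \<delta> (\<epsilon> / 2) (snd a) (Some \<circ> c, \<Phi> c))"
        using that by (intro finite_clash) (auto simp: C_def)
    next
      fix a b assume "a \<in> Y'" "b \<in> Y'" "a \<noteq> b"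
      then obtain n where "cap (map c [0..<n]) (snd a) (snd b)" using Y'(3) by blast
      then show "\<exists>n. fst (snd a) n \<noteq> None \<and> fst (snd a) n = fst (Some \<circ> c, \<Phi> c) n \<and> fst (snd b) n = fst (Some \<circ> c, \<Phi> c) n \<and>
        \<epsilon> < \<delta> n (snd (snd a) n) (snd (snd b) n)"
        unfolding cap_def by auto
    qed
  qed
  have "\<exists>h. \<forall>a. finite {n. 1 / Suc j < \<delta> n (\<Phi> a n) (h n (a n))}" for j
  proof -
    \<comment> \<open>The factor 9 lost in the uniformization is divided out in advance.\<close>
    have "good (9 * (1 / (9 * Suc j))) UNIV" by (rule approx) simp
    moreover have "9 * (1 / (9 * Suc j)) = 1 / Suc j" by (simp add: field_simps)
    ultimately have "good (1 / Suc j) UNIV" by simp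
    then obtain h where h: "\<forall>p\<in>C. finite {n. \<exists>u. fst p n = Some u \<and> (n, u) \<in> UNIV \<and> 1 / Suc j < \<delta> n (snd p n) (h n u)}"
      unfolding good_def by auto
    have "finite {n. 1 / Suc j < \<delta> n (\<Phi> a n) (h n (a n))}" for a
      using bspec[OF h, of "(Some \<circ> a, \<Phi> a)"] by (simp add: C_def)
    then show ?thesis by blast
  qed
  then have "\<forall>j. \<exists>h. \<forall>a. finite {n. 1 / Suc j < \<delta> n (\<Phi> a n) (h n (a n))}" by blast
  from choice[OF this] obtain h where h: "\<And>j a. finite {n. 1 / Suc j < \<delta> n (\<Phi> a n) (h j n (a n))}" by blast
  define apart where "apart i j n u \<longleftrightarrow> 1 / Suc i + 1 / Suc j < \<delta> n (h i n u) (h j n u)" for i j n u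
  have fin_apart: "finite {n. \<exists>u. apart i j n u}" for i j
  proof -
    \<comment> \<open>Uniformity in \<open>u\<close> comes from a single sequence: if two
      approximations are apart at some \<open>u\<close>, then \<open>a n\<close> is such a
      \<open>u\<close>, and \<open>\<Phi> a\<close> cannot be close to both.\<close>
    define a where "a n = (SOME u. apart i j n u)" for n
    have "{n. \<exists>u. apart i j n u} \<subseteq> {n. 1 / Suc i < \<delta> n (\<Phi> a n) (h i n (a n))} \<union> {n. 1 / Suc j < \<delta> n (\<Phi> a n) (h j n (a n))}"
    proof
      fix n assume "n \<in> {n. \<exists>u. apart i j n u}"
      then have "\<exists>u. apart i j n u" by simp
      then have "apart i j n (a n)" unfolding a_def by (rule someI_ex)
      then show "n \<in> {n. 1 / Suc i < \<delta> n (\<Phi> a n) (h i n (a n))} \<union> {n. 1 / Suc j < \<delta> n (\<Phi> a n) (h j n (a n))}"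
        unfolding apart_def
        using tri[of n "h i n (a n)" "h j n (a n)" "\<Phi> a n"] sym[of n "h i n (a n)" "\<Phi> a n"] by auto
    qed
    then show ?thesis by (rule finite_subset[OF _ finite_UnI[OF h h]])
  qed
  define ok where "ok n j \<longleftrightarrow> (\<forall>i\<le>j. \<forall>u. \<not> apart i j n u)" for n j
  \<comment> \<open>The finest precision up to \<open>n\<close> that is compatible at
    \<open>n\<close> with all coarser ones. It tends to infinity, and admitting 0 keeps the set
    nonempty.\<close>
  define J where "J n = Max {j. j \<le> n \<and> (j = 0 \<or> ok n j)}" for n
  have J: "J n = 0 \<or> ok n (J n)" "\<And>j. j \<le> n \<Longrightarrow> ok n j \<Longrightarrow> j \<le> J n" for n
  proof -
    have fin: "finite {j. j \<le> n \<and> (j = 0 \<or> ok n j)}" by simp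
    have "J n \<in> {j. j \<le> n \<and> (j = 0 \<or> ok n j)}" unfolding J_def by (rule Max_in[OF fin]) auto
    then show "J n = 0 \<or> ok n (J n)" by simp
    show "j \<le> J n" if "j \<le> n" "ok n j" for j unfolding J_def using that by (intro Max_ge[OF fin]) simp
  qed
  show thesis
  proof (rule that[of "\<lambda>n. h (J n) n"])
    fix a and e :: real assume "0 < e"
    then obtain j0 where "inverse (of_nat (Suc j0)) < e / 3" using reals_Archimedean[of "e / 3"] by auto
    moreover have "1 / real (Suc (Suc j0)) \<le> 1 / real (Suc j0)" by (simp add: frac_le)
    moreover define j where "j = Suc j0"
    ultimately have j: "1 / Suc j < e / 3" "0 < j" by (simp_all add: inverse_eq_divide)
    have fin: "finite ({..<j} \<union> (\<Union>i\<le>j. {n. \<exists>u. apart i j n u}) \<union> {n. 1 / Suc j < \<delta> n (\<Phi> a n) (h j n (a n))})"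
    proof (rule finite_UnI)
      show "finite {n. 1 / Suc j < \<delta> n (\<Phi> a n) (h j n (a n))}" by (rule h)
    qed (use fin_apart in auto)
    have "{n. e < \<delta> n (\<Phi> a n) (h (J n) n (a n))} \<subseteq>
      {..<j} \<union> (\<Union>i\<le>j. {n. \<exists>u. apart i j n u}) \<union> {n. 1 / Suc j < \<delta> n (\<Phi> a n) (h j n (a n))}"
    proof
      fix n assume n: "n \<in> {n. e < \<delta> n (\<Phi> a n) (h (J n) n (a n))}"
      show "n \<in> {..<j} \<union> (\<Union>i\<le>j. {n. \<exists>u. apart i j n u}) \<union> {n. 1 / Suc j < \<delta> n (\<Phi> a n) (h j n (a n))}"
      proof (rule ccontr)
        assume not: "\<not> ?thesis"
        then have 1: "j \<le> n" "ok n j" "\<delta> n (\<Phi> a n) (h j n (a n)) \<le> 1 / Suc j"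
          by (auto simp: ok_def)
        then have jJ: "j \<le> J n" using J(2) by blast
        then have "ok n (J n)" using J(1)[of n] j(2) by auto
        then have "\<delta> n (h j n (a n)) (h (J n) n (a n)) \<le> 1 / Suc j + 1 / Suc (J n)"
          using jJ unfolding ok_def apart_def by (auto simp: not_less)
        moreover have "1 / Suc (J n) \<le> 1 / Suc j" using jJ by (simp add: frac_le)
        ultimately show False using n 1(3) j(1) tri[of n "\<Phi> a n" "h (J n) n (a n)" "h j n (a n)"] by simp
      qed
    qed
    then show "finite {n. e < \<delta> n (\<Phi> a n) (h (J n) n (a n))}" using fin by (rule finite_subset)
  qed
qed

section \<open>Lifts of automorphisms of the algebra of sets modulo finite\<close>

abbreviation ev :: "(nat \<Rightarrow> bool) \<Rightarrow> bool" where "ev P \<equiv> eventually P sequentially"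

lemma finite_iff_ev: "finite A \<longleftrightarrow> ev (\<lambda>n. n \<notin> A)"
  unfolding eventually_sequentially finite_nat_set_iff_bounded by (meson not_le)

text \<open>\<open>\<Psi>\<close> selects representatives for an automorphism of the algebra of sets
  modulo finite, so every identity holds only up to a finite set; \<open>finite_of_image\<close> is
  injectivity, stated at zero.\<close>

locale boolean_lift =
  fixes \<Psi> :: "nat set \<Rightarrow> nat set"
  assumes cong: "ev (\<lambda>n. n \<in> A \<longleftrightarrow> n \<in> B) \<Longrightarrow> ev (\<lambda>n. n \<in> \<Psi> A \<longleftrightarrow> n \<in> \<Psi> B)"
    and inter: "ev (\<lambda>n. n \<in> \<Psi> (A \<inter> B) \<longleftrightarrow> n \<in> \<Psi> A \<and> n \<in> \<Psi> B)"
    and compl: "ev (\<lambda>n. n \<in> \<Psi> (- A) \<longleftrightarrow> n \<notin> \<Psi> A)"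
    and finite_of_image: "finite (\<Psi> A) \<Longrightarrow> finite A"
    and surj: "\<exists>A. ev (\<lambda>n. n \<in> \<Psi> A \<longleftrightarrow> n \<in> B)"
begin

lemma image_finite: "finite A \<Longrightarrow> finite (\<Psi> A)"
proof -
  assume "finite A"
  then have "ev (\<lambda>n. n \<in> A \<longleftrightarrow> n \<in> A \<inter> - A)" unfolding finite_iff_ev by eventually_elim auto
  from cong[OF this] inter[of A "- A"] compl[of A] show "finite (\<Psi> A)"
    unfolding finite_iff_ev by eventually_elim auto
qed

lemma finite_iff: "finite (\<Psi> A) \<longleftrightarrow> finite A"
  using image_finite finite_of_image by blast

lemma diff: "ev (\<lambda>n. n \<in> \<Psi> (A - B) \<longleftrightarrow> n \<in> \<Psi> A \<and> n \<notin> \<Psi> B)"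
  using inter[of A "- B"] compl[of B] unfolding Diff_eq by eventually_elim auto

lemma union: "ev (\<lambda>n. n \<in> \<Psi> (A \<union> B) \<longleftrightarrow> n \<in> \<Psi> A \<or> n \<in> \<Psi> B)"
proof -
  have eq: "- (- A \<inter> - B) = A \<union> B" by blast
  show ?thesis using inter[of "- A" "- B"] compl[of "- A \<inter> - B", unfolded eq] compl[of A] compl[of B]
    by eventually_elim auto
qed

lemma image_mono_ev: assumes "ev (\<lambda>n. n \<in> A \<longrightarrow> n \<in> B)" shows "ev (\<lambda>n. n \<in> \<Psi> A \<longrightarrow> n \<in> \<Psi> B)"
proof -
  from assms have "ev (\<lambda>n. n \<in> A \<longleftrightarrow> n \<in> A \<inter> B)" by eventually_elim auto
  from cong[OF this] inter[of A B] show ?thesis by eventually_elim auto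
qed

lemma image_mono_subset: "A \<subseteq> B \<Longrightarrow> ev (\<lambda>n. n \<in> \<Psi> A \<longrightarrow> n \<in> \<Psi> B)"
  by (rule image_mono_ev) (auto intro: always_eventually)

lemma ev_of_image: assumes "ev (\<lambda>n. n \<in> \<Psi> A \<longrightarrow> n \<in> \<Psi> B)" shows "ev (\<lambda>n. n \<in> A \<longrightarrow> n \<in> B)"
proof -
  from assms diff[of A B] have "finite (\<Psi> (A - B))" unfolding finite_iff_ev by eventually_elim auto
  then have "finite (A - B)" by (rule finite_of_image)
  then show ?thesis unfolding finite_iff_ev by eventually_elim auto
qed

lemma preimage_set:
  assumes "ev (\<lambda>n. n \<in> I \<longrightarrow> n \<in> \<Psi> B)"
  obtains C where "C \<subseteq> B" "ev (\<lambda>n. n \<in> \<Psi> C \<longleftrightarrow> n \<in> I)"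
proof -
  obtain C0 where "ev (\<lambda>n. n \<in> \<Psi> C0 \<longleftrightarrow> n \<in> I)" using surj by blast
  with assms inter[of C0 B] have "ev (\<lambda>n. n \<in> \<Psi> (C0 \<inter> B) \<longleftrightarrow> n \<in> I)" by eventually_elim auto
  then show thesis using that[of "C0 \<inter> B"] by blast
qed

definition trivial_via :: "nat set \<Rightarrow> (nat \<Rightarrow> nat) \<Rightarrow> bool" where
  "trivial_via S f \<longleftrightarrow> inj_on f S \<and> (\<forall>C\<subseteq>S. ev (\<lambda>n. n \<in> \<Psi> C \<longleftrightarrow> n \<in> f ` C))"

text \<open>The lift is given backwards, by a map \<open>g\<close> on the image side, and has to be
  inverted. The points of \<open>B\<close> missed by \<open>g\<close> form a set with finite image,
  hence a finite set. If a point is hit twice, its two preimages are separated by the image of some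
  \<open>C\<close>, although \<open>g\<close> cannot tell them apart; this happens for finitely many
  points only.\<close>

lemma trivial_of_lift:
  assumes lift: "\<And>A. A \<subseteq> B \<Longrightarrow> ev (\<lambda>i. i \<in> \<Psi> B \<longrightarrow> (i \<in> \<Psi> A \<longleftrightarrow> g i \<in> A))"
  shows "\<exists>S f. S \<subseteq> B \<and> finite (B - S) \<and> trivial_via S f"
proof -
  define E where "E = {n \<in> B. \<forall>i\<in>\<Psi> B. g i \<noteq> n}"
  have "E \<subseteq> B" by (auto simp: E_def)
  have "finite (\<Psi> E)" unfolding finite_iff_ev
    using lift[OF \<open>E \<subseteq> B\<close>] image_mono_subset[OF \<open>E \<subseteq> B\<close>] by eventually_elim (auto simp: E_def)
  then have "finite E" by (rule finite_of_image)
  define D where "D = {n \<in> B. \<exists>i\<in>\<Psi> B. \<exists>j\<in>\<Psi> B. i \<noteq> j \<and> g i = n \<and> g j = n}"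
  have "\<forall>n\<in>D. \<exists>ij. fst ij \<in> \<Psi> B \<and> snd ij \<in> \<Psi> B \<and> fst ij \<noteq> snd ij \<and> g (fst ij) = n \<and> g (snd ij) = n"
    by (auto simp: D_def)
  from bchoice[OF this] obtain ij where ij: "\<And>n. n \<in> D \<Longrightarrow> fst (ij n) \<in> \<Psi> B \<and> snd (ij n) \<in> \<Psi> B \<and>
      fst (ij n) \<noteq> snd (ij n) \<and> g (fst (ij n)) = n \<and> g (snd (ij n)) = n" by blast
  define I where "I = (\<lambda>n. fst (ij n)) ` D"
  have "ev (\<lambda>n. n \<in> I \<longrightarrow> n \<in> \<Psi> B)" using ij by (intro always_eventually) (auto simp: I_def)
  then obtain C where C: "C \<subseteq> B" "ev (\<lambda>n. n \<in> \<Psi> C \<longleftrightarrow> n \<in> I)" by (rule preimage_set)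
  have "ev (\<lambda>i. i \<in> \<Psi> B \<longrightarrow> (i \<in> I \<longleftrightarrow> g i \<in> C))" using C(2) lift[OF C(1)] by eventually_elim auto
  then obtain N where N: "\<And>i. N \<le> i \<Longrightarrow> i \<in> \<Psi> B \<Longrightarrow> i \<in> I \<longleftrightarrow> g i \<in> C" unfolding eventually_sequentially by blast
  have "D \<subseteq> g ` {..<N}"
  proof
    fix n assume n: "n \<in> D"
    show "n \<in> g ` {..<N}"
    proof (rule ccontr)
      assume "n \<notin> g ` {..<N}"
      then have no: "i \<notin> {..<N}" if "g i = n" for i using imageI[of i "{..<N}" g] \<open>n \<notin> g ` {..<N}\<close> that by auto
      have "fst (ij n) \<notin> {..<N}" "snd (ij n) \<notin> {..<N}" using ij[OF n] no[of "fst (ij n)"] no[of "snd (ij n)"] by simp_all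
      then have "N \<le> fst (ij n)" "N \<le> snd (ij n)" by auto
      moreover have "fst (ij n) \<in> I" using n by (simp add: I_def)
      ultimately have "snd (ij n) \<in> I" using N[of "fst (ij n)"] N[of "snd (ij n)"] ij[OF n] by auto
      then obtain n' where n': "n' \<in> D" "snd (ij n) = fst (ij n')" unfolding I_def by (elim imageE)
      then have "n' = n" using ij[OF n] ij[OF n'(1)] by simp
      then show False using n' ij[OF n] by simp
    qed
  qed
  then have "finite D" by (rule finite_subset) simp
  define S where "S = B - E - D"
  define f where "f n = (THE i. i \<in> \<Psi> B \<and> g i = n)" for n
  have f: "i \<in> \<Psi> B \<and> g i = n \<longleftrightarrow> i = f n" if n: "n \<in> S" for n i
  proof -
    obtain i0 where i0: "i0 \<in> \<Psi> B" "g i0 = n" using n unfolding S_def E_def by blast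
    have uniq: "j = i0" if j: "j \<in> \<Psi> B" "g j = n" for j
    proof (rule ccontr)
      assume "j \<noteq> i0"
      moreover have "n \<in> B" using n by (simp add: S_def)
      ultimately have "n \<in> D" unfolding D_def using i0 j by blast
      then show False using n by (simp add: S_def)
    qed
    have "f n = i0" unfolding f_def by (rule the_equality) (use i0 uniq in blast)+
    then show ?thesis using i0 uniq by blast
  qed
  have "trivial_via S f"
    unfolding trivial_via_def
  proof (intro conjI allI impI)
    show "inj_on f S"
    proof (rule inj_onI)
      fix m n assume "m \<in> S" "n \<in> S" and "f m = f n"
      have "g (f m) = m" "g (f n) = n" using f[OF \<open>m \<in> S\<close>, of "f m"] f[OF \<open>n \<in> S\<close>, of "f n"] by simp_all
      with \<open>f m = f n\<close> show "m = n" by metis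
    qed
    fix C assume "C \<subseteq> S"
    then have "C \<subseteq> B" by (auto simp: S_def)
    have im: "i \<in> f ` C \<longleftrightarrow> i \<in> \<Psi> B \<and> g i \<in> C" for i
    proof
      assume "i \<in> f ` C"
      then obtain n where "n \<in> C" "i = f n" ..
      moreover from \<open>n \<in> C\<close> \<open>C \<subseteq> S\<close> have "n \<in> S" by blast
      ultimately show "i \<in> \<Psi> B \<and> g i \<in> C" using f[of n i] by auto
    next
      assume "i \<in> \<Psi> B \<and> g i \<in> C"
      moreover from this \<open>C \<subseteq> S\<close> have "g i \<in> S" by blast
      ultimately show "i \<in> f ` C" using f[of "g i" i] by (intro image_eqI[of _ _ "g i"]) simp_all
    qed
    show "ev (\<lambda>n. n \<in> \<Psi> C \<longleftrightarrow> n \<in> f ` C)" unfolding im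
      using lift[OF \<open>C \<subseteq> B\<close>] image_mono_subset[OF \<open>C \<subseteq> B\<close>] by eventually_elim auto
  qed
  moreover have "finite (B - S)" by (rule finite_subset[of _ "E \<union> D"]) (use \<open>finite E\<close> \<open>finite D\<close> in \<open>auto simp: S_def\<close>)
  moreover have "S \<subseteq> B" by (auto simp: S_def)
  ultimately show ?thesis by (intro exI[of _ S] exI[of _ f] conjI)
qed

end

section \<open>Almost disjoint branches and countable diagonalization\<close>

lemma uncountable_binary_sequences: "uncountable (UNIV :: (nat \<Rightarrow> bool) set)"
proof
  assume "countable (UNIV :: (nat \<Rightarrow> bool) set)"
  then obtain e :: "nat \<Rightarrow> nat \<Rightarrow> bool" where e: "range e = UNIV"
    using uncountable_def by (metis UNIV_not_empty)
  then obtain n where "e n = (\<lambda>k. \<not> e k k)" by (metis UNIV_I imageE)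
  then show False by metis
qed

text \<open>Branches of the binary tree, with the nodes of the tree enumerated in
  \<open>R\<close>.\<close>

lemma almost_disjoint_family:
  assumes "infinite (R :: nat set)"
  obtains C :: "(nat \<Rightarrow> bool) \<Rightarrow> nat set" where "\<And>x. C x \<subseteq> R" "\<And>x. infinite (C x)"
    "\<And>x y. x \<noteq> y \<Longrightarrow> finite (C x \<inter> C y)"
proof -
  define e where "e t = enumerate R (to_nat t)" for t :: "bool list"
  have e: "inj e" "\<And>t. e t \<in> R"
    using enumerate_in_set[OF assms] strict_mono_enumerate[OF assms]
    by (auto simp: e_def inj_def strict_mono_eq)
  define C where "C x = range (\<lambda>j. e (map x [0..<j]))" for x :: "nat \<Rightarrow> bool"
  show thesis
  proof (rule that[of C])
    show "C x \<subseteq> R" for x using e(2) by (auto simp: C_def)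
    show "infinite (C x)" for x
    proof -
      have "inj (\<lambda>j. e (map x [0..<j]))"
        using injD[OF e(1)] by (intro injI) (metis length_map length_upt minus_nat.diff_0)
      then show ?thesis unfolding C_def using finite_imageD by blast
    qed
    fix x y :: "nat \<Rightarrow> bool" assume "x \<noteq> y"
    have "C x \<inter> C y \<subseteq> (\<lambda>j. e (map x [0..<j])) ` {..split_level x y}"
    proof
      fix n assume "n \<in> C x \<inter> C y"
      then have "n \<in> C x" "n \<in> C y" by auto
      then obtain i j where ij: "n = e (map x [0..<i])" "n = e (map y [0..<j])" unfolding C_def by (elim rangeE)
      then have eq: "map x [0..<i] = map y [0..<j]" using injD[OF e(1)] by metis
      then have "i = j" by (metis length_map length_upt minus_nat.diff_0)
      have "i \<le> split_level x y"
      proof (rule ccontr)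
        assume "\<not> i \<le> split_level x y"
        then have "x (split_level x y) = y (split_level x y)"
          using eq \<open>i = j\<close> by (auto simp: list_eq_iff_nth_eq)
        then show False using split_level_props(1)[OF \<open>x \<noteq> y\<close>] by simp
      qed
      then show "n \<in> (\<lambda>j. e (map x [0..<j])) ` {..split_level x y}" using ij(1) by blast
    qed
    then show "finite (C x \<inter> C y)" using finite_subset by blast
  qed
qed

context boolean_lift
begin

text \<open>Diagonalization: if every \<open>g j\<close> fails on some set, then it fails on a set \<open>C j\<close> whose image it maps off
  \<open>C j\<close>.  Shrinking the sets \<open>C j\<close> successively keeps all failures alive, and removing the witnesses from their
  union gives a set on which all \<open>g j\<close> fail.\<close>
lemma one_lift_of_countably_many:
  assumes fib: "\<And>j n. finite {i \<in> \<Psi> B. g j i = n}"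
    and some: "\<And>A. A \<subseteq> B \<Longrightarrow> \<exists>j :: nat. ev (\<lambda>i. i \<in> \<Psi> B \<longrightarrow> (i \<in> \<Psi> A \<longleftrightarrow> g j i \<in> A))"
  shows "\<exists>j. \<forall>A\<subseteq>B. ev (\<lambda>i. i \<in> \<Psi> B \<longrightarrow> (i \<in> \<Psi> A \<longleftrightarrow> g j i \<in> A))"
proof (rule ccontr)
  assume none: "\<not> ?thesis"
  \<comment> \<open>The failure of \<open>g j\<close> on \<open>A\<close> is made one-sided: the
    coordinates wrongly excluded, or those wrongly included, form an infinite set, which is almost
    the image of some \<open>C\<close> inside \<open>A\<close> or inside \<open>B - A\<close>
    respectively.\<close>
  have "\<exists>C\<subseteq>B. infinite C \<and> ev (\<lambda>i. i \<in> \<Psi> C \<longrightarrow> i \<in> \<Psi> B \<and> g j i \<notin> C)" for j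
  proof -
    obtain A where A: "A \<subseteq> B" "\<not> ev (\<lambda>i. i \<in> \<Psi> B \<longrightarrow> (i \<in> \<Psi> A \<longleftrightarrow> g j i \<in> A))" using none by blast
    define I where "I = {i \<in> \<Psi> B. i \<in> \<Psi> A \<and> g j i \<notin> A}"
    define I' where "I' = {i \<in> \<Psi> B. i \<notin> \<Psi> A \<and> g j i \<in> A}"
    have "infinite I \<or> infinite I'"
    proof (rule ccontr)
      assume "\<not> ?thesis"
      then have "ev (\<lambda>n. n \<notin> I)" "ev (\<lambda>n. n \<notin> I')" unfolding finite_iff_ev by auto
      then have "ev (\<lambda>i. i \<in> \<Psi> B \<longrightarrow> (i \<in> \<Psi> A \<longleftrightarrow> g j i \<in> A))" by eventually_elim (auto simp: I_def I'_def)
      then show False using A(2) by contradiction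
    qed
    then show ?thesis
    proof
      assume inf: "infinite I"
      have "ev (\<lambda>n. n \<in> I \<longrightarrow> n \<in> \<Psi> A)" by (intro always_eventually) (auto simp: I_def)
      then obtain C where C: "C \<subseteq> A" "ev (\<lambda>n. n \<in> \<Psi> C \<longleftrightarrow> n \<in> I)" by (rule preimage_set)
      show ?thesis
      proof (intro exI[of _ C] conjI)
        show "C \<subseteq> B" using A C by auto
        show "ev (\<lambda>i. i \<in> \<Psi> C \<longrightarrow> i \<in> \<Psi> B \<and> g j i \<notin> C)"
          using C(2) by eventually_elim (use C(1) in \<open>auto simp: I_def\<close>)
        show "infinite C"
        proof
          assume "finite C"
          then have "ev (\<lambda>n. n \<notin> \<Psi> C)" using image_finite finite_iff_ev by blast
          with C(2) have "ev (\<lambda>n. n \<notin> I)" by eventually_elim auto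
          then show False using inf finite_iff_ev by blast
        qed
      qed
    next
      assume inf: "infinite I'"
      have "ev (\<lambda>n. n \<in> I' \<longrightarrow> n \<in> \<Psi> (B - A))"
        using diff[of B A] by eventually_elim (auto simp: I'_def)
      then obtain C where C: "C \<subseteq> B - A" "ev (\<lambda>n. n \<in> \<Psi> C \<longleftrightarrow> n \<in> I')" by (rule preimage_set)
      show ?thesis
      proof (intro exI[of _ C] conjI)
        show "C \<subseteq> B" using C by auto
        show "ev (\<lambda>i. i \<in> \<Psi> C \<longrightarrow> i \<in> \<Psi> B \<and> g j i \<notin> C)"
          using C(2) by eventually_elim (use C(1) in \<open>auto simp: I'_def\<close>)
        show "infinite C"
        proof
          assume "finite C"
          then have "ev (\<lambda>n. n \<notin> \<Psi> C)" using image_finite finite_iff_ev by blast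
          with C(2) have "ev (\<lambda>n. n \<notin> I')" by eventually_elim auto
          then show False using inf finite_iff_ev by blast
        qed
      qed
    qed
  qed
  then obtain C where C: "\<And>j. C j \<subseteq> B" "\<And>j. infinite (C j)"
    "\<And>j. ev (\<lambda>i. i \<in> \<Psi> (C j) \<longrightarrow> i \<in> \<Psi> B \<and> g j i \<notin> C j)" by metis
  define K0 where "K0 j = {i \<in> \<Psi> (C j). i \<in> \<Psi> B \<and> g j i \<notin> C j}" for j
  define keeps where "keeps K \<longleftrightarrow> (\<forall>j. infinite (K j) \<and> K j \<subseteq> K0 j)" for K :: "nat \<Rightarrow> nat set"
  have "keeps K0" unfolding keeps_def
  proof (intro allI conjI subset_refl)
    fix j
    have "infinite (\<Psi> (C j))" using C(2) finite_iff by blast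
    then show "infinite (K0 j)"
    proof (rule contrapos_nn)
      assume "finite (K0 j)"
      with C(3)[of j] show "finite (\<Psi> (C j))" unfolding finite_iff_ev by eventually_elim (auto simp: K0_def)
    qed
  qed
  have step: "\<exists>C'\<subseteq>C l. ev (\<lambda>i. i \<in> \<Psi> C' \<longrightarrow> i \<in> K l) \<and> infinite C' \<and> (\<forall>j. infinite {i \<in> K j. g j i \<notin> C'})"
    if K: "keeps K" for K l
  proof -
    have "ev (\<lambda>n. n \<in> K l \<longrightarrow> n \<in> \<Psi> (C l))"
      using K by (intro always_eventually) (auto simp: keeps_def K0_def)
    then obtain R where R: "R \<subseteq> C l" "ev (\<lambda>n. n \<in> \<Psi> R \<longleftrightarrow> n \<in> K l)" by (rule preimage_set)
    have "infinite R"
    proof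
      assume "finite R"
      then have "ev (\<lambda>n. n \<notin> \<Psi> R)" using image_finite finite_iff_ev by blast
      with R(2) have "ev (\<lambda>n. n \<notin> K l)" by eventually_elim auto
      then show False using K finite_iff_ev unfolding keeps_def by blast
    qed
    then obtain F :: "(nat \<Rightarrow> bool) \<Rightarrow> nat set" where F: "\<And>x. F x \<subseteq> R" "\<And>x. infinite (F x)"
      "\<And>x y. x \<noteq> y \<Longrightarrow> finite (F x \<inter> F y)" using almost_disjoint_family by blast
    \<comment> \<open>Almost disjointness leaves at most one bad \<open>x\<close> for each
      \<open>j\<close>: for two of them, all but finitely many elements of \<open>K j\<close> would
      be mapped by \<open>g j\<close> into the finite intersection of \<open>F x\<close> and
      \<open>F y\<close>, against the finiteness of fibres.\<close>
    define bad where "bad j = {x. finite {i \<in> K j. g j i \<notin> F x}}" for j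
    have "countable (bad j)" for j
    proof -
      have "x = y" if xy: "x \<in> bad j" "y \<in> bad j" for x y
      proof (rule ccontr)
        assume "x \<noteq> y"
        have "K j \<subseteq> {i \<in> K j. g j i \<notin> F x} \<union> {i \<in> K j. g j i \<notin> F y} \<union> (\<Union>n\<in>F x \<inter> F y. {i \<in> \<Psi> B. g j i = n})"
          using K by (auto simp: keeps_def K0_def)
        moreover have "finite \<dots>" using xy fib F(3)[OF \<open>x \<noteq> y\<close>] by (auto simp: bad_def)
        ultimately have "finite (K j)" by (rule finite_subset)
        then show False using K unfolding keeps_def by blast
      qed
      then have "bad j = {} \<or> (\<exists>x. bad j = {x})" by blast
      then show ?thesis by auto
    qed
    then have "countable (\<Union>j. bad j)" by auto
    then obtain x where x: "x \<notin> (\<Union>j. bad j)" using uncountable_binary_sequences by (metis UNIV_I countable_subset subsetI)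
    have "ev (\<lambda>i. i \<in> \<Psi> (F x) \<longrightarrow> i \<in> K l)" using R(2) image_mono_subset[OF F(1)[of x]] by eventually_elim auto
    moreover have "F x \<subseteq> C l" using F(1) R(1) by (rule subset_trans)
    ultimately show ?thesis using F(2) x by (intro exI[of _ "F x"]) (auto simp: bad_def)
  qed
  define next_C where "next_C l K = (SOME C'. C' \<subseteq> C l \<and> ev (\<lambda>i. i \<in> \<Psi> C' \<longrightarrow> i \<in> K l) \<and> infinite C' \<and>
      (\<forall>j. infinite {i \<in> K j. g j i \<notin> C'}))" for l K
  have next_C: "next_C l K \<subseteq> C l \<and> ev (\<lambda>i. i \<in> \<Psi> (next_C l K) \<longrightarrow> i \<in> K l) \<and> infinite (next_C l K) \<and>
      (\<forall>j. infinite {i \<in> K j. g j i \<notin> next_C l K})" if "keeps K" for l K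
    unfolding next_C_def by (rule someI_ex) (use step[OF that, of l] in blast)
  \<comment> \<open>\<open>K j\<close> holds coordinates at which \<open>g j\<close> still fails. It
    is thinned to those mapped off the new set, except that for \<open>j = l\<close> it is confined
    to the image of that set.\<close>
  define next_K where "next_K l K j = (if j = l then K l \<inter> \<Psi> (next_C l K) else {i \<in> K j. g j i \<notin> next_C l K})" for l K j
  have inv_next: "keeps (next_K l K)" if K: "keeps K" for l K
    unfolding keeps_def
  proof (intro allI conjI)
    fix j
    show "next_K l K j \<subseteq> K0 j" using K by (auto simp: next_K_def keeps_def)
    show "infinite (next_K l K j)"
    proof (cases "j = l")
      case True
      have "infinite (\<Psi> (next_C l K))" using next_C[OF K, of l] finite_iff by blast
      moreover have "finite (\<Psi> (next_C l K))" if "finite (K l \<inter> \<Psi> (next_C l K))"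
        using that next_C[OF K, of l, THEN conjunct2, THEN conjunct1] unfolding finite_iff_ev by eventually_elim auto
      ultimately show ?thesis using True by (auto simp: next_K_def)
    next
      case False
      then show ?thesis using next_C[OF K, of l] by (simp add: next_K_def)
    qed
  qed
  define K where "K = rec_nat K0 next_K"
  have K_Suc: "K (Suc l) = next_K l (K l)" and K_0: "K 0 = K0" for l by (simp_all add: K_def)
  have invK: "keeps (K l)" for l by (induction l) (simp_all add: K_0 K_Suc \<open>keeps K0\<close> inv_next)
  define C' where "C' l = next_C l (K l)" for l
  have C': "C' l \<subseteq> C l" for l using next_C[OF invK] by (simp add: C'_def)
  have K_dec: "K t j \<subseteq> K l j" if "l \<le> t" for l t j
    using that by (induction rule: dec_induct) (auto simp: K_Suc next_K_def)
  have K_own: "K (Suc l) l \<subseteq> \<Psi> (C' l)" for l by (simp add: K_Suc next_K_def C'_def)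
  have K_avoid: "g j i \<notin> C' l" if i: "i \<in> K (Suc l) j" for i j l
  proof (cases "j = l")
    case True
    have "i \<in> K0 j" using i invK unfolding keeps_def by blast
    then show ?thesis using True C'[of l] by (auto simp: K0_def)
  next
    case False
    then show ?thesis using i by (simp add: K_Suc next_K_def C'_def)
  qed
  have "\<exists>i. t \<le> i \<and> i \<in> K (Suc t) j" for t j
    using invK[of "Suc t"] unfolding keeps_def infinite_nat_iff_unbounded_le by blast
  then have "\<forall>tj. \<exists>i. fst tj \<le> i \<and> i \<in> K (Suc (fst tj)) (snd tj)" by blast
  from choice[OF this] obtain p' where p': "\<And>tj. fst tj \<le> p' tj \<and> p' tj \<in> K (Suc (fst tj)) (snd tj)" by blast
  define p where "p j t = p' (t, j)" for j t
  have p: "t \<le> p j t" "p j t \<in> K (Suc t) j" for j t using p'[of "(t, j)"] by (simp_all add: p_def)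
  \<comment> \<open>Witness number t avoids every \<open>C' l\<close> with l at most t, so
    \<open>X\<close> meets each \<open>C' l\<close> in a finite set and can be removed from it
    without changing the image modulo finite.\<close>
  define X where "X = {g j (p j t) | j t. j \<le> t}"
  have X_fin: "finite (X \<inter> C' l)" for l
  proof (rule finite_subset)
    show "X \<inter> C' l \<subseteq> (\<lambda>(j, t). g j (p j t)) ` ({..<l} \<times> {..<l})"
    proof
      fix n assume n: "n \<in> X \<inter> C' l"
      then obtain j t where jt: "n = g j (p j t)" "j \<le> t" unfolding X_def by blast
      have "t < l"
      proof (rule ccontr)
        assume "\<not> t < l"
        then have "p j t \<in> K (Suc l) j" using p(2)[of j t] K_dec[of "Suc l" "Suc t" j] by auto
        from K_avoid[OF this] show False using n jt by simp
      qed
      then show "n \<in> (\<lambda>(j, t). g j (p j t)) ` ({..<l} \<times> {..<l})" using jt by force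
    qed
  qed simp
  define A where "A = (\<Union>l. C' l) - X"
  have "A \<subseteq> B" using C' C(1) unfolding A_def by blast
  from some[OF this] obtain j where j: "ev (\<lambda>i. i \<in> \<Psi> B \<longrightarrow> (i \<in> \<Psi> A \<longleftrightarrow> g j i \<in> A))" ..
  have "ev (\<lambda>n. n \<notin> X \<inter> C' j)" using X_fin[of j] by (simp only: finite_iff_ev)
  then have "ev (\<lambda>n. n \<in> C' j \<longrightarrow> n \<in> A)" by eventually_elim (auto simp: A_def)
  from image_mono_ev[OF this] j have "ev (\<lambda>i. i \<in> \<Psi> (C' j) \<and> i \<in> \<Psi> B \<longrightarrow> g j i \<in> A)" by eventually_elim auto
  then obtain N where N: "\<And>i. N \<le> i \<Longrightarrow> i \<in> \<Psi> (C' j) \<Longrightarrow> i \<in> \<Psi> B \<Longrightarrow> g j i \<in> A"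
    unfolding eventually_sequentially by blast
  define t where "t = max N j"
  have "p j t \<in> K (Suc j) j" using p(2)[of j t] K_dec[of "Suc j" "Suc t" j] by (auto simp: t_def)
  then have "p j t \<in> \<Psi> (C' j)" using K_own by blast
  moreover have "p j t \<in> \<Psi> B" using p(2)[of j t] invK[of "Suc t"] unfolding keeps_def K0_def by blast
  moreover have "N \<le> p j t" using p(1)[of t j] by (simp add: t_def)
  ultimately have "g j (p j t) \<in> A" using N by blast
  moreover have "g j (p j t) \<in> X" unfolding X_def using max.cobounded2[of j N] t_def by blast
  ultimately show False by (simp add: A_def)
qed

end

section \<open>Lifts that are locally continuous\<close>

abbreviation agree :: "nat \<Rightarrow> nat set \<Rightarrow> nat set \<Rightarrow> bool" where
  "agree k a b \<equiv> \<forall>n<k. n \<in> a \<longleftrightarrow> n \<in> b"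

text \<open>The Baire category argument: a condition is a triple \<open>(k, c, e)\<close> of which
  only the parts of \<open>c\<close> and \<open>e\<close> below \<open>k\<close> count, and
  \<open>local\<close> says that a requirement looks no further.\<close>

lemma generic_pair:
  fixes R :: "(nat \<Rightarrow> nat set \<Rightarrow> nat set \<Rightarrow> bool) set"
  assumes "countable R"
    and dense: "\<And>r k c e. r \<in> R \<Longrightarrow> c \<subseteq> B \<Longrightarrow> e \<subseteq> B \<Longrightarrow>
      \<exists>k' c' e'. k \<le> k' \<and> c' \<subseteq> B \<and> e' \<subseteq> B \<and> agree k c' c \<and> agree k e' e \<and> r k' c' e'"
    and local: "\<And>r k c e c' e'. r \<in> R \<Longrightarrow> r k c e \<Longrightarrow> agree k c' c \<Longrightarrow> agree k e' e \<Longrightarrow> r k c' e'"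
  obtains c e where "c \<subseteq> B" "e \<subseteq> B" "\<And>r. r \<in> R \<Longrightarrow> \<exists>k. r k c e"
proof (cases "R = {}")
  case True
  then show thesis using that[of "{}" "{}"] by blast
next
  case False
  then obtain r :: "nat \<Rightarrow> nat \<Rightarrow> nat set \<Rightarrow> nat set \<Rightarrow> bool" where r: "range r = R"
    using \<open>countable R\<close> uncountable_def by metis
  define ok where "ok q \<longleftrightarrow> fst (snd q) \<subseteq> B \<and> snd (snd q) \<subseteq> B" for q :: "nat \<times> nat set \<times> nat set"
  define ext where "ext q q' \<longleftrightarrow> fst q \<le> fst q' \<and> agree (fst q) (fst (snd q')) (fst (snd q)) \<and>
    agree (fst q) (snd (snd q')) (snd (snd q))" for q q' :: "nat \<times> nat set \<times> nat set"
  have step: "\<exists>q'. ok q' \<and> ext q q' \<and> r j (fst q') (fst (snd q')) (snd (snd q'))" if "ok q" for j q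
  proof -
    have "r j \<in> R" using r by blast
    from dense[OF this] that obtain k' c' e' where "fst q \<le> k'" "c' \<subseteq> B" "e' \<subseteq> B"
      "agree (fst q) c' (fst (snd q))" "agree (fst q) e' (snd (snd q))" "r j k' c' e'"
      unfolding ok_def by metis
    then show ?thesis by (intro exI[of _ "(k', c', e')"]) (simp add: ok_def ext_def)
  qed
  have "\<exists>G. \<forall>q. ok q \<longrightarrow> ok (G q) \<and> ext q (G q) \<and> r j (fst (G q)) (fst (snd (G q))) (snd (snd (G q)))" for j
    by (rule choice) (use step in blast)
  note G = this
  have "\<exists>F. \<forall>j q. ok q \<longrightarrow> ok (F j q) \<and> ext q (F j q) \<and> r j (fst (F j q)) (fst (snd (F j q))) (snd (snd (F j q)))"
    by (rule choice) (use G in blast)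
  then obtain F where F: "\<And>j q. ok q \<Longrightarrow> ok (F j q)" "\<And>j q. ok q \<Longrightarrow> ext q (F j q)"
    "\<And>j q. ok q \<Longrightarrow> r j (fst (F j q)) (fst (snd (F j q))) (snd (snd (F j q)))" by blast
  define Q where "Q = rec_nat (0, {}, {}) F"
  have Q_Suc: "Q (Suc j) = F j (Q j)" for j by (simp add: Q_def)
  have okQ: "ok (Q j)" for j
  proof (induction j)
    case 0
    then show ?case by (simp add: Q_def ok_def)
  qed (simp add: Q_Suc F(1))
  have extQ: "ext (Q i) (Q j)" if "i \<le> j" for i j
    using that
  proof (induction rule: dec_induct)
    case base
    then show ?case by (simp add: ext_def)
  next
    case (step j)
    have "ext (Q j) (Q (Suc j))" using F(2)[OF okQ] by (simp add: Q_Suc)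
    with step.IH show ?case unfolding ext_def by (meson order_trans less_le_trans)
  qed
  define c where "c = (\<Union>j. fst (snd (Q j)) \<inter> {..<fst (Q j)})"
  define e where "e = (\<Union>j. snd (snd (Q j)) \<inter> {..<fst (Q j)})"
  have c: "agree (fst (Q j)) c (fst (snd (Q j)))" for j
  proof (intro allI impI iffI)
    fix n assume n: "n < fst (Q j)" "n \<in> c"
    then obtain i where i: "n \<in> fst (snd (Q i))" "n < fst (Q i)" by (auto simp: c_def)
    from extQ[of i j] extQ[of j i] i n show "n \<in> fst (snd (Q j))" unfolding ext_def by (cases "i \<le> j") auto
  qed (auto simp: c_def)
  have e: "agree (fst (Q j)) e (snd (snd (Q j)))" for j
  proof (intro allI impI iffI)
    fix n assume n: "n < fst (Q j)" "n \<in> e"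
    then obtain i where i: "n \<in> snd (snd (Q i))" "n < fst (Q i)" by (auto simp: e_def)
    from extQ[of i j] extQ[of j i] i n show "n \<in> snd (snd (Q j))" unfolding ext_def by (cases "i \<le> j") auto
  qed (auto simp: e_def)
  show thesis
  proof (rule that)
    show "c \<subseteq> B" "e \<subseteq> B" using okQ unfolding c_def e_def ok_def by blast+
    fix r' assume "r' \<in> R"
    then obtain j where j: "r' = r j" using r by blast
    have "r j (fst (Q (Suc j))) (fst (snd (Q (Suc j)))) (snd (snd (Q (Suc j))))"
      using F(3)[OF okQ] by (simp add: Q_Suc)
    from local[OF \<open>r' \<in> R\<close>[unfolded j] this c e] show "\<exists>k. r' k c e" unfolding j ..
  qed
qed

text \<open>Weak continuity on each piece: a value is constant on the members of the piece below
  some stronger condition, possibly because there are no members. This is all that OCA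
  provides.\<close>

locale locally_continuous_lift = boolean_lift +
  fixes B :: "nat set" and W :: "nat \<Rightarrow> nat set set"
  assumes cover: "a \<subseteq> B \<Longrightarrow> \<exists>m. a \<in> W m"
    and decide: "i \<in> \<Psi> B \<Longrightarrow> s \<subseteq> B \<Longrightarrow> \<exists>k' s' v. k \<le> k' \<and> s' \<subseteq> B \<and> agree k s' s \<and>
      (\<forall>a\<in>W m. agree k' a s' \<longrightarrow> (i \<in> \<Psi> a \<longleftrightarrow> v))"
begin

text \<open>If no member of \<open>W m\<close> lies below the condition, both values are decided;
  density hypotheses exclude this wherever uniqueness of the value matters.\<close>

definition decided :: "nat \<Rightarrow> nat \<Rightarrow> nat set \<Rightarrow> nat \<Rightarrow> bool \<Rightarrow> bool" where
  "decided m k s i v \<longleftrightarrow> (\<forall>a\<in>W m. agree k a s \<longrightarrow> (i \<in> \<Psi> a \<longleftrightarrow> v))"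

lemma decided_mono: "decided m k s i v \<Longrightarrow> k \<le> k' \<Longrightarrow> agree k s' s \<Longrightarrow> decided m k' s' i v"
  unfolding decided_def by (meson less_le_trans)

text \<open>The points beyond the condition that can influence coordinate \<open>i\<close>, tested
  only between decided conditions. For a trivial lift one expects here the point sent to
  \<open>i\<close>.\<close>

definition dependence :: "nat \<Rightarrow> nat \<Rightarrow> nat set \<Rightarrow> nat \<Rightarrow> nat set" where
  "dependence m k s i = {n \<in> B. k \<le> n \<and> (\<exists>k' c v. c \<subseteq> B \<and> agree k c s \<and>
     decided m k' c i v \<and> decided m k' (sym_diff c {n}) i (\<not> v))}"

lemma dependence_mono: "k \<le> k' \<Longrightarrow> agree k s' s \<Longrightarrow> dependence m k' s' i \<subseteq> dependence m k s i \<inter> {k'..}"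
  unfolding dependence_def by (blast intro: order_trans less_le_trans)

lemma dependence_cong: "agree k s' s \<Longrightarrow> dependence m k s' i = dependence m k s i"
  unfolding dependence_def by auto

text \<open>Flip the points of \<open>F\<close> one after the other, extending the condition each time so that the flipped set is
  decided as well.\<close>
lemma flip_finite:
  assumes i: "i \<in> \<Psi> B" and dep: "dependence m k s i = {}"
    and c: "c \<subseteq> B" "agree k c s" "k \<le> k1" "decided m k1 c i v"
    and F: "finite F" "F \<subseteq> B" "\<And>n. n \<in> F \<Longrightarrow> k \<le> n"
  shows "\<exists>k2 c'. k1 \<le> k2 \<and> c' \<subseteq> B \<and> agree k1 c' c \<and> decided m k2 (sym_diff c' F) i v"
  using F
proof (induction F rule: finite_induct)
  case empty
  then show ?case using c by (intro exI[of _ k1] exI[of _ c]) simp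
next
  case (insert n F)
  then obtain k2 c' where k2: "k1 \<le> k2" "c' \<subseteq> B" "agree k1 c' c" "decided m k2 (sym_diff c' F) i v" by auto
  define t where "t = sym_diff c' (insert n F)"
  have "t \<subseteq> B" using k2 insert.prems by (auto simp: t_def)
  from decide[OF i this, of k2 m] obtain k3 u w where k3: "k2 \<le> k3" "u \<subseteq> B" "agree k2 u t" "decided m k3 u i w"
    unfolding decided_def by blast
  define c'' where "c'' = sym_diff u (insert n F)"
  have c''_B: "c'' \<subseteq> B" using k3 insert.prems by (auto simp: c''_def)
  have c''_c': "agree k2 c'' c'" using k3(3) by (auto simp: c''_def t_def)
  have u: "sym_diff c'' (insert n F) = u" by (auto simp: c''_def)
  have un: "sym_diff u {n} = sym_diff c'' F" using insert.hyps by (auto simp: c''_def)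
  have "agree k2 (sym_diff c'' F) (sym_diff c' F)" using c''_c' by auto
  from decided_mono[OF k2(4) k3(1) this] have d: "decided m k3 (sym_diff u {n}) i v" unfolding un .
  have "w = v"
  proof (rule ccontr)
    assume "w \<noteq> v"
    then have v: "v = (\<not> w)" by blast
    have us: "agree k u s"
    proof (intro allI impI)
      fix j assume "j < k"
      then have "j \<notin> insert n F" using insert.prems(2) not_le by blast
      moreover have "j < k1" "j < k2" using \<open>j < k\<close> c(3) k2(1) by simp_all
      ultimately show "j \<in> u \<longleftrightarrow> j \<in> s" using k3(3) k2(3) c(2) \<open>j < k\<close> by (simp add: t_def)
    qed
    have "n \<in> dependence m k s i" unfolding dependence_def
      using k3 us d[unfolded v] insert.prems by blast
    then show False using dep by simp
  qed
  show ?case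
  proof (intro exI conjI)
    show "k1 \<le> k3" using k2(1) k3(1) by simp
    show "c'' \<subseteq> B" by (rule c''_B)
    show "agree k1 c'' c" using c''_c' k2(1,3) by auto
    show "decided m k3 (sym_diff c'' (insert n F)) i v" using k3(4) \<open>w = v\<close> u by simp
  qed
qed

text \<open>With no dependence left, one decided condition is carried to the other by flipping their
  finite difference; \<open>dense\<close> supplies a member below the result, at which both values
  are read off.\<close>

lemma decided_unique:
  assumes i: "i \<in> \<Psi> B" and dep: "dependence m k s i = {}"
    and dense: "\<And>k' c. c \<subseteq> B \<Longrightarrow> agree k c s \<Longrightarrow> \<exists>a\<in>W m. agree k' a c"
    and c1: "c1 \<subseteq> B" "agree k c1 s" "decided m k1 c1 i v1"
    and c2: "c2 \<subseteq> B" "agree k c2 s" "decided m k2 c2 i v2"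
  shows "v1 = v2"
proof -
  define N where "N = max k (max k1 k2)"
  have d1: "decided m N c1 i v1" and d2: "decided m N c2 i v2"
    using decided_mono[OF c1(3), of N c1] decided_mono[OF c2(3), of N c2] by (auto simp: N_def)
  define F where "F = sym_diff c1 c2 \<inter> {..<N}"
  have F: "finite F" "F \<subseteq> B" using c1 c2 by (auto simp: F_def)
  have Fk: "k \<le> n" if "n \<in> F" for n
  proof (rule ccontr)
    assume "\<not> k \<le> n"
    then show False using that c1(2) c2(2) by (auto simp: F_def)
  qed
  have "k \<le> N" by (simp add: N_def)
  from flip_finite[OF i dep c1(1,2) this d1 F Fk] obtain k3 c' where
    c': "N \<le> k3" "c' \<subseteq> B" "agree N c' c1" "decided m k3 (sym_diff c' F) i v1" by blast
  have ag: "agree N (sym_diff c' F) c2" using c'(3) by (auto simp: F_def)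
  have d3: "decided m k3 (sym_diff c' F) i v2" by (rule decided_mono[OF d2 c'(1) ag])
  have sub: "sym_diff c' F \<subseteq> B" using c'(2) F(2) by auto
  have "agree k (sym_diff c' F) s" using ag c2(2) \<open>k \<le> N\<close> by auto
  from dense[OF sub this, of k3] obtain a where "a \<in> W m" "agree k3 a (sym_diff c' F)" by blast
  then show ?thesis using c'(4) d3 unfolding decided_def by blast
qed

text \<open>The image of \<open>glue A c e\<close> agrees with the image of \<open>c\<close> almost everywhere on the image of \<open>A\<close>.  If \<open>(c, e)\<close> is
  generic, the values decided on the image of \<open>A\<close> therefore depend on points of \<open>A\<close> only.\<close>
definition glue :: "nat set \<Rightarrow> nat set \<Rightarrow> nat set \<Rightarrow> nat set" where
  "glue A c e = (c \<inter> A) \<union> (e - A)"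

definition coherent_pair :: "nat set \<Rightarrow> nat \<Rightarrow> nat \<Rightarrow> nat \<Rightarrow> nat set \<Rightarrow> nat set \<Rightarrow> bool" where
  "coherent_pair A m m' q c e \<longleftrightarrow> c \<subseteq> B \<and> e \<subseteq> B \<and> c \<in> W m \<and> glue A c e \<in> W m' \<and>
     (\<forall>i\<ge>q. i \<in> \<Psi> A \<longrightarrow> (i \<in> \<Psi> c \<longleftrightarrow> i \<in> \<Psi> (glue A c e)))"

lemma coherent_pair_exists:
  assumes "A \<subseteq> B" "c \<subseteq> B" "e \<subseteq> B" "c \<in> W m"
  shows "\<exists>m' q. coherent_pair A m m' q c e"
proof -
  have "glue A c e \<subseteq> B" using assms by (auto simp: glue_def)
  then obtain m' where m': "glue A c e \<in> W m'" using cover by blast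
  have eq: "glue A c e \<inter> A = c \<inter> A" by (auto simp: glue_def)
  have "ev (\<lambda>i. i \<in> \<Psi> A \<longrightarrow> (i \<in> \<Psi> c \<longleftrightarrow> i \<in> \<Psi> (glue A c e)))"
    using inter[of "glue A c e" A, unfolded eq] inter[of c A] by eventually_elim auto
  then obtain q where "\<forall>i\<ge>q. i \<in> \<Psi> A \<longrightarrow> (i \<in> \<Psi> c \<longleftrightarrow> i \<in> \<Psi> (glue A c e))"
    unfolding eventually_sequentially by blast
  with m' assms show ?thesis unfolding coherent_pair_def by blast
qed

definition dense_below :: "(nat set \<Rightarrow> nat set \<Rightarrow> bool) \<Rightarrow> nat \<Rightarrow> nat set \<Rightarrow> nat set \<Rightarrow> bool" where
  "dense_below T k c e \<longleftrightarrow> (\<forall>k' c' e'. c' \<subseteq> B \<longrightarrow> e' \<subseteq> B \<longrightarrow> agree k c' c \<longrightarrow> agree k e' e \<longrightarrow>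
     (\<exists>c1 e1. T c1 e1 \<and> agree k' c1 c' \<and> agree k' e1 e'))"

text \<open>Flipping a point outside \<open>A\<close> changes \<open>c\<close> but not its part in
  \<open>A\<close>. Below a common tail deciding the glued set, the value of that set is the same
  before and after the flip, and coherence transfers it back to \<open>c\<close>; so the flip cannot
  change a decided value.\<close>

lemma dependence_subset:
  assumes dense: "dense_below (coherent_pair A m m' q) k c e" and "e \<subseteq> B" "A \<subseteq> B"
    and i: "i \<in> \<Psi> B" "i \<in> \<Psi> A" "q \<le> i"
  shows "dependence m k c i \<subseteq> A"
proof
  fix n assume "n \<in> dependence m k c i"
  then obtain k0 c' v where n: "n \<in> B" "k \<le> n" and c': "c' \<subseteq> B" "agree k c' c" "decided m k0 c' i v"
    "decided m k0 (sym_diff c' {n}) i (\<not> v)"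
    unfolding dependence_def by blast
  define k' where "k' = max k k0"
  have "k \<le> k'" by (simp add: k'_def)
  have d: "decided m k' c' i v" "decided m k' (sym_diff c' {n}) i (\<not> v)"
    using decided_mono[OF c'(3), of k' c'] decided_mono[OF c'(4), of k' "sym_diff c' {n}"] by (simp_all add: k'_def)
  show "n \<in> A"
  proof (rule ccontr)
    assume "n \<notin> A"
    have "glue A c' e \<subseteq> B" using c' \<open>e \<subseteq> B\<close> by (auto simp: glue_def)
    from decide[OF i(1) this, of k' m'] obtain k'' t w where
      t: "k' \<le> k''" "t \<subseteq> B" "agree k' t (glue A c' e)" "decided m' k'' t i w"
      unfolding decided_def by blast
    have value_w: "v' = w" if b: "b \<subseteq> B" "b \<inter> A = c' \<inter> A" "decided m k' b i v'" "agree k b c" for b v'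
    proof -
      \<comment> \<open>The tail of \<open>t\<close> is appended to both components, so the glued
        set follows \<open>t\<close> past \<open>k'\<close> whichever component a point is taken
        from.\<close>
      define b' where "b' = (b \<inter> {..<k'}) \<union> (t - {..<k'})"
      define e' where "e' = (e \<inter> {..<k'}) \<union> (t - {..<k'})"
      have 1: "b' \<subseteq> B" "e' \<subseteq> B" using b(1) t(2) \<open>e \<subseteq> B\<close> by (auto simp: b'_def e'_def)
      have 2: "agree k b' c" "agree k e' e" using b(4) \<open>k \<le> k'\<close> by (auto simp: b'_def e'_def)
      obtain c1 e1 where c1: "coherent_pair A m m' q c1 e1" "agree k'' c1 b'" "agree k'' e1 e'"
        using dense[unfolded dense_below_def, rule_format, OF 1, of k''] 2 by blast
      have "agree k' c1 b" using c1(2) t(1) by (auto simp: b'_def)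
      then have v: "i \<in> \<Psi> c1 \<longleftrightarrow> v'" using b(3) c1(1) unfolding decided_def coherent_pair_def by blast
      have "n' \<in> glue A c1 e1 \<longleftrightarrow> n' \<in> t" if "n' < k''" for n'
      proof (cases "n' < k'")
        case True
        have "n' \<in> b \<inter> A \<longleftrightarrow> n' \<in> c' \<inter> A" using b(2) by simp
        moreover have "n' \<in> t \<longleftrightarrow> n' \<in> glue A c' e" using t(3) True by blast
        moreover have "n' \<in> c1 \<longleftrightarrow> n' \<in> b" "n' \<in> e1 \<longleftrightarrow> n' \<in> e" using c1(2,3) that True by (simp_all add: b'_def e'_def)
        ultimately show ?thesis by (auto simp: glue_def)
      next
        case False
        then have "n' \<in> c1 \<longleftrightarrow> n' \<in> t" "n' \<in> e1 \<longleftrightarrow> n' \<in> t" using c1(2,3) that by (simp_all add: b'_def e'_def)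
        then show ?thesis by (auto simp: glue_def)
      qed
      then have "i \<in> \<Psi> (glue A c1 e1) \<longleftrightarrow> w" using t(4) c1(1) unfolding decided_def coherent_pair_def by blast
      moreover have "i \<in> \<Psi> c1 \<longleftrightarrow> i \<in> \<Psi> (glue A c1 e1)" using c1(1) i unfolding coherent_pair_def by blast
      ultimately show ?thesis using v by blast
    qed
    have "v = w" by (rule value_w[OF c'(1) refl d(1) c'(2)])
    moreover have "(\<not> v) = w"
    proof (rule value_w[OF _ _ d(2)])
      show "sym_diff c' {n} \<subseteq> B" using c'(1) n(1) by auto
      show "sym_diff c' {n} \<inter> A = c' \<inter> A" using \<open>n \<notin> A\<close> by auto
      show "agree k (sym_diff c' {n}) c" using c'(2) n(2) by auto
    qed
    ultimately show False by simp
  qed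
qed

text \<open>Coordinates with constant value below a condition.  Since a generic set splits every infinite set prescribed
  in advance, there are only finitely many of them.\<close>
definition frozen :: "bool \<Rightarrow> nat \<Rightarrow> nat \<Rightarrow> nat set \<Rightarrow> nat set" where
  "frozen v m k s = {i \<in> \<Psi> B. dependence m k s i = {} \<and>
     (\<exists>k' c. c \<subseteq> B \<and> agree k c s \<and> decided m k' c i v)}"

lemma frozen_cong: "agree k s' s \<Longrightarrow> frozen v m k s' = frozen v m k s"
  using dependence_cong[of k s' s] unfolding frozen_def by auto

definition frozen_points :: "bool \<Rightarrow> nat \<Rightarrow> nat \<Rightarrow> nat set \<Rightarrow> nat set" where
  "frozen_points v m k s = (SOME C. C \<subseteq> B \<and> ev (\<lambda>n. n \<in> \<Psi> C \<longleftrightarrow> n \<in> frozen v m k s))"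

lemma frozen_points: "frozen_points v m k s \<subseteq> B"
  "ev (\<lambda>n. n \<in> \<Psi> (frozen_points v m k s) \<longleftrightarrow> n \<in> frozen v m k s)"
proof -
  have "ev (\<lambda>n. n \<in> frozen v m k s \<longrightarrow> n \<in> \<Psi> B)" by (intro always_eventually) (auto simp: frozen_def)
  then have "\<exists>C. C \<subseteq> B \<and> ev (\<lambda>n. n \<in> \<Psi> C \<longleftrightarrow> n \<in> frozen v m k s)" using preimage_set by metis
  from someI_ex[OF this] show "frozen_points v m k s \<subseteq> B"
    "ev (\<lambda>n. n \<in> \<Psi> (frozen_points v m k s) \<longleftrightarrow> n \<in> frozen v m k s)" unfolding frozen_points_def by blast+
qed

text \<open>The requirements are countable in number because conditions enter only through finite
  sets \<open>s\<close>. The coherence clause turns coherence of the pair itself into density of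
  coherent pairs below a condition; the last clause makes \<open>c\<close> split the infinite sets
  of frozen points.\<close>

definition generic :: "nat set \<Rightarrow> nat set \<Rightarrow> nat set \<Rightarrow> bool" where
  "generic A c e \<longleftrightarrow> c \<subseteq> B \<and> e \<subseteq> B \<and>
     (\<forall>m. \<forall>i\<in>\<Psi> B. \<exists>k v. decided m k c i v) \<and>
     (\<forall>A'\<in>{A, B - A}. \<forall>m m' q. coherent_pair A' m m' q c e \<longrightarrow>
        (\<exists>k. dense_below (coherent_pair A' m m' q) k c e)) \<and>
     (\<forall>v m k s. finite s \<longrightarrow> infinite (frozen_points v m k s) \<longrightarrow>
        (\<forall>N. \<exists>n\<in>frozen_points v m k s. N \<le> n \<and> (n \<in> c \<longleftrightarrow> \<not> v)))"

lemma genericD: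
  assumes "generic A c e"
  shows "c \<subseteq> B" "e \<subseteq> B" "i \<in> \<Psi> B \<Longrightarrow> \<exists>k v. decided m k c i v"
    "A' \<in> {A, B - A} \<Longrightarrow> coherent_pair A' m m' q c e \<Longrightarrow> \<exists>k. dense_below (coherent_pair A' m m' q) k c e"
    "finite s \<Longrightarrow> infinite (frozen_points v m k s) \<Longrightarrow> \<exists>n\<in>frozen_points v m k s. N \<le> n \<and> (n \<in> c \<longleftrightarrow> \<not> v)"
proof -
  note gen = assms[unfolded generic_def]
  show "c \<subseteq> B" "e \<subseteq> B" using gen by simp_all
  show "\<exists>k v. decided m k c i v" if "i \<in> \<Psi> B" using gen that by simp
  show "\<exists>k. dense_below (coherent_pair A' m m' q) k c e" if "A' \<in> {A, B - A}" "coherent_pair A' m m' q c e"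
    by (rule gen[THEN conjunct2, THEN conjunct2, THEN conjunct2, THEN conjunct1, THEN bspec, rule_format, OF that])
  show "\<exists>n\<in>frozen_points v m k s. N \<le> n \<and> (n \<in> c \<longleftrightarrow> \<not> v)" if "finite s" "infinite (frozen_points v m k s)"
    by (rule gen[THEN conjunct2, THEN conjunct2, THEN conjunct2, THEN conjunct2, rule_format, OF that])
qed

lemma generic_exists: "\<exists>c e. generic A c e"
proof -
  define R1 where "R1 = (\<lambda>(m, i) k (c :: nat set) (e :: nat set). i \<in> \<Psi> B \<longrightarrow> (\<exists>v. decided m k c i v))"
  define T where "T b = coherent_pair (if b then A else B - A)" for b
  \<comment> \<open>Every condition extends to one that either has coherent pairs densely below it
    or has none at all; a generic pair that is itself coherent excludes the second case.\<close>
  define R2 where "R2 = (\<lambda>(b, m, m', q) k c e. dense_below (T b m m' q) k c e \<or>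
      (\<forall>c1 e1. agree k c1 c \<and> agree k e1 e \<longrightarrow> \<not> T b m m' q c1 e1))"
  define R3 where "R3 = (\<lambda>(v, m, k0, xs, N) k (c :: nat set) (e :: nat set).
      infinite (frozen_points v m k0 (set xs)) \<longrightarrow> (\<exists>n\<in>frozen_points v m k0 (set xs). N \<le> n \<and> n < k \<and> (n \<in> c \<longleftrightarrow> \<not> v)))"
  obtain c e where ce: "c \<subseteq> B" "e \<subseteq> B" "\<And>r. r \<in> range R1 \<union> range R2 \<union> range R3 \<Longrightarrow> \<exists>k. r k c e"
  proof (rule generic_pair[of "range R1 \<union> range R2 \<union> range R3" B])
    show "countable (range R1 \<union> range R2 \<union> range R3)" by simp
  next
    fix r k c e assume r: "r \<in> range R1 \<union> range R2 \<union> range R3" and "c \<subseteq> B" "e \<subseteq> B"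
    let ?goal = "\<exists>k' c' e'. k \<le> k' \<and> c' \<subseteq> B \<and> e' \<subseteq> B \<and> agree k c' c \<and> agree k e' e \<and> r k' c' e'"
    from r consider m i where "r = R1 (m, i)" | b m m' q where "r = R2 (b, m, m', q)"
      | v m k0 xs N where "r = R3 (v, m, k0, xs, N)" by auto
    then show ?goal
    proof cases
      case (1 m i)
      show ?thesis
      proof (cases "i \<in> \<Psi> B")
        case True
        from decide[OF this \<open>c \<subseteq> B\<close>, of k m] obtain k' c' v where "k \<le> k'" "c' \<subseteq> B" "agree k c' c" "decided m k' c' i v"
          unfolding decided_def by blast
        then show ?thesis using 1 \<open>e \<subseteq> B\<close> by (intro exI[of _ k'] exI[of _ c'] exI[of _ e]) (auto simp: R1_def)
      next
        case False
        then show ?thesis using 1 \<open>c \<subseteq> B\<close> \<open>e \<subseteq> B\<close> by (intro exI[of _ k] exI[of _ c] exI[of _ e]) (simp add: R1_def)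
      qed
    next
      case (2 b m m' q)
      show ?thesis
      proof (cases "dense_below (T b m m' q) k c e")
        case True
        then show ?thesis using 2 \<open>c \<subseteq> B\<close> \<open>e \<subseteq> B\<close> by (intro exI[of _ k] exI[of _ c] exI[of _ e]) (simp add: R2_def)
      next
        case False
        then obtain k' c' e' where k': "c' \<subseteq> B" "e' \<subseteq> B" "agree k c' c" "agree k e' e"
          "\<not> (\<exists>c1 e1. T b m m' q c1 e1 \<and> agree k' c1 c' \<and> agree k' e1 e')"
          unfolding dense_below_def by blast
        have "\<not> T b m m' q c1 e1" if "agree (max k k') c1 c'" "agree (max k k') e1 e'" for c1 e1
        proof
          assume "T b m m' q c1 e1"
          moreover have "agree k' c1 c'" "agree k' e1 e'" using that by simp_all
          ultimately show False using k'(5) by blast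
        qed
        then show ?thesis using 2 k'(1-4) by (intro exI[of _ "max k k'"] exI[of _ c'] exI[of _ e']) (simp add: R2_def)
      qed
    next
      case (3 v m k0 xs N)
      show ?thesis
      proof (cases "finite (frozen_points v m k0 (set xs))")
        case True
        then show ?thesis using 3 \<open>c \<subseteq> B\<close> \<open>e \<subseteq> B\<close> by (intro exI[of _ k] exI[of _ c] exI[of _ e]) (simp add: R3_def)
      next
        case False
        then obtain n where n: "max N k \<le> n" "n \<in> frozen_points v m k0 (set xs)"
          unfolding infinite_nat_iff_unbounded_le by blast
        have "n \<in> B" using n(2) frozen_points(1) by blast
        define c' where "c' = (if v then c - {n} else insert n c)"
        have "c' \<subseteq> B" "agree k c' c" "n \<in> c' \<longleftrightarrow> \<not> v" using \<open>c \<subseteq> B\<close> \<open>n \<in> B\<close> n(1) by (auto simp: c'_def)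
        then show ?thesis using 3 \<open>e \<subseteq> B\<close> n
          by (intro exI[of _ "Suc n"] exI[of _ c'] exI[of _ e]) (auto simp: R3_def intro!: bexI[of _ n])
      qed
    qed
  next
    fix r k c e c' e' assume r: "r \<in> range R1 \<union> range R2 \<union> range R3" and "r k c e"
      and ag: "agree k c' c" "agree k e' e"
    from r consider m i where "r = R1 (m, i)" | b m m' q where "r = R2 (b, m, m', q)"
      | v m k0 xs N where "r = R3 (v, m, k0, xs, N)" by auto
    then show "r k c' e'"
    proof cases
      case (1 m i)
      then show ?thesis using \<open>r k c e\<close> decided_mono[OF _ le_refl ag(1)] by (auto simp: R1_def)
    next
      case (2 b m m' q)
      then show ?thesis using \<open>r k c e\<close> ag by (simp add: R2_def dense_below_def)
    next
      case (3 v m k0 xs N)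
      then show ?thesis using \<open>r k c e\<close> ag by (auto simp: R3_def)
    qed
  qed (rule that)
  have "generic A c e"
    unfolding generic_def
  proof (intro conjI allI ballI impI ce(1,2))
    fix m i assume "i \<in> \<Psi> B"
    have "\<exists>k. R1 (m, i) k c e" by (rule ce(3)) blast
    then show "\<exists>k v. decided m k c i v" using \<open>i \<in> \<Psi> B\<close> unfolding R1_def prod.case by blast
  next
    fix A' m m' q assume "A' \<in> {A, B - A}" and T': "coherent_pair A' m m' q c e"
    then have T: "T (A' = A) m m' q = coherent_pair A' m m' q" by (auto simp: T_def)
    have "\<exists>k. R2 (A' = A, m, m', q) k c e" by (rule ce(3)) blast
    then show "\<exists>k. dense_below (coherent_pair A' m m' q) k c e" using T' unfolding R2_def T prod.case by blast
  next
    fix v m k0 s N assume "finite s" and inf: "infinite (frozen_points v m k0 s)"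
    then obtain xs where xs: "set xs = s" using finite_list by blast
    have "\<exists>k. R3 (v, m, k0, xs, N) k c e" by (rule ce(3)) blast
    then show "\<exists>n\<in>frozen_points v m k0 s. N \<le> n \<and> (n \<in> c \<longleftrightarrow> \<not> v)" using inf unfolding R3_def xs prod.case by blast
  qed
  then show ?thesis by blast
qed

text \<open>Preferring points above \<open>i\<close> makes the choice finite-to-one.\<close>
definition chosen_dependence :: "nat \<Rightarrow> nat \<Rightarrow> nat set \<Rightarrow> nat \<Rightarrow> nat" where
  "chosen_dependence m k s i = (if dependence m k s i = {} then i
     else if \<exists>n\<in>dependence m k s i. i \<le> n then SOME n. n \<in> dependence m k s i \<and> i \<le> n
     else Max (dependence m k s i))"

lemma chosen_dependence:
  assumes "dependence m k s i \<noteq> {}"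
  shows "chosen_dependence m k s i \<in> dependence m k s i"
    and "n \<in> dependence m k s i \<Longrightarrow> chosen_dependence m k s i < i \<Longrightarrow> n \<le> chosen_dependence m k s i"
proof -
  have 1: "chosen_dependence m k s i \<in> dependence m k s i \<and> i \<le> chosen_dependence m k s i"
    if "\<exists>n\<in>dependence m k s i. i \<le> n"
  proof -
    from that have "\<exists>n. n \<in> dependence m k s i \<and> i \<le> n" by blast
    from someI_ex[OF this] show ?thesis using that by (auto simp: chosen_dependence_def)
  qed
  have 2: "chosen_dependence m k s i \<in> dependence m k s i \<and> (\<forall>n\<in>dependence m k s i. n \<le> chosen_dependence m k s i)"
    if no: "\<not> (\<exists>n\<in>dependence m k s i. i \<le> n)"
  proof -
    have "finite (dependence m k s i)" by (rule finite_subset[of _ "{..<i}"]) (use no in auto)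
    then show ?thesis using that assms by (simp add: chosen_dependence_def)
  qed
  show "chosen_dependence m k s i \<in> dependence m k s i" using 1 2 by blast
  show "n \<le> chosen_dependence m k s i" if "n \<in> dependence m k s i" "chosen_dependence m k s i < i"
    using 1 2 that not_le by blast
qed

text \<open>The point is countability: each \<open>A\<close> needs its own generic pair, but the
  resulting map depends only on the index \<open>m\<close> of a piece and on a finite condition.
  Past a threshold, coordinates in \<open>\<Psi> A\<close> depend only on points of
  \<open>A\<close>, and those in \<open>\<Psi> (B - A)\<close> only on points of
  \<open>B - A\<close>, so choosing any point of dependence gives a lift on
  \<open>A\<close>.\<close>

lemma countably_many_lifts:
  obtains g :: "nat \<Rightarrow> nat \<Rightarrow> nat" where "\<And>j n. finite {i \<in> \<Psi> B. g j i = n}"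
    and "\<And>A. A \<subseteq> B \<Longrightarrow> \<exists>j. ev (\<lambda>i. i \<in> \<Psi> B \<longrightarrow> (i \<in> \<Psi> A \<longleftrightarrow> g j i \<in> A))"
proof -
  define h where "h = (\<lambda>(m, k, xs). chosen_dependence m k (set xs))"
  \<comment> \<open>Indices whose map has an infinite fibre are given the identity instead; the maps
    that arise from generic pairs are not among them.\<close>
  define g where "g j = (let h' = h (from_nat j) in if \<forall>n. finite {i \<in> \<Psi> B. h' i = n} then h' else id)" for j
  show thesis
  proof (rule that)
    fix j n
    show "finite {i \<in> \<Psi> B. g j i = n}"
    proof (cases "\<forall>n. finite {i \<in> \<Psi> B. h (from_nat j) i = n}")
      case False
      have "{i \<in> \<Psi> B. i = n} \<subseteq> {n}" by blast
      then have "finite {i \<in> \<Psi> B. i = n}" using finite_subset by blast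
      then show ?thesis using False by (simp add: g_def Let_def)
    qed (simp add: g_def Let_def)
  next
    fix A assume "A \<subseteq> B"
    obtain c e where gen: "generic A c e" using generic_exists by blast
    note ce = genericD(1,2)[OF gen]
    obtain m where m: "c \<in> W m" using cover[OF ce(1)] by blast
    have dens: "\<exists>m' q k. dense_below (coherent_pair A' m m' q) k c e" if A': "A' \<in> {A, B - A}" for A'
    proof -
      have "A' \<subseteq> B" using A' \<open>A \<subseteq> B\<close> by auto
      from coherent_pair_exists[OF this ce m] obtain m' q where "coherent_pair A' m m' q c e" by blast
      from genericD(4)[OF gen A' this] obtain k where "dense_below (coherent_pair A' m m' q) k c e" ..
      then show ?thesis by (intro exI)
    qed
    obtain m1 q1 k1 where 1: "dense_below (coherent_pair A m m1 q1) k1 c e" using dens[OF insertI1] by (elim exE)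
    obtain m2 q2 k2 where 2: "dense_below (coherent_pair (B - A) m m2 q2) k2 c e" using dens[OF insertI2[OF singletonI]] by (elim exE)
    define k where "k = max k1 k2"
    define s where "s = c \<inter> {..<k}"
    have dense_mono: "dense_below T k' c e" if "dense_below T k c e" "k \<le> k'" for T k k'
      unfolding dense_below_def
    proof (intro allI impI)
      fix l c' e' assume "c' \<subseteq> B" "e' \<subseteq> B" "agree k' c' c" "agree k' e' e"
      then show "\<exists>c1 e1. T c1 e1 \<and> agree l c1 c' \<and> agree l e1 e'"
        using that(1)[unfolded dense_below_def, rule_format, of c' e' l] \<open>k \<le> k'\<close> by simp
    qed
    have dep_in: "dependence m k c i \<subseteq> A" if "i \<in> \<Psi> B" "i \<in> \<Psi> A" "q1 \<le> i" for i
      by (rule dependence_subset[OF dense_mono[OF 1] ce(2) \<open>A \<subseteq> B\<close> that]) (simp add: k_def)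
    have dep_out: "dependence m k c i \<subseteq> B - A" if "i \<in> \<Psi> B" "i \<in> \<Psi> (B - A)" "q2 \<le> i" for i
      by (rule dependence_subset[OF dense_mono[OF 2] ce(2) Diff_subset that]) (simp add: k_def)
    have dense_W: "\<exists>a\<in>W m. agree k'' a b" if kb: "k \<le> k'" "b \<subseteq> B" "agree k' b c" for k' k'' b
    proof -
      have "dense_below (coherent_pair A m m1 q1) k' c e" by (rule dense_mono[OF 1]) (use kb in \<open>simp add: k_def\<close>)
      from this[unfolded dense_below_def, rule_format, OF kb(2) ce(2), of k''] kb(3)
      obtain c1 e1 where "coherent_pair A m m1 q1 c1 e1" "agree k'' c1 b" by auto
      then show ?thesis unfolding coherent_pair_def by blast
    qed
    \<comment> \<open>Frozen coordinates have the value \<open>v\<close> at \<open>c\<close>, so the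
      points below them lie almost all in \<open>c\<close> or almost all outside it, according to
      \<open>v\<close>. A generic \<open>c\<close> does this to no infinite set of frozen
      points.\<close>
    have fin_v: "finite (frozen v m k' c)" if "k \<le> k'" for v k'
    proof -
      define s' where "s' = c \<inter> {..<k'}"
      have s': "frozen v m k' c = frozen v m k' s'" by (rule frozen_cong) (simp add: s'_def)
      have val: "i \<in> \<Psi> c \<longleftrightarrow> v" if "i \<in> frozen v m k' c" for i
      proof -
        from that obtain k0 c0 where i: "i \<in> \<Psi> B" "dependence m k' c i = {}" "c0 \<subseteq> B" "agree k' c0 c" "decided m k0 c0 i v"
          unfolding frozen_def by blast
        obtain k3 w where w: "decided m k3 c i w" using genericD(3)[OF gen i(1)] by blast
        have "v = w"
        proof (rule decided_unique[OF i(1,2) _ i(3-5) ce(1) _ w])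
          show "\<exists>a\<in>W m. agree k'' a b" if "b \<subseteq> B" "agree k' b c" for k'' b
            by (rule dense_W[OF \<open>k \<le> k'\<close> that])
        qed simp
        then show ?thesis using w m unfolding decided_def by blast
      qed
      have "ev (\<lambda>n. n \<in> frozen_points v m k' s' \<longrightarrow> (n \<in> c \<longleftrightarrow> v))"
      proof (cases v)
        case True
        have "ev (\<lambda>n. n \<in> \<Psi> (frozen_points v m k' s') \<longrightarrow> n \<in> \<Psi> c)"
          using frozen_points(2)[of v m k' s'] by eventually_elim (use val True s' in auto)
        from ev_of_image[OF this] show ?thesis using True by simp
      next
        case False
        have "ev (\<lambda>n. n \<in> \<Psi> (frozen_points v m k' s') \<longrightarrow> n \<in> \<Psi> (- c))"
          using frozen_points(2)[of v m k' s'] compl[of c] by eventually_elim (use val False s' in auto)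
        from ev_of_image[OF this] show ?thesis using False by simp
      qed
      then obtain N where N: "\<And>n. N \<le> n \<Longrightarrow> n \<in> frozen_points v m k' s' \<Longrightarrow> n \<in> c \<longleftrightarrow> v"
        unfolding eventually_sequentially by blast
      have "finite (frozen_points v m k' s')"
      proof (rule ccontr)
        assume "infinite (frozen_points v m k' s')"
        moreover have "finite s'" by (simp add: s'_def)
        ultimately obtain n where "n \<in> frozen_points v m k' s'" "N \<le> n" "n \<in> c \<longleftrightarrow> \<not> v"
          using genericD(5)[OF gen] by blast
        with N show False by blast
      qed
      then have "ev (\<lambda>n. n \<notin> \<Psi> (frozen_points v m k' s'))" using image_finite finite_iff_ev by blast
      with frozen_points(2)[of v m k' s'] show ?thesis unfolding s' finite_iff_ev by eventually_elim auto
    qed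
    have fin: "finite {i \<in> \<Psi> B. dependence m k' c i = {}}" if "k \<le> k'" for k'
    proof (rule finite_subset)
      show "{i \<in> \<Psi> B. dependence m k' c i = {}} \<subseteq> frozen True m k' c \<union> frozen False m k' c"
      proof
        fix i assume i: "i \<in> {i \<in> \<Psi> B. dependence m k' c i = {}}"
        then have "i \<in> \<Psi> B" by blast
        from genericD(3)[OF gen this] obtain k3 w where w: "decided m k3 c i w" by blast
        have "i \<in> frozen w m k' c" unfolding frozen_def using i w ce(1) by blast
        then show "i \<in> frozen True m k' c \<union> frozen False m k' c" by (cases w) simp_all
      qed
      show "finite (frozen True m k' c \<union> frozen False m k' c)" using fin_v[OF that] by simp
    qed
    have "finite s" by (simp add: s_def)
    then obtain xs where xs: "set xs = s" using finite_list by blast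
    have dep: "dependence m k s i = dependence m k c i" for i by (rule dependence_cong) (simp add: s_def)
    define h' where "h' = h (m, k, xs)"
    have h': "h' = chosen_dependence m k s" by (simp add: h'_def h_def xs)
    \<comment> \<open>If \<open>h' i = n\<close> with n below i, then n bounds the dependence of i,
      which is therefore empty at level \<open>Suc n\<close>; there are only finitely many such
      i.\<close>
    have fib: "finite {i \<in> \<Psi> B. h' i = n}" for n
    proof (rule finite_subset)
      show "{i \<in> \<Psi> B. h' i = n} \<subseteq> {..n} \<union> {i \<in> \<Psi> B. dependence m (max k (Suc n)) c i = {}}"
      proof
        fix i assume i: "i \<in> {i \<in> \<Psi> B. h' i = n}"
        show "i \<in> {..n} \<union> {i \<in> \<Psi> B. dependence m (max k (Suc n)) c i = {}}"
        proof (cases "i \<le> n")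
          case False
          have "x \<le> n" if x: "x \<in> dependence m k c i" for x
            using chosen_dependence(2)[of m k s i x] i False x by (auto simp: dep h')
          moreover have "dependence m (max k (Suc n)) c i \<subseteq> dependence m k c i \<inter> {max k (Suc n)..}"
            by (rule dependence_mono) simp_all
          ultimately have "dependence m (max k (Suc n)) c i = {}" by fastforce
          then show ?thesis using i by simp
        qed simp
      qed
    qed (use fin[of "max k (Suc n)"] in simp)
    define j where "j = to_nat (m, k, xs)"
    have gj: "g j = h'" using fib by (simp add: g_def j_def h'_def[symmetric] Let_def)
    have "ev (\<lambda>i. i \<notin> {i \<in> \<Psi> B. dependence m k c i = {}})" using fin[OF le_refl] unfolding finite_iff_ev .
    moreover have "ev (\<lambda>i. max q1 q2 \<le> i)" by (rule eventually_ge_at_top)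
    ultimately have "ev (\<lambda>i. i \<in> \<Psi> B \<longrightarrow> (i \<in> \<Psi> A \<longleftrightarrow> g j i \<in> A))"
      using diff[of B A]
    proof eventually_elim
      case (elim i)
      show ?case
      proof
        assume "i \<in> \<Psi> B"
        with elim(1) have ne: "dependence m k s i \<noteq> {}" by (simp add: dep)
        from chosen_dependence(1)[OF ne] have gi: "g j i \<in> dependence m k c i" by (simp add: gj h' dep)
        show "i \<in> \<Psi> A \<longleftrightarrow> g j i \<in> A"
        proof (cases "i \<in> \<Psi> A")
          case True
          from dep_in[OF \<open>i \<in> \<Psi> B\<close> True] elim gi True show ?thesis by auto
        next
          case False
          with elim(3) \<open>i \<in> \<Psi> B\<close> have "i \<in> \<Psi> (B - A)" by simp
          from dep_out[OF \<open>i \<in> \<Psi> B\<close> this] elim gi False show ?thesis by auto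
        qed
      qed
    qed
    then show "\<exists>j. ev (\<lambda>i. i \<in> \<Psi> B \<longrightarrow> (i \<in> \<Psi> A \<longleftrightarrow> g j i \<in> A))" ..
  qed
qed

lemma trivial_almost_everywhere: "\<exists>S f. S \<subseteq> B \<and> finite (B - S) \<and> trivial_via S f"
proof -
  obtain g :: "nat \<Rightarrow> nat \<Rightarrow> nat" where g: "\<And>j n. finite {i \<in> \<Psi> B. g j i = n}"
    "\<And>A. A \<subseteq> B \<Longrightarrow> \<exists>j. ev (\<lambda>i. i \<in> \<Psi> B \<longrightarrow> (i \<in> \<Psi> A \<longleftrightarrow> g j i \<in> A))"
    by (rule countably_many_lifts) (rule that)
  from one_lift_of_countably_many[of B g, OF g(1) g(2)] obtain j where
    "\<forall>A\<subseteq>B. ev (\<lambda>i. i \<in> \<Psi> B \<longrightarrow> (i \<in> \<Psi> A \<longleftrightarrow> g j i \<in> A))" by blast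
  then have "ev (\<lambda>i. i \<in> \<Psi> B \<longrightarrow> (i \<in> \<Psi> A \<longleftrightarrow> g j i \<in> A))" if "A \<subseteq> B" for A using that by blast
  then show ?thesis by (rule trivial_of_lift)
qed

end

section \<open>Local continuity on the branches of a tree\<close>

context boolean_lift
begin

text \<open>Two branches meet only in the finite part below their split. A pair is coloured if the
  sets agree on that part while their images differ inside both branch images. A homogeneous family
  would be the traces of one set on its branches, so one image would account for all of them up to
  finite errors, which pigeonhole refutes. In the resulting cover, countably many branches carry
  representatives, and every other branch is compared with these.\<close>

lemma trivial_on_branches:
  fixes P :: "bool list \<Rightarrow> nat set"
  assumes OCA and fin: "\<And>t. finite (P t)" and disj: "\<And>s t. s \<noteq> t \<Longrightarrow> P s \<inter> P t = {}"
  shows "countable {x. \<not> (\<exists>S f. S \<subseteq> (\<Union>j. P (map x [0..<j])) \<and>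
    finite ((\<Union>j. P (map x [0..<j])) - S) \<and> trivial_via S f)}"
proof -
  define A where "A x = (\<Union>j. P (map x [0..<j]))" for x :: "nat \<Rightarrow> bool"
  define pre where "pre x k = (\<Union>j\<le>k. P (map x [0..<j]))" for x :: "nat \<Rightarrow> bool" and k
  have pre_fin: "finite (pre x k)" for x k using fin by (simp add: pre_def)
  have pre_A: "pre x k \<subseteq> A x" for x k by (auto simp: pre_def A_def)
  have pre_cong: "pre x k = pre y k" if "\<And>j. j < k \<Longrightarrow> x j = y j" for x y k
  proof -
    have "map x [0..<j] = map y [0..<j]" if "j \<le> k" for j unfolding map_upt_eq_iff using that \<open>\<And>j. j < k \<Longrightarrow> x j = y j\<close> by simp
    then show ?thesis unfolding pre_def by (intro SUP_cong refl arg_cong[of _ _ P]) (simp only: atMost_iff)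
  qed
  have pre_split: "pre x (split_level x y) = pre y (split_level x y)" if "x \<noteq> y" for x y
    by (rule pre_cong) (rule split_level_props(2)[OF that])
  have A_inter: "A x \<inter> A y \<subseteq> pre x (split_level x y)" if "x \<noteq> y" for x y
  proof
    fix n assume "n \<in> A x \<inter> A y"
    then obtain i j where ij: "n \<in> P (map x [0..<i])" "n \<in> P (map y [0..<j])" unfolding A_def by blast
    then have eq: "map x [0..<i] = map y [0..<j]" using disj by blast
    then have "length (map x [0..<i]) = length (map y [0..<j])" by (rule arg_cong)
    then have "i = j" by simp
    have "i \<le> split_level x y"
    proof (rule ccontr)
      assume "\<not> i \<le> split_level x y"
      then show False using eq split_level_props(1)[OF that] unfolding \<open>i = j\<close> map_upt_eq_iff by simp
    qed
    then show "n \<in> pre x (split_level x y)" using ij(1) unfolding pre_def by blast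
  qed
  define S where "S = {p. snd p \<subseteq> A (fst p)}"
  \<comment> \<open>Membership in the images is coded as well, since it need not depend continuously
    on the sets; this makes the colour open.\<close>
  define code where "code p n = to_nat (fst p n, n \<in> snd p, n \<in> \<Psi> (snd p), n \<in> \<Psi> (A (fst p)))"
    for p :: "(nat \<Rightarrow> bool) \<times> nat set" and n
  have code: "code p n = code q n \<longleftrightarrow> fst p n = fst q n \<and> (n \<in> snd p \<longleftrightarrow> n \<in> snd q) \<and>
    (n \<in> \<Psi> (snd p) \<longleftrightarrow> n \<in> \<Psi> (snd q)) \<and> (n \<in> \<Psi> (A (fst p)) \<longleftrightarrow> n \<in> \<Psi> (A (fst q)))" for p q n
    by (simp add: code_def)
  define K where "K p q \<longleftrightarrow> fst p \<noteq> fst q \<and>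
    (\<forall>n\<in>pre (fst p) (split_level (fst p) (fst q)). n \<in> snd p \<longleftrightarrow> n \<in> snd q) \<and>
    (\<exists>i\<in>\<Psi> (A (fst p)) \<inter> \<Psi> (A (fst q)). (i \<in> \<Psi> (snd p)) \<noteq> (i \<in> \<Psi> (snd q)))" for p q
  have inj: "inj_on code S"
  proof (rule inj_onI)
    fix p q assume "code p = code q"
    then have "code p n = code q n" for n by simp
    then have "fst p = fst q" "snd p = snd q" unfolding code by auto
    then show "p = q" by (rule prod_eqI)
  qed
  have K_sym: "K q p" if "K p q" for p q
    using that pre_split[of "fst p" "fst q"] split_level_sym[of "fst p" "fst q"] unfolding K_def by auto
  have K_open: "\<exists>N. \<forall>p'\<in>S. \<forall>q'\<in>S. (\<forall>n<N. code p' n = code p n) \<and> (\<forall>n<N. code q' n = code q n) \<longrightarrow> K p' q'"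
    if "K p q" for p q
  proof -
    define k where "k = split_level (fst p) (fst q)"
    from that obtain i where i: "i \<in> \<Psi> (A (fst p))" "i \<in> \<Psi> (A (fst q))" "(i \<in> \<Psi> (snd p)) \<noteq> (i \<in> \<Psi> (snd q))"
      and ne: "fst p \<noteq> fst q" and ag: "\<forall>n\<in>pre (fst p) k. n \<in> snd p \<longleftrightarrow> n \<in> snd q"
      unfolding K_def k_def by blast
    obtain M where M: "\<forall>n\<in>pre (fst p) k. n < M" using pre_fin unfolding finite_nat_set_iff_bounded ..
    define N where "N = max M (max (Suc k) (Suc i))"
    show ?thesis
    proof (intro exI[of _ N] ballI impI, elim conjE)
      fix p' q' assume p': "\<forall>n<N. code p' n = code p n" and q': "\<forall>n<N. code q' n = code q n"
      note p'' = p'[rule_format, unfolded code] and q'' = q'[rule_format, unfolded code]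
      have kN: "k < N" "i < N" by (auto simp: N_def)
      have sl: "split_level (fst p') (fst q') = k"
      proof (rule split_levelI)
        show "fst p' j = fst q' j" if "j < k" for j
          using p''[of j] q''[of j] that kN split_level_props(2)[OF ne, of j] by (simp add: k_def)
        show "fst p' k \<noteq> fst q' k"
          using p''[of k] q''[of k] kN split_level_props(1)[OF ne] by (simp add: k_def)
      qed
      have ne': "fst p' \<noteq> fst q'" using p''[of k] q''[of k] kN split_level_props(1)[OF ne] by (auto simp: k_def)
      have pr: "pre (fst p') k = pre (fst p) k" by (rule pre_cong) (use p'' kN in simp)
      have "n \<in> snd p' \<longleftrightarrow> n \<in> snd q'" if "n \<in> pre (fst p) k" for n
      proof -
        have "n < N" using M that by (simp add: N_def less_max_iff_disj)
        then show ?thesis using p''[of n] q''[of n] ag that by simp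
      qed
      moreover have "i \<in> \<Psi> (A (fst p'))" "i \<in> \<Psi> (A (fst q'))" "(i \<in> \<Psi> (snd p')) \<noteq> (i \<in> \<Psi> (snd q'))"
        using i p''[OF kN(2)] q''[OF kN(2)] by simp_all
      ultimately show "K p' q'" unfolding K_def sl pr using ne' by blast
    qed
  qed
  have no_hom: "\<exists>p\<in>Y. \<exists>q\<in>Y. p \<noteq> q \<and> \<not> K p q" if Y: "Y \<subseteq> S" "uncountable Y" for Y
  proof (rule ccontr)
    assume none: "\<not> ?thesis"
    have hom: "K p q" if "p \<in> Y" "q \<in> Y" "p \<noteq> q" for p q
      using none that by blast
    \<comment> \<open>Agreement below the splits makes the trace of \<open>c\<close> on the branch
      of \<open>p\<close> equal to \<open>snd p\<close>, so the images are almost traces of the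
      single set \<open>\<Psi> c\<close>.\<close>
    define c where "c = (\<Union>p\<in>Y. snd p)"
    have c: "c \<inter> A (fst p) = snd p" if p: "p \<in> Y" for p
    proof
      show "snd p \<subseteq> c \<inter> A (fst p)" using p Y(1) by (auto simp: c_def S_def)
      show "c \<inter> A (fst p) \<subseteq> snd p"
      proof
        fix n assume n: "n \<in> c \<inter> A (fst p)"
        then obtain q where q: "q \<in> Y" "n \<in> snd q" by (auto simp: c_def)
        show "n \<in> snd p"
        proof (cases "p = q")
          case False
          have K: "K p q" by (rule hom[OF p q(1) False])
          have "n \<in> A (fst q)" using q Y(1) by (auto simp: S_def)
          then have "n \<in> pre (fst p) (split_level (fst p) (fst q))" using A_inter[of "fst p" "fst q"] K n by (auto simp: K_def)
          then show ?thesis using K q(2) unfolding K_def by blast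
        qed (use q in simp)
      qed
    qed
    have "\<exists>N. \<forall>i\<ge>N. i \<in> \<Psi> (snd p) \<longleftrightarrow> i \<in> \<Psi> c \<and> i \<in> \<Psi> (A (fst p))" if "p \<in> Y" for p
      using inter[of c "A (fst p)"] unfolding c[OF that] eventually_sequentially .
    then have "\<exists>N. \<forall>p\<in>Y. \<forall>i\<ge>N p. i \<in> \<Psi> (snd p) \<longleftrightarrow> i \<in> \<Psi> c \<and> i \<in> \<Psi> (A (fst p))"
      by (intro bchoice ballI)
    then obtain N where N: "\<And>p i. p \<in> Y \<Longrightarrow> N p \<le> i \<Longrightarrow> i \<in> \<Psi> (snd p) \<longleftrightarrow> i \<in> \<Psi> c \<and> i \<in> \<Psi> (A (fst p))" by blast
    obtain p q where pq: "p \<in> Y" "q \<in> Y" "p \<noteq> q" "(N p, map (\<lambda>i. i \<in> \<Psi> (snd p)) [0..<N p]) = (N q, map (\<lambda>i. i \<in> \<Psi> (snd q)) [0..<N q])"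
      by (rule uncountable_collision[OF Y(2), of "\<lambda>p. (N p, map (\<lambda>i. i \<in> \<Psi> (snd p)) [0..<N p])"])
    from hom[OF pq(1-3)] obtain i where i: "i \<in> \<Psi> (A (fst p))" "i \<in> \<Psi> (A (fst q))" "(i \<in> \<Psi> (snd p)) \<noteq> (i \<in> \<Psi> (snd q))"
      unfolding K_def by blast
    have Npq: "N p = N q" using pq(4) by simp
    then have below: "\<forall>i<N q. (i \<in> \<Psi> (snd p)) = (i \<in> \<Psi> (snd q))" using pq(4) by (simp add: map_upt_eq_iff)
    show False
    proof (cases "i < N q")
      case True
      then show ?thesis using below i(3) by blast
    next
      case False
      then show ?thesis using N[OF pq(1), of i] N[OF pq(2), of i] i Npq by simp
    qed
  qed
  obtain Z :: "nat \<Rightarrow> ((nat \<Rightarrow> bool) \<times> nat set) set" where Z: "S = (\<Union>m. Z m)"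
    "\<And>m p q. p \<in> Z m \<Longrightarrow> q \<in> Z m \<Longrightarrow> p \<noteq> q \<Longrightarrow> \<not> K p q"
  proof (rule OCA_coded[OF \<open>OCA\<close> inj])
    show "K q p" if "K p q" for p q using that by (rule K_sym)
    show "\<exists>N. \<forall>p'\<in>S. \<forall>q'\<in>S. (\<forall>n<N. code p' n = code p n) \<and> (\<forall>n<N. code q' n = code q n) \<longrightarrow> K p' q'"
      if "K p q" for p q using that by (rule K_open)
    show "\<exists>p\<in>Y. \<exists>q\<in>Y. p \<noteq> q \<and> \<not> K p q" if "Y \<subseteq> S" "uncountable Y" for Y
      using that by (rule no_hom)
    fix Z :: "nat \<Rightarrow> ((nat \<Rightarrow> bool) \<times> nat set) set"
    assume 1: "S = (\<Union>m. Z m)" and 2: "\<And>m p q. p \<in> Z m \<Longrightarrow> q \<in> Z m \<Longrightarrow> p \<noteq> q \<Longrightarrow> \<not> K p q"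
    show thesis by (rule that[OF 1 2])
  qed
  \<comment> \<open>One member of each piece for every finite part of a code; their branches are the
    exceptional ones.\<close>
  define rep where "rep m l = (SOME p. p \<in> Z m \<and> map (code p) [0..<length l] = l)" for m l
  define X0 where "X0 = (\<lambda>(m, l). fst (rep m l)) ` (UNIV :: (nat \<times> nat list) set)"
  have "countable X0" unfolding X0_def by simp
  have rep: "\<exists>q\<in>Z m. fst q \<in> X0 \<and> (\<forall>n<N. code q n = code p n)" if "p \<in> Z m" for m N p
  proof -
    define l where "l = map (code p) [0..<N]"
    have "p \<in> Z m \<and> map (code p) [0..<length l] = l" using that by (simp add: l_def)
    from someI[of "\<lambda>p. p \<in> Z m \<and> map (code p) [0..<length l] = l", OF this]
    have q: "rep m l \<in> Z m" "map (code (rep m l)) [0..<length l] = l" by (simp_all add: rep_def)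
    have "fst (rep m l) \<in> X0" unfolding X0_def by (rule image_eqI[of _ _ "(m, l)"]) simp_all
    moreover have "\<forall>n<N. code (rep m l) n = code p n"
    proof -
      have "length l = N" by (simp add: l_def)
      with q(2) have "map (code (rep m l)) [0..<N] = map (code p) [0..<N]" by (simp add: l_def)
      then show ?thesis unfolding map_upt_eq_iff .
    qed
    ultimately show ?thesis using q(1) by blast
  qed
  have "\<exists>S f. S \<subseteq> A x \<and> finite (A x - S) \<and> trivial_via S f" if x: "x \<notin> X0" for x
  proof -
    define W where "W m = {a. (x, a) \<in> Z m}" for m
    interpret L: locally_continuous_lift \<Psi> "A x" W
    proof
      show "\<exists>m. a \<in> W m" if "a \<subseteq> A x" for a
      proof -
        have "(x, a) \<in> S" using that by (simp add: S_def)
        then show ?thesis unfolding Z(1) W_def by blast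
      qed
      fix i s k m assume i: "i \<in> \<Psi> (A x)" and s: "s \<subseteq> A x"
      show "\<exists>k' s' v. k \<le> k' \<and> s' \<subseteq> A x \<and> agree k s' s \<and> (\<forall>a\<in>W m. agree k' a s' \<longrightarrow> (i \<in> \<Psi> a \<longleftrightarrow> v))"
      proof (cases "\<exists>a\<in>W m. agree k a s")
        case False
        then show ?thesis using s by (intro exI[of _ k] exI[of _ s]) blast
      next
        case True
        then obtain a0 where a0: "(x, a0) \<in> Z m" "agree k a0 s" unfolding W_def by blast
        have "(x, a0) \<in> S" using a0(1) Z(1) by blast
        then have a0A: "a0 \<subseteq> A x" by (simp add: S_def)
        define N where "N = max k (Suc i)"
        from rep[OF a0(1), of N] obtain q where q: "q \<in> Z m" "fst q \<in> X0" "\<forall>n<N. code q n = code (x, a0) n" by blast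
        note qc = q(3)[rule_format, unfolded code fst_conv snd_conv]
        have xq: "x \<noteq> fst q" using x q(2) by auto
        have "q \<in> S" using q(1) Z(1) by blast
        then have qA: "snd q \<subseteq> A (fst q)" by (simp add: S_def)
        have iN: "i < N" by (simp add: N_def)
        define l where "l = split_level x (fst q)"
        obtain M where M: "\<forall>n\<in>pre x l. n < M" using pre_fin unfolding finite_nat_set_iff_bounded ..
        \<comment> \<open>The representative \<open>q\<close> lies on another branch, so only its
          part below the split concerns \<open>x\<close>. Members of the piece over \<open>x\<close>
          that agree with it there are not coloured with \<open>q\<close>, hence share its value at
          \<open>i\<close>.\<close>
        define s' where "s' = snd q \<inter> pre x l"
        show ?thesis
        proof (intro exI conjI)
          show "k \<le> max k M" by simp
          show "s' \<subseteq> A x" using pre_A unfolding s'_def by blast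
          show "agree k s' s"
          proof (intro allI impI)
            fix n assume "n < k"
            then have n: "n \<in> snd q \<longleftrightarrow> n \<in> a0" "n \<in> a0 \<longleftrightarrow> n \<in> s" using qc[of n] a0(2) by (simp_all add: N_def)
            have "n \<in> pre x l" if "n \<in> a0" "n \<in> snd q"
              using that a0A qA A_inter[OF xq] unfolding l_def by blast
            then show "n \<in> s' \<longleftrightarrow> n \<in> s" using n unfolding s'_def by blast
          qed
          show "\<forall>a\<in>W m. agree (max k M) a s' \<longrightarrow> (i \<in> \<Psi> a \<longleftrightarrow> i \<in> \<Psi> (snd q))"
          proof (intro ballI impI)
            fix a assume a: "a \<in> W m" and ag: "agree (max k M) a s'"
            have "(x, a) \<noteq> q" using xq by auto
            from Z(2)[OF _ q(1) this] a have nK: "\<not> K (x, a) q" by (simp add: W_def)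
            have "\<forall>n\<in>pre x l. n \<in> a \<longleftrightarrow> n \<in> snd q"
            proof
              fix n assume n: "n \<in> pre x l"
              then have "n < max k M" using M by (simp add: less_max_iff_disj)
              then show "n \<in> a \<longleftrightarrow> n \<in> snd q" using ag n by (simp add: s'_def)
            qed
            moreover have "i \<in> \<Psi> (A (fst q))" using qc[OF iN] i by simp
            ultimately show "i \<in> \<Psi> a \<longleftrightarrow> i \<in> \<Psi> (snd q)" using nK xq i unfolding K_def l_def by auto
          qed
        qed
      qed
    qed
    show ?thesis by (rule L.trivial_almost_everywhere)
  qed
  then have "{x. \<not> (\<exists>S f. S \<subseteq> A x \<and> finite (A x - S) \<and> trivial_via S f)} \<subseteq> X0" by blast
  from countable_subset[OF this \<open>countable X0\<close>] show ?thesis unfolding A_def .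
qed

end

section \<open>Automorphisms are induced by point maps\<close>

text \<open>Ramsey's theorem: the other homogeneous colour would give a point with infinitely many
  neighbours.\<close>

lemma infinite_independent_subset:
  fixes A :: "nat set"
  assumes "infinite A" and sym: "\<And>a b. r a b \<Longrightarrow> r b a" and fin: "\<And>a. a \<in> A \<Longrightarrow> finite {b \<in> A. r a b}"
  obtains M where "M \<subseteq> A" "infinite M" "\<And>a b. a \<in> M \<Longrightarrow> b \<in> M \<Longrightarrow> a \<noteq> b \<Longrightarrow> \<not> r a b"
proof -
  define col where "col X = (if \<exists>a b. X = {a, b} \<and> r a b then 1 else 0 :: nat)" for X :: "nat set"
  have "\<forall>a\<in>A. \<forall>b\<in>A. a \<noteq> b \<longrightarrow> col {a, b} < 2" by (simp add: col_def)
  from Ramsey2[OF \<open>infinite A\<close> this] obtain M t where M: "M \<subseteq> A" "infinite M"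
    "\<forall>a\<in>M. \<forall>b\<in>M. a \<noteq> b \<longrightarrow> col {a, b} = t" by blast
  have col: "col {a, b} = (if r a b then 1 else 0)" for a b
  proof -
    have "(\<exists>a' b'. {a, b} = {a', b'} \<and> r a' b') \<longleftrightarrow> r a b"
    proof
      assume "\<exists>a' b'. {a, b} = {a', b'} \<and> r a' b'"
      then obtain a' b' where "{a, b} = {a', b'}" and r: "r a' b'" by blast
      then have "a = a' \<and> b = b' \<or> a = b' \<and> b = a'" by (simp only: doubleton_eq_iff)
      then show "r a b" using r sym[OF r] by (elim disjE conjE) simp_all
    qed blast
    then show ?thesis by (simp add: col_def)
  qed
  from M(2) have "M \<noteq> {}" by auto
  then obtain a where "a \<in> M" by blast
  have "t = 0"
  proof (rule ccontr)
    assume "t \<noteq> 0"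
    have "M - {a} \<subseteq> {b \<in> A. r a b}"
    proof
      fix b assume b: "b \<in> M - {a}"
      then have "col {a, b} = t" using M(3)[rule_format, of a b] \<open>a \<in> M\<close> by simp
      then have "r a b" using \<open>t \<noteq> 0\<close> unfolding col by (auto split: if_splits)
      then show "b \<in> {b \<in> A. r a b}" using b M(1) by auto
    qed
    from finite_subset[OF this fin] have "finite (M - {a})" using M(1) \<open>a \<in> M\<close> by blast
    then show False using M(2) by simp
  qed
  have "\<not> r a b" if "a \<in> M" "b \<in> M" "a \<noteq> b" for a b
    using M(3)[rule_format, OF that] unfolding col \<open>t = 0\<close> by (auto split: if_splits)
  then show thesis using that[OF M(1,2)] by blast
qed

text \<open>Greedy choice. The edges already chosen have at most \<open>2 * card R\<close> ends, and
  by injectivity each end excludes at most two indices, one through \<open>u\<close> and one through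
  \<open>v\<close>; this is the origin of the factor 4 in the colour.\<close>

lemma disjoint_edges:
  fixes u v :: "'r \<Rightarrow> nat \<Rightarrow> nat"
  assumes "finite R" and "\<And>r. r \<in> R \<Longrightarrow> finite (I r) \<and> 4 * card R \<le> card (I r) \<and> inj_on (u r) (I r) \<and> inj_on (v r) (I r)"
  shows "\<exists>\<nu>. (\<forall>r\<in>R. \<nu> r \<in> I r) \<and>
    (\<forall>r\<in>R. \<forall>r'\<in>R. r \<noteq> r' \<longrightarrow> {u r (\<nu> r), v r (\<nu> r)} \<inter> {u r' (\<nu> r'), v r' (\<nu> r')} = {})"
  using assms
proof (induction R rule: finite_induct)
  case (insert r R)
  have prem: "finite (I r') \<and> 4 * card R + 4 \<le> card (I r') \<and> inj_on (u r') (I r') \<and> inj_on (v r') (I r')"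
    if "r' \<in> insert r R" for r' using insert.prems[OF that] insert.hyps by simp
  have "\<exists>\<nu>. (\<forall>r\<in>R. \<nu> r \<in> I r) \<and>
    (\<forall>r\<in>R. \<forall>r'\<in>R. r \<noteq> r' \<longrightarrow> {u r (\<nu> r), v r (\<nu> r)} \<inter> {u r' (\<nu> r'), v r' (\<nu> r')} = {})"
  proof (rule insert.IH)
    fix r' assume "r' \<in> R"
    then have "r' \<in> insert r R" by simp
    from prem[OF this] show "finite (I r') \<and> 4 * card R \<le> card (I r') \<and> inj_on (u r') (I r') \<and> inj_on (v r') (I r')"
      by simp
  qed
  then obtain \<nu> where \<nu>: "\<forall>r\<in>R. \<nu> r \<in> I r"
    "\<forall>r\<in>R. \<forall>r'\<in>R. r \<noteq> r' \<longrightarrow> {u r (\<nu> r), v r (\<nu> r)} \<inter> {u r' (\<nu> r'), v r' (\<nu> r')} = {}" by blast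
  define U where "U = (\<lambda>r. u r (\<nu> r)) ` R \<union> (\<lambda>r. v r (\<nu> r)) ` R"
  have "finite U" using insert.hyps by (simp add: U_def)
  have "card U \<le> card ((\<lambda>r. u r (\<nu> r)) ` R) + card ((\<lambda>r. v r (\<nu> r)) ` R)"
    unfolding U_def by (rule card_Un_le)
  also have "\<dots> \<le> card R + card R" by (intro add_mono card_image_le insert.hyps)
  finally have U: "card U \<le> 2 * card R" by simp
  have p: "finite (I r)" "4 * card R + 4 \<le> card (I r)" "inj_on (u r) (I r)" "inj_on (v r) (I r)" using prem[of r] by simp_all
  define bad where "bad = {i \<in> I r. u r i \<in> U} \<union> {i \<in> I r. v r i \<in> U}"
  have c1: "card {i \<in> I r. u r i \<in> U} \<le> card U"
    by (rule card_inj_on_le[of "u r"]) (use p \<open>finite U\<close> in \<open>auto intro: inj_on_subset\<close>)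
  have c2: "card {i \<in> I r. v r i \<in> U} \<le> card U"
    by (rule card_inj_on_le[of "v r"]) (use p \<open>finite U\<close> in \<open>auto intro: inj_on_subset\<close>)
  have "card bad \<le> card {i \<in> I r. u r i \<in> U} + card {i \<in> I r. v r i \<in> U}" unfolding bad_def by (rule card_Un_le)
  also have "\<dots> < card (I r)" using c1 c2 U p(2) by linarith
  finally have "\<not> I r \<subseteq> bad" using card_mono[of bad "I r"] p(1) unfolding bad_def by auto
  then obtain i where i: "i \<in> I r" "i \<notin> bad" by blast
  have iU: "u r i \<notin> U" "v r i \<notin> U" using i by (auto simp: bad_def)
  show ?case
  proof (intro exI[of _ "\<nu>(r := i)"] conjI ballI impI)
    show "(\<nu>(r := i)) s \<in> I s" if "s \<in> insert r R" for s using that \<nu>(1) i(1) by auto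
    fix s s' assume s: "s \<in> insert r R" "s' \<in> insert r R" "s \<noteq> s'"
    have R: "u t (\<nu> t) \<in> U" "v t (\<nu> t) \<in> U" if "t \<in> R" for t using that by (simp_all add: U_def)
    from s consider "s = r" "s' \<noteq> r" "s' \<in> R" | "s' = r" "s \<noteq> r" "s \<in> R" | "s \<noteq> r" "s' \<noteq> r" "s \<in> R" "s' \<in> R" by blast
    then show "{u s ((\<nu>(r := i)) s), v s ((\<nu>(r := i)) s)} \<inter> {u s' ((\<nu>(r := i)) s'), v s' ((\<nu>(r := i)) s')} = {}"
    proof cases
      case 1
      then show ?thesis using R[of s'] iU by (simp, metis)
    next
      case 2
      then show ?thesis using R[of s] iU by (simp, metis)
    next
      case 3
      then show ?thesis using \<nu>(2) s(3) by simp
    qed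
  qed
qed simp

section \<open>Trivializing maps as a coherent family\<close>

context boolean_lift
begin

lemma trivial_subset: "trivial_via S f \<Longrightarrow> T \<subseteq> S \<Longrightarrow> trivial_via T f"
  unfolding trivial_via_def by (meson inj_on_subset subset_trans)

lemma trivial_inj: "trivial_via S f \<Longrightarrow> inj_on f S"
  and trivial_image: "trivial_via S f \<Longrightarrow> C \<subseteq> S \<Longrightarrow> ev (\<lambda>n. n \<in> \<Psi> C \<longleftrightarrow> n \<in> f ` C)"
  unfolding trivial_via_def by blast+

text \<open>An infinite set of disagreement can be thinned to an \<open>M\<close> whose images under
  \<open>f\<close> and \<open>g\<close> are disjoint, although both are almost
  \<open>\<Psi> M\<close>.\<close>

lemma trivial_maps_agree:
  assumes f: "trivial_via S f" and g: "trivial_via T g"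
  shows "finite {n \<in> S \<inter> T. f n \<noteq> g n}"
proof (rule ccontr)
  define D where "D = {n \<in> S \<inter> T. f n \<noteq> g n}"
  have fD: "trivial_via D f" and gD: "trivial_via D g"
    using trivial_subset[OF f, of D] trivial_subset[OF g, of D] by (auto simp: D_def)
  assume "infinite {n \<in> S \<inter> T. f n \<noteq> g n}"
  then have "infinite D" by (simp add: D_def)
  then obtain M where M: "M \<subseteq> D" "infinite M" "\<And>a b. a \<in> M \<Longrightarrow> b \<in> M \<Longrightarrow> a \<noteq> b \<Longrightarrow> \<not> (f a = g b \<or> f b = g a)"
  proof (rule infinite_independent_subset[where r = "\<lambda>a b. f a = g b \<or> f b = g a"])
    fix a assume "a \<in> D"
    have "finite {b \<in> D. g b = f a}"
      using finite_vimage_IntI[of "{f a}" g D] trivial_inj[OF gD] by (simp add: vimage_def Int_def conj_commute)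
    moreover have "finite {b \<in> D. f b = g a}"
      using finite_vimage_IntI[of "{g a}" f D] trivial_inj[OF fD] by (simp add: vimage_def Int_def conj_commute)
    ultimately have "finite ({b \<in> D. g b = f a} \<union> {b \<in> D. f b = g a})" by simp
    then show "finite {b \<in> D. f a = g b \<or> f b = g a}" by (rule rev_finite_subset) auto
  qed blast+
  have "f ` M \<inter> g ` M = {}"
  proof -
    have "f a \<noteq> g b" if "a \<in> M" "b \<in> M" for a b
    proof (cases "a = b")
      case True
      then show ?thesis using M(1) that by (auto simp: D_def)
    next
      case False
      then show ?thesis using M(3)[OF that] by blast
    qed
    then show ?thesis by blast
  qed
  then have disj: "n \<notin> f ` M \<or> n \<notin> g ` M" for n by blast
  from trivial_image[OF fD M(1)] trivial_image[OF gD M(1)] have "finite (\<Psi> M)"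
    unfolding finite_iff_ev by eventually_elim (use disj in auto)
  then show False using M(2) finite_iff by blast
qed

text \<open>The two parts are disjoint, so their images under \<open>f\<close> and \<open>g\<close>
  meet only in a finite set \<open>X\<close>; removing the points that \<open>f\<close> sends into
  \<open>X\<close> restores injectivity.\<close>

lemma trivial_mix:
  assumes f: "trivial_via S f" and g: "trivial_via T g"
  shows "\<exists>R. R \<subseteq> (S \<inter> M) \<union> (T - M) \<and> finite ((S \<inter> M) \<union> (T - M) - R) \<and>
    trivial_via R (\<lambda>n. if n \<in> M then f n else g n)"
proof -
  define h where "h n = (if n \<in> M then f n else g n)" for n
  define X where "X = f ` (S \<inter> M) \<inter> g ` (T - M)"
  define R where "R = {n \<in> S \<inter> M. f n \<notin> X} \<union> (T - M)"
  have "S \<inter> M \<inter> (T - M) = {}" by blast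
  then have "ev (\<lambda>n. n \<notin> \<Psi> (S \<inter> M \<inter> (T - M)))" using finite_iff[of "{}"] finite_iff_ev by simp
  then have "finite X"
    using trivial_image[OF f Int_lower1[of S M]] trivial_image[OF g Diff_subset[of T M]] inter[of "S \<inter> M" "T - M"]
    unfolding finite_iff_ev by eventually_elim (auto simp: X_def)
  have "finite ((S \<inter> M) \<union> (T - M) - R)"
  proof (rule finite_subset)
    show "(S \<inter> M) \<union> (T - M) - R \<subseteq> f -` X \<inter> S" by (auto simp: R_def)
    show "finite (f -` X \<inter> S)" by (rule finite_vimage_IntI[OF \<open>finite X\<close> trivial_inj[OF f]])
  qed
  moreover have "trivial_via R h"
    unfolding trivial_via_def
  proof (intro conjI allI impI)
    show "inj_on h R"
    proof (rule inj_onI)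
      fix a b assume ab: "a \<in> R" "b \<in> R" "h a = h b"
      have cross: False if "a \<in> R" "b \<in> R" "h a = h b" "a \<in> M" "b \<notin> M" for a b
      proof -
        have "f a = g b" "b \<in> T - M" "a \<in> S \<inter> M" "f a \<notin> X" using that by (auto simp: R_def h_def)
        then show False unfolding X_def by blast
      qed
      show "a = b"
      proof (cases "a \<in> M \<longleftrightarrow> b \<in> M")
        case True
        then show ?thesis using ab inj_onD[OF trivial_inj[OF f], of a b] inj_onD[OF trivial_inj[OF g], of a b]
          by (cases "a \<in> M") (simp_all add: R_def h_def)
      next
        case False
        then show ?thesis using cross[of a b] cross[of b a] ab by auto
      qed
    qed
    fix C assume C: "C \<subseteq> R"
    have sub: "C \<inter> M \<subseteq> S" "C - M \<subseteq> T" using C by (auto simp: R_def)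
    have im: "h ` C = f ` (C \<inter> M) \<union> g ` (C - M)" by (auto simp: h_def)
    have CM: "(C \<inter> M) \<union> (C - M) = C" by blast
    show "ev (\<lambda>n. n \<in> \<Psi> C \<longleftrightarrow> n \<in> h ` C)"
      using trivial_image[OF f sub(1)] trivial_image[OF g sub(2)] union[of "C \<inter> M" "C - M"]
      unfolding CM im by eventually_elim blast
  qed
  moreover have "R \<subseteq> (S \<inter> M) \<union> (T - M)" by (auto simp: R_def)
  ultimately show ?thesis unfolding h_def by blast
qed

text \<open>The tasks are built into the tree: node \<open>t\<close> holds a set
  \<open>w m b\<close> for each \<open>m\<close> up to its length, in a block of its own. Every
  branch then contains infinitely many sets of each sequence, and some branch is trivial up to a
  finite set.\<close>

lemma trivial_reservoir:
  fixes w :: "nat \<Rightarrow> nat \<Rightarrow> nat set"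
  assumes OCA and w: "\<And>m i. finite (w m i) \<and> w m i \<subseteq> {i..}"
  shows "\<exists>S f. trivial_via S f \<and> (\<forall>m. infinite {i. w m i \<subseteq> S})"
proof -
  define piece where "piece j b = (\<Union>m\<le>length (from_nat j :: bool list). w m b)" for j b
  have piece: "finite (piece j b)" "piece j b \<subseteq> {b..}" for j b using w by (auto simp: piece_def)
  define base where "base = rec_nat 0 (\<lambda>j b. Suc (Max (insert b (piece j b))))"
  have base_Suc: "base (Suc j) = Suc (Max (insert (base j) (piece j (base j))))" for j by (simp add: base_def)
  have base: "base j < base (Suc j)" "n \<in> piece j (base j) \<Longrightarrow> n < base (Suc j)" for j n
    unfolding base_Suc using piece(1) by (simp_all add: less_Suc_eq_le)
  have mono: "strict_mono base" using base(1) by (simp add: strict_mono_Suc_iff)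
  define P where "P t = piece (to_nat t) (base (to_nat t))" for t :: "bool list"
  have P_disj: "P s \<inter> P t = {}" if "s \<noteq> t" for s t
  proof -
    have ord: "piece i (base i) \<inter> piece j (base j) = {}" if "i < j" for i j
    proof -
      have "base (Suc i) \<le> base j" using that mono by (simp add: strict_mono_less_eq Suc_le_eq)
      then show ?thesis using base(2)[of _ i] piece(2)[of j "base j"] by fastforce
    qed
    have "to_nat s \<noteq> to_nat t" using that by simp
    then consider "to_nat s < to_nat t" | "to_nat t < to_nat s" by linarith
    then show ?thesis unfolding P_def using ord[of "to_nat s" "to_nat t"] ord[of "to_nat t" "to_nat s"] by cases blast+
  qed
  define A where "A x = (\<Union>j. P (map x [0..<j]))" for x :: "nat \<Rightarrow> bool"
  have "countable {x. \<not> (\<exists>S f. S \<subseteq> A x \<and> finite (A x - S) \<and> trivial_via S f)}"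
    unfolding A_def by (rule trivial_on_branches[OF \<open>OCA\<close> _ P_disj]) (simp_all add: P_def piece)
  then have "{x. \<not> (\<exists>S f. S \<subseteq> A x \<and> finite (A x - S) \<and> trivial_via S f)} \<noteq> UNIV"
    using uncountable_binary_sequences by metis
  then obtain x S f where S: "finite (A x - S)" "trivial_via S f" by blast
  have "infinite {i. w m i \<subseteq> S}" for m
  proof -
    obtain M where M: "\<forall>n\<in>A x - S. n < M" using S(1) unfolding finite_nat_set_iff_bounded ..
    define b where "b j = base (to_nat (map x [0..<j]))" for j
    have "inj b"
    proof (rule injI)
      fix i j assume "b i = b j"
      then have "to_nat (map x [0..<i]) = to_nat (map x [0..<j])"
        unfolding b_def by (rule injD[OF strict_mono_imp_inj_on[OF mono]])
      then have "length (map x [0..<i]) = length (map x [0..<j])" by simp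
      then show "i = j" by simp
    qed
    then have "inj_on b {m..}" by (rule inj_on_subset) simp
    then have inf: "infinite (b ` {m..})" using infinite_Ici finite_imageD by blast
    have "b ` {m..} - {..<M} \<subseteq> {i. w m i \<subseteq> S}"
    proof
      fix i assume i: "i \<in> b ` {m..} - {..<M}"
      then obtain j where j: "m \<le> j" "i = b j" by auto
      have "w m i \<subseteq> P (map x [0..<j])" using j by (auto simp: P_def piece_def b_def)
      then have "w m i \<subseteq> A x" by (auto simp: A_def)
      moreover have "n \<notin> A x - S" if "n \<in> w m i" for n
      proof -
        have "i \<le> n" using w[of m i] that by auto
        moreover have "M \<le> i" using i by simp
        ultimately show ?thesis using M by (meson not_le order_trans)
      qed
      ultimately show "i \<in> {i. w m i \<subseteq> S}" by blast
    qed
    moreover have "infinite (b ` {m..} - {..<M})" using inf by simp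
    ultimately show ?thesis using finite_subset by blast
  qed
  then show ?thesis using S(2) by blast
qed

text \<open>A map that trivializes the automorphism on \<open>S\<close> becomes a partial section of \<open>\<nat> \<times> {0}\<close> with domain \<open>S\<close>.\<close>
definition trivial_points :: "section_point set" where
  "trivial_points = {p. trivial_via (dom (fst p)) (snd p) \<and> ran (fst p) \<subseteq> {0}}"

lemma trivial_pointI:
  "trivial_via S f \<Longrightarrow> (\<lambda>n. if n \<in> S then Some 0 else None, f) \<in> trivial_points"
proof -
  have "dom (\<lambda>n. if n \<in> S then Some 0 else None) = S" "ran (\<lambda>n. if n \<in> S then Some 0 else None) \<subseteq> {0::nat}"
    by (auto simp: dom_def ran_def split: if_splits)
  note dr = this
  assume "trivial_via S f"
  then show ?thesis unfolding trivial_points_def mem_Collect_eq fst_conv snd_conv dr(1) using dr(2) by blast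
qed

lemma trivial_point_value: "p \<in> trivial_points \<Longrightarrow> fst p n = (if n \<in> dom (fst p) then Some 0 else None)"
  unfolding trivial_points_def by (auto simp: ran_def dom_def)

abbreviation discrete_dist :: "nat \<Rightarrow> nat \<Rightarrow> nat \<Rightarrow> real" where
  "discrete_dist n u v \<equiv> (if u = v then 0 else 1)"

lemma clash_trivial:
  assumes "p \<in> trivial_points" "q \<in> trivial_points" "0 < e"
  shows "clash discrete_dist e p q \<subseteq> {n \<in> dom (fst p) \<inter> dom (fst q). snd p n \<noteq> snd q n}"
proof
  fix n assume "n \<in> clash discrete_dist e p q"
  then show "n \<in> {n \<in> dom (fst p) \<inter> dom (fst q). snd p n \<noteq> snd q n}"
    using \<open>0 < e\<close> by (auto simp: clash_def split: if_splits)
qed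

lemma finite_clash_trivial:
  assumes "p \<in> trivial_points" "q \<in> trivial_points" "0 < e"
  shows "finite (clash discrete_dist e p q)"
  by (rule finite_subset[OF clash_trivial[OF assms]], rule trivial_maps_agree)
    (use assms in \<open>simp_all add: trivial_points_def\<close>)

lemma coherent_trivial_points:
  assumes OCA
  shows "coherent_points discrete_dist {0} trivial_points"
proof
  show "discrete_dist n u v = discrete_dist n v u" for n u v by auto
  show "discrete_dist n u w \<le> discrete_dist n u v + discrete_dist n v w" for n u v w by auto
  show "u \<in> {0}" if "p \<in> trivial_points" "fst p n = Some u" for p n u
    using that by (auto simp: trivial_points_def ran_def)
  show "finite (clash discrete_dist e p q)" if "p \<in> trivial_points" "q \<in> trivial_points" "0 < e" for p q e
    using that by (rule finite_clash_trivial)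
next
  fix W :: "nat \<Rightarrow> nat \<Rightarrow> nat \<rightharpoonup> nat"
  assume W: "\<And>m i. finite (dom (W m i)) \<and> dom (W m i) \<subseteq> {i..} \<and> ran (W m i) \<subseteq> {0}"
  obtain S f where S: "trivial_via S f" "\<And>m. infinite {i. dom (W m i) \<subseteq> S}"
    using trivial_reservoir[OF \<open>OCA\<close>, of "\<lambda>m i. dom (W m i)"] W by blast
  let ?p = "(\<lambda>n. if n \<in> S then Some 0 else None, f)"
  have "W m i \<subseteq>\<^sub>m fst ?p" if "dom (W m i) \<subseteq> S" for m i
    unfolding map_le_def
  proof
    fix n assume n: "n \<in> dom (W m i)"
    then obtain u where u: "W m i n = Some u" by blast
    then have "u \<in> ran (W m i)" by (rule ranI)
    then have "u = 0" using W[of m i] by blast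
    then show "W m i n = fst ?p n" using u n that by auto
  qed
  then have "infinite {i. W m i \<subseteq>\<^sub>m fst ?p}" for m
    by (intro infinite_super[OF _ S(2)[of m]]) blast
  with trivial_pointI[OF S(1)] show "\<exists>p\<in>trivial_points. \<forall>m. infinite {i. W m i \<subseteq>\<^sub>m fst p}" by blast
next
  fix p q :: section_point and M assume p: "p \<in> trivial_points" and q: "q \<in> trivial_points"
  then have "trivial_via (dom (fst p)) (snd p)" "trivial_via (dom (fst q)) (snd q)" by (simp_all add: trivial_points_def)
  from trivial_mix[OF this, of M] obtain R where R: "finite ((dom (fst p) \<inter> M) \<union> (dom (fst q) - M) - R)"
    "trivial_via R (\<lambda>n. if n \<in> M then snd p n else snd q n)" by blast
  let ?r = "(\<lambda>n. if n \<in> R then Some (0::nat) else None, \<lambda>n. if n \<in> M then snd p n else snd q n)"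
  have "finite {n \<in> M. fst p n \<noteq> None \<and> fst ?r n \<noteq> fst p n}"
    by (rule finite_subset[OF _ R(1)]) (use trivial_point_value[OF p] in \<open>auto split: if_splits\<close>)
  moreover have "finite {n \<in> - M. fst q n \<noteq> None \<and> fst ?r n \<noteq> fst q n}"
    by (rule finite_subset[OF _ R(1)]) (use trivial_point_value[OF q] in \<open>auto split: if_splits\<close>)
  ultimately show "\<exists>r\<in>trivial_points. finite {n \<in> M. fst p n \<noteq> None \<and> fst r n \<noteq> fst p n} \<and>
      finite {n \<in> - M. fst q n \<noteq> None \<and> fst r n \<noteq> fst q n}"
    using trivial_pointI[OF R(2)] by blast
qed

text \<open>The inverse of the point map; types and captures are taken on the image side, where the
  generic colouring lives.\<close>

definition fibre_point :: "section_point \<Rightarrow> nat \<Rightarrow> nat option" where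
  "fibre_point p n = (if \<exists>i\<in>dom (fst p). snd p i = n then Some (SOME i. i \<in> dom (fst p) \<and> snd p i = n) else None)"

lemma fibre_point: "p \<in> trivial_points \<Longrightarrow> fibre_point p n = Some i \<longleftrightarrow> i \<in> dom (fst p) \<and> snd p i = n"
proof -
  assume "p \<in> trivial_points"
  then have inj: "inj_on (snd p) (dom (fst p))" using trivial_inj by (simp add: trivial_points_def)
  have some: "(SOME i. i \<in> dom (fst p) \<and> snd p i = n) = j" if j: "j \<in> dom (fst p)" "snd p j = n" for j
    by (rule some_equality) (use j inj in \<open>auto dest: inj_onD\<close>)
  show ?thesis
  proof (cases "\<exists>i\<in>dom (fst p). snd p i = n")
    case True
    then obtain j where j: "j \<in> dom (fst p)" "snd p j = n" by blast
    have "fibre_point p n = Some j" using True some[OF j] unfolding fibre_point_def by simp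
    moreover have "i = j" if "i \<in> dom (fst p)" "snd p i = n" using some[OF that] some[OF j] by simp
    ultimately show ?thesis using j by auto
  next
    case False
    then show ?thesis unfolding fibre_point_def by auto
  qed
qed

text \<open>The generic object is a two-colouring \<open>c\<close> of the image side that separates
  the two images of some common \<open>i\<close>. As \<open>c\<close> is almost the image of a set
  \<open>M\<close>, every trivial map sends points of \<open>M\<close> to one colour and the others
  to the other colour past some threshold. Two elements with equal thresholds and equal fibres below
  them cannot be separated.\<close>

lemma trivial_clash_countable:
  assumes MA: MA_aleph1_sigma_linked and Y: "Y \<subseteq> UNIV \<times> trivial_points" "uncountable Y" and "0 < \<epsilon>"
    and hom: "\<And>a b. a \<in> Y \<Longrightarrow> b \<in> Y \<Longrightarrow> a \<noteq> b \<Longrightarrow>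
      fst a \<noteq> fst b \<and> 4 * split_level (fst a) (fst b) \<le> card (clash discrete_dist \<epsilon> (snd a) (snd b))"
  shows False
proof -
  define tp where "tp k p = map (fibre_point p) [0..<k]" for k p
  define cap where "cap s p q \<longleftrightarrow> (\<exists>i m n. m < length s \<and> n < length s \<and> fibre_point p m = Some i \<and>
      fibre_point q n = Some i \<and> s ! m \<noteq> s ! n)" for s :: "bool list" and p q
  have tr: "p \<in> trivial_points" if "p \<in> snd ` Y" for p using that Y(1) by auto
  obtain c :: "nat \<Rightarrow> bool" and Y' where Y': "Y' \<subseteq> Y" "uncountable Y'"
    "\<And>a b. a \<in> Y' \<Longrightarrow> b \<in> Y' \<Longrightarrow> a \<noteq> b \<Longrightarrow> \<exists>n. cap (map c [0..<n]) (snd a) (snd b)"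
  proof (rule MA_types[where tp = tp and cap = cap and far = "\<lambda>j p q. 4 * j \<le> card (clash discrete_dist \<epsilon> p q)",
      OF MA Y(2)])
    show "fst a \<noteq> fst b \<and> 4 * split_level (fst a) (fst b) \<le> card (clash discrete_dist \<epsilon> (snd a) (snd b))"
      if "a \<in> Y" "b \<in> Y" "a \<noteq> b" for a b using that by (rule hom)
    show "cap s q p" if "cap s p q" for s p q using that unfolding cap_def by metis
    show "cap s' p q" if "prefix s s'" "cap s p q" for s s' p q
    proof -
      from \<open>cap s p q\<close> obtain i m n where c: "m < length s" "n < length s" "fibre_point p m = Some i"
        "fibre_point q n = Some i" "s ! m \<noteq> s ! n" unfolding cap_def by blast
      have "m < length s'" "n < length s'" using c(1,2) prefix_length_le[OF \<open>prefix s s'\<close>] by simp_all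
      moreover have "s' ! m \<noteq> s' ! n" using c prefix_nth[OF \<open>prefix s s'\<close>] by simp
      ultimately show ?thesis using c(3,4) unfolding cap_def by blast
    qed
    show "cap s p q'" if "cap s p q" "tp (length s) q = tp (length s) q'" for s p q q'
    proof -
      have "\<forall>n<length s. fibre_point q n = fibre_point q' n" using that(2) unfolding tp_def map_upt_eq_iff .
      with \<open>cap s p q\<close> show ?thesis unfolding cap_def by metis
    qed
    fix s :: "bool list" and R :: "(section_point \<times> section_point) set"
    assume R: "finite R" "card R \<le> length s" "R \<subseteq> snd ` Y \<times> snd ` Y"
      and far: "\<And>p q. (p, q) \<in> R \<Longrightarrow> tp (length s) p = tp (length s) q \<and>
        (\<exists>j\<ge>length s. 4 * j \<le> card (clash discrete_dist \<epsilon> p q))"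
    define k where "k = length s"
    define I where "I r = clash discrete_dist \<epsilon> (fst r) (snd r)" for r :: "section_point \<times> section_point"
    have Rtr: "fst r \<in> trivial_points" "snd r \<in> trivial_points" if "r \<in> R" for r using that R(3) tr by force+
    have I: "i \<in> dom (fst (fst r))" "i \<in> dom (fst (snd r))" "snd (fst r) i \<noteq> snd (snd r) i" if "r \<in> R" "i \<in> I r" for r i
      using clash_trivial[OF Rtr[OF that(1)] \<open>0 < \<epsilon>\<close>] that(2) unfolding I_def by blast+
    \<comment> \<open>One end of each chosen edge is to be coloured true and the other false, so
      ends of different edges must not meet.\<close>
    have "\<exists>\<nu>. (\<forall>r\<in>R. \<nu> r \<in> I r) \<and> (\<forall>r\<in>R. \<forall>r'\<in>R. r \<noteq> r' \<longrightarrow>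
        {snd (fst r) (\<nu> r), snd (snd r) (\<nu> r)} \<inter> {snd (fst r') (\<nu> r'), snd (snd r') (\<nu> r')} = {})"
    proof (rule disjoint_edges[OF R(1), of I "\<lambda>r. snd (fst r)" "\<lambda>r. snd (snd r)"], intro conjI)
      fix r assume r: "r \<in> R"
      show "finite (I r)" unfolding I_def by (rule finite_clash_trivial[OF Rtr[OF r] \<open>0 < \<epsilon>\<close>])
      obtain j where "length s \<le> j" "4 * j \<le> card (I r)" using far[of "fst r" "snd r"] r by (auto simp: I_def)
      then show "4 * card R \<le> card (I r)" using R(2) by linarith
      show "inj_on (snd (fst r)) (I r)" "inj_on (snd (snd r)) (I r)"
        using Rtr[OF r] I[OF r] by (auto simp: trivial_points_def intro!: inj_on_subset[OF trivial_inj])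
    qed
    then obtain \<nu> where \<nu>: "\<And>r. r \<in> R \<Longrightarrow> \<nu> r \<in> I r"
      "\<And>r r'. r \<in> R \<Longrightarrow> r' \<in> R \<Longrightarrow> r \<noteq> r' \<Longrightarrow>
        {snd (fst r) (\<nu> r), snd (snd r) (\<nu> r)} \<inter> {snd (fst r') (\<nu> r'), snd (snd r') (\<nu> r')} = {}" by blast
    define a where "a r = snd (fst r) (\<nu> r)" for r
    define b where "b r = snd (snd r) (\<nu> r)" for r
    have ab: "fibre_point (fst r) (a r) = Some (\<nu> r)" "fibre_point (snd r) (b r) = Some (\<nu> r)" "a r \<noteq> b r"
      if "r \<in> R" for r
      using I[OF that \<nu>(1)[OF that]] fibre_point[OF Rtr(1)[OF that]] fibre_point[OF Rtr(2)[OF that]]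
      by (simp_all add: a_def b_def)
    have large: "k \<le> a r" "k \<le> b r" if r: "r \<in> R" for r
    proof -
      have "tp k (fst r) = tp k (snd r)" using far[of "fst r" "snd r"] r by (simp add: k_def)
      then have tp: "\<forall>n<k. fibre_point (fst r) n = fibre_point (snd r) n" unfolding tp_def map_upt_eq_iff .
      show "k \<le> a r"
      proof (rule ccontr)
        assume "\<not> k \<le> a r"
        then have "fibre_point (snd r) (a r) = Some (\<nu> r)" using tp ab(1)[OF r] by simp
        then have "a r = b r" using fibre_point[OF Rtr(2)[OF r]] by (simp add: b_def)
        then show False using ab(3)[OF r] by simp
      qed
      show "k \<le> b r"
      proof (rule ccontr)
        assume "\<not> k \<le> b r"
        then have "fibre_point (fst r) (b r) = Some (\<nu> r)" using tp ab(2)[OF r] by simp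
        then have "a r = b r" using fibre_point[OF Rtr(1)[OF r]] by (simp add: a_def)
        then show False using ab(3)[OF r] by simp
      qed
    qed
    obtain L where L: "\<forall>n\<in>a ` R \<union> b ` R. n < L"
      using finite_nat_set_iff_bounded[of "a ` R \<union> b ` R"] R(1) by blast
    \<comment> \<open>Beyond the old stem exactly the first ends get the colour true. All ends are
      at least \<open>k\<close>, because elements of equal type have equal fibres over smaller
      points.\<close>
    define s' where "s' = s @ map (\<lambda>n. n \<in> a ` R) [k..<max k L]"
    have len: "length s' = max k L" by (simp add: s'_def k_def)
    have nth: "s' ! n \<longleftrightarrow> n \<in> a ` R" if "k \<le> n" "n < L" for n
    proof -
      have "[k..<max k L] ! (n - k) = n" using that by (subst nth_upt) auto
      moreover have "n - k < length [k..<max k L]" using that by auto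
      ultimately show ?thesis using that(1) unfolding s'_def nth_append k_def[symmetric] by (simp del: length_upt)
    qed
    show "\<exists>s'. prefix s s' \<and> (\<forall>(p, q)\<in>R. cap s' p q)"
    proof (intro exI[of _ s'] conjI)
      show "prefix s s'" by (simp add: s'_def)
      have "cap s' (fst r) (snd r)" if r: "r \<in> R" for r
      proof -
        have "a r < L" "b r < L" using L r by blast+
        moreover have "b r \<notin> a ` R"
        proof
          assume "b r \<in> a ` R"
          then obtain r' where r': "r' \<in> R" "b r = a r'" by blast
          show False
          proof (cases "r = r'")
            case True
            then show ?thesis using r' ab(3)[OF r] by simp
          next
            case False
            then show ?thesis using \<nu>(2)[OF r r'(1)] r'(2) unfolding a_def b_def by blast
          qed
        qed
        ultimately have ne: "s' ! a r \<noteq> s' ! b r" using nth large[OF r] r by blast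
        show ?thesis unfolding cap_def
        proof (intro exI conjI)
          show "a r < length s'" "b r < length s'" unfolding len using \<open>a r < L\<close> \<open>b r < L\<close> by simp_all
        qed (fact ab[OF r] ne)+
      qed
      then show "\<forall>(p, q)\<in>R. cap s' p q" by fastforce
    qed
  qed (rule that)
  obtain M where M: "ev (\<lambda>n. n \<in> \<Psi> M \<longleftrightarrow> c n)" using surj[of "{n. c n}"] by auto
  have "\<exists>N. \<forall>n\<ge>N. \<forall>i\<in>dom (fst (snd x)). snd (snd x) i = n \<longrightarrow> (c n \<longleftrightarrow> i \<in> M)" if "x \<in> Y'" for x
  proof -
    have "snd x \<in> trivial_points" using that Y'(1) Y(1) by auto
    then have t: "trivial_via (dom (fst (snd x))) (snd (snd x))" by (simp add: trivial_points_def)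
    have "ev (\<lambda>n. \<forall>i\<in>dom (fst (snd x)). snd (snd x) i = n \<longrightarrow> (c n \<longleftrightarrow> i \<in> M))"
      using M inter[of "dom (fst (snd x))" M] trivial_image[OF t subset_refl] trivial_image[OF t Int_lower1[of _ M]]
    proof eventually_elim
      case (elim n)
      show ?case
      proof (intro ballI impI)
        fix i assume i: "i \<in> dom (fst (snd x))" "snd (snd x) i = n"
        have "n \<in> snd (snd x) ` (dom (fst (snd x)) \<inter> M) \<longleftrightarrow> i \<in> M"
          using i inj_onD[OF trivial_inj[OF t]] by blast
        moreover have "n \<in> snd (snd x) ` dom (fst (snd x))" using i by blast
        ultimately show "c n \<longleftrightarrow> i \<in> M" using elim by blast
      qed
    qed
    then show ?thesis unfolding eventually_sequentially .
  qed
  then have "\<exists>N. \<forall>x\<in>Y'. \<forall>n\<ge>N x. \<forall>i\<in>dom (fst (snd x)). snd (snd x) i = n \<longrightarrow> (c n \<longleftrightarrow> i \<in> M)"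
    by (intro bchoice ballI)
  then obtain N where N: "\<And>x n i. x \<in> Y' \<Longrightarrow> N x \<le> n \<Longrightarrow> i \<in> dom (fst (snd x)) \<Longrightarrow> snd (snd x) i = n \<Longrightarrow> c n \<longleftrightarrow> i \<in> M"
    by blast
  obtain x y where xy: "x \<in> Y'" "y \<in> Y'" "x \<noteq> y" "(N x, tp (N x) (snd x)) = (N y, tp (N y) (snd y))"
    by (rule uncountable_collision[OF Y'(2), of "\<lambda>x. (N x, tp (N x) (snd x))"])
  have Nxy: "N x = N y" using xy(4) by simp
  then have tp: "\<forall>n<N y. fibre_point (snd x) n = fibre_point (snd y) n" using xy(4) by (simp add: tp_def map_upt_eq_iff)
  from Y'(3)[OF xy(1-3)] obtain n0 where "cap (map c [0..<n0]) (snd x) (snd y)" ..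
  then obtain i m n where mn: "m < length (map c [0..<n0])" "n < length (map c [0..<n0])"
    and f: "fibre_point (snd x) m = Some i" "fibre_point (snd y) n = Some i"
    and "map c [0..<n0] ! m \<noteq> map c [0..<n0] ! n"
    unfolding cap_def by blast
  then have cmn: "c m \<noteq> c n" by simp
  have tx: "snd x \<in> trivial_points" and ty: "snd y \<in> trivial_points" using xy(1,2) Y'(1) Y(1) by auto
  note fx = fibre_point[OF tx] and fy = fibre_point[OF ty]
  \<comment> \<open>Below the threshold the fibres coincide, so \<open>m\<close> and
    \<open>n\<close> are images of \<open>i\<close> under the same map.\<close>
  have "m = n" if "m < N y \<or> n < N y"
  proof -
    from that have "fibre_point (snd y) m = Some i \<or> fibre_point (snd x) n = Some i" using f tp by auto
    then show ?thesis using f unfolding fx fy by auto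
  qed
  then have "N y \<le> m" "N y \<le> n" using cmn by (auto simp: not_less[symmetric])
  then have "c m \<longleftrightarrow> i \<in> M" "c n \<longleftrightarrow> i \<in> M"
    using N[OF xy(1), of m i] N[OF xy(2), of n i] f Nxy unfolding fx fy by auto
  then show False using cmn by simp
qed

text \<open>Every infinite set contains an infinite trivial set, on which the uniformizing
  \<open>h\<close> is already right. An infinite difference between \<open>\<Psi> C\<close> and the
  image of \<open>C\<close> under \<open>h\<close>, pulled back to points of \<open>C\<close>, would
  contain such a set with finite \<open>\<Psi>\<close>-image.\<close>

theorem lift_by_point_map:
  assumes OCA MA_aleph1_sigma_linked
  shows "\<exists>h. \<forall>C. ev (\<lambda>n. n \<in> \<Psi> C \<longleftrightarrow> n \<in> h ` C)"
proof -
  interpret coherent_points discrete_dist "{0}" trivial_points using \<open>OCA\<close> by (rule coherent_trivial_points)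
  \<comment> \<open>Any tolerance below 1 forces equality in the discrete metric; 9/10 is
    such.\<close>
  have "good (9 * (1/10)) UNIV"
  proof (rule uniformization_OCA[OF \<open>OCA\<close>])
    fix Y assume Y: "Y \<subseteq> UNIV \<times> trivial_points" "uncountable Y" and
      hom: "\<And>a b. a \<in> Y \<Longrightarrow> b \<in> Y \<Longrightarrow> a \<noteq> b \<Longrightarrow>
        fst a \<noteq> fst b \<and> 4 * split_level (fst a) (fst b) \<le> card (clash discrete_dist (1/10) (snd a) (snd b))"
    show False by (rule trivial_clash_countable[OF assms(2) Y _ hom]) simp_all
  qed simp
  then obtain h0 where h0: "\<And>p. p \<in> trivial_points \<Longrightarrow>
      finite {n. \<exists>u. fst p n = Some u \<and> (n, u) \<in> UNIV \<and> 9 * (1/10) < discrete_dist n (snd p n) (h0 n u)}"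
    unfolding good_def by blast
  define h where "h n = h0 n 0" for n
  have h: "finite {n \<in> S. f n \<noteq> h n}" if "trivial_via S f" for S f
    by (rule finite_subset[OF _ h0[OF trivial_pointI[OF that]]]) (auto simp: h_def)
  have image_h: "ev (\<lambda>n. n \<in> \<Psi> S \<longleftrightarrow> n \<in> h ` S)" if t: "trivial_via S f" for S f
  proof -
    define D where "D = {n \<in> S. f n \<noteq> h n}"
    have "finite (f ` D \<union> h ` D)" using h[OF t] by (simp add: D_def)
    then have "ev (\<lambda>n. n \<notin> f ` D \<union> h ` D)" unfolding finite_iff_ev .
    note off_D = this
    have eq: "n \<in> f ` S \<longleftrightarrow> n \<in> h ` S" if "n \<notin> f ` D \<union> h ` D" for n
    proof -
      have *: "i \<in> S \<and> f i = n \<longleftrightarrow> i \<in> S \<and> h i = n" for i using that unfolding D_def by auto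
      have "n \<in> f ` S \<longleftrightarrow> (\<exists>i. i \<in> S \<and> f i = n)" "n \<in> h ` S \<longleftrightarrow> (\<exists>i. i \<in> S \<and> h i = n)" by auto
      then show ?thesis unfolding * by simp
    qed
    show ?thesis using off_D trivial_image[OF t subset_refl] by eventually_elim (use eq in blast)
  qed
  have dense: "\<exists>S f. S \<subseteq> X \<and> infinite S \<and> trivial_via S f" if X: "infinite X" for X
  proof -
    have "\<forall>i. \<exists>n. i \<le> n \<and> n \<in> X" using X unfolding infinite_nat_iff_unbounded_le by blast
    from choice[OF this] obtain e where e: "\<And>i. i \<le> e i" "\<And>i. e i \<in> X" by blast
    have "finite {e i} \<and> {e i} \<subseteq> {i..}" for m i :: nat using e by simp
    from trivial_reservoir[OF \<open>OCA\<close>, of "\<lambda>m i. {e i}", OF this]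
    obtain S f where S: "trivial_via S f" "infinite {i. {e i} \<subseteq> S}" by blast
    have "infinite (S \<inter> X)"
      unfolding infinite_nat_iff_unbounded_le
    proof
      fix m
      obtain i where "m \<le> i" "i \<in> {i. {e i} \<subseteq> S}" using S(2) unfolding infinite_nat_iff_unbounded_le by blast
      then show "\<exists>n\<ge>m. n \<in> S \<inter> X" using e[of i] by (intro exI[of _ "e i"]) auto
    qed
    moreover have "trivial_via (S \<inter> X) f" by (rule trivial_subset[OF S(1)]) simp
    ultimately show ?thesis by (intro exI[of _ "S \<inter> X"] exI[of _ f]) simp
  qed
  have "ev (\<lambda>n. n \<in> \<Psi> C \<longleftrightarrow> n \<in> h ` C)" for C
  proof -
    have "finite (h ` C - \<Psi> C)"
    proof (rule ccontr)
      assume inf: "infinite (h ` C - \<Psi> C)"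
      define X where "X = inv_into C h ` (h ` C - \<Psi> C)"
      have "inj_on (inv_into C h) (h ` C - \<Psi> C)" by (rule inj_on_inv_into) simp
      then have "infinite X" unfolding X_def using inf finite_imageD by blast
      then obtain S f where S: "S \<subseteq> X" "infinite S" "trivial_via S f" using dense by blast
      have "X \<subseteq> C" unfolding X_def by (auto intro: inv_into_into)
      have "h i \<notin> \<Psi> C" if "i \<in> X" for i using that unfolding X_def by (auto simp: f_inv_into_f)
      then have "n \<notin> h ` S \<or> n \<notin> \<Psi> C" for n using S(1) by blast
      note S_C = this
      have "ev (\<lambda>n. n \<in> \<Psi> S \<longrightarrow> n \<in> \<Psi> C)" by (rule image_mono_subset) (use S(1) \<open>X \<subseteq> C\<close> in blast)
      with image_h[OF S(3)] have "finite (\<Psi> S)" unfolding finite_iff_ev by eventually_elim (use S_C in blast)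
      then show False using S(2) finite_iff by blast
    qed
    moreover have "finite (\<Psi> C - h ` C)"
    proof (rule ccontr)
      assume inf: "infinite (\<Psi> C - h ` C)"
      have "ev (\<lambda>n. n \<in> \<Psi> C - h ` C \<longrightarrow> n \<in> \<Psi> C)" by simp
      then obtain D where D: "D \<subseteq> C" "ev (\<lambda>n. n \<in> \<Psi> D \<longleftrightarrow> n \<in> \<Psi> C - h ` C)" by (rule preimage_set)
      have "infinite D"
      proof
        assume "finite D"
        then have "ev (\<lambda>n. n \<notin> \<Psi> D)" using image_finite finite_iff_ev by blast
        with D(2) have "finite (\<Psi> C - h ` C)" unfolding finite_iff_ev by eventually_elim blast
        then show False using inf by contradiction
      qed
      then obtain S f where S: "S \<subseteq> D" "infinite S" "trivial_via S f" using dense by blast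
      have sub: "h ` S \<subseteq> h ` C" using S(1) D(1) by blast
      have "finite (\<Psi> S)" unfolding finite_iff_ev
        using image_h[OF S(3)] image_mono_subset[OF S(1)] D(2) by eventually_elim (use sub in blast)
      then show False using S(2) finite_iff by blast
    qed
    ultimately show ?thesis unfolding finite_iff_ev by eventually_elim blast
  qed
  then show ?thesis by blast
qed

text \<open>Select one preimage of each value taken twice. These values lie both in the image of the
  selected set and in that of its complement, whose images under \<open>\<Psi>\<close> are almost
  complementary, so they are finite in number. Since fibres are finite, only finitely many arguments
  are lost.\<close>

lemma point_map_almost_permutation:
  assumes h: "\<And>C. ev (\<lambda>n. n \<in> \<Psi> C \<longleftrightarrow> n \<in> h ` C)"
  shows "almost_permutation h"
proof -
  have fib: "finite (h -` {n})" for n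
  proof -
    have "h ` (h -` {n}) \<subseteq> {n}" by blast
    then have "finite (h ` (h -` {n}))" by (rule finite_subset) simp
    then have "ev (\<lambda>m. m \<notin> h ` (h -` {n}))" unfolding finite_iff_ev .
    with h[of "h -` {n}"] have "finite (\<Psi> (h -` {n}))" unfolding finite_iff_ev by eventually_elim blast
    then show ?thesis by (rule finite_of_image)
  qed
  define D where "D = {n. \<exists>i j. i \<noteq> j \<and> h i = n \<and> h j = n}"
  have "\<forall>n\<in>D. \<exists>i. h i = n" by (auto simp: D_def)
  from bchoice[OF this] obtain s where s: "\<And>n. n \<in> D \<Longrightarrow> h (s n) = n" by blast
  have D1: "n \<in> h ` (s ` D)" if "n \<in> D" for n by (rule image_eqI[of _ _ "s n"]) (use s[OF that] that in auto)
  have D2: "n \<in> h ` (- s ` D)" if n: "n \<in> D" for n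
  proof -
    obtain i j where "i \<noteq> j" "h i = n" "h j = n" using n unfolding D_def by blast
    then have "i \<noteq> s n \<and> h i = n \<or> j \<noteq> s n \<and> h j = n" by metis
    then obtain i where i: "i \<noteq> s n" "h i = n" by blast
    have "i \<notin> s ` D"
    proof
      assume "i \<in> s ` D"
      then obtain m where "m \<in> D" "i = s m" by blast
      then show False using s[of m] i by simp
    qed
    then show ?thesis using i(2) by blast
  qed
  have "finite D" unfolding finite_iff_ev
    using h[of "s ` D"] h[of "- s ` D"] compl[of "s ` D"] by eventually_elim (use D1 D2 in blast)
  define A where "A = - h -` D"
  have "h -` D = (\<Union>n\<in>D. h -` {n})" by blast
  then have "finite (- A)" using \<open>finite D\<close> fib by (simp add: A_def)
  have "ev (\<lambda>n. n \<notin> \<Psi> (- UNIV))" using finite_iff[of "{}"] unfolding finite_iff_ev by simp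
  then have "ev (\<lambda>n. n \<notin> - range h)"
    using h[of UNIV] compl[of UNIV] by eventually_elim blast
  then have "finite (- range h)" unfolding finite_iff_ev .
  moreover have "- h ` A \<subseteq> - range h \<union> D" by (auto simp: A_def)
  ultimately have "finite (- h ` A)" using \<open>finite D\<close> by (intro finite_subset[of "- h ` A" "- range h \<union> D"]) simp_all
  moreover have "inj_on h A"
  proof (rule inj_onI, rule ccontr)
    fix i j assume ij: "i \<in> A" "h i = h j" "i \<noteq> j"
    then have "h i \<in> D" unfolding D_def by (intro CollectI exI[of _ i] exI[of _ j]) simp
    then show False using ij(1) by (simp add: A_def)
  qed
  ultimately show ?thesis using \<open>finite (- A)\<close> unfolding almost_permutation_def bij_betw_def by blast
qed

end

section \<open>Reduced products\<close>

lemma abs_eq_iff_ev: "abs_nat_set_mod_fin A = abs_nat_set_mod_fin B \<longleftrightarrow> ev (\<lambda>n. n \<in> A \<longleftrightarrow> n \<in> B)"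
proof -
  have "n \<notin> sym_diff A B \<longleftrightarrow> (n \<in> A \<longleftrightarrow> n \<in> B)" for n by blast
  then show ?thesis unfolding nat_set_mod_fin.abs_eq_iff finite_iff_ev by simp
qed

lemma abs_rep: "abs_nat_set_mod_fin (rep_nat_set_mod_fin S) = S"
  by (rule Quotient_abs_rep[OF Quotient_nat_set_mod_fin])

lemma almost_permutation_finite_vimage:
  assumes "almost_permutation f" "finite F"
  shows "finite (f -` F)"
proof -
  obtain A B where A: "finite (- A)" "bij_betw f A B" using assms(1) unfolding almost_permutation_def by blast
  have "f -` F \<subseteq> (f -` F \<inter> A) \<union> - A" by blast
  moreover have "finite (f -` F \<inter> A)" using assms(2) bij_betw_imp_inj_on[OF A(2)] by (rule finite_vimage_IntI)
  ultimately show ?thesis using A(1) by (meson finite_Un finite_subset)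
qed

lemma almost_permutation_vimage_image:
  assumes f: "almost_permutation f"
  shows "finite (f -` (f ` C) - C)"
proof -
  obtain A B where A: "finite (- A)" "bij_betw f A B" using f unfolding almost_permutation_def by blast
  have "f -` (f ` C) - C \<subseteq> - A \<union> f -` (f ` (- A))"
  proof
    fix n assume n: "n \<in> f -` (f ` C) - C"
    then obtain c where "c \<in> C" "f n = f c" by blast
    then show "n \<in> - A \<union> f -` (f ` (- A))" using n inj_onD[OF bij_betw_imp_inj_on[OF A(2)], of n c] by blast
  qed
  moreover have "finite (- A \<union> f -` (f ` (- A)))"
    using A(1) almost_permutation_finite_vimage[OF f, of "f ` (- A)"] by simp
  ultimately show ?thesis by (rule finite_subset)
qed

lemma almost_permutation_at_top:
  assumes "almost_permutation f"
  shows "filterlim f at_top sequentially"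
  unfolding filterlim_at_top
proof
  fix Z
  have "finite (f -` {..<Z})" using assms by (rule almost_permutation_finite_vimage) simp
  then show "ev (\<lambda>n. Z \<le> f n)" unfolding finite_iff_ev by eventually_elim simp
qed

theorem automorphism_induced_by_point_map:
  assumes OCA MA_aleph1_sigma_linked and \<theta>: "boolean_algebra_automorphism \<theta>"
  obtains f where "almost_permutation f" "\<And>A. \<theta> (abs_nat_set_mod_fin A) = abs_nat_set_mod_fin (f -` A)"
proof -
  \<comment> \<open>The lift is of the inverse of \<open>\<theta>\<close>, so that a point map
    inducing \<open>\<Psi>\<close> by images induces \<open>\<theta>\<close> by preimages.\<close>
  define \<Psi> where "\<Psi> A = rep_nat_set_mod_fin (inv_into UNIV \<theta> (abs_nat_set_mod_fin A))" for A
  have bij: "bij \<theta>" and \<theta>_inf: "\<And>S T. \<theta> (inf S T) = inf (\<theta> S) (\<theta> T)" and \<theta>_compl: "\<And>S. \<theta> (- S) = - \<theta> S"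
    and \<theta>_bot: "\<theta> Orderings.bot = Orderings.bot"
    using \<theta> unfolding boolean_algebra_automorphism_def by blast+
  have \<theta>\<Psi>: "\<theta> (abs_nat_set_mod_fin (\<Psi> A)) = abs_nat_set_mod_fin A" for A
    unfolding \<Psi>_def abs_rep by (rule surj_f_inv_f[OF bij_is_surj[OF bij]])
  have ev_\<theta>: "ev (\<lambda>n. n \<in> A \<longleftrightarrow> n \<in> B)" if "\<theta> (abs_nat_set_mod_fin A) = \<theta> (abs_nat_set_mod_fin B)" for A B
    using injD[OF bij_is_inj[OF bij] that] unfolding abs_eq_iff_ev .
  interpret boolean_lift \<Psi>
  proof
    fix A B
    show "ev (\<lambda>n. n \<in> \<Psi> A \<longleftrightarrow> n \<in> \<Psi> B)" if "ev (\<lambda>n. n \<in> A \<longleftrightarrow> n \<in> B)"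
      using that by (intro ev_\<theta>) (simp only: \<theta>\<Psi> abs_eq_iff_ev)
    have "ev (\<lambda>n. n \<in> \<Psi> (A \<inter> B) \<longleftrightarrow> n \<in> \<Psi> A \<inter> \<Psi> B)"
      by (rule ev_\<theta>) (simp only: \<theta>\<Psi> \<theta>_inf inf_nat_set_mod_fin.abs_eq[symmetric])
    then show "ev (\<lambda>n. n \<in> \<Psi> (A \<inter> B) \<longleftrightarrow> n \<in> \<Psi> A \<and> n \<in> \<Psi> B)" by simp
    have "ev (\<lambda>n. n \<in> \<Psi> (- A) \<longleftrightarrow> n \<in> - \<Psi> A)"
      by (rule ev_\<theta>) (simp only: \<theta>\<Psi> \<theta>_compl uminus_nat_set_mod_fin.abs_eq[symmetric])
    then show "ev (\<lambda>n. n \<in> \<Psi> (- A) \<longleftrightarrow> n \<notin> \<Psi> A)" by simp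
    show "finite A" if "finite (\<Psi> A)"
    proof -
      have "abs_nat_set_mod_fin (\<Psi> A) = Orderings.bot"
        unfolding bot_nat_set_mod_fin_def abs_eq_iff_ev using that unfolding finite_iff_ev by simp
      then have "abs_nat_set_mod_fin A = Orderings.bot" using \<theta>\<Psi>[of A] \<theta>_bot by simp
      then show ?thesis unfolding bot_nat_set_mod_fin_def abs_eq_iff_ev finite_iff_ev by simp
    qed
    show "\<exists>A. ev (\<lambda>n. n \<in> \<Psi> A \<longleftrightarrow> n \<in> B)"
      by (rule exI[of _ "rep_nat_set_mod_fin (\<theta> (abs_nat_set_mod_fin B))"], rule ev_\<theta>) (simp only: \<theta>\<Psi> abs_rep)
  qed
  obtain f where f: "\<And>C. ev (\<lambda>n. n \<in> \<Psi> C \<longleftrightarrow> n \<in> f ` C)" using lift_by_point_map[OF assms(1,2)] by blast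
  have ap: "almost_permutation f" by (rule point_map_almost_permutation[OF f])
  have "\<theta> (abs_nat_set_mod_fin A) = abs_nat_set_mod_fin (f -` A)" for A
  proof -
    define C where "C = rep_nat_set_mod_fin (\<theta> (abs_nat_set_mod_fin A))"
    have C: "abs_nat_set_mod_fin C = \<theta> (abs_nat_set_mod_fin A)" by (simp add: C_def abs_rep)
    have "ev (\<lambda>n. n \<in> \<Psi> C \<longleftrightarrow> n \<in> A)" by (rule ev_\<theta>) (simp only: \<theta>\<Psi> C)
    with f[of C] have "ev (\<lambda>n. n \<notin> sym_diff (f ` C) A)" by eventually_elim blast
    then have "finite (sym_diff (f ` C) A)" unfolding finite_iff_ev .
    from almost_permutation_finite_vimage[OF ap this] almost_permutation_vimage_image[OF ap, of C]
    have "ev (\<lambda>n. n \<in> C \<longleftrightarrow> n \<in> f -` A)" unfolding finite_iff_ev by eventually_elim blast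
    then show ?thesis unfolding C[symmetric] abs_eq_iff_ev .
  qed
  with ap show thesis by (rule that)
qed

lemma tendsto_zero_iff_finite:
  fixes g :: "nat \<Rightarrow> real"
  assumes "\<And>n. 0 \<le> g n"
  shows "(g \<longlongrightarrow> 0) (inf sequentially (principal A)) \<longleftrightarrow> (\<forall>e>0. finite {n \<in> A. e < g n})"
proof
  assume lim: "(g \<longlongrightarrow> 0) (inf sequentially (principal A))"
  show "\<forall>e>0. finite {n \<in> A. e < g n}"
  proof (intro allI impI)
    fix e :: real assume "0 < e"
    from tendstoD[OF lim this] have "ev (\<lambda>n. n \<in> A \<longrightarrow> dist (g n) 0 < e)" unfolding eventually_inf_principal .
    then show "finite {n \<in> A. e < g n}" unfolding finite_iff_ev by eventually_elim auto
  qed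
next
  assume fin: "\<forall>e>0. finite {n \<in> A. e < g n}"
  show "(g \<longlongrightarrow> 0) (inf sequentially (principal A))"
  proof (rule tendstoI)
    fix e :: real assume "0 < e"
    then have "0 < e / 2" by simp
    with fin have "finite {n \<in> A. e / 2 < g n}" by blast
    then show "eventually (\<lambda>n. dist (g n) 0 < e) (inf sequentially (principal A))"
      unfolding eventually_inf_principal finite_iff_ev
    proof eventually_elim
      case (elim n)
      then show ?case using assms[of n] \<open>0 < e\<close> by (auto simp: dist_real_def)
    qed
  qed
qed

section \<open>Classes of sequences and reindexing\<close>

locale metric_groups =
  fixes G :: "nat \<Rightarrow> ('a, 'b) monoid_scheme" and d :: "nat \<Rightarrow> 'a \<Rightarrow> 'a \<Rightarrow> real"
  assumes G: "separable_metric_groups_bounded G d"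
begin

lemma grp: "group (G n)" and met: "Metric_space (carrier (G n)) (d n)"
  and sep: "separable_space (Metric_space.mtopology (carrier (G n)) (d n))"
  and right_invariant: "x \<in> carrier (G n) \<Longrightarrow> y \<in> carrier (G n) \<Longrightarrow> z \<in> carrier (G n) \<Longrightarrow>
    d n (x \<otimes>\<^bsub>G n\<^esub> z) (y \<otimes>\<^bsub>G n\<^esub> z) = d n x y"
proof -
  have "bi_invariant_metric_group (G n) (d n) \<and> separable_space (Metric_space.mtopology (carrier (G n)) (d n))"
    using G by (simp add: separable_metric_groups_bounded_def)
  note n = this[unfolded bi_invariant_metric_group_def]
  show "group (G n)" "Metric_space (carrier (G n)) (d n)"
    "separable_space (Metric_space.mtopology (carrier (G n)) (d n))" using n by simp_all
  show "d n (x \<otimes>\<^bsub>G n\<^esub> z) (y \<otimes>\<^bsub>G n\<^esub> z) = d n x y"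
    if "x \<in> carrier (G n)" "y \<in> carrier (G n)" "z \<in> carrier (G n)" using n that by simp
qed

lemma nonneg: "0 \<le> d n x y" by (rule Metric_space.nonneg[OF met])

lemma equal_along_iff:
  assumes "a \<in> carrier (seq_group G k)" "b \<in> carrier (seq_group G k)"
  shows "equal_along_set G d k A (seq_class G d k a) (seq_class G d k b) \<longleftrightarrow>
    (\<forall>e>0. finite {n \<in> A. e < d (k n) (a n) (b n)})"
  unfolding equal_along_set_seq_class[OF G assms] by (rule tendsto_zero_iff_finite) (rule nonneg)

lemma seq_class_eq_iff:
  assumes a: "a \<in> carrier (seq_group G k)" and b: "b \<in> carrier (seq_group G k)"
  shows "seq_class G d k a = seq_class G d k b \<longleftrightarrow> (\<forall>e>0. finite {n. e < d (k n) (a n) (b n)})"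
proof
  have zero: "d (k n) (a n) (a n) = 0" for n
    using a Metric_space.zero[OF met] by (simp add: seq_group_simps(1))
  assume "seq_class G d k a = seq_class G d k b"
  moreover have "equal_along_set G d k UNIV (seq_class G d k a) (seq_class G d k a)"
    unfolding equal_along_iff[OF a a] by (simp add: zero)
  ultimately have "equal_along_set G d k UNIV (seq_class G d k a) (seq_class G d k b)" by simp
  then show "\<forall>e>0. finite {n. e < d (k n) (a n) (b n)}" unfolding equal_along_iff[OF a b] by simp
next
  interpret N: normal "null_seqs G d k" "seq_group G k" using G by (rule null_seqs_normal)
  assume fin: "\<forall>e>0. finite {n. e < d (k n) (a n) (b n)}"
  define h where "h = a \<otimes>\<^bsub>seq_group G k\<^esub> inv\<^bsub>seq_group G k\<^esub> b"
  have h: "h \<in> carrier (seq_group G k)" "a = h \<otimes>\<^bsub>seq_group G k\<^esub> b"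
    using a b by (simp_all add: h_def N.m_assoc)
  have "d (k n) (h n) \<one>\<^bsub>G (k n)\<^esub> = d (k n) (a n) (b n)" for n
  proof -
    interpret H: group "G (k n)" by (rule grp)
    have "h n \<in> carrier (G (k n))" "b n \<in> carrier (G (k n))" using h(1) b by (simp_all add: seq_group_simps(1))
    note mem = this
    have an: "a n = h n \<otimes>\<^bsub>G (k n)\<^esub> b n" using fun_cong[OF h(2), of n] unfolding seq_group_simps(2) .
    show ?thesis using right_invariant[OF mem(1) H.one_closed mem(2)]
      unfolding an[symmetric] H.l_one[OF mem(2)] by (rule sym)
  qed
  then have "(\<lambda>n. d (k n) (h n) \<one>\<^bsub>G (k n)\<^esub>) \<longlonglongrightarrow> 0"
    using fin tendsto_zero_iff_finite[of "\<lambda>n. d (k n) (a n) (b n)" UNIV] nonneg by simp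
  with h(1) have "h \<in> null_seqs G d k" unfolding null_seqs_def by (intro CollectI conjI)
  then have "a \<in> seq_class G d k b" unfolding seq_class_def r_coset_def using h(2) by blast
  then show "seq_class G d k a = seq_class G d k b"
    unfolding seq_class_def by (rule N.repr_independence[OF _ b N.subgroup_axioms, symmetric])
qed

lemma seq_class_in: "a \<in> carrier (seq_group G k) \<Longrightarrow> seq_class G d k a \<in> carrier (reduced_product G d k)"
  by (simp add: reduced_product_def carrier_FactGroup seq_class_def)

lemma reduced_product_cases:
  assumes "x \<in> carrier (reduced_product G d k)"
  obtains a where "a \<in> carrier (seq_group G k)" "x = seq_class G d k a"
  using assms by (auto simp: reduced_product_def carrier_FactGroup seq_class_def)

lemma reduced_product_mult:
  assumes "a \<in> carrier (seq_group G k)" "b \<in> carrier (seq_group G k)"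
  shows "seq_class G d k a \<otimes>\<^bsub>reduced_product G d k\<^esub> seq_class G d k b = seq_class G d k (a \<otimes>\<^bsub>seq_group G k\<^esub> b)"
proof -
  interpret N: normal "null_seqs G d k" "seq_group G k" using G by (rule null_seqs_normal)
  show ?thesis using N.rcos_sum[OF assms] by (simp add: reduced_product_def seq_class_def)
qed

lemma seq_group_mult_closed:
  assumes "a \<in> carrier (seq_group G k)" "b \<in> carrier (seq_group G k)"
  shows "a \<otimes>\<^bsub>seq_group G k\<^esub> b \<in> carrier (seq_group G k)"
proof -
  interpret N: normal "null_seqs G d k" "seq_group G k" using G by (rule null_seqs_normal)
  show ?thesis using assms by simp
qed

lemma reduced_product_group: "group (reduced_product G d k)"
proof -
  interpret N: normal "null_seqs G d k" "seq_group G k" using G by (rule null_seqs_normal)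
  show ?thesis unfolding reduced_product_def by (rule N.factorgroup_is_group)
qed

lemma reindexing_map_class:
  assumes "almost_permutation f" and a: "a \<in> carrier (seq_group G k)"
  shows "reindexing_map G d k f (seq_class G d k a) = seq_class G d (k \<circ> f) (a \<circ> f)"
proof -
  have F: "(\<lambda>a. a \<circ> f) \<in> carrier (seq_group G k) \<rightarrow> carrier (seq_group G (k \<circ> f))"
    by (auto simp: seq_group_simps(1))
  have "seq_class G d (k \<circ> f) (b \<circ> f) = seq_class G d (k \<circ> f) (a \<circ> f)"
    if b: "b \<in> carrier (seq_group G k)" "seq_class G d k b = seq_class G d k a" for b
  proof -
    have "finite {n. e < d (k (f n)) (b (f n)) (a (f n))}" if "0 < e" for e
    proof -
      have "finite {m. e < d (k m) (b m) (a m)}" using b that seq_class_eq_iff[OF b(1) a] by blast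
      from almost_permutation_finite_vimage[OF assms(1) this] show ?thesis by (simp add: vimage_def)
    qed
    then show ?thesis using F a b(1) by (subst seq_class_eq_iff) auto
  qed
  then have "class_map G d (k \<circ> f) (\<lambda>a. a \<circ> f) (seq_class G d k a) \<in> carrier (reduced_product G d (k \<circ> f))"
    using class_map_in_reduced_product_iff(1)[OF G F a] by blast
  from class_map_in_reduced_product_iff(2)[OF G F a this] show ?thesis unfolding reindexing_map_def .
qed

text \<open>An inverse of the reindexing up to finitely many coordinates; positions that
  \<open>f\<close> does not reach from \<open>A\<close> are filled with the identity.\<close>

lemma reindexed_representative:
  assumes f: "almost_permutation f" and b: "b \<in> carrier (seq_group G (k \<circ> f))"
  obtains a where "a \<in> carrier (seq_group G k)" "finite {n. a (f n) \<noteq> b n}"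
proof -
  obtain A B where A: "finite (- A)" "bij_betw f A B" using f unfolding almost_permutation_def by blast
  define a where "a m = (if m \<in> f ` A then b (inv_into A f m) else \<one>\<^bsub>G (k m)\<^esub>)" for m
  show thesis
  proof (rule that)
    have "a m \<in> carrier (G (k m))" for m
    proof (cases "m \<in> f ` A")
      case True
      then have "f (inv_into A f m) = m" by (rule f_inv_into_f)
      moreover have "b (inv_into A f m) \<in> carrier (G (k (f (inv_into A f m))))" using b by (simp add: seq_group_simps(1))
      ultimately show ?thesis using True by (simp add: a_def)
    next
      case False
      then show ?thesis using group.is_monoid[OF grp] monoid.one_closed by (simp add: a_def)
    qed
    then show "a \<in> carrier (seq_group G k)" by (simp add: seq_group_simps(1))
    have "a (f n) = b n" if "n \<in> A" for n using that inv_into_f_f[OF bij_betw_imp_inj_on[OF A(2)]] by (simp add: a_def)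
    then have "{n. a (f n) \<noteq> b n} \<subseteq> - A" by blast
    then show "finite {n. a (f n) \<noteq> b n}" using A(1) by (rule finite_subset)
  qed
qed

lemma seq_class_eqI:
  assumes "a \<in> carrier (seq_group G k)" "b \<in> carrier (seq_group G k)" "finite {n. a n \<noteq> b n}"
  shows "seq_class G d k a = seq_class G d k b"
  unfolding seq_class_eq_iff[OF assms(1,2)]
proof (intro allI impI)
  fix e :: real assume "0 < e"
  have "d (k n) (b n) (b n) = 0" for n using assms(2) Metric_space.zero[OF met] by (simp add: seq_group_simps(1))
  then have "{n. e < d (k n) (a n) (b n)} \<subseteq> {n. a n \<noteq> b n}" using \<open>0 < e\<close> by fastforce
  then show "finite {n. e < d (k n) (a n) (b n)}" using assms(3) by (rule finite_subset)
qed

lemma reindexing_map_iso: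
  assumes f: "almost_permutation f"
  shows "reindexing_map G d k f \<in> iso (reduced_product G d k) (reduced_product G d (k \<circ> f))"
proof -
  have cl: "a \<circ> f \<in> carrier (seq_group G (k \<circ> f))" if "a \<in> carrier (seq_group G k)" for a
    using that by (simp add: seq_group_simps(1))
  have hom: "reindexing_map G d k f \<in> hom (reduced_product G d k) (reduced_product G d (k \<circ> f))"
  proof (rule homI)
    fix x assume "x \<in> carrier (reduced_product G d k)"
    then obtain a where a: "a \<in> carrier (seq_group G k)" "x = seq_class G d k a" by (rule reduced_product_cases)
    then show "reindexing_map G d k f x \<in> carrier (reduced_product G d (k \<circ> f))"
      by (simp add: reindexing_map_class[OF f] seq_class_in cl)
    fix y assume "y \<in> carrier (reduced_product G d k)"
    then obtain b where b: "b \<in> carrier (seq_group G k)" "y = seq_class G d k b" by (rule reduced_product_cases)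
    have "(a \<otimes>\<^bsub>seq_group G k\<^esub> b) \<circ> f = (a \<circ> f) \<otimes>\<^bsub>seq_group G (k \<circ> f)\<^esub> (b \<circ> f)"
      by (simp add: seq_group_simps(2) comp_def)
    then show "reindexing_map G d k f (x \<otimes>\<^bsub>reduced_product G d k\<^esub> y) =
        reindexing_map G d k f x \<otimes>\<^bsub>reduced_product G d (k \<circ> f)\<^esub> reindexing_map G d k f y"
      unfolding a(2) b(2) reduced_product_mult[OF a(1) b(1)] reindexing_map_class[OF f a(1)]
        reindexing_map_class[OF f b(1)] reindexing_map_class[OF f seq_group_mult_closed[OF a(1) b(1)]]
        reduced_product_mult[OF cl[OF a(1)] cl[OF b(1)]] by simp
  qed
  moreover have "bij_betw (reindexing_map G d k f) (carrier (reduced_product G d k)) (carrier (reduced_product G d (k \<circ> f)))"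
    unfolding bij_betw_def
  proof
    show "inj_on (reindexing_map G d k f) (carrier (reduced_product G d k))"
    proof (rule inj_onI)
      fix x y assume "x \<in> carrier (reduced_product G d k)" "y \<in> carrier (reduced_product G d k)"
        and eq: "reindexing_map G d k f x = reindexing_map G d k f y"
      then obtain a b where a: "a \<in> carrier (seq_group G k)" "x = seq_class G d k a"
        and b: "b \<in> carrier (seq_group G k)" "y = seq_class G d k b" by (metis reduced_product_cases)
      obtain A B where AB: "finite (- B)" "bij_betw f A B" using f unfolding almost_permutation_def by blast
      have "finite {m. e < d (k m) (a m) (b m)}" if "0 < e" for e
      proof (rule finite_subset)
        show "{m. e < d (k m) (a m) (b m)} \<subseteq> - B \<union> f ` {n. e < d (k (f n)) (a (f n)) (b (f n))}"
        proof
          fix m assume m: "m \<in> {m. e < d (k m) (a m) (b m)}"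
          show "m \<in> - B \<union> f ` {n. e < d (k (f n)) (a (f n)) (b (f n))}"
          proof (cases "m \<in> B")
            case True
            then obtain n where "m = f n" using bij_betw_imp_surj_on[OF AB(2)] by blast
            then show ?thesis using m by blast
          qed simp
        qed
        have "seq_class G d (k \<circ> f) (a \<circ> f) = seq_class G d (k \<circ> f) (b \<circ> f)"
          using eq by (simp add: a b reindexing_map_class[OF f])
        then have "finite {n. e < d ((k \<circ> f) n) ((a \<circ> f) n) ((b \<circ> f) n)}"
          using that seq_class_eq_iff[OF cl[OF a(1)] cl[OF b(1)]] by blast
        then show "finite (- B \<union> f ` {n. e < d (k (f n)) (a (f n)) (b (f n))})" using AB(1) by simp
      qed
      then show "x = y" unfolding a(2) b(2) seq_class_eq_iff[OF a(1) b(1)] by blast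
    qed
    show "reindexing_map G d k f ` carrier (reduced_product G d k) = carrier (reduced_product G d (k \<circ> f))"
    proof
      show "reindexing_map G d k f ` carrier (reduced_product G d k) \<subseteq> carrier (reduced_product G d (k \<circ> f))"
        using hom_in_carrier[OF hom] by (rule image_subsetI)
      show "carrier (reduced_product G d (k \<circ> f)) \<subseteq> reindexing_map G d k f ` carrier (reduced_product G d k)"
      proof
        fix y assume "y \<in> carrier (reduced_product G d (k \<circ> f))"
        then obtain b where b: "b \<in> carrier (seq_group G (k \<circ> f))" "y = seq_class G d (k \<circ> f) b"
          by (rule reduced_product_cases)
        obtain a where a: "a \<in> carrier (seq_group G k)" "finite {n. a (f n) \<noteq> b n}"
          using f b(1) by (rule reindexed_representative)
        have y: "seq_class G d (k \<circ> f) (a \<circ> f) = y"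
          unfolding b(2) by (rule seq_class_eqI[OF cl[OF a(1)] b(1)]) (use a(2) in simp)
        show "y \<in> reindexing_map G d k f ` carrier (reduced_product G d k)"
          by (rule rev_image_eqI[OF seq_class_in[OF a(1)]]) (simp only: reindexing_map_class[OF f a(1)] y)
      qed
    qed
  qed
  ultimately show ?thesis by (rule isoI)
qed

lemma dense_sequence:
  obtains E :: "nat \<Rightarrow> nat \<Rightarrow> 'a" where "\<And>m j. E m j \<in> carrier (G m)"
    "\<And>m x r. x \<in> carrier (G m) \<Longrightarrow> 0 < r \<Longrightarrow> \<exists>j. d m x (E m j) < r"
proof -
  have "\<exists>F :: nat \<Rightarrow> 'a. (\<forall>j. F j \<in> carrier (G m)) \<and> (\<forall>x\<in>carrier (G m). \<forall>r>0. \<exists>j. d m x (F j) < r)" for m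
  proof -
    interpret M: Metric_space "carrier (G m)" "d m" by (rule met)
    obtain C where C: "countable C" "C \<subseteq> carrier (G m)" "M.mtopology closure_of C = carrier (G m)"
      using sep[of m] unfolding separable_space_def by auto
    have near: "\<exists>y\<in>C. d m x y < r" if xr: "x \<in> carrier (G m)" "0 < r" for x r
    proof -
      have "x \<in> M.mtopology closure_of C" using C(3) xr(1) by simp
      then obtain y where "y \<in> C" "y \<in> M.mball x r" using xr(2) unfolding M.metric_closure_of by blast
      then show ?thesis by auto
    qed
    have "\<one>\<^bsub>G m\<^esub> \<in> carrier (G m)" using group.is_monoid[OF grp] by (rule monoid.one_closed)
    from near[OF this, of 1] have "C \<noteq> {}" by auto
    then obtain F :: "nat \<Rightarrow> 'a" where F: "range F = C" using C(1) uncountable_def by metis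
    show ?thesis
    proof (intro exI[of _ F] conjI allI ballI impI)
      show "F j \<in> carrier (G m)" for j using F C(2) by blast
      fix x and r :: real assume "x \<in> carrier (G m)" "0 < r"
      from near[OF this] obtain y where "y \<in> C" "d m x y < r" by blast
      then show "\<exists>j. d m x (F j) < r" using F by blast
    qed
  qed
  then have "\<exists>E :: nat \<Rightarrow> nat \<Rightarrow> 'a. \<forall>m. (\<forall>j. E m j \<in> carrier (G m)) \<and> (\<forall>x\<in>carrier (G m). \<forall>r>0. \<exists>j. d m x (E m j) < r)"
    by (rule choice[OF allI])
  then show thesis using that by blast
qed

end

section \<open>Isomorphisms of product form\<close>

context metric_groups
begin

text \<open>Dense sequences code group elements by natural numbers within 1/(n+1) at coordinate n,
  an error that vanishes in the reduced product. The induced map on codes respects coordinates, so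
  the combinatorial theorem applies to it; encoding, applying \<open>h\<close> and decoding give the
  coordinate maps.\<close>

lemma product_form_of_coordinate_respecting_iso:
  assumes OCA MA_aleph1_sigma_linked
    and \<psi>: "\<psi> \<in> carrier (reduced_product G d k) \<rightarrow> carrier (reduced_product G d l)"
    and resp: "\<And>a b A. a \<in> carrier (seq_group G k) \<Longrightarrow> b \<in> carrier (seq_group G k) \<Longrightarrow>
      equal_along_set G d k A (seq_class G d k a) (seq_class G d k b) \<Longrightarrow>
      equal_along_set G d l A (\<psi> (seq_class G d k a)) (\<psi> (seq_class G d k b))"
  shows "product_form G d k l \<psi>"
proof -
  obtain E :: "nat \<Rightarrow> nat \<Rightarrow> 'a" where E: "\<And>m j. E m j \<in> carrier (G m)"
    "\<And>m x r. x \<in> carrier (G m) \<Longrightarrow> 0 < r \<Longrightarrow> \<exists>j. d m x (E m j) < r"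
    using dense_sequence by blast
  define near where "near m n x = (SOME j. d m x (E m j) < 1 / (real n + 1))" for m n x
  have near: "d m x (E m (near m n x)) < 1 / (real n + 1)" if "x \<in> carrier (G m)" for m n x
    unfolding near_def by (rule someI_ex, rule E(2)[OF that]) simp
  have small: "finite {n. e < d (r n) (x n) (E (r n) (near (r n) n (x n)))}"
    if "x \<in> carrier (seq_group G r)" "0 < e" for x r and e :: real
  proof -
    obtain N :: nat where N: "1 / e < real N" using reals_Archimedean2 by blast
    have "n < N" if "e < d (r n) (x n) (E (r n) (near (r n) n (x n)))" for n
    proof (rule ccontr)
      assume "\<not> n < N"
      then have "1 / e < real n + 1" using N by simp
      then have "1 / (real n + 1) < e" using \<open>0 < e\<close> by (simp add: field_simps)
      moreover have "x n \<in> carrier (G (r n))" using \<open>x \<in> _\<close> by (simp add: seq_group_simps(1))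
      ultimately show False using near[of "x n" "r n" n] that by linarith
    qed
    then have "{n. e < d (r n) (x n) (E (r n) (near (r n) n (x n)))} \<subseteq> {..<N}" by blast
    then show ?thesis by (rule finite_subset) simp
  qed
  define dec where "dec r x = (\<lambda>n. E (r n) (x n))" for r :: "nat \<Rightarrow> nat" and x :: "nat \<Rightarrow> nat"
  have dec: "dec r x \<in> carrier (seq_group G r)" for r x using E(1) by (simp add: dec_def seq_group_simps(1))
  have "\<exists>c. c \<in> carrier (seq_group G l) \<and> \<psi> (seq_class G d k (dec k x)) = seq_class G d l c" for x
  proof -
    have "\<psi> (seq_class G d k (dec k x)) \<in> carrier (reduced_product G d l)"
      using \<psi> seq_class_in[OF dec] by (rule funcset_mem)
    then show ?thesis by (rule reduced_product_cases) blast
  qed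
  then have "\<exists>c. \<forall>x. c x \<in> carrier (seq_group G l) \<and> \<psi> (seq_class G d k (dec k x)) = seq_class G d l (c x)"
    by (intro choice allI)
  then obtain c where c: "\<And>x. c x \<in> carrier (seq_group G l)" "\<And>x. \<psi> (seq_class G d k (dec k x)) = seq_class G d l (c x)"
    by blast
  have tri: "d m x z \<le> d m x y + d m y z" if "x \<in> carrier (G m)" "y \<in> carrier (G m)" "z \<in> carrier (G m)" for m x y z
    using Metric_space.triangle[OF met that] .
  have E0: "d m (E m j) (E m j) = 0" for m j using Metric_space.zero[OF met E(1) E(1)] by simp
  have com: "d m x y = d m y x" for m x y by (rule Metric_space.commute[OF met])
  define \<Phi> where "\<Phi> x n = near (l n) n (c x n)" for x n
  define \<delta> where "\<delta> n u v = d (l n) (E (l n) u) (E (l n) v)" for n u v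
  have c_in: "c x n \<in> carrier (G (l n))" for x n using c(1) by (simp add: seq_group_simps(1))
  have \<Phi>: "finite {n. e < d (l n) (c x n) (E (l n) (\<Phi> x n))}" if "0 < e" for x e
    unfolding \<Phi>_def using c(1) that by (rule small)
  obtain h where h: "\<And>x e. 0 < e \<Longrightarrow> finite {n. e < \<delta> n (\<Phi> x n) (h n (x n))}"
  proof (rule product_form_of_coordinate_respecting[OF assms(1,2), of \<delta> \<Phi>])
    show "\<delta> n u v = \<delta> n v u" for n u v unfolding \<delta>_def by (rule com)
    show "\<delta> n u w \<le> \<delta> n u v + \<delta> n v w" for n u v w unfolding \<delta>_def by (rule tri) (rule E(1))+
    show "\<delta> n u u = 0" for n u by (simp add: \<delta>_def E0)
    show "finite {n. x n = y n \<and> e < \<delta> n (\<Phi> x n) (\<Phi> y n)}" if "0 < e" for x y and e :: real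
    proof -
      define A where "A = {n. x n = y n}"
      have "equal_along_set G d k A (seq_class G d k (dec k x)) (seq_class G d k (dec k y))"
        unfolding equal_along_iff[OF dec dec]
      proof (intro allI impI)
        fix e :: real assume "0 < e"
        have "{n \<in> A. e < d (k n) (dec k x n) (dec k y n)} = {}"
          using \<open>0 < e\<close> E0 by (auto simp: A_def dec_def)
        then show "finite {n \<in> A. e < d (k n) (dec k x n) (dec k y n)}" by (simp only: finite.emptyI)
      qed
      from resp[OF dec dec this] have "\<forall>e>0. finite {n \<in> A. e < d (l n) (c x n) (c y n)}"
        unfolding c(2) equal_along_iff[OF c(1) c(1)] .
      moreover have "0 < e / 3" using that by simp
      ultimately have f1: "finite {n \<in> A. e / 3 < d (l n) (c x n) (c y n)}" by blast
      have f2: "finite {n. e / 3 < d (l n) (c x n) (E (l n) (\<Phi> x n))}"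
        "finite {n. e / 3 < d (l n) (c y n) (E (l n) (\<Phi> y n))}" using \<open>0 < e / 3\<close> by (rule \<Phi>)+
      have "{n. x n = y n \<and> e < \<delta> n (\<Phi> x n) (\<Phi> y n)} \<subseteq> {n \<in> A. e / 3 < d (l n) (c x n) (c y n)} \<union>
          {n. e / 3 < d (l n) (c x n) (E (l n) (\<Phi> x n))} \<union> {n. e / 3 < d (l n) (c y n) (E (l n) (\<Phi> y n))}"
      proof
        fix n assume n: "n \<in> {n. x n = y n \<and> e < \<delta> n (\<Phi> x n) (\<Phi> y n)}"
        have "\<delta> n (\<Phi> x n) (\<Phi> y n) \<le> d (l n) (E (l n) (\<Phi> x n)) (c x n) + d (l n) (c x n) (E (l n) (\<Phi> y n))"
          unfolding \<delta>_def by (rule tri) (rule E(1) c_in)+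
        moreover have "d (l n) (c x n) (E (l n) (\<Phi> y n)) \<le> d (l n) (c x n) (c y n) + d (l n) (c y n) (E (l n) (\<Phi> y n))"
          by (rule tri) (rule E(1) c_in)+
        moreover have "d (l n) (E (l n) (\<Phi> x n)) (c x n) = d (l n) (c x n) (E (l n) (\<Phi> x n))" by (rule com)
        ultimately have "e / 3 < d (l n) (c x n) (c y n) \<or> e / 3 < d (l n) (c x n) (E (l n) (\<Phi> x n)) \<or>
            e / 3 < d (l n) (c y n) (E (l n) (\<Phi> y n))" using n by (simp, linarith)
        then show "n \<in> {n \<in> A. e / 3 < d (l n) (c x n) (c y n)} \<union>
          {n. e / 3 < d (l n) (c x n) (E (l n) (\<Phi> x n))} \<union> {n. e / 3 < d (l n) (c y n) (E (l n) (\<Phi> y n))}"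
          using n by (simp add: A_def)
      qed
      then show ?thesis by (rule finite_subset) (use f1 f2 in simp)
    qed
  qed (rule that)
  define H where "H n g = E (l n) (h n (near (k n) n g))" for n g
  show ?thesis
    unfolding product_form_def
  proof (intro exI[of _ H] conjI allI ballI)
    show "H n \<in> carrier (G (k n)) \<rightarrow> carrier (G (l n))" for n using E(1) by (auto simp: H_def)
    fix a assume a: "a \<in> carrier (seq_group G k)"
    define x where "x n = near (k n) n (a n)" for n
    have "seq_class G d k a = seq_class G d k (dec k x)"
      unfolding seq_class_eq_iff[OF a dec] unfolding dec_def x_def using small[OF a] by blast
    then have "\<psi> (seq_class G d k a) = seq_class G d l (c x)" by (simp add: c(2))
    also have "\<dots> = seq_class G d l (\<lambda>n. H n (a n))"
    proof -
      have Ha: "(\<lambda>n. H n (a n)) \<in> carrier (seq_group G l)" using E(1) by (simp add: H_def seq_group_simps(1))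
      show ?thesis
        unfolding seq_class_eq_iff[OF c(1) Ha]
      proof (intro allI impI)
        fix e :: real assume "0 < e"
        then have "0 < e / 2" by simp
        have "{n. e < d (l n) (c x n) (H n (a n))} \<subseteq>
            {n. e / 2 < d (l n) (c x n) (E (l n) (\<Phi> x n))} \<union> {n. e / 2 < \<delta> n (\<Phi> x n) (h n (x n))}"
        proof
          fix n assume n: "n \<in> {n. e < d (l n) (c x n) (H n (a n))}"
          have "d (l n) (c x n) (H n (a n)) \<le> d (l n) (c x n) (E (l n) (\<Phi> x n)) + \<delta> n (\<Phi> x n) (h n (x n))"
            unfolding \<delta>_def H_def x_def by (rule tri) (rule E(1) c_in)+
          then have "e / 2 < d (l n) (c x n) (E (l n) (\<Phi> x n)) \<or> e / 2 < \<delta> n (\<Phi> x n) (h n (x n))"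
            using n by (simp, linarith)
          then show "n \<in> {n. e / 2 < d (l n) (c x n) (E (l n) (\<Phi> x n))} \<union> {n. e / 2 < \<delta> n (\<Phi> x n) (h n (x n))}" by blast
        qed
        then show "finite {n. e < d (l n) (c x n) (H n (a n))}"
          by (rule finite_subset) (use \<Phi>[OF \<open>0 < e / 2\<close>] h[OF \<open>0 < e / 2\<close>] in simp)
      qed
    qed
    finally show "\<psi> (seq_class G d k a) = seq_class G d l (\<lambda>n. H n (a n))" .
  qed
qed

text \<open>Undoing the reindexing moves agreement on \<open>A\<close> to agreement on its image
  under \<open>f\<close>; \<open>\<theta>\<close> moves it on to the preimage of that image, which
  contains \<open>A\<close>.\<close>

lemma reindexed_iso_respects_coordinates:
  assumes f: "almost_permutation f" and \<theta>: "\<And>A. \<theta> (abs_nat_set_mod_fin A) = abs_nat_set_mod_fin (f -` A)"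
    and \<phi>: "\<phi> \<in> iso (reduced_product G d k) (reduced_product G d l)"
    and \<phi>_\<theta>: "\<And>a b S. a \<in> carrier (reduced_product G d k) \<Longrightarrow> b \<in> carrier (reduced_product G d k) \<Longrightarrow>
      equal_along G d k S a b \<Longrightarrow> equal_along G d l (\<theta> S) (\<phi> a) (\<phi> b)"
    and \<psi>: "\<And>x. x \<in> carrier (reduced_product G d k) \<Longrightarrow> \<psi> (reindexing_map G d k f x) = \<phi> x"
    and a': "a' \<in> carrier (seq_group G (k \<circ> f))" and b': "b' \<in> carrier (seq_group G (k \<circ> f))"
    and eq: "equal_along_set G d (k \<circ> f) A (seq_class G d (k \<circ> f) a') (seq_class G d (k \<circ> f) b')"
  shows "equal_along_set G d l A (\<psi> (seq_class G d (k \<circ> f) a')) (\<psi> (seq_class G d (k \<circ> f) b'))"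
proof -
  obtain a where a: "a \<in> carrier (seq_group G k)" "finite {n. a (f n) \<noteq> a' n}" using f a' by (rule reindexed_representative)
  obtain b where b: "b \<in> carrier (seq_group G k)" "finite {n. b (f n) \<noteq> b' n}" using f b' by (rule reindexed_representative)
  have cl: "x \<circ> f \<in> carrier (seq_group G (k \<circ> f))" if "x \<in> carrier (seq_group G k)" for x
    using that by (simp add: seq_group_simps(1))
  have ca: "seq_class G d (k \<circ> f) a' = reindexing_map G d k f (seq_class G d k a)"
    unfolding reindexing_map_class[OF f a(1)] by (rule seq_class_eqI[OF cl[OF a(1)] a', symmetric]) (use a(2) in simp)
  have cb: "seq_class G d (k \<circ> f) b' = reindexing_map G d k f (seq_class G d k b)"
    unfolding reindexing_map_class[OF f b(1)] by (rule seq_class_eqI[OF cl[OF b(1)] b', symmetric]) (use b(2) in simp)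
  have "equal_along_set G d (k \<circ> f) A (seq_class G d (k \<circ> f) (a \<circ> f)) (seq_class G d (k \<circ> f) (b \<circ> f))"
    using eq unfolding ca cb reindexing_map_class[OF f a(1)] reindexing_map_class[OF f b(1)] .
  then have fin: "\<forall>e>0. finite {n \<in> A. e < d (k (f n)) (a (f n)) (b (f n))}"
    unfolding equal_along_iff[OF cl[OF a(1)] cl[OF b(1)]] by simp
  have "equal_along_set G d k (f ` A) (seq_class G d k a) (seq_class G d k b)"
    unfolding equal_along_iff[OF a(1) b(1)]
  proof (intro allI impI)
    fix e :: real assume "0 < e"
    with fin have "finite (f ` {n \<in> A. e < d (k (f n)) (a (f n)) (b (f n))})" by simp
    then show "finite {m \<in> f ` A. e < d (k m) (a m) (b m)}" by (rule rev_finite_subset) blast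
  qed
  then have "equal_along G d k (abs_nat_set_mod_fin (f ` A)) (seq_class G d k a) (seq_class G d k b)"
    unfolding equal_along.abs_eq .
  from \<phi>_\<theta>[OF seq_class_in[OF a(1)] seq_class_in[OF b(1)] this]
  have eql: "equal_along_set G d l (f -` (f ` A)) (\<phi> (seq_class G d k a)) (\<phi> (seq_class G d k b))"
    unfolding \<theta> equal_along.abs_eq .
  have \<phi>_in: "\<phi> (seq_class G d k x) \<in> carrier (reduced_product G d l)" if "x \<in> carrier (seq_group G k)" for x
    by (rule hom_in_carrier[OF iso_imp_homomorphism[OF \<phi>] seq_class_in[OF that]])
  obtain u where u: "u \<in> carrier (seq_group G l)" "\<phi> (seq_class G d k a) = seq_class G d l u"
    using \<phi>_in[OF a(1)] by (rule reduced_product_cases)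
  obtain v where v: "v \<in> carrier (seq_group G l)" "\<phi> (seq_class G d k b) = seq_class G d l v"
    using \<phi>_in[OF b(1)] by (rule reduced_product_cases)
  have "\<forall>e>0. finite {n \<in> f -` (f ` A). e < d (l n) (u n) (v n)}"
    using eql unfolding u(2) v(2) equal_along_iff[OF u(1) v(1)] .
  note fin' = this
  have "\<forall>e>0. finite {n \<in> A. e < d (l n) (u n) (v n)}"
  proof (intro allI impI)
    fix e :: real assume "0 < e"
    with fin' have "finite {n \<in> f -` (f ` A). e < d (l n) (u n) (v n)}" by blast
    then show "finite {n \<in> A. e < d (l n) (u n) (v n)}" by (rule rev_finite_subset) blast
  qed
  then have "equal_along_set G d l A (seq_class G d l u) (seq_class G d l v)"
    unfolding equal_along_iff[OF u(1) v(1)] .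
  then show ?thesis unfolding ca cb \<psi>[OF seq_class_in[OF a(1)]] \<psi>[OF seq_class_in[OF b(1)]] u(2) v(2) .
qed

end

theorem lemma1p2:
  fixes G :: "nat \<Rightarrow> ('a, 'b) monoid_scheme"
    and d :: "nat \<Rightarrow> 'a \<Rightarrow> 'a \<Rightarrow> real"
    and E :: "(nat \<Rightarrow> nat) rel"
    and \<Gamma> :: "(nat \<Rightarrow> nat) \<Rightarrow> (nat \<Rightarrow> nat) \<Rightarrow> (nat \<Rightarrow> 'a) set \<Rightarrow> (nat \<Rightarrow> 'a) set"
  assumes "OCA" and "MA_aleph1_sigma_linked"
    and "separable_metric_groups_bounded G d"
    and "equiv seqs_to_infinity E"
    and "\<And>k l. (k, l) \<in> E \<Longrightarrow>
           \<Gamma> k l \<in> iso (reduced_product G d k) (reduced_product G d l) \<and> product_form G d k l (\<Gamma> k l)"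
    and "condition_CR G d"
    and "condition_PF G d E \<Gamma>"
  shows "\<forall>k\<in>seqs_to_infinity. \<forall>l\<in>seqs_to_infinity.
         \<forall>\<phi>\<in>iso (reduced_product G d k) (reduced_product G d l).
           \<exists>f \<alpha>. almost_permutation f \<and> (\<forall>n. \<alpha> n \<in> iso (G (l n)) (G (l n))) \<and>
             (k \<circ> f, l) \<in> E \<and>
             coordinatewise_map G d l \<alpha> \<in> iso (reduced_product G d l) (reduced_product G d l) \<and>
             (\<forall>x\<in>carrier (reduced_product G d k).
                \<phi> x = coordinatewise_map G d l \<alpha> (\<Gamma> (k \<circ> f) l (reindexing_map G d k f x)))"
proof (intro ballI)
  fix k l \<phi>
  assume k: "k \<in> seqs_to_infinity" and l: "l \<in> seqs_to_infinity"
    and \<phi>: "\<phi> \<in> iso (reduced_product G d k) (reduced_product G d l)"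
  interpret metric_groups G d using assms(3) by (rule metric_groups.intro)
  obtain \<theta> where \<theta>: "boolean_algebra_automorphism \<theta>"
    and \<phi>_\<theta>: "\<forall>a\<in>carrier (reduced_product G d k). \<forall>b\<in>carrier (reduced_product G d k). \<forall>S.
      equal_along G d k S a b \<longleftrightarrow> equal_along G d l (\<theta> S) (\<phi> a) (\<phi> b)"
    using assms(6)[unfolded condition_CR_def, rule_format, OF k l \<phi>] by blast
  obtain f where f: "almost_permutation f"
    and \<theta>f: "\<And>A. \<theta> (abs_nat_set_mod_fin A) = abs_nat_set_mod_fin (f -` A)"
    using automorphism_induced_by_point_map[OF assms(1,2) \<theta>] by blast
  \<comment> \<open>(PF) is to be applied to the reindexed sequence, which must still tend to
    infinity.\<close>
  have kf: "k \<circ> f \<in> seqs_to_infinity"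
    using filterlim_compose[OF _ almost_permutation_at_top[OF f], of k at_top] k
    by (simp add: seqs_to_infinity_def comp_def)
  let ?\<rho> = "reindexing_map G d k f"
  have \<rho>: "?\<rho> \<in> iso (reduced_product G d k) (reduced_product G d (k \<circ> f))" by (rule reindexing_map_iso[OF f])
  \<comment> \<open>Composing with the inverse of the reindexing cancels the point map behind
    \<open>\<theta>\<close>, so \<open>\<psi>\<close> preserves agreement along each set of
    coordinates.\<close>
  define \<psi> where "\<psi> = \<phi> \<circ> inv_into (carrier (reduced_product G d k)) ?\<rho>"
  have \<psi>_iso: "\<psi> \<in> iso (reduced_product G d (k \<circ> f)) (reduced_product G d l)"
    unfolding \<psi>_def by (rule iso_set_trans[OF group.iso_set_sym[OF reduced_product_group \<rho>] \<phi>])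
  have \<rho>_in: "?\<rho> x \<in> carrier (reduced_product G d (k \<circ> f))" if "x \<in> carrier (reduced_product G d k)" for x
    by (rule hom_in_carrier[OF iso_imp_homomorphism[OF \<rho>] that])
  have \<psi>\<rho>: "\<psi> (?\<rho> x) = \<phi> x" if "x \<in> carrier (reduced_product G d k)" for x
  proof -
    have "inj_on ?\<rho> (carrier (reduced_product G d k))" using \<rho> by (simp add: iso_iff)
    then show ?thesis using \<rho>_in[OF that] that by (simp add: \<psi>_def inv_into_f_f)
  qed
  have "product_form G d (k \<circ> f) l \<psi>"
  proof (rule product_form_of_coordinate_respecting_iso[OF assms(1,2)])
    show "\<psi> \<in> carrier (reduced_product G d (k \<circ> f)) \<rightarrow> carrier (reduced_product G d l)"
      using iso_imp_homomorphism[OF \<psi>_iso] by (simp add: hom_def)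
    fix a b A assume a: "a \<in> carrier (seq_group G (k \<circ> f))" and b: "b \<in> carrier (seq_group G (k \<circ> f))"
      and eq: "equal_along_set G d (k \<circ> f) A (seq_class G d (k \<circ> f) a) (seq_class G d (k \<circ> f) b)"
    show "equal_along_set G d l A (\<psi> (seq_class G d (k \<circ> f) a)) (\<psi> (seq_class G d (k \<circ> f) b))"
    proof (rule reindexed_iso_respects_coordinates[OF f \<theta>f \<phi> _ \<psi>\<rho> a b eq])
      show "equal_along G d l (\<theta> S) (\<phi> x) (\<phi> y)" if "x \<in> carrier (reduced_product G d k)"
        "y \<in> carrier (reduced_product G d k)" "equal_along G d k S x y" for x y S
        using \<phi>_\<theta> that by blast
    qed
  qed
  with assms(7)[unfolded condition_PF_def, rule_format, OF kf l \<psi>_iso]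
  obtain \<alpha> where \<alpha>: "(k \<circ> f, l) \<in> E" "\<forall>n. \<alpha> n \<in> iso (G (l n)) (G (l n))"
    "coordinatewise_map G d l \<alpha> \<in> iso (reduced_product G d l) (reduced_product G d l)"
    "\<forall>x\<in>carrier (reduced_product G d (k \<circ> f)). \<psi> x = coordinatewise_map G d l \<alpha> (\<Gamma> (k \<circ> f) l x)"
    by blast
  show "\<exists>f \<alpha>. almost_permutation f \<and> (\<forall>n. \<alpha> n \<in> iso (G (l n)) (G (l n))) \<and>
      (k \<circ> f, l) \<in> E \<and>
      coordinatewise_map G d l \<alpha> \<in> iso (reduced_product G d l) (reduced_product G d l) \<and>
      (\<forall>x\<in>carrier (reduced_product G d k).
         \<phi> x = coordinatewise_map G d l \<alpha> (\<Gamma> (k \<circ> f) l (reindexing_map G d k f x)))"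
  proof (intro exI[of _ f] exI[of _ \<alpha>] conjI ballI f \<alpha>(1-3))
    fix x assume x: "x \<in> carrier (reduced_product G d k)"
    show "\<phi> x = coordinatewise_map G d l \<alpha> (\<Gamma> (k \<circ> f) l (?\<rho> x))"
      using \<alpha>(4)[rule_format, OF \<rho>_in[OF x]] unfolding \<psi>\<rho>[OF x] .
  qed
qed

end
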